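(* There is an algorithm which, given a finite tree $T$, determines $ub(T)$ in time $O(|V(T)|)$; furthermore, whenever $ub(T)=\lceil \Delta(T)/3\rceil$, the algorithm also outputs a decomposition of $T$ into UBVTs such that each vertex of $T$ lies in at most $\lceil \Delta(T)/3\rceil$ of the UBVTs.
   Context: A bar is a closed horizontal line segment of length $1$ in the plane. Two bars of an arrangement of pairwise disjoint bars see each other if there is an axis-parallel rectangle of positive width whose bottom side lies in one of them, whose top side lies in the other, and whose interior meets no bar of the arrangement. For a nonnegative integer $t$, a $t$-unit-bar visibility representation of a graph $G$ assigns to each vertex a set of at most $t$ bars, all bars pairwise disjoint, such that two distinct vertices are adjacent iff some bar of one sees some bar of the other; $ub(G)$ is the minimum such $t$. A unit bar visibility tree (UBVT) is a tree having a $1$-unit-bar visibility representation. A decomposition of $T$ into UBVTs is a collection of subtrees of $T$, each a UBVT, whose edge sets partition $E(T)$. $\Delta(T)$ denotes the maximum degree of $T$. *)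

theory Defs
  imports Complex_Main "HOL-Library.Disjoint_Sets"
begin

section \<open>Finite simple graphs and trees\<close>

text \<open>A graph is given by its vertex set and its set of edges, each a two-element set of vertices.\<close>

definition simple_graph :: "'a set \<Rightarrow> 'a set set \<Rightarrow> bool" where
  "simple_graph V E \<longleftrightarrow> finite V \<and> (\<forall>e\<in>E. \<exists>u\<in>V. \<exists>v\<in>V. u \<noteq> v \<and> e = {u, v})"

definition is_walk :: "'a set \<Rightarrow> 'a set set \<Rightarrow> 'a list \<Rightarrow> bool" where
  "is_walk V E p \<longleftrightarrow> p \<noteq> [] \<and> set p \<subseteq> V \<and> successively (\<lambda>u v. {u, v} \<in> E) p"

definition graph_connected :: "'a set \<Rightarrow> 'a set set \<Rightarrow> bool" where
  "graph_connected V E \<longleftrightarrow>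
     V \<noteq> {} \<and> (\<forall>u\<in>V. \<forall>v\<in>V. \<exists>p. is_walk V E p \<and> hd p = u \<and> last p = v)"

definition is_cycle :: "'a set \<Rightarrow> 'a set set \<Rightarrow> 'a list \<Rightarrow> bool" where
  "is_cycle V E p \<longleftrightarrow>
     3 \<le> length p \<and> distinct p \<and> is_walk V E p \<and> {last p, hd p} \<in> E"

definition is_tree :: "'a set \<Rightarrow> 'a set set \<Rightarrow> bool" where
  "is_tree V E \<longleftrightarrow> simple_graph V E \<and> graph_connected V E \<and> (\<nexists>p. is_cycle V E p)"

definition degree :: "'a set set \<Rightarrow> 'a \<Rightarrow> nat" where
  "degree E v = card {e \<in> E. v \<in> e}"

definition max_degree :: "'a set \<Rightarrow> 'a set set \<Rightarrow> nat" where
  "max_degree V E = Max (degree E ` V)"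

section \<open>Unit bar visibility\<close>

definition is_bar :: "(real \<times> real) set \<Rightarrow> bool" where
  "is_bar B \<longleftrightarrow> (\<exists>x y. B = {x..x + 1} \<times> {y})"

definition sees :: "(real \<times> real) set set \<Rightarrow> (real \<times> real) set \<Rightarrow> (real \<times> real) set \<Rightarrow> bool" where
  "sees \<A> B C \<longleftrightarrow>
     (\<exists>a b c d. a < b \<and> c < d \<and>
        ({a..b} \<times> {c} \<subseteq> B \<and> {a..b} \<times> {d} \<subseteq> C \<or>
         {a..b} \<times> {c} \<subseteq> C \<and> {a..b} \<times> {d} \<subseteq> B) \<and>
        (\<forall>X\<in>\<A>. ({a<..<b} \<times> {c<..<d}) \<inter> X = {}))"

text \<open>Disjointness is required of the bars as occurrences, so a bar is never assigned to two vertices.\<close>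

definition unit_bar_rep ::
  "nat \<Rightarrow> 'a set \<Rightarrow> 'a set set \<Rightarrow> ('a \<Rightarrow> (real \<times> real) set set) \<Rightarrow> bool" where
  "unit_bar_rep t V E f \<longleftrightarrow>
     (\<forall>v\<in>V. finite (f v) \<and> card (f v) \<le> t \<and> (\<forall>B\<in>f v. is_bar B)) \<and>
     (\<forall>u\<in>V. \<forall>v\<in>V. \<forall>B\<in>f u. \<forall>C\<in>f v. (u, B) \<noteq> (v, C) \<longrightarrow> B \<inter> C = {}) \<and>
     (\<forall>u\<in>V. \<forall>v\<in>V. u \<noteq> v \<longrightarrow>
        ({u, v} \<in> E \<longleftrightarrow> (\<exists>B\<in>f u. \<exists>C\<in>f v. sees (\<Union>w\<in>V. f w) B C)))"

definition ub :: "'a set \<Rightarrow> 'a set set \<Rightarrow> nat" where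
  "ub V E = (LEAST t. \<exists>f. unit_bar_rep t V E f)"

definition ubvt :: "'a set \<Rightarrow> 'a set set \<Rightarrow> bool" where
  "ubvt V E \<longleftrightarrow> is_tree V E \<and> (\<exists>f. unit_bar_rep 1 V E f)"

text \<open>The parts of a partition are nonempty, so every member of a decomposition has an edge;
  as members are connected, the edge set of a member determines it.\<close>

definition ubvt_decomposition :: "'a set \<Rightarrow> 'a set set \<Rightarrow> ('a set \<times> 'a set set) set \<Rightarrow> bool" where
  "ubvt_decomposition V E D \<longleftrightarrow>
     (\<forall>(W, F)\<in>D. W \<subseteq> V \<and> F \<subseteq> E \<and> ubvt W F) \<and> partition_on E (snd ` D)"

section \<open>Random access machine\<close>

text \<open>
  The model is the uniform-cost RAM with addition and (truncated) subtraction, presented as a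
  structured language. A program mentions finitely many registers; the memory is indirectly
  addressable. In \<open>run W p s t s'\<close>, \<open>t\<close> counts the instructions and tests executed. Every
  value written must be at most \<open>W\<close>, otherwise there is no run: with \<open>W\<close> polynomial in the
  input size, words have logarithmically many bits and unit cost cannot be exploited through
  very large numbers.
\<close>

datatype com =
    Const nat nat          (* r := k *)
  | Add nat nat nat        (* r := a + b *)
  | Sub nat nat nat        (* r := a - b *)
  | Load nat nat           (* r := mem[a] *)
  | Store nat nat          (* mem[a] := b *)
  | Seq com com
  | IfLess nat nat com com
  | WhileLess nat nat com

type_synonym ram_state = "(nat \<Rightarrow> nat) \<times> (nat \<Rightarrow> nat)"

inductive run :: "nat \<Rightarrow> com \<Rightarrow> ram_state \<Rightarrow> nat \<Rightarrow> ram_state \<Rightarrow> bool" for W :: nat where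
  Const: "k \<le> W \<Longrightarrow> run W (Const r k) (R, M) 1 (R(r := k), M)"
| Add: "R a + R b \<le> W \<Longrightarrow> run W (Add r a b) (R, M) 1 (R(r := R a + R b), M)"
| Sub: "R a - R b \<le> W \<Longrightarrow> run W (Sub r a b) (R, M) 1 (R(r := R a - R b), M)"
| Load: "M (R a) \<le> W \<Longrightarrow> run W (Load r a) (R, M) 1 (R(r := M (R a)), M)"
| Store: "R b \<le> W \<Longrightarrow> run W (Store a b) (R, M) 1 (R, M(R a := R b))"
| Seq: "run W p s t s' \<Longrightarrow> run W q s' t' s'' \<Longrightarrow> run W (Seq p q) s (t + t') s''"
| IfTrue: "R a < R b \<Longrightarrow> run W p (R, M) t s' \<Longrightarrow> run W (IfLess a b p q) (R, M) (t + 1) s'"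
| IfFalse: "\<not> R a < R b \<Longrightarrow> run W q (R, M) t s' \<Longrightarrow> run W (IfLess a b p q) (R, M) (t + 1) s'"
| WhileFalse: "\<not> R a < R b \<Longrightarrow> run W (WhileLess a b p) (R, M) 1 (R, M)"
| WhileTrue: "R a < R b \<Longrightarrow> run W p (R, M) t s' \<Longrightarrow> run W (WhileLess a b p) s' t' s'' \<Longrightarrow>
    run W (WhileLess a b p) (R, M) (t + t' + 1) s''"

section \<open>Encoding of input and output\<close>

text \<open>A tree with vertices \<open>{..<n}\<close> is presented by a list of its edges, in any order and with
  endpoints in any order. Memory cell 0 initially holds \<open>n\<close> and the following cells hold
  the endpoints of the edges; all other cells and all registers are 0.\<close>

definition edge_of :: "nat \<times> nat \<Rightarrow> nat set" where
  "edge_of e = {fst e, snd e}"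

definition edge_list :: "(nat \<times> nat) list \<Rightarrow> nat set set \<Rightarrow> bool" where
  "edge_list es E \<longleftrightarrow> distinct (map edge_of es) \<and> edge_of ` set es = E"

definition input_state :: "nat \<Rightarrow> (nat \<times> nat) list \<Rightarrow> ram_state" where
  "input_state n es =
     (let xs = n # concat (map (\<lambda>(u, v). [u, v]) es)
      in (\<lambda>_. 0, \<lambda>a. if a < length xs then xs ! a else 0))"

text \<open>On termination, cell 0 holds the computed value of \<open>ub\<close>, and cell \<open>Suc i\<close> holds a label
  of the \<open>i\<close>-th edge of the input list. Edges with equal labels form one member of the
  decomposition that is output.\<close>

definition output_decomposition ::
  "(nat \<times> nat) list \<Rightarrow> (nat \<Rightarrow> nat) \<Rightarrow> (nat set \<times> nat set set) set" where
  "output_decomposition es M =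
     (\<lambda>i. let F = {edge_of (es ! j) |j. j < length es \<and> M (Suc j) = M (Suc i)} in (\<Union>F, F))
       ` {..<length es}"

end

(* Root the tree and look at a representation with t bars per vertex. Every edge is realised by a
   visibility rectangle that can be widened until it is bounded on either side by the end of a bar; a
   half-edge gets as weight the number of the two sides at which its own vertex provides that end. The two
   halves of an edge have total weight 2. A bar has only two ends, and being in a tree it carries at most one
   half-edge of weight 0, so at every vertex the weights add up to at most 2t and the numbers max 1 w to
   at most 3t. Conversely, given such weights, the half-edges at a vertex can be distributed over t groups
   with weight sum at most 2 and at most 3 places each; joining the groups along the edges splits the tree
   into combs, a spine with pendant paths, which are unit bar visibility trees.

   Removing leaves one by one and giving every edge the least feasible weight at its parent is optimal,
   so it decides whether ub(T) is t or t + 1, where t is the ceiling of a third of the maximum degree: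
   putting weight 0 at every parent always works for t + 1. *)

theory Submission
  imports Defs
begin

section \<open>Rooted trees\<close>

text \<open>The obstacle in the lower bound is that an edge may be seen in many places, that bars of
  one vertex may see each other, and that many bars may begin or end at one abscissa. In a column of
  bars, a block of k ending bars between two surviving ones leaves k + 1 vertical gaps, but only k
  ends to charge. The tree saves the count: every edge is a bridge, so the parity of its traversals
  between two bars of a column depends only on the owners of these bars. If all k + 1 gaps stand for
  edges, each is traversed once, hence again in the new column, and one of them can be postponed.
  Unit length enters because a bar that ends first also began first: if one bar provides both ends
  of a visibility, the two bars are aligned.

  Linear time is reached without adjacency lists, multiplication or division. A vertex keeps the sum
  of the indices of its remaining edges, which at a leaf is the index of its only edge; products and
  halves are tabulated. Labels of the parts are handed down from the root in the reverse of the
  order of removal.\<close>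

definition rooted :: "'a set \<Rightarrow> 'a set set \<Rightarrow> 'a \<Rightarrow> ('a \<Rightarrow> 'a) \<Rightarrow> ('a \<Rightarrow> nat) \<Rightarrow> bool" where
  "rooted V E r par pos \<longleftrightarrow> finite V \<and> r \<in> V \<and>
     (\<forall>c\<in>V - {r}. par c \<in> V \<and> pos c < pos (par c)) \<and> E = (\<lambda>c. {c, par c}) ` (V - {r})"

text \<open>The child of an edge is its end with the smaller \<open>pos\<close>. Since
  \<open>pos\<close> grows towards the root, induction on \<open>pos\<close> climbs from the leaves,
  and induction on the distance from its maximum descends from the root.\<close>

lemma rooted_edge_inj:
  assumes "rooted V E r par pos"
  shows "inj_on (\<lambda>c. {c, par c}) (V - {r})"
proof (rule inj_onI)
  fix c d assume "c \<in> V - {r}" "d \<in> V - {r}" and eq: "{c, par c} = {d, par d}"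
  then have "pos c < pos (par c)" "pos d < pos (par d)"
    using assms by (auto simp: rooted_def)
  then show "c = d" using eq by (metis doubleton_eq_iff less_asym)
qed



lemma finite_max:
  fixes f :: "'a \<Rightarrow> nat"
  assumes "finite A" "A \<noteq> {}"
  shows "\<exists>x\<in>A. \<forall>y\<in>A. f y \<le> f x"
proof -
  have "Max (f ` A) \<in> f ` A" using assms by (intro Max_in) auto
  then obtain x where "x \<in> A" "f x = Max (f ` A)" by auto
  then have "f y \<le> f x" if "y \<in> A" for y using that assms by simp
  then show ?thesis using \<open>x \<in> A\<close> by blast
qed

lemma rooted_edgeE:
  assumes "rooted V E r par pos" "e \<in> E"
  obtains c where "c \<in> V - {r}" "e = {c, par c}"
proof -
  have "e \<in> (\<lambda>c. {c, par c}) ` (V - {r})" using assms by (simp add: rooted_def)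
  then show ?thesis using that by blast
qed

lemma rooted_simple_graph:
  assumes r: "rooted V E r par pos"
  shows "simple_graph V E"
  unfolding simple_graph_def
proof (intro conjI ballI)
  show "finite V" using r by (simp add: rooted_def)
  fix e assume "e \<in> E"
  with r obtain c where c: "c \<in> V - {r}" "e = {c, par c}" by (rule rooted_edgeE)
  then have "par c \<in> V" "pos c < pos (par c)" using r unfolding rooted_def by blast+
  then show "\<exists>u\<in>V. \<exists>v\<in>V. u \<noteq> v \<and> e = {u, v}" using c by (metis DiffD1 less_irrefl)
qed

lemma walk_rev:
  assumes "is_walk V E p"
  shows "is_walk V E (rev p)"
proof -
  have "(\<lambda>x y. {y, x} \<in> E) = (\<lambda>x y. {x, y} \<in> E)" by (intro ext) (metis insert_commute)
  then have "successively (\<lambda>x y. {y, x} \<in> E) p"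
    using assms unfolding is_walk_def by metis
  then show ?thesis using assms unfolding is_walk_def successively_rev by simp
qed

lemma walk_join:
  assumes "is_walk V E p" "is_walk V E q" "last p = hd q"
  shows "is_walk V E (p @ tl q)" "hd (p @ tl q) = hd p" "last (p @ tl q) = last q"
proof -
  obtain a q' where q: "q = a # q'" using assms by (cases q) (auto simp: is_walk_def)
  show "is_walk V E (p @ tl q)"
    using assms unfolding q by (cases q') (auto simp: is_walk_def successively_append_iff)
  show "hd (p @ tl q) = hd p" using assms by (auto simp: is_walk_def)
  show "last (p @ tl q) = last q" using assms unfolding q by auto
qed

lemma rooted_walk_to_root:
  assumes "rooted V E r par pos" "v \<in> V"
  shows "\<exists>p. is_walk V E p \<and> hd p = v \<and> last p = r"
proof -
  define m where "m = Max (pos ` V)"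
  have fin: "finite V" using assms by (simp add: rooted_def)
  show ?thesis using assms(2)
  proof (induction "m - pos v" arbitrary: v rule: less_induct)
    case less
    show ?case
    proof (cases "v = r")
      case True
      then show ?thesis using less.prems by (intro exI[of _ "[r]"]) (auto simp: is_walk_def)
    next
      case False
      then have pv: "par v \<in> V" "pos v < pos (par v)" "{v, par v} \<in> E"
        using assms(1) less.prems by (auto simp: rooted_def)
      moreover have "pos (par v) \<le> m" unfolding m_def using fin pv(1) by (intro Max_ge) auto
      ultimately obtain p where p: "is_walk V E p" "hd p = par v" "last p = r"
        using less.hyps[of "par v"] by (meson diff_less_mono2 less_le_trans)
      then have "is_walk V E (v # p)"
        using less.prems pv(3) by (cases p) (auto simp: is_walk_def)
      then show ?thesis using p by (intro exI[of _ "v # p"]) (auto simp: is_walk_def)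
    qed
  qed
qed

lemma cycle_two_neighbours:
  assumes "is_cycle V E p" "x \<in> set p"
  shows "\<exists>a\<in>set p. \<exists>b\<in>set p. a \<noteq> b \<and> {a, x} \<in> E \<and> {x, b} \<in> E"
proof -
  from assms have len: "3 \<le> length p" and dist: "distinct p"
    and suc: "successively (\<lambda>u v. {u, v} \<in> E) p" and cl: "{last p, hd p} \<in> E"
    by (auto simp: is_cycle_def is_walk_def)
  obtain i where i: "i < length p" "p ! i = x" using assms(2) by (auto simp: in_set_conv_nth)
  define n where "n = length p"
  have ne: "p \<noteq> []" using len by auto
  have step: "{p ! j, p ! Suc j} \<in> E" if "Suc j < n" for j
    using suc that unfolding n_def by (auto simp: successively_conv_nth)
  have cl': "{p ! (n - 1), p ! 0} \<in> E"
    using cl ne unfolding n_def by (simp add: last_conv_nth hd_conv_nth)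
  define a where "a = (if i = 0 then n - 1 else i - 1)"
  define b where "b = (if i = n - 1 then 0 else Suc i)"
  have ab: "a < n" "b < n" "a \<noteq> b" using i len unfolding a_def b_def n_def by auto
  have 1: "{p ! a, x} \<in> E"
    using step[of "i - 1"] cl' i unfolding a_def n_def by (cases "i = 0") auto
  have 2: "{x, p ! b} \<in> E"
    using step[of i] cl' i unfolding b_def n_def by (cases "i = length p - 1") auto
  have "p ! a \<noteq> p ! b" using ab dist unfolding n_def by (simp add: nth_eq_iff_index_eq)
  then show ?thesis using 1 2 ab nth_mem unfolding n_def by blast
qed

lemma rooted_is_tree:
  assumes r: "rooted V E r par pos"
  shows "is_tree V E"
proof -
  have "graph_connected V E"
    unfolding graph_connected_def
  proof (intro conjI ballI)
    show "V \<noteq> {}" using r by (auto simp: rooted_def)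
    fix u v assume uv: "u \<in> V" "v \<in> V"
    obtain p q where p: "is_walk V E p" "hd p = u" "last p = r"
      and q: "is_walk V E q" "hd q = v" "last q = r"
      using rooted_walk_to_root[OF r] uv by metis
    have q': "is_walk V E (rev q)" "hd (rev q) = r" "last (rev q) = v"
      using walk_rev[OF q(1)] q by (auto simp: hd_rev last_rev)
    show "\<exists>p. is_walk V E p \<and> hd p = u \<and> last p = v"
      using walk_join[OF p(1) q'(1)] p q' by metis
  qed
  moreover have "\<not> is_cycle V E p" for p
  proof
    assume cyc: "is_cycle V E p"
    then have ps: "set p \<subseteq> V" "p \<noteq> []" by (auto simp: is_cycle_def is_walk_def)
    \<comment> \<open>No neighbour of the lowest vertex of a cycle on that cycle lies below it, but
      the only neighbour above a vertex is its parent.\<close>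
    obtain x where x: "x \<in> set p" "\<forall>y\<in>set p. pos x \<le> pos y"
      using arg_min_if_finite[of "set p" pos] ps(2) by (metis List.finite_set leI set_empty)
    obtain a b where ab: "a \<in> set p" "b \<in> set p" "a \<noteq> b" "{a, x} \<in> E" "{x, b} \<in> E"
      using cycle_two_neighbours[OF cyc x(1)] by blast
    have nb: "False" if yp: "y \<in> set p" and xy: "{x, y} \<in> E" and y: "y \<noteq> par x \<or> x = r" for y
    proof -
      obtain c where c: "c \<in> V - {r}" "{x, y} = {c, par c}" using rooted_edgeE[OF r xy] .
      then have "pos c < pos (par c)" using r by (auto simp: rooted_def)
      moreover have "pos x \<le> pos y" using x yp by blast
      ultimately show False using c y by (auto simp: doubleton_eq_iff)
    qed
    show False using nb[OF ab(1)] nb[OF ab(2)] ab by (metis insert_commute)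
  qed
  ultimately show ?thesis using rooted_simple_graph[OF r] by (auto simp: is_tree_def)
qed

text \<open>\<open>S\<close> is one side of the bridge \<open>e\<close>. Counting passages between
  \<open>S\<close> and its complement is what replaces topology in the sweep.\<close>

definition cut :: "'a set set \<Rightarrow> 'a set \<Rightarrow> 'a set \<Rightarrow> bool" where
  "cut E e S \<longleftrightarrow> (\<forall>u v. {u, v} \<in> E \<longrightarrow> (u \<in> S) \<noteq> (v \<in> S) \<longleftrightarrow> {u, v} = e)"

text \<open>The side is the set of descendants of the lower end of \<open>e\<close>: it can be left
  only through the edge at its top.\<close>

lemma rooted_cut:
  assumes r: "rooted V E r par pos" and e: "e \<in> E"
  shows "\<exists>S. cut E e S"
proof -
  define P where "P = {(d, par d) | d. d \<in> V - {r}}"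
  obtain c where c: "c \<in> V - {r}" "e = {c, par c}" using rooted_edgeE[OF r e] .
  define S where "S = {v. (v, c) \<in> P\<^sup>*}"
  have le: "pos v \<le> pos w" if "(v, w) \<in> P\<^sup>*" for v w
    using that
  proof induction
    case (step y z)
    then have "pos y < pos z" using r by (auto simp: P_def rooted_def)
    then show ?case using step by simp
  qed simp
  have cs: "c \<in> S" "par c \<notin> S"
    using le[of "par c" c] c r by (auto simp: S_def rooted_def not_less[symmetric])
  have key: "(d \<in> S) \<noteq> (par d \<in> S) \<longleftrightarrow> {d, par d} = e" if d: "d \<in> V - {r}" for d
  proof (cases "d = c")
    case True
    then show ?thesis using cs c by auto
  next
    case False
    have "{d, par d} \<noteq> e"
      using rooted_edge_inj[OF r] d c False by (auto dest: inj_onD)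
    moreover have "(d \<in> S) = (par d \<in> S)"
    proof
      assume "d \<in> S"
      then obtain y where "(d, y) \<in> P" "(y, c) \<in> P\<^sup>*"
        using False unfolding S_def by (metis converse_rtranclE mem_Collect_eq)
      then show "par d \<in> S" by (auto simp: P_def S_def)
    next
      assume "par d \<in> S"
      then show "d \<in> S" using d unfolding S_def P_def
        by (auto intro: converse_rtrancl_into_rtrancl)
    qed
    ultimately show ?thesis by simp
  qed
  have "cut E e S" unfolding cut_def
  proof (intro allI impI)
    fix u v assume "{u, v} \<in> E"
    then obtain d where d: "d \<in> V - {r}" "{u, v} = {d, par d}" using rooted_edgeE[OF r] by metis
    then consider "u = d" "v = par d" | "u = par d" "v = d" by (auto simp: doubleton_eq_iff)
    then show "((u \<in> S) \<noteq> (v \<in> S)) = ({u, v} = e)"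
      using key[OF d(1)] by cases (auto simp: insert_commute)
  qed
  then show ?thesis by blast
qed

section \<open>Leaves\<close>

lemma tree_edge:
  assumes "is_tree V E" "e \<in> E"
  shows "\<exists>u\<in>V. \<exists>v\<in>V. u \<noteq> v \<and> e = {u, v}"
  using assms by (auto simp: is_tree_def simple_graph_def)

lemma tree_finite_edges:
  assumes "is_tree V E"
  shows "finite E"
proof -
  have "E \<subseteq> Pow V" using tree_edge[OF assms] by blast
  then show ?thesis using assms by (auto simp: is_tree_def simple_graph_def intro: finite_subset)
qed

lemma tree_connected:
  assumes "is_tree V E" "u \<in> V" "v \<in> V"
  obtains p where "is_walk V E p" "hd p = u" "last p = v"
proof -
  have "\<forall>u\<in>V. \<forall>v\<in>V. \<exists>p. is_walk V E p \<and> hd p = u \<and> last p = v"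
    using assms(1) unfolding is_tree_def graph_connected_def by simp
  then have "\<exists>p. is_walk V E p \<and> hd p = u \<and> last p = v" using assms by simp
  then show ?thesis using that by blast
qed

lemma tree_neighbour:
  assumes t: "is_tree V E" and v: "v \<in> V" and "V \<noteq> {v}"
  shows "\<exists>w\<in>V. w \<noteq> v \<and> {v, w} \<in> E"
proof -
  obtain u where u: "u \<in> V" "u \<noteq> v" using assms by auto
  obtain p where p: "is_walk V E p" "hd p = v" "last p = u"
    using tree_connected[OF t v u(1)] .
  then obtain w q where "p = v # w # q"
    using u by (cases p; cases "tl p") (auto simp: is_walk_def)
  then have "{v, w} \<in> E" using p by (auto simp: is_walk_def)
  moreover have "v \<noteq> w" "w \<in> V" using tree_edge[OF t \<open>{v, w} \<in> E\<close>] by (auto simp: doubleton_eq_iff)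
  ultimately show ?thesis by auto
qed

text \<open>An end of a longest path is a leaf: by maximality all its neighbours lie on the path,
  and one that is not next on the path would close a cycle.\<close>

lemma tree_has_leaf:
  assumes t: "is_tree V E" and "V \<noteq> {v0}" "v0 \<in> V"
  shows "\<exists>v\<in>V. degree E v = 1"
proof -
  have fin: "finite V" using t by (auto simp: is_tree_def simple_graph_def)
  define PS where "PS = {p. is_walk V E p \<and> distinct p}"
  have "PS \<subseteq> {p. set p \<subseteq> V \<and> length p \<le> card V}"
    unfolding PS_def using fin by (auto simp: is_walk_def distinct_card[symmetric] card_mono)
  then have finPS: "finite PS" using finite_lists_length_le[OF fin] finite_subset by blast
  have "[v0] \<in> PS" unfolding PS_def using assms by (auto simp: is_walk_def)
  then obtain p where p: "p \<in> PS" "\<forall>q\<in>PS. length q \<le> length p"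
    using finite_max[OF finPS, of length] by auto
  then have w: "is_walk V E p" "distinct p" by (auto simp: PS_def)
  define x where "x = hd p"
  obtain p' where pp: "p = x # p'" using w unfolding x_def by (cases p) (auto simp: is_walk_def)
  have xV: "x \<in> V" using w pp by (auto simp: is_walk_def)
  have inp: "y \<in> set p'" if "{x, y} \<in> E" for y
  proof -
    have y: "y \<in> V" "y \<noteq> x" using tree_edge[OF t that] by (auto simp: doubleton_eq_iff)
    show ?thesis
    proof (rule ccontr)
      assume "y \<notin> set p'"
      then have "y # p \<in> PS"
        using w y that pp unfolding PS_def by (auto simp: is_walk_def insert_commute)
      then show False using p(2) by force
    qed
  qed
  obtain y0 where y0: "{x, y0} \<in> E" using tree_neighbour[OF t xV] assms
    by (metis singletonD)
  have one: "y = hd p'" if xy: "{x, y} \<in> E" for y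
  proof (rule ccontr)
    assume ne: "y \<noteq> hd p'"
    obtain a b where ab: "p' = a @ y # b" using inp[OF xy] by (meson split_list)
    then have a: "a \<noteq> []" using ne by auto
    have "is_cycle V E (x # a @ [y])"
      unfolding is_cycle_def using w xy a unfolding pp ab
      by (auto simp: is_walk_def successively_append_iff successively_Cons Suc_le_eq insert_commute)
    then show False using t by (auto simp: is_tree_def)
  qed
  have "{e \<in> E. x \<in> e} = {{x, y0}}"
  proof
    show "{e \<in> E. x \<in> e} \<subseteq> {{x, y0}}"
    proof
      fix e assume e: "e \<in> {e \<in> E. x \<in> e}"
      then obtain y where "e = {x, y}" using tree_edge[OF t, of e] by auto
      then show "e \<in> {{x, y0}}" using one[of y] one[OF y0] e by auto
    qed
  qed (use y0 in auto)
  then show ?thesis using xV unfolding degree_def by (intro bexI[of _ x]) auto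
qed

lemma leaf_edge:
  assumes t: "is_tree V E" and d: "degree E v = 1"
  obtains w where "w \<in> V" "w \<noteq> v" "v \<in> V" "{e \<in> E. v \<in> e} = {{v, w}}"
proof -
  obtain e where e: "{e \<in> E. v \<in> e} = {e}" using d unfolding degree_def by (meson card_1_singletonE)
  then have "e \<in> E" "v \<in> e" by auto
  then obtain w where "e = {v, w}" "w \<in> V" "w \<noteq> v" "v \<in> V" using tree_edge[OF t, of e] by auto
  then show ?thesis using that e by blast
qed

lemma successively_remdups:
  assumes "successively P xs" "xs \<noteq> []"
  shows "\<exists>ys. successively P ys \<and> distinct ys \<and> set ys \<subseteq> set xs \<and> ys \<noteq> [] \<and> hd ys = hd xs \<and> last ys = last xs"
  using assms
proof (induction "length xs" arbitrary: xs rule: less_induct)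
  case less
  show ?case
  proof (cases "distinct xs")
    case False
    then obtain a b c y where xs: "xs = a @ [y] @ b @ [y] @ c"
      using not_distinct_decomp by blast
    define zs where "zs = a @ [y] @ c"
    have "successively P zs"
      using less.prems(1) unfolding zs_def xs
      by (cases c) (auto simp: successively_append_iff successively_Cons)
    moreover have "zs \<noteq> []" "length zs < length xs" "set zs \<subseteq> set xs" "hd zs = hd xs" "last zs = last xs"
      unfolding zs_def xs by (auto simp: hd_append)
    ultimately show ?thesis using less.hyps[of zs] by (metis order_trans)
  qed (use less.prems in blast)
qed

lemma tree_remove_leaf:
  assumes t: "is_tree V E" and d: "degree E v = 1"
  shows "is_tree (V - {v}) (E - {e \<in> E. v \<in> e})"
proof -
  obtain w where w: "w \<in> V" "w \<noteq> v" "v \<in> V" "{e \<in> E. v \<in> e} = {{v, w}}"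
    using leaf_edge[OF t d] .
  have sg: "simple_graph (V - {v}) (E - {e \<in> E. v \<in> e})"
    unfolding simple_graph_def
  proof (intro conjI ballI)
    show "finite (V - {v})" using t by (simp add: is_tree_def simple_graph_def)
    fix e assume e: "e \<in> E - {e \<in> E. v \<in> e}"
    then have "e \<in> E" by simp
    then obtain a b where "a \<in> V" "b \<in> V" "a \<noteq> b" "e = {a, b}" using tree_edge[OF t] by blast
    then show "\<exists>u\<in>V - {v}. \<exists>w\<in>V - {v}. u \<noteq> w \<and> e = {u, w}" using e by auto
  qed
  have walk: "is_walk (V - {v}) (E - {e \<in> E. v \<in> e}) p" if "is_walk V E p" "v \<notin> set p" for p
    using that unfolding is_walk_def
    by (auto elim!: successively_mono)
  have "graph_connected (V - {v}) (E - {e \<in> E. v \<in> e})"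
    unfolding graph_connected_def
  proof (intro conjI ballI)
    show "V - {v} \<noteq> {}" using w by auto
    fix a b assume ab: "a \<in> V - {v}" "b \<in> V - {v}"
    then have aV: "a \<in> V" and bV: "b \<in> V" by auto
    obtain p where p: "is_walk V E p" "hd p = a" "last p = b"
      using tree_connected[OF t aV bV] .
    then have "\<exists>q. successively (\<lambda>u v. {u, v} \<in> E) q \<and> distinct q \<and> set q \<subseteq> set p \<and> q \<noteq> [] \<and>
      hd q = hd p \<and> last q = last p"
      using successively_remdups[of "\<lambda>u v. {u, v} \<in> E" p] unfolding is_walk_def by blast
    then obtain q where q: "successively (\<lambda>u v. {u, v} \<in> E) q" "distinct q" "set q \<subseteq> V" "q \<noteq> []"
      "hd q = a" "last q = b"
      using p unfolding is_walk_def by blast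
    \<comment> \<open>A path without repetitions that passed through the leaf would enter and leave
      it by the same neighbour.\<close>
    have "v \<notin> set q"
    proof
      assume "v \<in> set q"
      then obtain q1 q2 where qq: "q = q1 @ v # q2" by (meson split_list)
      have "q1 \<noteq> []" "q2 \<noteq> []" using qq q ab by auto
      define x where "x = last q1"
      define y where "y = hd q2"
      have xy: "{x, v} \<in> E" "{v, y} \<in> E" "x \<in> set q1" "y \<in> set q2"
        using q(1) \<open>q1 \<noteq> []\<close> \<open>q2 \<noteq> []\<close> unfolding qq x_def y_def
        by (auto simp: successively_append_iff successively_Cons)
      then have "{x, v} \<in> {e \<in> E. v \<in> e}" "{v, y} \<in> {e \<in> E. v \<in> e}" by auto
      then have "{x, v} = {v, w}" "{v, y} = {v, w}" unfolding w(4) by blast+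
      then have "x = y" by (metis doubleton_eq_iff)
      then show False using q(2) qq xy by auto
    qed
    then show "\<exists>p. is_walk (V - {v}) (E - {e \<in> E. v \<in> e}) p \<and> hd p = a \<and> last p = b"
      using walk[of q] q by (auto simp: is_walk_def)
  qed
  moreover have "\<not> is_cycle (V - {v}) (E - {e \<in> E. v \<in> e}) p" for p
  proof
    assume "is_cycle (V - {v}) (E - {e \<in> E. v \<in> e}) p"
    then have "is_cycle V E p" unfolding is_cycle_def is_walk_def
      by (auto elim!: successively_mono)
    then show False using t by (auto simp: is_tree_def)
  qed
  ultimately show ?thesis using sg by (auto simp: is_tree_def)
qed

lemma tree_card_edges:
  assumes "is_tree V E"
  shows "Suc (card E) = card V"
  using assms
proof (induction "card V" arbitrary: V E rule: less_induct)
  case less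
  have fin: "finite V" "V \<noteq> {}"
    using less.prems by (auto simp: is_tree_def simple_graph_def graph_connected_def)
  then obtain v0 where v0: "v0 \<in> V" by auto
  show ?case
  proof (cases "V = {v0}")
    case True
    then have "E = {}" using tree_edge[OF less.prems] by blast
    then show ?thesis using True by simp
  next
    case False
    obtain v where v: "v \<in> V" "degree E v = 1" using tree_has_leaf[OF less.prems False v0] by blast
    obtain w where w: "{e \<in> E. v \<in> e} = {{v, w}}" using leaf_edge[OF less.prems v(2)] by metis
    have "Suc (card (E - {e \<in> E. v \<in> e})) = card (V - {v})"
      using less.hyps[OF _ tree_remove_leaf[OF less.prems v(2)]] v fin
      by (meson card_Diff1_less)
    moreover have "{v, w} \<in> E" using w by auto
    moreover have "card V = Suc (card (V - {v}))" using card.remove[OF fin(1) v(1)] .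
    moreover have "card E = Suc (card (E - {{v, w}}))"
      using card.remove[OF tree_finite_edges[OF less.prems] \<open>{v, w} \<in> E\<close>] .
    ultimately show ?thesis unfolding w by linarith
  qed
qed

section \<open>Necessity of the weights, combinatorial half: columns of bars and their
  changes\<close>

section \<open>Sweeping a bar representation of a tree\<close>

text \<open>Applied to the bars met by a vertical line, in the order of their heights, this yields
  the pairs that see each other along that line.\<close>

fun cells :: "'b list \<Rightarrow> ('b \<times> 'b) list" where
  "cells (x # y # zs) = (x, y) # cells (y # zs)"
| "cells _ = []"

lemma cells_Cons: "cells (x # xs) = (if xs = [] then [] else (x, hd xs) # cells xs)"
  by (cases xs) auto

lemma cells_append:
  "cells (xs @ ys) = cells xs @ (if xs = [] \<or> ys = [] then [] else [(last xs, hd ys)]) @ cells ys"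
  by (induction xs) (auto simp: cells_Cons hd_append)

lemma cells_mem: "c \<in> set (cells xs) \<Longrightarrow> fst c \<in> set (butlast xs) \<and> snd c \<in> set (tl xs)"
  by (induction xs rule: cells.induct) (auto dest: in_set_butlastD)

lemma cells_mem': "c \<in> set (cells xs) \<Longrightarrow> fst c \<in> set xs \<and> snd c \<in> set xs"
  using cells_mem[of c xs] by (auto dest: in_set_butlastD list.set_sel(2)[rotated])

lemma cells_split:
  "c \<in> set (cells xs) \<Longrightarrow> \<exists>ys zs. xs = ys @ fst c # snd c # zs"
proof (induction xs rule: cells.induct)
  case (1 x y zs)
  then show ?case
  proof (cases "c = (x, y)")
    case False
    then obtain us vs where "y # zs = us @ fst c # snd c # vs" using 1 by auto
    then have "x # y # zs = (x # us) @ fst c # snd c # vs" by simp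
    then show ?thesis by blast
  qed (auto intro: exI[of _ "[]"])
qed auto

lemma cells_inj:
  assumes "distinct xs"
  shows "inj_on fst (set (cells xs))" "inj_on snd (set (cells xs))" "distinct (cells xs)"
  using assms
proof (induction xs rule: cells.induct)
  case (1 x y zs)
  {
    case 1
    then show ?case using "1.IH" cells_mem'[of _ "y # zs"] by (fastforce simp: inj_on_def)
  next
    case 2
    then show ?case using "1.IH" cells_mem[of _ "y # zs"] by (fastforce simp: inj_on_def)
  next
    case 3
    then show ?case using "1.IH" cells_mem'[of _ "y # zs"] by fastforce
  }
qed auto

text \<open>\<open>last1\<close> and \<open>first1\<close> give the neighbours of a segment as lists
  of length at most one, because the segment may reach either end of the column.\<close>

definition last1 :: "'b list \<Rightarrow> 'b list" where
  "last1 p = (if p = [] then [] else [last p])"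

definition first1 :: "'b list \<Rightarrow> 'b list" where
  "first1 s = (if s = [] then [] else [hd s])"

lemma cells_segment:
  "set (cells (p @ m @ s)) =
     set (cells p) \<union> set (cells (last1 p @ m @ first1 s)) \<union> set (cells s)"
  by (cases p rule: rev_cases; cases s) (auto simp: last1_def first1_def cells_append cells_Cons)

lemma segment_cells_inner:
  assumes "c \<in> set (cells (last1 p @ m @ first1 s))" "m \<noteq> []"
  shows "fst c \<in> set m \<or> snd c \<in> set m"
  using assms cells_mem'[of c m] by (auto simp: last1_def first1_def cells_append cells_Cons split: if_splits)

lemma segment_cells_empty:
  "set (cells (last1 p @ [] @ first1 s)) = (if p = [] \<or> s = [] then {} else {(last p, hd s)})"
  by (auto simp: last1_def first1_def)

lemma segment_lower: "c \<in> set (cells (last1 p @ m)) \<Longrightarrow> snd c \<in> set m"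
  using cells_mem[of c "last1 p @ m"] by (auto simp: last1_def split: if_splits dest: list.set_sel(2)[rotated])

lemma segment_upper: "c \<in> set (cells (m @ first1 s)) \<Longrightarrow> fst c \<in> set m"
  using cells_mem[of c "m @ first1 s"]
  by (auto simp: first1_def butlast_append split: if_splits dest: in_set_butlastD)

lemma split_unused:
  assumes "G \<subseteq> set (cells (last1 p @ m @ first1 s))"
    and "p \<noteq> [] \<Longrightarrow> s \<noteq> [] \<Longrightarrow> \<exists>c\<in>set (cells (last1 p @ m @ first1 s)). c \<notin> G"
  shows "\<exists>m1 m2. m = m1 @ m2 \<and> G \<subseteq> set (cells (last1 p @ m1)) \<union> set (cells (m2 @ first1 s))"
proof (cases "p = [] \<or> s = []")
  case True
  then show ?thesis
  proof
    assume "p = []"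
    then show ?thesis using assms(1) by (intro exI[of _ "[]"] exI[of _ m]) (auto simp: last1_def)
  next
    assume "s = []"
    then show ?thesis using assms(1) by (intro exI[of _ m] exI[of _ "[]"]) (auto simp: first1_def)
  qed
next
  case False
  then obtain c where c: "c \<in> set (cells (last p # m @ [hd s]))" "c \<notin> G"
    using assms(2) by (auto simp: last1_def first1_def)
  obtain ys zs where yz: "last p # m @ [hd s] = (ys @ [fst c]) @ (snd c # zs)"
    using cells_split[OF c(1)] by auto
  define m1 where "m1 = tl (ys @ [fst c])"
  define m2 where "m2 = butlast (snd c # zs)"
  have 1: "last p # m1 = ys @ [fst c]" using yz unfolding m1_def by (cases ys) auto
  have "butlast (last p # m @ [hd s]) = last p # m" by (simp add: butlast_append)
  moreover have "butlast ((ys @ [fst c]) @ (snd c # zs)) = (ys @ [fst c]) @ m2"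
    unfolding m2_def by (subst butlast_append) simp
  ultimately have "last p # m = (last p # m1) @ m2" unfolding 1 yz by simp
  then have m: "m = m1 @ m2" by simp
  have 2: "m2 @ [hd s] = snd c # zs"
    using yz m unfolding 1[symmetric] by simp
  have "cells (last p # m @ [hd s]) = cells (last p # m1) @ [c] @ cells (m2 @ [hd s])"
    unfolding yz 1 2 by (subst cells_append) auto
  then have "G \<subseteq> set (cells (last1 p @ m1)) \<union> set (cells (m2 @ first1 s))"
    using assms(1) c(2) False by (auto simp: last1_def first1_def)
  then show ?thesis using m by blast
qed

locale tree_sweep =
  fixes E :: "'a set set" and own :: "'b \<Rightarrow> 'a" and left :: "'b \<Rightarrow> real"
  assumes edge2: "e \<in> E \<Longrightarrow> \<exists>u v. u \<noteq> v \<and> e = {u, v}"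
    and cuts: "e \<in> E \<Longrightarrow> \<exists>S. cut E e S"
begin

definition lbl :: "'b \<times> 'b \<Rightarrow> 'a set" where
  "lbl c = {own (fst c), own (snd c)}"

text \<open>Neighbours in a column see each other, so their owners are equal or adjacent: read
  upwards, the owners form a walk in the tree that may pause.\<close>

definition lazy_walk :: "'b list \<Rightarrow> bool" where
  "lazy_walk w \<longleftrightarrow> (\<forall>c\<in>set (cells w). own (fst c) = own (snd c) \<or> lbl c \<in> E)"

definition seen :: "'b list \<Rightarrow> 'a set set" where
  "seen w = lbl ` set (cells w) \<inter> E"

text \<open>One step replaces a maximal block of consecutive bars of a column that end at the same
  abscissa by the bars that start there; \<open>S\<close> and \<open>D\<close> collect the bars started and the tree edges
  seen so far.\<close>

inductive sweep :: "'b list \<Rightarrow> 'b set \<Rightarrow> 'a set set \<Rightarrow> bool" where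
  init: "sweep [] {} {}"
| step: "sweep (p @ \<alpha> @ s) S D \<Longrightarrow> \<alpha> \<noteq> [] \<or> \<beta> \<noteq> [] \<Longrightarrow> set \<beta> \<inter> S = {} \<Longrightarrow> distinct \<beta> \<Longrightarrow>
    (\<And>b. b \<in> set \<beta> \<Longrightarrow> left b = z) \<Longrightarrow> (\<And>b. b \<in> set (last1 p @ first1 s) \<Longrightarrow> left b < z) \<Longrightarrow>
    (\<And>a b. a \<in> set \<alpha> \<Longrightarrow> b \<in> set (p @ \<alpha> @ s) \<Longrightarrow> left a \<le> left b) \<Longrightarrow>
    lazy_walk (p @ \<beta> @ s) \<Longrightarrow> sweep (p @ \<beta> @ s) (S \<union> set \<beta>) (D \<union> seen (p @ \<beta> @ s))"

text \<open>The walk changes sides of the cut exactly when it traverses \<open>e\<close>.\<close>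

lemma crossing_parity:
  assumes "lazy_walk xs" "xs \<noteq> []" "e \<in> E" "cut E e C"
  shows "odd (length (filter (\<lambda>c. lbl c = e) (cells xs))) \<longleftrightarrow> (own (hd xs) \<in> C) \<noteq> (own (last xs) \<in> C)"
  using assms(1,2)
proof (induction xs rule: cells.induct)
  case (1 x y zs)
  have lz: "lazy_walk (y # zs)" using "1.prems" by (simp add: lazy_walk_def)
  have "own x = own y \<or> {own x, own y} \<in> E" using "1.prems" by (simp add: lazy_walk_def lbl_def)
  then have "(own x \<in> C) \<noteq> (own y \<in> C) \<longleftrightarrow> lbl (x, y) = e"
  proof
    assume "own x = own y"
    then show ?thesis using edge2[OF assms(3)] by (auto simp: lbl_def doubleton_eq_iff)
  next
    assume "{own x, own y} \<in> E"
    then show ?thesis using assms(4) by (auto simp: cut_def lbl_def)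
  qed
  then show ?case using "1.IH"[OF lz] by auto
qed auto

lemma segment_lazy:
  assumes "lazy_walk (p @ m @ s)"
  shows "lazy_walk (last1 p @ m @ first1 s)"
  using assms unfolding lazy_walk_def cells_segment[of p m s] by blast

text \<open>Both columns run from \<open>X\<close> to \<open>W\<close>, so every edge is traversed
  with the same parity in both. An edge met exactly once in the first is therefore met in the
  second.\<close>

lemma once_transfer:
  assumes lz: "lazy_walk (X # m @ [W])" "lazy_walk (X # m' @ [W])" and dist: "distinct (X # m @ [W])"
    and c: "c \<in> set (cells (X # m @ [W]))" "lbl c \<in> E"
    and uniq: "\<And>d. d \<in> set (cells (X # m @ [W])) \<Longrightarrow> lbl d = lbl c \<Longrightarrow> d = c"
  shows "lbl c \<in> lbl ` set (cells (X # m' @ [W]))"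
proof -
  obtain C where C: "cut E (lbl c) C" using cuts[OF c(2)] by blast
  let ?f = "\<lambda>xs. filter (\<lambda>d. lbl d = lbl c) (cells xs)"
  have "distinct (?f (X # m @ [W]))" using cells_inj(3)[OF dist] by simp
  moreover have "set (?f (X # m @ [W])) = {c}" using c(1) uniq by auto
  ultimately have "length (?f (X # m @ [W])) = 1" by (metis card_1_singleton_iff distinct_card One_nat_def)
  then have "odd (length (?f (X # m @ [W])))" by simp
  then have "odd (length (?f (X # m' @ [W])))"
    using crossing_parity[OF lz(1) _ c(2) C] crossing_parity[OF lz(2) _ c(2) C] by simp
  then have "?f (X # m' @ [W]) \<noteq> []" by force
  then have "\<exists>d\<in>set (cells (X # m' @ [W])). lbl d = lbl c"
    using filter_False[of "cells (X # m' @ [W])" "\<lambda>d. lbl d = lbl c"] by blast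
  then show ?thesis by (metis image_eqI)
qed

text \<open>\<open>F\<close> contains one visibility for each edge seen so far. It begins with the
  left end of \<open>st c\<close>, the later of its two bars, and stops with the right end of
  \<open>en c\<close>, the earlier one; \<open>en\<close> is constrained only once a bar of the pair
  has left the column \<open>w\<close>. Injectivity says that each end of a bar is charged once. The
  clause on pairs with equal \<open>left\<close> says that of two aligned visibilities at a bar
  \<open>b\<close> one has its start charged to \<open>b\<close>; it will yield at most one
  half-edge of weight 0 per bar. A pair that is still present must still be adjacent, since
  otherwise its visibility would have stopped with no end to charge.\<close>

definition matched :: "'b list \<Rightarrow> 'b set \<Rightarrow> 'a set set \<Rightarrow> ('b \<times> 'b) set \<Rightarrow>
    ('b \<times> 'b \<Rightarrow> 'b) \<Rightarrow> ('b \<times> 'b \<Rightarrow> 'b) \<Rightarrow> bool" where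
  "matched w S D F st en \<longleftrightarrow>
     (\<forall>c\<in>F. fst c \<in> S \<and> snd c \<in> S) \<and> inj_on lbl F \<and> lbl ` F = D \<and> D \<subseteq> E \<and>
     (\<forall>c\<in>F. st c \<in> {fst c, snd c} \<and> left (fst c) \<le> left (st c) \<and> left (snd c) \<le> left (st c)) \<and>
     inj_on st F \<and>
     (\<forall>c\<in>F. \<forall>d\<in>F. \<forall>b. c \<noteq> d \<longrightarrow> b \<in> {fst c, snd c} \<longrightarrow> b \<in> {fst d, snd d} \<longrightarrow>
        left (fst c) = left (snd c) \<longrightarrow> left (fst d) = left (snd d) \<longrightarrow> st c = b \<or> st d = b) \<and>
     (\<forall>c\<in>F. fst c \<in> set w \<longrightarrow> snd c \<in> set w \<longrightarrow> c \<in> set (cells w)) \<and>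
     (\<forall>c\<in>F. \<not> (fst c \<in> set w \<and> snd c \<in> set w) \<longrightarrow> en c \<in> {fst c, snd c} \<and> en c \<notin> set w \<and>
        left (en c) \<le> left (fst c) \<and> left (en c) \<le> left (snd c)) \<and>
     inj_on en {c \<in> F. \<not> (fst c \<in> set w \<and> snd c \<in> set w)} \<and>
     distinct w \<and> set w \<subseteq> S \<and> lazy_walk w \<and> seen w \<subseteq> D"

lemma choice_inj:
  assumes "distinct (m1 @ m2)" "distinct (last1 p @ m1)" "distinct (m2 @ first1 s)"
  shows "inj_on (\<lambda>c. if c \<in> set (cells (last1 p @ m1)) then snd c else fst c)
           (set (cells (last1 p @ m1)) \<union> set (cells (m2 @ first1 s)))"
proof (rule inj_onI)
  let ?A = "set (cells (last1 p @ m1))" and ?B = "set (cells (m2 @ first1 s))"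
  fix c d assume *: "c \<in> ?A \<union> ?B" "d \<in> ?A \<union> ?B"
    "(if c \<in> ?A then snd c else fst c) = (if d \<in> ?A then snd d else fst d)"
  have disj: "x \<notin> set m2" if "x \<in> set m1" for x using that assms(1) by auto
  show "c = d"
  proof (cases "c \<in> ?A")
    case cA: True
    show ?thesis
    proof (cases "d \<in> ?A")
      case True
      then show ?thesis using * cA inj_onD[OF cells_inj(2)[OF assms(2)], of c d] by simp
    next
      case False
      then have "snd c \<in> set m1" "fst d \<in> set m2" "snd c = fst d"
        using * cA segment_lower[of c p m1] segment_upper[of d m2 s] by simp_all
      then show ?thesis using disj by simp
    qed
  next
    case cA: False
    show ?thesis
    proof (cases "d \<in> ?A")
      case True
      then have "snd d \<in> set m1" "fst c \<in> set m2" "snd d = fst c"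
        using * cA segment_lower[of d p m1] segment_upper[of c m2 s] by simp_all
      then show ?thesis using disj by simp
    next
      case False
      then show ?thesis using * cA inj_onD[OF cells_inj(1)[OF assms(3)], of c d] by simp
    qed
  qed
qed

text \<open>A segment with bars on both sides has one cell more than it has bars. If all cells of
  the old segment are chosen (\<open>full\<close>), their edges are distinct, so
  \<open>once_transfer\<close> finds each of them in the new segment as well. The cell
  \<open>f0\<close> can then be dropped before any end has been charged to it, and its edge gets a
  new cell that starts at a bar of \<open>\<beta>\<close>.\<close>

lemma matched_step:
  assumes inv: "matched (p @ \<alpha> @ s) S D F st en"
    and ne: "\<alpha> \<noteq> [] \<or> \<beta> \<noteq> []" and fresh: "set \<beta> \<inter> S = {}" and db: "distinct \<beta>"
    and lb: "\<And>b. b \<in> set \<beta> \<Longrightarrow> left b = z" and ls: "\<And>b. b \<in> set (last1 p @ first1 s) \<Longrightarrow> left b < z"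
    and la: "\<And>a b. a \<in> set \<alpha> \<Longrightarrow> b \<in> set (p @ \<alpha> @ s) \<Longrightarrow> left a \<le> left b"
    and lz': "lazy_walk (p @ \<beta> @ s)"
  shows "\<exists>F st en. matched (p @ \<beta> @ s) (S \<union> set \<beta>) (D \<union> seen (p @ \<beta> @ s)) F st en"
proof -
  let ?w = "p @ \<alpha> @ s" and ?w' = "p @ \<beta> @ s"
  from inv have FS: "\<forall>c\<in>F. fst c \<in> S \<and> snd c \<in> S" and li: "inj_on lbl F" and lD: "lbl ` F = D"
    and DE: "D \<subseteq> E"
    and stF: "\<forall>c\<in>F. st c \<in> {fst c, snd c} \<and> left (fst c) \<le> left (st c) \<and> left (snd c) \<le> left (st c)"
    and sti: "inj_on st F"
    and J: "\<forall>c\<in>F. \<forall>d\<in>F. \<forall>b. c \<noteq> d \<longrightarrow> b \<in> {fst c, snd c} \<longrightarrow> b \<in> {fst d, snd d} \<longrightarrow>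
        left (fst c) = left (snd c) \<longrightarrow> left (fst d) = left (snd d) \<longrightarrow> st c = b \<or> st d = b"
    and act: "\<forall>c\<in>F. fst c \<in> set ?w \<longrightarrow> snd c \<in> set ?w \<longrightarrow> c \<in> set (cells ?w)"
    and enF: "\<forall>c\<in>F. \<not> (fst c \<in> set ?w \<and> snd c \<in> set ?w) \<longrightarrow> en c \<in> {fst c, snd c} \<and>
        en c \<notin> set ?w \<and> left (en c) \<le> left (fst c) \<and> left (en c) \<le> left (snd c)"
    and eni: "inj_on en {c \<in> F. \<not> (fst c \<in> set ?w \<and> snd c \<in> set ?w)}"
    and dw: "distinct ?w" and wS: "set ?w \<subseteq> S" and lz: "lazy_walk ?w" and sD: "seen ?w \<subseteq> D"
    unfolding matched_def by - (elim conjE, assumption)+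
  note FS = FS[rule_format] and stF = stF[rule_format] and J = J[rule_format]
    and act = act[rule_format] and enF = enF[rule_format]
  let ?A = "last1 p @ \<alpha> @ first1 s" and ?B = "last1 p @ \<beta> @ first1 s"
  have dw': "distinct ?w'" using dw db fresh wS by auto
  have px: "set (last1 p) \<subseteq> set p" "set (first1 s) \<subseteq> set s" "distinct (last1 p)" "distinct (first1 s)"
    by (auto simp: last1_def first1_def)
  have dA: "distinct ?A" and dB: "distinct ?B" using dw dw' px by (auto 0 3)
  have lzA: "lazy_walk ?A" and lzB: "lazy_walk ?B" using segment_lazy lz lz' by auto
  have cw: "set (cells ?w) = set (cells p) \<union> set (cells ?A) \<union> set (cells s)" by (rule cells_segment)
  have cw': "set (cells ?w') = set (cells p) \<union> set (cells ?B) \<union> set (cells s)" by (rule cells_segment)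
  define full where "full \<longleftrightarrow> p \<noteq> [] \<and> s \<noteq> [] \<and> set (cells ?A) \<subseteq> F"
  define f0 where "f0 = hd (cells ?A)"
  have cAne: "cells ?A \<noteq> []" "cells ?B \<noteq> []" if "p \<noteq> []" "s \<noteq> []"
    using that by (auto simp: last1_def first1_def cells_Cons)
  have f0: "f0 \<in> set (cells ?A)" "f0 \<in> F" if full
    using that cAne(1) unfolding full_def f0_def by (auto intro: hd_in_set)
  define F1 where "F1 = (if full then F - {f0} else F)"
  \<comment> \<open>The edges that need a cell of the new column: those seen for the first time, and
    the one whose cell was dropped.\<close>
  define N where "N = (seen ?B - D) \<union> (if full then {lbl f0} else {})"
  have once: "lbl c \<in> lbl ` set (cells ?B)" if "full" "c \<in> set (cells ?A)" for c
  proof -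
    have ps: "p \<noteq> []" "s \<noteq> []" and AF: "set (cells ?A) \<subseteq> F" using that(1) by (auto simp: full_def)
    have A: "?A = last p # \<alpha> @ [hd s]" and B: "?B = last p # \<beta> @ [hd s]"
      using ps by (simp_all add: last1_def first1_def)
    have "lbl c \<in> E" using that(2) AF lD DE by blast
    moreover have "d = c" if "d \<in> set (cells ?A)" "lbl d = lbl c" for d
      using inj_onD[OF li that(2)] that(1) \<open>c \<in> set (cells ?A)\<close> AF by blast
    ultimately show ?thesis
      using once_transfer[of "last p" \<alpha> "hd s" \<beta> c] lzA lzB dA that(2) unfolding A B by blast
  qed
  have NB: "N \<subseteq> lbl ` set (cells ?B)" using once f0 unfolding N_def seen_def by auto
  have NE: "N \<subseteq> E" using f0 lD DE unfolding N_def seen_def by (auto split: if_splits)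
  have "\<forall>e\<in>N. \<exists>c. c \<in> set (cells ?B) \<and> lbl c = e" using NB by blast
  from bchoice[OF this] obtain g where g: "\<forall>e\<in>N. g e \<in> set (cells ?B) \<and> lbl (g e) = e" by blast
  define G where "G = g ` N"
  have GB: "G \<subseteq> set (cells ?B)" using g unfolding G_def by blast
  have lG: "lbl ` G = N" unfolding G_def image_image using g by simp
  have liG: "inj_on lbl G" unfolding G_def inj_on_def using g by simp
  \<comment> \<open>If every cell of the new segment were a new choice, each edge in it would occur
    once and hence, by transfer, also in the old segment. It would not be new, so it could only be
    the edge of \<open>f0\<close>. Then both segments have a single cell, and nothing was
    replaced.\<close>
  have unusedB: "\<exists>c\<in>set (cells ?B). c \<notin> G" if ps: "p \<noteq> []" "s \<noteq> []"
  proof (rule ccontr)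
    assume "\<not> ?thesis"
    then have all: "set (cells ?B) \<subseteq> G" by blast
    have old: "lbl c = lbl f0 \<and> full" if c: "c \<in> set (cells ?B)" for c
    proof -
      have cN: "lbl c \<in> N" using all c lG by blast
      have A: "?A = last p # \<alpha> @ [hd s]" and B: "?B = last p # \<beta> @ [hd s]"
        using ps by (simp_all add: last1_def first1_def)
      have "d = c" if "d \<in> set (cells ?B)" "lbl d = lbl c" for d
        using inj_onD[OF liG that(2)] that(1) c all by blast
      moreover have "lbl c \<in> E" using cN NE by blast
      ultimately have "lbl c \<in> lbl ` set (cells ?A)"
        using once_transfer[of "last p" \<beta> "hd s" \<alpha> c] lzA lzB dB c unfolding A B by blast
      then have "lbl c \<in> seen ?w" using cN NE cw unfolding seen_def by auto
      then show ?thesis using cN sD unfolding N_def by (auto split: if_splits)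
    qed
    then have full: full using cAne(2)[OF ps] by (meson hd_in_set)
    have one: "c = d" if "c \<in> set (cells ?B)" "d \<in> set (cells ?B)" for c d
      using old[OF that(1)] old[OF that(2)] liG all that by (metis inj_onD subsetD)
    have oneA: "c = d" if "c \<in> set (cells ?A)" "d \<in> set (cells ?A)" for c d
    proof -
      have "lbl c = lbl f0" "lbl d = lbl f0" using once[OF full] that old by fastforce+
      then show ?thesis using that full li unfolding full_def by (metis inj_onD subsetD)
    qed
    have "\<alpha> = []"
    proof (cases \<alpha>)
      case (Cons a \<alpha>')
      then have "(last p, a) \<in> set (cells ?A)" "(last (a # \<alpha>'), hd s) \<in> set (cells ?A)"
        using ps by (auto simp: last1_def first1_def cells_append cells_Cons)
      then have "last p = last (a # \<alpha>')" using oneA by blast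
      moreover have "last (a # \<alpha>') \<in> set \<alpha>" using Cons by (metis last_in_set list.distinct(1))
      moreover have "last p \<in> set p" using ps by simp
      ultimately show ?thesis using dw by (metis disjoint_iff distinct_append Un_iff set_append)
    qed
    moreover have "\<beta> = []"
    proof (cases \<beta>)
      case (Cons a \<beta>')
      then have "(last p, a) \<in> set (cells ?B)" "(last (a # \<beta>'), hd s) \<in> set (cells ?B)"
        using ps by (auto simp: last1_def first1_def cells_append cells_Cons)
      then have "last p = last (a # \<beta>')" using one by blast
      moreover have "last (a # \<beta>') \<in> set \<beta>" using Cons by (metis last_in_set list.distinct(1))
      moreover have "last p \<in> set p" using ps by simp
      ultimately show ?thesis using dw' by (metis disjoint_iff distinct_append Un_iff set_append)
    qed
    ultimately show False using ne by simp
  qed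
  obtain \<beta>1 \<beta>2 where b12: "\<beta> = \<beta>1 @ \<beta>2" "G \<subseteq> set (cells (last1 p @ \<beta>1)) \<union> set (cells (\<beta>2 @ first1 s))"
    using split_unused[OF GB unusedB] by blast
  have unusedA: "\<exists>c\<in>set (cells ?A). c \<notin> F1 \<inter> set (cells ?A)" if "p \<noteq> []" "s \<noteq> []"
    using that f0 unfolding F1_def full_def by auto
  obtain \<alpha>1 \<alpha>2 where a12: "\<alpha> = \<alpha>1 @ \<alpha>2"
    "F1 \<inter> set (cells ?A) \<subseteq> set (cells (last1 p @ \<alpha>1)) \<union> set (cells (\<alpha>2 @ first1 s))"
    using split_unused[of "F1 \<inter> set (cells ?A)" p \<alpha> s] unusedA by blast
  \<comment> \<open>Below the split a cell is charged to its upper bar, above the split to its lower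
    bar. Hence \<open>sx\<close> charges starts to bars of \<open>\<beta>\<close>, and
    \<open>ex\<close> charges ends to bars of \<open>\<alpha>\<close>.\<close>
  define sx where "sx c = (if c \<in> set (cells (last1 p @ \<beta>1)) then snd c else fst c)" for c
  define ex where "ex c = (if c \<in> set (cells (last1 p @ \<alpha>1)) then snd c else fst c)" for c
  define F' where "F' = F1 \<union> G"
  define st' where "st' c = (if c \<in> G then sx c else st c)" for c
  define en' where "en' c = (if fst c \<in> set ?w \<and> snd c \<in> set ?w then ex c else en c)" for c
  have F1F: "F1 \<subseteq> F" unfolding F1_def by auto
  have sxb: "sx c \<in> set \<beta>" if "c \<in> G" for c
    using that b12 segment_lower[of c p \<beta>1] segment_upper[of c \<beta>2 s] unfolding sx_def by auto
  have exa: "ex c \<in> set \<alpha>" if "c \<in> F1" "c \<in> set (cells ?A)" for c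
    using that a12 segment_lower[of c p \<alpha>1] segment_upper[of c \<alpha>2 s] unfolding ex_def by auto
  have sxi: "inj_on sx G"
  proof -
    have "inj_on sx (set (cells (last1 p @ \<beta>1)) \<union> set (cells (\<beta>2 @ first1 s)))"
      unfolding sx_def by (rule choice_inj) (use dB b12(1) in auto)
    then show ?thesis using b12(2) by (rule inj_on_subset)
  qed
  have exi: "inj_on ex (F1 \<inter> set (cells ?A))"
  proof -
    have "inj_on ex (set (cells (last1 p @ \<alpha>1)) \<union> set (cells (\<alpha>2 @ first1 s)))"
      unfolding ex_def by (rule choice_inj) (use dA a12(1) in auto)
    then show ?thesis using a12(2) by (rule inj_on_subset)
  qed
  have FG: "c \<notin> F" if "c \<in> G" for c
  proof
    assume cF: "c \<in> F"
    have "fst c \<in> set \<beta> \<or> snd c \<in> set \<beta>"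
      using sxb[OF that] unfolding sx_def by (auto split: if_splits)
    then show False using FS[OF cF] fresh by auto
  qed
  have Gw: "fst c \<in> set ?w' \<and> snd c \<in> set ?w'" if "c \<in> G" for c
    using that GB cw' cells_mem'[of c ?w'] by blast
  have lF1: "lbl ` F1 = D - (if full then {lbl f0} else {})"
    using lD li f0 unfolding F1_def by (auto simp: inj_on_def)
  have lF': "lbl ` F' = D \<union> seen ?w'"
  proof -
    have "seen ?w' \<subseteq> seen ?w \<union> seen ?B" "seen ?B \<subseteq> seen ?w'"
      unfolding seen_def cw cw' by auto
    then show ?thesis using sD f0 lD unfolding F'_def image_Un lG lF1 N_def by (auto split: if_splits)
  qed
  have liF': "inj_on lbl F'"
  proof -
    have "inj_on lbl F1" using li F1F inj_on_subset by blast
    moreover have "lbl ` F1 \<inter> lbl ` G = {}" unfolding lG lF1 N_def by auto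
    ultimately show ?thesis using liG unfolding F'_def by (auto simp: inj_on_Un)
  qed
  have Gal: "fst c \<in> set \<beta> \<and> snd c \<in> set \<beta>" if c: "c \<in> G" and al: "left (fst c) = left (snd c)" for c
  proof -
    have sb: "fst c \<in> set \<beta> \<or> snd c \<in> set \<beta>" using sxb[OF c] unfolding sx_def by (auto split: if_splits)
    have "fst c \<in> set ?B" "snd c \<in> set ?B" using c GB cells_mem'[of c ?B] by auto
    then show ?thesis using sb al lb ls by (auto, (metis less_irrefl)+)
  qed
  \<comment> \<open>A chosen pair that ceases to be present was a cell of the replaced segment, so
    its end can be charged to \<open>\<alpha>\<close>.\<close>
  have newend: "c \<in> F1 \<inter> set (cells ?A)"
    if "c \<in> F'" "\<not> (fst c \<in> set ?w' \<and> snd c \<in> set ?w')" "fst c \<in> set ?w" "snd c \<in> set ?w" for c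
  proof -
    have "c \<in> F1" using that(1,2) Gw[of c] unfolding F'_def by blast
    moreover have "c \<in> set (cells ?w)" using act[OF _ that(3,4)] calculation F1F by blast
    ultimately show ?thesis using that cw cells_mem'[of c p] cells_mem'[of c s] by auto
  qed
  have "matched ?w' (S \<union> set \<beta>) (D \<union> seen ?w') F' st' en'"
    unfolding matched_def
  proof (intro conjI ballI allI impI)
    fix c assume c: "c \<in> F'"
    show "fst c \<in> S \<union> set \<beta>" "snd c \<in> S \<union> set \<beta>"
      using c Gw[of c] FS[of c] F1F wS unfolding F'_def by auto
    show "st' c \<in> {fst c, snd c}"
      using c stF[of c] F1F unfolding F'_def st'_def sx_def by auto
    have "left b \<le> left (st' c)" if "b = fst c \<or> b = snd c" for b
    proof (cases "c \<in> G")
      case True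
      have "b \<in> set ?B" using True that GB cells_mem'[of c ?B] by auto
      then have "left b \<le> z" using lb ls by (auto intro: less_imp_le)
      then show ?thesis using True sxb[OF True] lb unfolding st'_def by simp
    next
      case False
      then show ?thesis using c stF[of c] F1F that unfolding F'_def st'_def by auto
    qed
    then show "left (fst c) \<le> left (st' c)" "left (snd c) \<le> left (st' c)" by auto
  next
    fix c d b
    assume c: "c \<in> F'" and d: "d \<in> F'" and cd: "c \<noteq> d" "b \<in> {fst c, snd c}" "b \<in> {fst d, snd d}"
      and al: "left (fst c) = left (snd c)" "left (fst d) = left (snd d)"
    consider "c \<notin> G" "d \<notin> G" | "c \<in> G" "d \<notin> G" | "c \<notin> G" "d \<in> G" | "c \<in> G" "d \<in> G" by blast
    then show "st' c = b \<or> st' d = b"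
    proof cases
      case 1
      then have "c \<in> F" "d \<in> F" using c d F1F unfolding F'_def by auto
      then show ?thesis using J[OF _ _ cd al] 1 unfolding st'_def by simp
    next
      case 2
      then have "b \<in> set \<beta>" "b \<in> S" using Gal[OF _ al(1)] cd FS[of d] d F1F unfolding F'_def by auto
      then show ?thesis using fresh by auto
    next
      case 3
      then have "b \<in> set \<beta>" "b \<in> S" using Gal[OF _ al(2)] cd FS[of c] c F1F unfolding F'_def by auto
      then show ?thesis using fresh by auto
    next
      case 4
      \<comment> \<open>The bar \<open>b\<close> is the upper bar of one of the two cells and the
        lower bar of the other. On whichever side of the split it lies, one of the two cells is
        charged to it.\<close>
      have bb: "b \<in> set \<beta>" using Gal[OF 4(1) al(1)] cd by auto
      have cB: "c \<in> set (cells ?B)" "d \<in> set (cells ?B)" using 4 GB by auto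
      have nf: "\<not> (fst c = b \<and> fst d = b)" "\<not> (snd c = b \<and> snd d = b)"
        using inj_onD[OF cells_inj(1)[OF dB] _ cB] inj_onD[OF cells_inj(2)[OF dB] _ cB] cd(1) by auto
      have key: "sx e = b" if e: "e \<in> G" "(b \<in> set \<beta>1 \<and> snd e = b) \<or> (b \<in> set \<beta>2 \<and> fst e = b)" for e
      proof -
        have "snd e \<in> set (\<beta>2 @ first1 s)" if "e \<in> set (cells (\<beta>2 @ first1 s))"
          using cells_mem'[OF that] by auto
        moreover have "fst e \<in> set (last1 p @ \<beta>1)" if "e \<in> set (cells (last1 p @ \<beta>1))"
          using cells_mem'[OF that] by auto
        ultimately show ?thesis using e b12 dB unfolding sx_def by auto
      qed
      have "(b \<in> set \<beta>1 \<and> (snd c = b \<or> snd d = b)) \<or> (b \<in> set \<beta>2 \<and> (fst c = b \<or> fst d = b))"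
        using bb b12(1) nf cd by auto
      then show ?thesis using key[of c] key[of d] 4 unfolding st'_def by auto
    qed
  next
    fix c assume c: "c \<in> F'" "fst c \<in> set ?w'" "snd c \<in> set ?w'"
    show "c \<in> set (cells ?w')"
    proof (cases "c \<in> G")
      case True
      then show ?thesis using GB cw' by auto
    next
      case False
      then have c1: "c \<in> F1" "c \<in> F" using c F1F unfolding F'_def by auto
      then have nb: "fst c \<notin> set \<beta>" "snd c \<notin> set \<beta>" using FS[of c] fresh by auto
      then have cc: "c \<in> set (cells ?w)" using act[OF c1(2)] c by auto
      \<comment> \<open>Both bars survive, so a cell of the old segment formed by them would mean
        that \<open>\<alpha>\<close> is empty. The segment would consist of this one chosen cell,
        hence be full, and the cell would have been dropped.\<close>
      have "c \<notin> set (cells ?A)"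
      proof
        assume cA: "c \<in> set (cells ?A)"
        have "fst c \<notin> set \<alpha>" "snd c \<notin> set \<alpha>" using c nb dw by auto
        then have a: "\<alpha> = []" using segment_cells_inner[OF cA] by blast
        then have "set (cells ?A) = {c}" "p \<noteq> []" "s \<noteq> []"
          using cA segment_cells_empty[of p s] by (auto split: if_splits)
        then have "full" "f0 = c" using c1(2) f0(1) unfolding full_def by auto
        then show False using c1(1) unfolding F1_def by simp
      qed
      then show ?thesis using cc cw cw' by auto
    qed
  next
    fix c assume c: "c \<in> F'" "\<not> (fst c \<in> set ?w' \<and> snd c \<in> set ?w')"
    have c1: "c \<in> F1" using c Gw[of c] unfolding F'_def by blast
    then have cF: "c \<in> F" using F1F by blast
    show "en' c \<in> {fst c, snd c}"
      using enF[OF cF] unfolding en'_def ex_def by auto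
    have "en' c \<notin> set ?w' \<and> left (en' c) \<le> left (fst c) \<and> left (en' c) \<le> left (snd c)"
    proof (cases "fst c \<in> set ?w \<and> snd c \<in> set ?w")
      case True
      then have cA: "ex c \<in> set \<alpha>" using newend[OF c] exa by auto
      then have "ex c \<in> S" using wS by auto
      then have "ex c \<notin> set ?w'" using cA dw fresh by auto
      then show ?thesis using la[OF cA] True unfolding en'_def by auto
    next
      case False
      then have *: "en c \<in> {fst c, snd c} \<and> en c \<notin> set ?w \<and> left (en c) \<le> left (fst c) \<and> left (en c) \<le> left (snd c)"
        using enF[OF cF] by auto
      then have "en c \<in> S" using FS[OF cF] by auto
      then have "en c \<notin> set ?w'" using * fresh by auto
      then show ?thesis using * False unfolding en'_def by auto
    qed
    then show "en' c \<notin> set ?w'" "left (en' c) \<le> left (fst c)" "left (en' c) \<le> left (snd c)" by auto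
  next
    show "inj_on en' {c \<in> F'. \<not> (fst c \<in> set ?w' \<and> snd c \<in> set ?w')}"
    proof (rule inj_onI)
      fix c d assume "c \<in> {c \<in> F'. \<not> (fst c \<in> set ?w' \<and> snd c \<in> set ?w')}"
        "d \<in> {c \<in> F'. \<not> (fst c \<in> set ?w' \<and> snd c \<in> set ?w')}" and eq: "en' c = en' d"
      then have c: "c \<in> F'" "\<not> (fst c \<in> set ?w' \<and> snd c \<in> set ?w')"
        and d: "d \<in> F'" "\<not> (fst d \<in> set ?w' \<and> snd d \<in> set ?w')" by auto
      have F: "c \<in> F" "d \<in> F" using c d Gw[of c] Gw[of d] F1F unfolding F'_def by blast+
      have o: "en e \<notin> set \<alpha>" if "e \<in> F" "\<not> (fst e \<in> set ?w \<and> snd e \<in> set ?w)" for e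
        using enF[OF that] by auto
      show "c = d"
        using eq newend[OF c] newend[OF d] exa[of c] exa[of d] o[OF F(1)] o[OF F(2)]
          inj_onD[OF exi, of c d] inj_onD[OF eni, of c d] F
        unfolding en'_def mem_Collect_eq by (auto split: if_splits)
    qed
  next
    show "inj_on st' F'"
    proof (rule inj_onI)
      fix c d assume c: "c \<in> F'" and d: "d \<in> F'" and eq: "st' c = st' d"
      have o: "st e \<notin> set \<beta>" if "e \<in> F" for e
        using stF[OF that] FS[OF that] fresh by auto
      show "c = d"
        using eq c d sxb[of c] sxb[of d] o[of c] o[of d] inj_onD[OF sxi, of c d]
          inj_onD[OF sti, of c d] F1F
        unfolding st'_def F'_def by (auto split: if_splits)
    qed
  next
    show "D \<union> seen ?w' \<subseteq> E" using DE unfolding seen_def by auto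
  qed (use liF' lF' dw' lz' wS in auto)
  then show ?thesis by blast
qed

lemma sweep_matched: "sweep w S D \<Longrightarrow> \<exists>F st en. matched w S D F st en"
proof (induction rule: sweep.induct)
  case init
  then show ?case by (auto simp: matched_def lazy_walk_def seen_def)
next
  case (step p \<alpha> s S D \<beta> z)
  then show ?case using matched_step[of p \<alpha> s S D _ _ _ \<beta> z] by blast
qed

end

section \<open>Necessity of the weights: counting ends of visibilities\<close>

section \<open>Weightings of the half-edges of a tree\<close>

text \<open>The weight \<open>y v e\<close> counts how many of the two ends of the visibility that represents \<open>e\<close> are
  ends of bars of \<open>v\<close>.\<close>

definition weighting :: "nat \<Rightarrow> 'a set \<Rightarrow> 'a set set \<Rightarrow> ('a \<Rightarrow> 'a set \<Rightarrow> nat) \<Rightarrow> bool" where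
  "weighting t V E y \<longleftrightarrow> (\<forall>u v. {u, v} \<in> E \<longrightarrow> y u {u, v} + y v {u, v} = 2) \<and>
     (\<forall>v\<in>V. (\<Sum>e\<in>{e\<in>E. v \<in> e}. y v e) \<le> 2 * t \<and> (\<Sum>e\<in>{e\<in>E. v \<in> e}. max 1 (y v e)) \<le> 3 * t)"

context tree_sweep
begin

lemma matched_weighting:
  assumes m: "matched [] S D F st en" and fS: "finite S" "finite D"
    and few: "\<And>v. v \<in> V \<Longrightarrow> card {b \<in> S. own b = v} \<le> t"
  shows "\<exists>y. weighting t V D y"
proof -
  from m have FS: "\<forall>c\<in>F. fst c \<in> S \<and> snd c \<in> S" and li: "inj_on lbl F" and lD: "lbl ` F = D"
    and DE: "D \<subseteq> E"
    and stF: "\<forall>c\<in>F. st c \<in> {fst c, snd c} \<and> left (fst c) \<le> left (st c) \<and> left (snd c) \<le> left (st c)"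
    and sti: "inj_on st F"
    and J: "\<forall>c\<in>F. \<forall>d\<in>F. \<forall>b. c \<noteq> d \<longrightarrow> b \<in> {fst c, snd c} \<longrightarrow> b \<in> {fst d, snd d} \<longrightarrow>
        left (fst c) = left (snd c) \<longrightarrow> left (fst d) = left (snd d) \<longrightarrow> st c = b \<or> st d = b"
    and enF': "\<forall>c\<in>F. \<not> (fst c \<in> set [] \<and> snd c \<in> set []) \<longrightarrow> en c \<in> {fst c, snd c} \<and> en c \<notin> set [] \<and>
        left (en c) \<le> left (fst c) \<and> left (en c) \<le> left (snd c)"
    and eni': "inj_on en {c \<in> F. \<not> (fst c \<in> set [] \<and> snd c \<in> set [])}"
    unfolding matched_def by - (elim conjE, assumption)+
  have enF: "\<forall>c\<in>F. en c \<in> {fst c, snd c} \<and> left (en c) \<le> left (fst c) \<and> left (en c) \<le> left (snd c)"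
    using enF' by simp
  have eni: "inj_on en F" using eni' by simp
  define ph where "ph = inv_into F lbl"
  have ph: "ph e \<in> F" "lbl (ph e) = e" if "e \<in> D" for e
    using that lD inv_into_into[of e lbl F] f_inv_into_f[of e lbl F] unfolding ph_def by simp_all
  have phi: "inj_on ph D" using ph(2) by (metis inj_onI)
  define y where "y v e = of_bool (own (st (ph e)) = v) + (of_bool (own (en (ph e)) = v) :: nat)" for v e
  have own2: "own (fst (ph e)) \<noteq> own (snd (ph e))" if "e \<in> D" for e
  proof
    assume eq: "own (fst (ph e)) = own (snd (ph e))"
    have "e \<in> E" using that DE by blast
    then obtain u v where "u \<noteq> v" "e = {u, v}" using edge2 by blast
    moreover have "e = {own (snd (ph e))}" using ph(2)[OF that] eq by (simp add: lbl_def)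
    ultimately show False by auto
  qed
  have bound: "card {e \<in> D. v \<in> e \<and> own (h (ph e)) = v} \<le> t"
    if v: "v \<in> V" and h: "inj_on h F" "\<forall>c\<in>F. h c \<in> {fst c, snd c}" for v and h :: "'b \<times> 'b \<Rightarrow> 'b"
  proof -
    have "card {e \<in> D. v \<in> e \<and> own (h (ph e)) = v} \<le> card {b \<in> S. own b = v}"
    proof (rule card_inj_on_le)
      show "inj_on (\<lambda>e. h (ph e)) {e \<in> D. v \<in> e \<and> own (h (ph e)) = v}"
        using h(1) phi ph(1) by (auto simp: inj_on_def)
      show "(\<lambda>e. h (ph e)) ` {e \<in> D. v \<in> e \<and> own (h (ph e)) = v} \<subseteq> {b \<in> S. own b = v}"
      proof safe
        fix e assume "e \<in> D"
        then have "ph e \<in> F" by (rule ph(1))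
        then show "h (ph e) \<in> S" using h(2) FS by fastforce
      qed
    qed (use fS in auto)
    then show ?thesis using few[OF v] by simp
  qed
  have sum_y: "(\<Sum>e\<in>{e\<in>D. v \<in> e}. y v e) =
      card {e \<in> D. v \<in> e \<and> own (st (ph e)) = v} + card {e \<in> D. v \<in> e \<and> own (en (ph e)) = v}" for v
    using fS unfolding y_def by (simp add: sum.distrib of_bool_def sum.If_cases Int_def conj_assoc)
  \<comment> \<open>If \<open>v\<close> owns neither end of the visibility, both come from the other
    bar, whose \<open>left\<close> is then both the greatest and the least of the two: the bars are
    aligned. The clause of \<open>matched\<close> on aligned pairs keeps the bar of \<open>v\<close>
    from serving two such edges.\<close>
  have zero: "card {e \<in> D. v \<in> e \<and> y v e = 0} \<le> t" if v: "v \<in> V" for v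
  proof -
    define zb where "zb e = (if own (fst (ph e)) = v then fst (ph e) else snd (ph e))" for e
    let ?Z = "{e \<in> D. v \<in> e \<and> y v e = 0}"
    have zb: "zb e \<in> {fst (ph e), snd (ph e)}" "own (zb e) = v" if "e \<in> ?Z" for e
    proof -
      have "v \<in> lbl (ph e)" using that ph(2)[of e] by auto
      then show "zb e \<in> {fst (ph e), snd (ph e)}" "own (zb e) = v" unfolding zb_def lbl_def by auto
    qed
    have al: "left (fst (ph e)) = left (snd (ph e))" "st (ph e) \<noteq> zb e" if e: "e \<in> ?Z" for e
    proof -
      have F: "ph e \<in> F" using e ph by auto
      have "own (st (ph e)) \<noteq> v" "own (en (ph e)) \<noteq> v" using e unfolding y_def by (auto split: if_splits)
      then have ne: "st (ph e) \<noteq> zb e" "en (ph e) \<noteq> zb e" using zb(2)[OF e] by auto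
      have "st (ph e) \<in> {fst (ph e), snd (ph e)}" "en (ph e) \<in> {fst (ph e), snd (ph e)}"
        using F stF enF by auto
      then have "st (ph e) = en (ph e)" using ne zb(1)[OF e] by auto
      moreover have "left (fst (ph e)) \<le> left (st (ph e))" "left (snd (ph e)) \<le> left (st (ph e))"
        "left (en (ph e)) \<le> left (fst (ph e))" "left (en (ph e)) \<le> left (snd (ph e))"
        using F stF enF by blast+
      ultimately show "left (fst (ph e)) = left (snd (ph e))" by simp
      show "st (ph e) \<noteq> zb e" by (rule ne)
    qed
    have "card ?Z \<le> card {b \<in> S. own b = v}"
    proof (rule card_inj_on_le)
      show "inj_on zb ?Z"
      proof (rule inj_onI, rule ccontr)
        fix e e' assume e: "e \<in> ?Z" and e': "e' \<in> ?Z" and eq: "zb e = zb e'" and "e \<noteq> e'"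
        then have "ph e \<noteq> ph e'" using phi by (auto simp: inj_on_def)
        moreover have "ph e \<in> F" "ph e' \<in> F" using e e' ph by auto
        ultimately have "st (ph e) = zb e \<or> st (ph e') = zb e"
          using J[rule_format, of "ph e" "ph e'" "zb e"] zb(1)[OF e] zb(1)[OF e'] al(1)[OF e] al(1)[OF e']
          unfolding eq by blast
        then show False using al(2)[OF e] al(2)[OF e'] eq by simp
      qed
      show "zb ` ?Z \<subseteq> {b \<in> S. own b = v}"
      proof
        fix b assume "b \<in> zb ` ?Z"
        then obtain e where e: "e \<in> ?Z" "b = zb e" by blast
        then have "ph e \<in> F" using ph by auto
        then show "b \<in> {b \<in> S. own b = v}" using zb[OF e(1)] FS e(2) by auto
      qed
    qed (use fS in auto)
    then show ?thesis using few[OF v] by simp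
  qed
  have "weighting t V D y" unfolding weighting_def
  proof (intro conjI allI impI ballI)
    fix u v assume e: "{u, v} \<in> D"
    let ?c = "ph {u, v}"
    have "lbl ?c = {u, v}" "?c \<in> F" using ph[OF e] by auto
    moreover have "u \<noteq> v" using edge2[of "{u, v}"] e DE by auto
    ultimately have "(own x = u \<and> own x \<noteq> v) \<or> (own x = v \<and> own x \<noteq> u)" if "x \<in> {fst ?c, snd ?c}" for x
      using that by (auto simp: lbl_def doubleton_eq_iff)
    moreover have "st ?c \<in> {fst ?c, snd ?c}" "en ?c \<in> {fst ?c, snd ?c}" using stF enF \<open>?c \<in> F\<close> by auto
    ultimately show "y u {u, v} + y v {u, v} = 2" unfolding y_def by fastforce
  next
    fix v assume v: "v \<in> V"
    show Y: "(\<Sum>e\<in>{e\<in>D. v \<in> e}. y v e) \<le> 2 * t"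
      unfolding sum_y using bound[OF v sti] bound[OF v eni] stF enF by fastforce
    \<comment> \<open>The maximum with 1 exceeds the weight only where the weight is 0. This turns
      the bounds \<open>2 * t\<close> on ends and \<open>t\<close> on half-edges of weight 0 into
      \<open>3 * t\<close>.\<close>
    have "(\<Sum>e\<in>{e\<in>D. v \<in> e}. max 1 (y v e)) = (\<Sum>e\<in>{e\<in>D. v \<in> e}. y v e + of_bool (y v e = 0))"
      by (rule sum.cong) auto
    also have "\<dots> = (\<Sum>e\<in>{e\<in>D. v \<in> e}. y v e) + card {e \<in> D. v \<in> e \<and> y v e = 0}"
      using fS by (simp add: sum.distrib of_bool_def sum.If_cases Int_def conj_assoc)
    finally show "(\<Sum>e\<in>{e\<in>D. v \<in> e}. max 1 (y v e)) \<le> 3 * t" using Y zero[OF v] by simp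
  qed
  then show ?thesis by blast
qed

lemma sweep_seen: "sweep w S D \<Longrightarrow> seen w \<subseteq> D"
  by (induction rule: sweep.induct) (auto simp: seen_def)

lemma lazy_append:
  assumes "lazy_walk (xs @ k # ys)" "lazy_walk (k # zs)"
  shows "lazy_walk (xs @ k # zs)"
  using assms unfolding lazy_walk_def by (auto simp: cells_append)

lemma lazy_suffix: "lazy_walk (xs @ ys) \<Longrightarrow> lazy_walk ys"
  unfolding lazy_walk_def by (auto simp: cells_append)

text \<open>At the abscissa \<open>z\<close> blocks at several heights may change at once. The bars
  of \<open>K\<close> survive, in the same order in \<open>u\<close> and \<open>v\<close>, and cut
  both into blocks, which are exchanged one after the other from the bottom; \<open>p\<close> is the
  part already updated. Unit length makes the ending bars those with the least \<open>left\<close>,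
  namely \<open>z - 1\<close>, as a step of \<open>sweep\<close> demands.\<close>

lemma column_step:
  assumes "sweep (p @ u) S D" and "filter (\<lambda>b. b \<in> K) u = filter (\<lambda>b. b \<in> K) v"
    and "\<And>b. b \<in> set u - K \<Longrightarrow> left b = z - 1"
    and "\<And>b. b \<in> set v - K \<Longrightarrow> left b = z \<and> b \<notin> S"
    and "\<And>b. b \<in> K \<Longrightarrow> left b < z" and "\<And>b. b \<in> set p \<union> set u \<Longrightarrow> z - 1 \<le> left b"
    and "p \<noteq> [] \<Longrightarrow> last p \<in> K" and "distinct v" and "lazy_walk (p @ v)" and "lazy_walk u"
  shows "\<exists>D'. sweep (p @ v) (S \<union> (set v - K)) D' \<and> D \<subseteq> D'"
  using assms
proof (induction "filter (\<lambda>b. b \<in> K) u" arbitrary: p u v S D)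
  case Nil
  have uK: "set u \<inter> K = {}" and vK: "set v \<inter> K = {}"
    using Nil.hyps Nil.prems(2) by (metis (no_types, lifting) disjoint_iff filter_empty_conv)+
  show ?case
  proof (cases "u = [] \<and> v = []")
    case True
    then show ?thesis using Nil.prems(1) by auto
  next
    case False
    have "sweep (p @ v @ []) (S \<union> set v) (D \<union> seen (p @ v @ []))"
    proof (rule sweep.step[of p u "[]" S D v z])
      show "left b < z" if "b \<in> set (last1 p @ first1 [])" for b
        using that Nil.prems(5,7) by (auto simp: last1_def first1_def split: if_splits)
      show "left a \<le> left b" if "a \<in> set u" "b \<in> set (p @ u @ [])" for a b
      proof -
        have "a \<in> set u - K" using uK that by blast
        then show ?thesis using Nil.prems(3)[of a] Nil.prems(6)[of b] that by auto
      qed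
      show "left b = z" if "b \<in> set v" for b
        using Nil.prems(4)[of b] that vK by auto
      show "set v \<inter> S = {}" using Nil.prems(4) vK by blast
    qed (use Nil.prems(1,8,9) False in auto)
    moreover have "set v - K = set v" using vK by auto
    ultimately show ?thesis by (metis append_Nil2 Un_upper1)
  qed
next
  case (Cons k ks)
  from Cons.hyps(2) obtain \<alpha> u' where u: "u = \<alpha> @ k # u'" "\<forall>b\<in>set \<alpha>. b \<notin> K" "k \<in> K"
    "ks = filter (\<lambda>b. b \<in> K) u'"
    using filter_eq_Cons_iff[of "\<lambda>b. b \<in> K" u k ks] by metis
  from Cons.hyps(2) Cons.prems(2) obtain \<beta> v' where v: "v = \<beta> @ k # v'" "\<forall>b\<in>set \<beta>. b \<notin> K"
    "ks = filter (\<lambda>b. b \<in> K) v'"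
    using filter_eq_Cons_iff[of "\<lambda>b. b \<in> K" v k ks] by metis
  \<comment> \<open>The mixed column is lazy because its two parts meet in the surviving bar
    \<open>k\<close>, which belongs to the old and to the new column.\<close>
  have lz: "lazy_walk (p @ \<beta> @ k # u')"
    using lazy_append[of "p @ \<beta>" k v' u'] Cons.prems(9,10) lazy_suffix[of \<alpha> "k # u'"] u v by simp
  have "\<exists>D1. sweep (p @ \<beta> @ k # u') (S \<union> set \<beta>) D1 \<and> D \<subseteq> D1"
  proof (cases "\<alpha> = [] \<and> \<beta> = []")
    case True
    then show ?thesis using Cons.prems(1) u by auto
  next
    case False
    have "sweep (p @ \<beta> @ (k # u')) (S \<union> set \<beta>) (D \<union> seen (p @ \<beta> @ (k # u')))"
    proof (rule sweep.step[of p \<alpha> "k # u'" S D \<beta> z])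
      show "left b < z" if "b \<in> set (last1 p @ first1 (k # u'))" for b
        using that Cons.prems(5,7) u by (auto simp: last1_def first1_def split: if_splits)
      show "left a \<le> left b" if "a \<in> set \<alpha>" "b \<in> set (p @ \<alpha> @ k # u')" for a b
      proof -
        have "a \<in> set u - K" using u that by auto
        then show ?thesis using Cons.prems(3)[of a] Cons.prems(6)[of b] u that by auto
      qed
      show "left b = z" if "b \<in> set \<beta>" for b
        using Cons.prems(4)[of b] that v by auto
      show "set \<beta> \<inter> S = {}" using Cons.prems(4) v by auto
    qed (use Cons.prems(1,8) False u v lz in auto)
    then show ?thesis by blast
  qed
  then obtain D1 where D1: "sweep ((p @ \<beta> @ [k]) @ u') (S \<union> set \<beta>) D1" "D \<subseteq> D1" by auto
  have "\<exists>D'. sweep ((p @ \<beta> @ [k]) @ v') ((S \<union> set \<beta>) \<union> (set v' - K)) D' \<and> D1 \<subseteq> D'"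
  proof (rule Cons.hyps(1)[OF u(4) D1(1)])
    show "filter (\<lambda>b. b \<in> K) u' = filter (\<lambda>b. b \<in> K) v'" using u v by simp
    show "left b = z \<and> b \<notin> S \<union> set \<beta>" if "b \<in> set v' - K" for b
      using that Cons.prems(4)[of b] Cons.prems(8) v by auto
    show "z - 1 \<le> left b" if "b \<in> set (p @ \<beta> @ [k]) \<union> set u'" for b
      using that Cons.prems(6)[of b] Cons.prems(4)[of b] u v by auto
    show "lazy_walk u'" using lazy_suffix[of "\<alpha> @ [k]" u'] Cons.prems(10) u by simp
  qed (use Cons.prems u v in auto)
  then obtain D' where D': "sweep ((p @ \<beta> @ [k]) @ v') ((S \<union> set \<beta>) \<union> (set v' - K)) D'" "D1 \<subseteq> D'"
    by blast
  have e1: "(S \<union> set \<beta>) \<union> (set v' - K) = S \<union> (set v - K)" using u v by auto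
  have e2: "(p @ \<beta> @ [k]) @ v' = p @ v" using v by simp
  have "sweep (p @ v) (S \<union> (set v - K)) D'" using D'(1) unfolding e1 e2 .
  then show ?case using D1(2) D'(2) by blast
qed

end

section \<open>Necessity of the weights, geometric half: the column above an abscissa\<close>

section \<open>Columns of a bar arrangement\<close>

definition column :: "('b \<Rightarrow> real) \<Rightarrow> 'b set \<Rightarrow> 'b list" where
  "column ht A = map (inv_into A ht) (sorted_list_of_set (ht ` A))"

lemma column:
  assumes "finite A" "inj_on ht A"
  shows "set (column ht A) = A" "sorted_wrt (\<lambda>a b. ht a < ht b) (column ht A)" "distinct (column ht A)"
proof -
  have *: "ht (inv_into A ht h) = h" if "h \<in> ht ` A" for h using that by (rule f_inv_into_f)
  show 1: "set (column ht A) = A"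
    using assms unfolding column_def by (simp add: image_image)
  have "map ht (column ht A) = sorted_list_of_set (ht ` A)"
    unfolding column_def map_map using assms(1) by (intro map_idI) (simp add: *)
  then have "sorted_wrt (<) (map ht (column ht A))" using strict_sorted_list_of_set by metis
  then show 2: "sorted_wrt (\<lambda>a b. ht a < ht b) (column ht A)" by (simp add: sorted_wrt_map)
  show "distinct (column ht A)"
    using distinct_map[of ht "column ht A"] \<open>map ht (column ht A) = sorted_list_of_set (ht ` A)\<close> by simp
qed

lemma sorted_wrt_unique:
  fixes ht :: "'b \<Rightarrow> real"
  assumes "sorted_wrt (\<lambda>a b. ht a < ht b) xs" "sorted_wrt (\<lambda>a b. ht a < ht b) ys" "set xs = set ys"
  shows "xs = ys"
  using assms
proof (induction xs arbitrary: ys)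
  case (Cons x xs)
  then obtain y ys' where ys: "ys = y # ys'" by (cases ys) auto
  have "x = y"
  proof (rule ccontr)
    assume "x \<noteq> y"
    then have "x \<in> set ys'" "y \<in> set xs" using Cons.prems(3) ys by auto
    then show False using Cons.prems(1,2) ys by (auto dest: less_asym)
  qed
  moreover have "x \<notin> set xs" "y \<notin> set ys'" using Cons.prems ys by auto
  ultimately have "set xs = set ys'" using Cons.prems(3) ys by auto
  then show ?case using Cons ys \<open>x = y\<close> by auto
qed auto

lemma column_filter:
  assumes "finite A" "inj_on ht A"
  shows "filter (\<lambda>b. b \<in> C) (column ht A) = column ht (A \<inter> C)"
proof (rule sorted_wrt_unique[of ht])
  have "finite (A \<inter> C)" "inj_on ht (A \<inter> C)" using assms by (auto intro: inj_on_subset)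
  then show "sorted_wrt (\<lambda>a b. ht a < ht b) (column ht (A \<inter> C))"
    "set (filter (\<lambda>b. b \<in> C) (column ht A)) = set (column ht (A \<inter> C))"
    using column[of "A \<inter> C" ht] column(1)[OF assms] by auto
  show "sorted_wrt (\<lambda>a b. ht a < ht b) (filter (\<lambda>b. b \<in> C) (column ht A))"
    using column(2)[OF assms] by (rule sorted_wrt_filter)
qed

lemma column_cells:
  assumes "finite A" "inj_on ht A"
  shows "(b, c) \<in> set (cells (column ht A)) \<longleftrightarrow>
    b \<in> A \<and> c \<in> A \<and> ht b < ht c \<and> (\<forall>d\<in>A. ht d \<le> ht b \<or> ht c \<le> ht d)"
proof
  note col = column[OF assms]
  assume bc: "(b, c) \<in> set (cells (column ht A))"
  obtain ys zs where w: "column ht A = ys @ b # c # zs" using cells_split[OF bc] by auto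
  have "A = set ys \<union> {b, c} \<union> set zs" using col(1) unfolding w by auto
  moreover have "ht b < ht c" "\<forall>y\<in>set ys. ht y < ht b" "\<forall>y\<in>set zs. ht c < ht y"
    using col(2) unfolding w by (auto simp: sorted_wrt_append)
  ultimately show "b \<in> A \<and> c \<in> A \<and> ht b < ht c \<and> (\<forall>d\<in>A. ht d \<le> ht b \<or> ht c \<le> ht d)"
    by (auto intro: less_imp_le)
next
  note col = column[OF assms]
  assume *: "b \<in> A \<and> c \<in> A \<and> ht b < ht c \<and> (\<forall>d\<in>A. ht d \<le> ht b \<or> ht c \<le> ht d)"
  then obtain ys zs where w: "column ht A = ys @ b # zs" using col(1) by (metis split_list)
  have A: "A = set ys \<union> {b} \<union> set zs" using col(1) unfolding w by auto
  have s: "\<forall>y\<in>set ys. ht y < ht b" "\<forall>y\<in>set zs. ht b < ht y" "sorted_wrt (\<lambda>a b. ht a < ht b) zs"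
    using col(2) unfolding w by (auto simp: sorted_wrt_append)
  have "c \<in> set zs" using * A s by (auto dest: less_asym)
  then obtain d zs' where zs: "zs = d # zs'" by (cases zs) auto
  have "d \<in> A" using A zs by auto
  then have "ht c \<le> ht d" using * s zs by fastforce
  then have "d = c" using s(3) \<open>c \<in> set zs\<close> zs by (auto dest: less_le_trans)
  then show "(b, c) \<in> set (cells (column ht A))" unfolding w zs by (simp add: cells_append)
qed

locale bar_sweep = tree_sweep +
  fixes ht :: "'b \<Rightarrow> real" and BB :: "'b set"
  assumes fin: "finite BB"
    and apart: "\<And>b c z. b \<in> BB \<Longrightarrow> c \<in> BB \<Longrightarrow> b \<noteq> c \<Longrightarrow> left b \<le> z \<Longrightarrow> z \<le> left b + 1 \<Longrightarrow>
      left c \<le> z \<Longrightarrow> z \<le> left c + 1 \<Longrightarrow> ht b \<noteq> ht c"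
begin

text \<open>Half-open, so that at an event the ending bars are gone and the starting ones are
  present: the column at \<open>z\<close> is the one that holds on a short interval to the right of
  \<open>z\<close>.\<close>

definition active :: "real \<Rightarrow> 'b set" where
  "active z = {b \<in> BB. left b \<le> z \<and> z < left b + 1}"

definition word :: "real \<Rightarrow> 'b list" where
  "word z = column ht (active z)"

lemma active_fin: "finite (active z)" "inj_on ht (active z)"
proof -
  show "finite (active z)" using fin unfolding active_def by simp
  show "inj_on ht (active z)"
  proof (rule inj_onI, rule ccontr)
    fix b c assume "b \<in> active z" "c \<in> active z" "ht b = ht c" "b \<noteq> c"
    then show False using apart[of b c z] unfolding active_def by simp
  qed
qed

lemma sweep_columns:
  assumes lazy: "\<And>z. lazy_walk (word z)"
  shows "\<exists>D. sweep (word z) {b \<in> BB. left b \<le> z} D \<and> (\<forall>z'\<le>z. seen (word z') \<subseteq> D)"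
proof -
  define Ev where "Ev = left ` BB \<union> (\<lambda>b. left b + 1) ` BB"
  have finEv: "finite Ev" unfolding Ev_def using fin by simp
  have ev: "left b \<in> Ev" "left b + 1 \<in> Ev" if "b \<in> BB" for b using that unfolding Ev_def by auto
  show ?thesis
  proof (induction "card {\<tau> \<in> Ev. \<tau> \<le> z}" arbitrary: z rule: less_induct)
    case less
    show ?case
    proof (cases "{\<tau> \<in> Ev. \<tau> \<le> z} = {}")
      case True
      then have "active z' = {}" if "z' \<le> z" for z'
        using that ev unfolding active_def by force
      then have "word z' = []" if "z' \<le> z" for z' using that by (simp add: word_def column_def)
      moreover have S0: "{b \<in> BB. left b \<le> z} = {}" using True ev by blast
      ultimately show ?thesis unfolding S0 using sweep.init by (auto simp: seen_def)
    next
      case False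
      define z0 where "z0 = Max {\<tau> \<in> Ev. \<tau> \<le> z}"
      have z0: "z0 \<in> Ev" "z0 \<le> z" and z0max: "\<And>\<tau>. \<tau> \<in> Ev \<Longrightarrow> \<tau> \<le> z \<Longrightarrow> \<tau> \<le> z0"
        using Max_in[of "{\<tau> \<in> Ev. \<tau> \<le> z}"] False finEv unfolding z0_def by auto
      \<comment> \<open>\<open>z1\<close> is the preceding event, or just an earlier abscissa if
        there is none. The column is constant from \<open>z1\<close> until just before
        \<open>z0\<close> and again from \<open>z0\<close> to \<open>z\<close>, so a single
        \<open>column_step\<close> leads from one to the other.\<close>
      obtain z1 where z1: "z1 < z0" "\<And>\<tau>. \<tau> \<in> Ev \<Longrightarrow> \<tau> < z0 \<Longrightarrow> \<tau> \<le> z1"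
      proof (cases "{\<tau> \<in> Ev. \<tau> < z0} = {}")
        case True
        then show ?thesis using that[of "z0 - 1"] by auto
      next
        case ne: False
        have "Max {\<tau> \<in> Ev. \<tau> < z0} \<in> {\<tau> \<in> Ev. \<tau> < z0}" using ne finEv by (intro Max_in) auto
        then show ?thesis using that[of "Max {\<tau> \<in> Ev. \<tau> < z0}"] finEv by auto
      qed
      have L: "left b \<le> z' \<longleftrightarrow> left b < z0" "z' < left b + 1 \<longleftrightarrow> z0 \<le> left b + 1"
        if "z1 \<le> z'" "z' < z0" "b \<in> BB" for z' b
        using z1(2)[OF ev(1)[OF that(3)]] z1(2)[OF ev(2)[OF that(3)]] that by linarith+
      have U: "left b \<le> z' \<longleftrightarrow> left b \<le> z0" "z' < left b + 1 \<longleftrightarrow> z0 < left b + 1"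
        if "z0 \<le> z'" "z' \<le> z" "b \<in> BB" for z' b
        using z0max[OF ev(1)[OF that(3)]] z0max[OF ev(2)[OF that(3)]] that by linarith+
      have act1: "active z' = {b \<in> BB. left b < z0 \<and> z0 \<le> left b + 1}" if "z1 \<le> z'" "z' < z0" for z'
        unfolding active_def using L[OF that] by blast
      have act0: "active z' = active z0" if "z0 \<le> z'" "z' \<le> z" for z'
        unfolding active_def using U[OF that] by blast
      have "{\<tau> \<in> Ev. \<tau> \<le> z1} \<subset> {\<tau> \<in> Ev. \<tau> \<le> z}" using z0 z1 by force
      then have "card {\<tau> \<in> Ev. \<tau> \<le> z1} < card {\<tau> \<in> Ev. \<tau> \<le> z}"
        using finEv by (intro psubset_card_mono) auto
      from less[OF this] obtain D where D: "sweep (word z1) {b \<in> BB. left b \<le> z1} D"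
        "\<forall>z'\<le>z1. seen (word z') \<subseteq> D" by blast
      define K where "K = active z1 \<inter> active z0"
      have sets: "set (word z1) = active z1" "set (word z0) = active z0" "distinct (word z0)"
        unfolding word_def by (simp_all add: column active_fin)
      have a1: "active z1 = {b \<in> BB. left b < z0 \<and> z0 \<le> left b + 1}" using act1 z1(1) by simp
      have "\<exists>D'. sweep ([] @ word z0) ({b \<in> BB. left b \<le> z1} \<union> (set (word z0) - K)) D' \<and> D \<subseteq> D'"
      proof (rule column_step[of "[]" "word z1" _ D K "word z0" z0])
        show "filter (\<lambda>b. b \<in> K) (word z1) = filter (\<lambda>b. b \<in> K) (word z0)"
          unfolding word_def column_filter[OF active_fin] K_def by (simp add: Int_ac)
        show "left b = z0 - 1" if "b \<in> set (word z1) - K" for b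
          using that unfolding sets K_def a1 by (auto simp: active_def)
        show "left b = z0 \<and> b \<notin> {b \<in> BB. left b \<le> z1}" if "b \<in> set (word z0) - K" for b
          using that z1(1) unfolding sets K_def a1 by (auto simp: active_def)
        show "left b < z0" if "b \<in> K" for b using that unfolding K_def a1 by auto
        show "z0 - 1 \<le> left b" if "b \<in> set [] \<union> set (word z1)" for b
          using that unfolding sets a1 by auto
      qed (use D lazy sets in auto)
      moreover have "{b \<in> BB. left b \<le> z1} \<union> (set (word z0) - K) = {b \<in> BB. left b \<le> z}"
      proof -
        have "b \<in> {b \<in> BB. left b \<le> z1} \<union> (set (word z0) - K) \<longleftrightarrow> b \<in> {b \<in> BB. left b \<le> z}"
          if b: "b \<in> BB" for b
          using L[OF _ _ b, of z1] U[OF _ _ b, of z] z0 z1(1) b unfolding sets K_def a1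
          by (auto simp: active_def)
        then show ?thesis unfolding sets by (auto simp: active_def)
      qed
      ultimately obtain D' where D': "sweep (word z0) {b \<in> BB. left b \<le> z} D'" "D \<subseteq> D'" by auto
      have "seen (word z') \<subseteq> D'" if "z' \<le> z" for z'
      proof -
        consider "z' \<le> z1" | "z1 \<le> z'" "z' < z0" | "z0 \<le> z'" by linarith
        then show ?thesis
        proof cases
          case 1
          then show ?thesis using D(2) D'(2) by blast
        next
          case 2
          then have w: "word z' = word z1" unfolding word_def using act1 z1(1) by simp
          have "seen (word z1) \<subseteq> D" using D(2) by blast
          then show ?thesis unfolding w using D'(2) by (rule order_trans)
        next
          case 3
          then have w: "word z' = word z0" unfolding word_def using act0[OF 3 that] by simp
          show ?thesis unfolding w by (rule sweep_seen[OF D'(1)])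
        qed
      qed
      moreover have w: "word z = word z0" unfolding word_def using act0[OF z0(2) order_refl] by simp
      ultimately have "sweep (word z) {b \<in> BB. left b \<le> z} D' \<and> (\<forall>z'\<le>z. seen (word z') \<subseteq> D')"
        using D'(1) unfolding w by blast
      then show ?thesis by blast
    qed
  qed
qed

lemma sweep_weighting:
  assumes lazy: "\<And>z. lazy_walk (word z)" and all: "\<And>e. e \<in> E \<Longrightarrow> \<exists>z. e \<in> seen (word z)"
    and "finite E" and "\<And>v. v \<in> V \<Longrightarrow> card {b \<in> BB. own b = v} \<le> t"
  shows "\<exists>y. weighting t V E y"
proof -
  have "\<forall>e\<in>E. \<exists>z. e \<in> seen (word z)" using all by blast
  from bchoice[OF this] obtain ze where ze: "\<And>e. e \<in> E \<Longrightarrow> e \<in> seen (word (ze e))" by blast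
  \<comment> \<open>Far enough to the right for all bars to have ended and all edges to have been
    seen.\<close>
  define z where "z = Max (insert 0 ((\<lambda>b. left b + 1) ` BB \<union> ze ` E))"
  have z: "left b + 1 \<le> z" if "b \<in> BB" for b unfolding z_def using that fin \<open>finite E\<close> by (intro Max_ge) auto
  have z': "ze e \<le> z" if "e \<in> E" for e unfolding z_def using that fin \<open>finite E\<close> by (intro Max_ge) auto
  have "active z = {}" using z unfolding active_def by force
  then have w: "word z = []" unfolding word_def column_def by simp
  have BB: "{b \<in> BB. left b \<le> z} = BB" using z by fastforce
  obtain D where D: "sweep [] BB D" "\<forall>z'\<le>z. seen (word z') \<subseteq> D"
    using sweep_columns[OF lazy, of z] unfolding w BB by blast
  obtain F st en where m: "matched [] BB D F st en" using sweep_matched[OF D(1)] by blast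
  have "D = E"
  proof
    show "D \<subseteq> E" using m unfolding matched_def by - (elim conjE, assumption)
    show "E \<subseteq> D"
    proof
      fix e assume "e \<in> E"
      then have "e \<in> seen (word (ze e))" "seen (word (ze e)) \<subseteq> D" using ze[of e] z'[of e] D(2) by simp_all
      then show "e \<in> D" by blast
    qed
  qed
  then have "matched [] BB E F st en" using m by simp
  then show ?thesis using fin assms(3,4) by (rule matched_weighting)
qed

end

definition bar_x :: "(real \<times> real) set \<Rightarrow> real" where
  "bar_x B = (SOME x. \<exists>y. B = {x..x + 1} \<times> {y})"

definition bar_y :: "(real \<times> real) set \<Rightarrow> real" where
  "bar_y B = (SOME y. B = {bar_x B..bar_x B + 1} \<times> {y})"

lemma bar_eq: "is_bar B \<Longrightarrow> B = {bar_x B..bar_x B + 1} \<times> {bar_y B}"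
  unfolding is_bar_def bar_y_def bar_x_def by (rule someI_ex, rule someI_ex)

theorem representation_weighting:
  assumes rep: "unit_bar_rep t V E f" and tr: "rooted V E r par pos"
  shows "\<exists>y. weighting t V E y"
proof -
  have tree: "is_tree V E" by (rule rooted_is_tree[OF tr])
  have finV: "finite V" using tr by (simp add: rooted_def)
  \<comment> \<open>Bars are tagged with their vertices, which makes the owner a function of the
    bar, namely \<open>fst\<close>.\<close>
  define BB where "BB = (SIGMA v:V. f v)"
  define left :: "'a \<times> (real \<times> real) set \<Rightarrow> real" where "left b = bar_x (snd b)" for b
  define ht :: "'a \<times> (real \<times> real) set \<Rightarrow> real" where "ht b = bar_y (snd b)" for b
  have rep1: "finite (f v)" "card (f v) \<le> t" "\<And>B. B \<in> f v \<Longrightarrow> is_bar B" if "v \<in> V" for v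
    using rep that unfolding unit_bar_rep_def by auto
  have bar: "snd b = {left b..left b + 1} \<times> {ht b}" if "b \<in> BB" for b
  proof -
    have "is_bar (snd b)" using that rep1(3)[of "fst b" "snd b"] unfolding BB_def by auto
    then show ?thesis unfolding left_def ht_def by (rule bar_eq)
  qed
  have disj: "snd b \<inter> snd c = {}" if "b \<in> BB" "c \<in> BB" "b \<noteq> c" for b c
  proof -
    have "\<forall>u\<in>V. \<forall>v\<in>V. \<forall>B\<in>f u. \<forall>C\<in>f v. (u, B) \<noteq> (v, C) \<longrightarrow> B \<inter> C = {}"
      using rep unfolding unit_bar_rep_def by blast
    moreover have "fst b \<in> V" "snd b \<in> f (fst b)" "fst c \<in> V" "snd c \<in> f (fst c)"
      using that unfolding BB_def by auto
    moreover have "(fst b, snd b) \<noteq> (fst c, snd c)" using that by simp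
    ultimately show ?thesis by blast
  qed
  have edge: "{u, v} \<in> E \<longleftrightarrow> (\<exists>B\<in>f u. \<exists>C\<in>f v. sees (\<Union>w\<in>V. f w) B C)" if "u \<in> V" "v \<in> V" "u \<noteq> v" for u v
    using rep that unfolding unit_bar_rep_def by auto
  have bars: "(\<Union>w\<in>V. f w) = snd ` BB" unfolding BB_def by force
  interpret bar_sweep E fst left ht BB
  proof unfold_locales
    show "\<exists>u v. u \<noteq> v \<and> e = {u, v}" if "e \<in> E" for e using tree_edge[OF tree that] by blast
    show "\<exists>S. cut E e S" if "e \<in> E" for e using rooted_cut[OF tr that] .
    show "finite BB" unfolding BB_def using finV rep1(1) by auto
    fix b c z assume *: "b \<in> BB" "c \<in> BB" "b \<noteq> c" "left b \<le> z" "z \<le> left b + 1" "left c \<le> z" "z \<le> left c + 1"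
    show "ht b \<noteq> ht c"
    proof
      assume "ht b = ht c"
      then have "(z, ht b) \<in> snd b \<inter> snd c" using * bar by auto
      then show False using disj * by blast
    qed
  qed
  have mem: "b \<in> active z \<longleftrightarrow> b \<in> BB \<and> left b \<le> z \<and> z < left b + 1" for b z unfolding active_def by auto
  have cell: "(b, c) \<in> set (cells (word z)) \<longleftrightarrow>
      b \<in> active z \<and> c \<in> active z \<and> ht b < ht c \<and> (\<forall>d\<in>active z. ht d \<le> ht b \<or> ht c \<le> ht d)" for b c z
    unfolding word_def by (rule column_cells[OF active_fin])
  have sees_cell: "sees (\<Union>w\<in>V. f w) (snd b) (snd c)" if bc: "(b, c) \<in> set (cells (word z))" for b c z
  proof -
    define Ev where "Ev = left ` BB \<union> (\<lambda>b. left b + 1) ` BB"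
    have "finite Ev" unfolding Ev_def using fin by simp
    \<comment> \<open>The next event after \<open>z\<close>, or \<open>z + 1\<close> if there is
      none: up to it the active bars do not change, so the strip between two neighbours in the
      column is free.\<close>
    define z2 where "z2 = Min (insert (z + 1) {\<tau> \<in> Ev. z < \<tau>})"
    have z2: "z < z2" "\<And>\<tau>. \<tau> \<in> Ev \<Longrightarrow> z < \<tau> \<Longrightarrow> z2 \<le> \<tau>"
      using \<open>finite Ev\<close> unfolding z2_def by auto
    have ev: "left b \<le> z \<or> z2 \<le> left b" "left b + 1 \<le> z \<or> z2 \<le> left b + 1" if "b \<in> BB" for b
      using z2(2)[of "left b"] z2(2)[of "left b + 1"] that unfolding Ev_def by force+
    have b: "b \<in> BB" "left b \<le> z" "z < left b + 1" and c: "c \<in> BB" "left c \<le> z" "z < left c + 1"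
      and lt: "ht b < ht c" using bc unfolding cell mem by auto
    have "{z..z2} \<times> {ht b} \<subseteq> snd b" "{z..z2} \<times> {ht c} \<subseteq> snd c"
      using b c ev[OF b(1)] ev[OF c(1)] bar by auto
    moreover have "({z<..<z2} \<times> {ht b<..<ht c}) \<inter> X = {}" if X: "X \<in> (\<Union>w\<in>V. f w)" for X
    proof -
      obtain d where d: "d \<in> BB" "X = snd d" using X unfolding bars by blast
      show ?thesis
      proof (rule ccontr)
        assume "\<not> ?thesis"
        then obtain x where x: "z < x" "x < z2" "ht b < ht d" "ht d < ht c" "left d \<le> x" "x \<le> left d + 1"
          using bar[OF d(1)] d(2) by auto
        then have "d \<in> active z" using ev[OF d(1)] d(1) unfolding mem by linarith
        then show False using bc x unfolding cell by force
      qed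
    qed
    ultimately show ?thesis unfolding sees_def using z2(1) lt by blast
  qed
  have lazy: "lazy_walk (word z)" for z
    unfolding lazy_walk_def
  proof
    fix p assume p: "p \<in> set (cells (word z))"
    obtain b c where pp: "p = (b, c)" by (cases p)
    have "b \<in> BB" "c \<in> BB" using p unfolding pp cell mem by auto
    then have V: "fst b \<in> V" "fst c \<in> V" "snd b \<in> f (fst b)" "snd c \<in> f (fst c)" unfolding BB_def by auto
    then show "fst (fst p) = fst (snd p) \<or> lbl p \<in> E"
    proof (cases "fst b = fst c")
      case False
      have "sees (\<Union>w\<in>V. f w) (snd b) (snd c)" using sees_cell[of b c z] p unfolding pp by simp
      then have "{fst b, fst c} \<in> E" using edge[OF V(1,2) False] V(3,4) by blast
      then show ?thesis unfolding pp lbl_def by simp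
    qed (simp add: pp)
  qed
  have all: "\<exists>z. e \<in> seen (word z)" if e: "e \<in> E" for e
  proof -
    obtain u v where uv: "u \<in> V" "v \<in> V" "u \<noteq> v" "e = {u, v}" using tree_edge[OF tree e] by blast
    then obtain B C where BC: "B \<in> f u" "C \<in> f v" "sees (\<Union>w\<in>V. f w) B C" using edge[OF uv(1-3)] e by blast
    obtain x x' y y' where r: "x < x'" "y < y'"
      "{x..x'} \<times> {y} \<subseteq> B \<and> {x..x'} \<times> {y'} \<subseteq> C \<or> {x..x'} \<times> {y} \<subseteq> C \<and> {x..x'} \<times> {y'} \<subseteq> B"
      "\<forall>X\<in>(\<Union>w\<in>V. f w). ({x<..<x'} \<times> {y<..<y'}) \<inter> X = {}"
      using BC(3) unfolding sees_def by blast
    have uB: "(u, B) \<in> BB" and vC: "(v, C) \<in> BB" using uv BC unfolding BB_def by auto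
    obtain b c where bc: "b \<in> BB" "c \<in> BB" "{x..x'} \<times> {y} \<subseteq> snd b" "{x..x'} \<times> {y'} \<subseteq> snd c" "{fst b, fst c} = e"
      using r(3)
    proof
      assume "{x..x'} \<times> {y} \<subseteq> B \<and> {x..x'} \<times> {y'} \<subseteq> C"
      then show ?thesis using that[of "(u, B)" "(v, C)"] uB vC uv(4) by simp
    next
      assume "{x..x'} \<times> {y} \<subseteq> C \<and> {x..x'} \<times> {y'} \<subseteq> B"
      then show ?thesis using that[of "(v, C)" "(u, B)"] uB vC uv(4) by (simp add: insert_commute)
    qed
    have in1: "(x, y) \<in> snd b" "(x', y) \<in> snd b" "(x, y') \<in> snd c" "(x', y') \<in> snd c"
      using bc(3,4) r(1) by auto
    then have yb: "y = ht b" "left b \<le> x" "x' \<le> left b + 1" and yc: "y' = ht c" "left c \<le> x" "x' \<le> left c + 1"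
      using bar[OF bc(1)] bar[OF bc(2)] by auto
    have btw: "ht d \<le> ht b \<or> ht c \<le> ht d" if d: "d \<in> active x" for d
    proof (rule ccontr)
      assume n: "\<not> ?thesis"
      have d': "d \<in> BB" "left d \<le> x" "x < left d + 1" using d unfolding mem by auto
      \<comment> \<open>The bar \<open>d\<close> reaches from \<open>x\<close> at least to
        \<open>m\<close>, so the midpoint of this stretch puts a point of \<open>d\<close> into the
        interior of the rectangle.\<close>
      define m where "m = min x' (left d + 1)"
      have "x < m" "m \<le> x'" "m \<le> left d + 1" using r(1) d' unfolding m_def by auto
      then have "((x + m) / 2, ht d) \<in> ({x<..<x'} \<times> {y<..<y'}) \<inter> snd d"
        using n d' yb yc bar[OF d'(1)] by auto
      moreover have "snd d \<in> (\<Union>w\<in>V. f w)" using d'(1) unfolding bars by auto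
      ultimately show False using r(4) by blast
    qed
    have "b \<in> active x" "c \<in> active x" "ht b < ht c" unfolding mem using bc(1,2) yb yc r(1,2) by auto
    then have in_cells: "(b, c) \<in> set (cells (word x))" unfolding cell using btw by blast
    have "lbl (b, c) = e" using bc(5) by (simp add: lbl_def)
    then have "e \<in> lbl ` set (cells (word x))" using in_cells by (metis image_eqI)
    then have "e \<in> seen (word x)" unfolding seen_def using e by simp
    then show ?thesis by blast
  qed
  show ?thesis
  proof (rule sweep_weighting[OF lazy all tree_finite_edges[OF tree]])
    fix v assume v: "v \<in> V"
    have "{b \<in> BB. fst b = v} = Pair v ` f v" using v unfolding BB_def by auto
    then show "card {b \<in> BB. fst b = v} \<le> t" using rep1(2)[OF v] by (simp add: card_image inj_on_def)
  qed
qed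

section \<open>Sufficiency of the weights: drawing combs with unit bars\<close>

section \<open>Comb layouts\<close>

text \<open>A comb is a list of columns. The heads of adjacent nonempty columns are joined, and so are
  consecutive entries of a column; an empty column separates components.\<close>

definition path_edges :: "'a list \<Rightarrow> 'a set set" where
  "path_edges xs = (\<lambda>c. {fst c, snd c}) ` set (cells xs)"

definition link :: "'a list \<Rightarrow> 'a list \<Rightarrow> 'a set set" where
  "link c d = (if c = [] \<or> d = [] then {} else {{hd c, hd d}})"

definition comb_edges :: "'a list list \<Rightarrow> 'a set set" where
  "comb_edges cs = (\<Union>c\<in>set cs. path_edges c) \<union> (\<Union>(c, d)\<in>set (cells cs). link c d)"

lemma path_edges_simps:
  "path_edges [] = {}" "path_edges [x] = {}"
  "path_edges (xs @ ys) = path_edges xs \<union> path_edges ys \<union> (if xs = [] \<or> ys = [] then {} else {{last xs, hd ys}})"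
  by (auto simp: path_edges_def cells_append)

lemma path_edges_Cons: "path_edges (x # xs) = path_edges xs \<union> (if xs = [] then {} else {{x, hd xs}})"
  by (auto simp: path_edges_def cells_Cons)

lemma comb_edges_simps:
  "comb_edges [] = {}" "comb_edges [c] = path_edges c"
  "comb_edges (xs @ ys) = comb_edges xs \<union> comb_edges ys \<union>
     (if xs = [] \<or> ys = [] then {} else link (last xs) (hd ys))"
  by (auto simp: comb_edges_def cells_append)

lemma comb_edges_Cons:
  "comb_edges (c # cs) = path_edges c \<union> comb_edges cs \<union> (if cs = [] then {} else link c (hd cs))"
  by (auto simp: comb_edges_def cells_Cons)

lemma link_sym: "link c d = link d c"
  by (auto simp: link_def insert_commute)

lemma comb_edges_rev: "comb_edges (rev cs) = comb_edges cs"
  by (induction cs) (auto simp: comb_edges_simps comb_edges_Cons last_rev link_sym)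

lemma cells_nth: "(a, b) \<in> set (cells xs) \<longleftrightarrow> (\<exists>k. Suc k < length xs \<and> a = xs ! k \<and> b = xs ! Suc k)"
proof (induction xs rule: cells.induct)
  case (1 x y zs)
  show ?case
  proof
    assume "(a, b) \<in> set (cells (x # y # zs))"
    then consider "a = x" "b = y" | "(a, b) \<in> set (cells (y # zs))" by auto
    then show "\<exists>k. Suc k < length (x # y # zs) \<and> a = (x # y # zs) ! k \<and> b = (x # y # zs) ! Suc k"
    proof cases
      case 2
      then obtain k where "Suc k < length (y # zs)" "a = (y # zs) ! k" "b = (y # zs) ! Suc k"
        using 1 by blast
      then show ?thesis by (intro exI[of _ "Suc k"]) auto
    qed (auto intro!: exI[of _ 0])
  next
    assume "\<exists>k. Suc k < length (x # y # zs) \<and> a = (x # y # zs) ! k \<and> b = (x # y # zs) ! Suc k"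
    then obtain k where k: "Suc k < length (x # y # zs)" "a = (x # y # zs) ! k" "b = (x # y # zs) ! Suc k"
      by blast
    show "(a, b) \<in> set (cells (x # y # zs))"
    proof (cases k)
      case (Suc k')
      then have "\<exists>k. Suc k < length (y # zs) \<and> a = (y # zs) ! k \<and> b = (y # zs) ! Suc k"
        using k by (intro exI[of _ k']) auto
      then show ?thesis using 1 by simp
    qed (use k in simp)
  qed
qed auto

text \<open>Columns are shifted by 0.6: adjacent ones overlap in an interval of length 0.4, and
  those two apart are disjoint since 1.2 exceeds 1. Even columns go down from height 0 and odd ones
  up from height 1, so heads of adjacent columns face each other and screen everything behind
  them.\<close>

definition comb_bar :: "nat \<Rightarrow> nat \<Rightarrow> (real \<times> real) set" where
  "comb_bar i k = {6 * real i / 10..6 * real i / 10 + 1} \<times> {if even i then - real k else real k + 1}"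

definition slot :: "'a list list \<Rightarrow> nat \<Rightarrow> nat \<Rightarrow> bool" where
  "slot cs i k \<longleftrightarrow> i < length cs \<and> k < length (cs ! i)"

definition slot_adj :: "nat \<Rightarrow> nat \<Rightarrow> nat \<Rightarrow> nat \<Rightarrow> bool" where
  "slot_adj i k i' k' \<longleftrightarrow> (i = i' \<and> (k' = Suc k \<or> k = Suc k')) \<or> (k = 0 \<and> k' = 0 \<and> (i' = Suc i \<or> i = Suc i'))"

lemma comb_bar_sub:
  assumes "a < b"
  shows "{a..b} \<times> {h} \<subseteq> comb_bar i k \<longleftrightarrow>
    h = (if even i then - real k else real k + 1) \<and> 6 * real i / 10 \<le> a \<and> b \<le> 6 * real i / 10 + 1"
proof
  assume *: "{a..b} \<times> {h} \<subseteq> comb_bar i k"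
  have "(a, h) \<in> {a..b} \<times> {h}" "(b, h) \<in> {a..b} \<times> {h}" using assms by auto
  then have "(a, h) \<in> comb_bar i k" "(b, h) \<in> comb_bar i k" using * by blast+
  then show "h = (if even i then - real k else real k + 1) \<and> 6 * real i / 10 \<le> a \<and> b \<le> 6 * real i / 10 + 1"
    unfolding comb_bar_def by auto
qed (auto simp: comb_bar_def)

lemma comb_bar_disjoint:
  assumes "(i, k) \<noteq> (i', k')"
  shows "comb_bar i k \<inter> comb_bar i' k' = {}"
proof (rule ccontr)
  assume "\<not> ?thesis"
  then obtain x where x: "6 * real i / 10 \<le> x" "x \<le> 6 * real i / 10 + 1" "6 * real i' / 10 \<le> x"
    "x \<le> 6 * real i' / 10 + 1"
    and h: "(if even i then - real k else real k + 1) = (if even i' then - real k' else real k' + 1)"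
    unfolding comb_bar_def by auto
  have par: "even i = even i'" "k = k'" using h by (auto split: if_splits)
  \<comment> \<open>A common abscissa forces 0.6 times the difference of the columns to be at most
    1, so the difference is below 2; columns at distance 1 lie on different sides of the
    spine.\<close>
  have "real i \<le> real i' + 1.7" "real i' \<le> real i + 1.7" using x by auto
  then have "i < i' + 2" "i' < i + 2" by linarith+
  moreover have "i \<noteq> Suc i'" "i' \<noteq> Suc i" using par by auto
  ultimately have "i = i'" by linarith
  then show False using assms par by simp
qed

lemma comb_bar_sees_only:
  assumes sl: "slot cs i k" "slot cs i' k'" and A: "\<A> = {comb_bar i k |i k. slot cs i k}"
    and sees: "sees \<A> (comb_bar i k) (comb_bar i' k')"
  shows "slot_adj i k i' k'"
proof -
  let ?h = "\<lambda>i k. if even i then - real k else real k + 1"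
  obtain a b c d where r: "a < b" "c < d"
    and sub: "{a..b} \<times> {c} \<subseteq> comb_bar i k \<and> {a..b} \<times> {d} \<subseteq> comb_bar i' k' \<or>
      {a..b} \<times> {c} \<subseteq> comb_bar i' k' \<and> {a..b} \<times> {d} \<subseteq> comb_bar i k"
    and free: "\<forall>X\<in>\<A>. ({a<..<b} \<times> {c<..<d}) \<inter> X = {}"
    using sees unfolding sees_def by blast
  have x: "6 * real i / 10 \<le> a" "b \<le> 6 * real i / 10 + 1" "6 * real i' / 10 \<le> a" "b \<le> 6 * real i' / 10 + 1"
    using sub unfolding comb_bar_sub[OF r(1)] by auto
  have h: "c = ?h i k \<and> d = ?h i' k' \<or> c = ?h i' k' \<and> d = ?h i k"
    using sub unfolding comb_bar_sub[OF r(1)] by auto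
  \<comment> \<open>The bars of a column lie exactly above each other, so any bar of either column
    at an intermediate height blocks the whole rectangle.\<close>
  have block: False
    if s: "slot cs j m" and j: "j = i \<or> j = i'" and between: "c < ?h j m" "?h j m < d" for j m
  proof -
    have "((a + b) / 2, ?h j m) \<in> {a<..<b} \<times> {c<..<d}" using r between by auto
    moreover have "((a + b) / 2, ?h j m) \<in> comb_bar j m" using x j r unfolding comb_bar_def by auto
    moreover have "comb_bar j m \<in> \<A>" unfolding A using s by blast
    ultimately show False using free by blast
  qed
  have down: "slot cs j m'" if "slot cs j m" "m' \<le> m" for j m m' using that unfolding slot_def by auto
  have "real i \<le> real i' + 1.7" "real i' \<le> real i + 1.7" using x r by auto
  then have "i < i' + 2" "i' < i + 2" by linarith+
  then consider "i = i'" | "i' = Suc i" | "i = Suc i'" by linarith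
  then show ?thesis
  proof cases
    case 1
    have "k \<noteq> k'" using h r 1 by auto
    moreover have "\<not> Suc k < k'" using block[of i "Suc k"] down[OF sl(2), of "Suc k"] h r 1 by (auto split: if_splits)
    moreover have "\<not> Suc k' < k" using block[of i "Suc k'"] down[OF sl(1), of "Suc k'"] h r 1 by (auto split: if_splits)
    ultimately show ?thesis unfolding slot_adj_def using 1 by linarith
  next
    case 2
    have "k = 0" using block[of i 0] down[OF sl(1), of 0] h r 2 by (cases k) (auto split: if_splits)
    moreover have "k' = 0" using block[of i' 0] down[OF sl(2), of 0] h r 2 by (cases k') (auto split: if_splits)
    ultimately show ?thesis unfolding slot_adj_def using 2 by simp
  next
    case 3
    have "k = 0" using block[of i 0] down[OF sl(1), of 0] h r 3 by (cases k) (auto split: if_splits)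
    moreover have "k' = 0" using block[of i' 0] down[OF sl(2), of 0] h r 3 by (cases k') (auto split: if_splits)
    ultimately show ?thesis unfolding slot_adj_def using 3 by simp
  qed
qed

lemma sees_sym: "sees \<A> B C \<longleftrightarrow> sees \<A> C B"
  unfolding sees_def by (intro iff_exI) blast

lemma comb_bar_sees:
  assumes A: "\<A> = {comb_bar i k |i k. slot cs i k}" and adj: "slot_adj i k i' k'"
  shows "sees \<A> (comb_bar i k) (comb_bar i' k')"
proof -
  \<comment> \<open>All bars have integer heights, so nothing lies strictly between two consecutive
    integers.\<close>
  have free: "({a<..<b} \<times> {real_of_int h<..<real_of_int h + 1}) \<inter> X = {}" if X: "X \<in> \<A>" for X a b h
  proof (rule ccontr)
    assume "\<not> ?thesis"
    then obtain x y where xy: "(x, y) \<in> X" "real_of_int h < y" "y < real_of_int h + 1" by auto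
    obtain j m where "X = comb_bar j m" using X unfolding A by blast
    then have "y = (if even j then - real m else real m + 1)" using xy(1) unfolding comb_bar_def by simp
    then have "real_of_int h < real_of_int (if even j then - int m else int m + 1)"
      "real_of_int (if even j then - int m else int m + 1) < real_of_int (h + 1)"
      using xy by (auto split: if_splits)
    then show False unfolding of_int_less_iff by linarith
  qed
  have seesI: "sees \<A> B C"
    if "a < b" "{a..b} \<times> {real_of_int h} \<subseteq> B \<and> {a..b} \<times> {real_of_int h + 1} \<subseteq> C \<or>
      {a..b} \<times> {real_of_int h} \<subseteq> C \<and> {a..b} \<times> {real_of_int h + 1} \<subseteq> B" for a b h B C
    unfolding sees_def
  proof (intro exI conjI ballI)
    show "a < b" by (rule that(1))
    show "real_of_int h < real_of_int h + 1" by simp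
    show "{a..b} \<times> {real_of_int h} \<subseteq> B \<and> {a..b} \<times> {real_of_int h + 1} \<subseteq> C \<or>
      {a..b} \<times> {real_of_int h} \<subseteq> C \<and> {a..b} \<times> {real_of_int h + 1} \<subseteq> B" by (rule that(2))
    show "({a<..<b} \<times> {real_of_int h<..<real_of_int h + 1}) \<inter> X = {}" if "X \<in> \<A>" for X
      using that by (rule free)
  qed
  have vert: "sees \<A> (comb_bar i k) (comb_bar i (Suc k))" for i k
  proof (cases "even i")
    case True
    have "{6 * real i / 10..6 * real i / 10 + 1} \<times> {real_of_int (- int (Suc k))} \<subseteq> comb_bar i (Suc k)"
      "{6 * real i / 10..6 * real i / 10 + 1} \<times> {real_of_int (- int (Suc k)) + 1} \<subseteq> comb_bar i k"
      using True unfolding comb_bar_def by auto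
    then show ?thesis by (intro seesI[of "6 * real i / 10" "6 * real i / 10 + 1" "- int (Suc k)"]) simp_all
  next
    case False
    have "{6 * real i / 10..6 * real i / 10 + 1} \<times> {real_of_int (int k + 1)} \<subseteq> comb_bar i k"
      "{6 * real i / 10..6 * real i / 10 + 1} \<times> {real_of_int (int k + 1) + 1} \<subseteq> comb_bar i (Suc k)"
      using False unfolding comb_bar_def by auto
    then show ?thesis by (intro seesI[of "6 * real i / 10" "6 * real i / 10 + 1" "int k + 1"]) simp_all
  qed
  have hor: "sees \<A> (comb_bar i 0) (comb_bar (Suc i) 0)" for i
  proof -
    let ?a = "6 * real (Suc i) / 10" and ?b = "6 * real i / 10 + 1"
    have "?a < ?b" by simp
    moreover have "{?a..?b} \<times> {real_of_int 0} \<subseteq> comb_bar i 0 \<and> {?a..?b} \<times> {real_of_int 0 + 1} \<subseteq> comb_bar (Suc i) 0 \<or>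
        {?a..?b} \<times> {real_of_int 0} \<subseteq> comb_bar (Suc i) 0 \<and> {?a..?b} \<times> {real_of_int 0 + 1} \<subseteq> comb_bar i 0"
      unfolding comb_bar_sub[OF \<open>?a < ?b\<close>] by (cases "even i") auto
    ultimately show ?thesis by (rule seesI)
  qed
  show ?thesis using adj vert hor sees_sym unfolding slot_adj_def by blast
qed

lemma comb_edges_slots:
  "e \<in> comb_edges cs \<longleftrightarrow>
     (\<exists>i k i' k'. slot cs i k \<and> slot cs i' k' \<and> slot_adj i k i' k' \<and> e = {cs ! i ! k, cs ! i' ! k'})"
proof
  assume "e \<in> comb_edges cs"
  then consider c where "c \<in> set cs" "e \<in> path_edges c"
    | c d where "(c, d) \<in> set (cells cs)" "e \<in> link c d"
    unfolding comb_edges_def by auto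
  then show "\<exists>i k i' k'. slot cs i k \<and> slot cs i' k' \<and> slot_adj i k i' k' \<and> e = {cs ! i ! k, cs ! i' ! k'}"
  proof cases
    case 1
    then obtain i where i: "i < length cs" "c = cs ! i" by (auto simp: in_set_conv_nth)
    obtain a b where ab: "(a, b) \<in> set (cells c)" "e = {a, b}" using 1(2) unfolding path_edges_def by auto
    then obtain k where "Suc k < length c" "a = c ! k" "b = c ! Suc k" unfolding cells_nth by blast
    then show ?thesis using i ab(2)
      by (intro exI[of _ i] exI[of _ k] exI[of _ i] exI[of _ "Suc k"]) (auto simp: slot_def slot_adj_def)
  next
    case 2
    then obtain i where "Suc i < length cs" "c = cs ! i" "d = cs ! Suc i" unfolding cells_nth by blast
    then show ?thesis using 2(2)
      by (intro exI[of _ i] exI[of _ 0] exI[of _ "Suc i"] exI[of _ 0])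
        (auto simp: slot_def slot_adj_def link_def hd_conv_nth split: if_splits)
  qed
next
  have vert: "{cs ! i ! k, cs ! i ! Suc k} \<in> comb_edges cs" if "slot cs i (Suc k)" for i k
  proof -
    have "(cs ! i ! k, cs ! i ! Suc k) \<in> set (cells (cs ! i))" using that unfolding cells_nth slot_def by blast
    then have "{cs ! i ! k, cs ! i ! Suc k} \<in> path_edges (cs ! i)" unfolding path_edges_def by force
    then show ?thesis using that unfolding comb_edges_def slot_def by auto
  qed
  have hor: "{cs ! i ! 0, cs ! Suc i ! 0} \<in> comb_edges cs" if "slot cs i 0" "slot cs (Suc i) 0" for i
  proof -
    have "(cs ! i, cs ! Suc i) \<in> set (cells cs)" using that unfolding cells_nth slot_def by blast
    moreover have "{cs ! i ! 0, cs ! Suc i ! 0} \<in> link (cs ! i) (cs ! Suc i)"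
      using that unfolding slot_def link_def by (auto simp: hd_conv_nth)
    ultimately show ?thesis unfolding comb_edges_def by blast
  qed
  assume "\<exists>i k i' k'. slot cs i k \<and> slot cs i' k' \<and> slot_adj i k i' k' \<and> e = {cs ! i ! k, cs ! i' ! k'}"
  then show "e \<in> comb_edges cs" using vert hor unfolding slot_adj_def by (auto simp: insert_commute)
qed

lemma card_slots: "card {(i, k). slot cs i k \<and> cs ! i ! k = v} = count_list (concat cs) v"
proof -
  have "{(i, k). slot cs i k \<and> cs ! i ! k = v} = (SIGMA i:{..<length cs}. {k. k < length (cs ! i) \<and> cs ! i ! k = v})"
    unfolding slot_def by auto
  then have "card {(i, k). slot cs i k \<and> cs ! i ! k = v} =
      (\<Sum>i<length cs. card {k. k < length (cs ! i) \<and> cs ! i ! k = v})" by (simp add: card_SigmaI)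
  also have "\<dots> = (\<Sum>i<length cs. count_list (cs ! i) v)"
    by (simp add: count_list_eq_length_filter length_filter_conv_card eq_commute)
  also have "\<dots> = sum_list (map (\<lambda>c. count_list c v) cs)"
    by (simp add: sum_list_sum_nth atLeast0LessThan)
  also have "\<dots> = count_list (concat cs) v" by (induction cs) auto
  finally show ?thesis .
qed

text \<open>A vertex gets one bar for each of its occurrences. This serves twice: with bound 1 for a
  single comb, and with bound \<open>t\<close> for all combs of a decomposition side by
  side.\<close>

lemma comb_representation:
  assumes cV: "set (concat cs) \<subseteq> V" and cnt: "\<And>v. v \<in> V \<Longrightarrow> count_list (concat cs) v \<le> t"
    and E: "E = comb_edges cs"
  shows "\<exists>f. unit_bar_rep t V E f"
proof -
  define f where "f v = {comb_bar i k |i k. slot cs i k \<and> cs ! i ! k = v}" for v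
  have finS: "finite {(i, k). slot cs i k \<and> cs ! i ! k = v}" for v
  proof (rule finite_subset)
    show "{(i, k). slot cs i k \<and> cs ! i ! k = v} \<subseteq> (SIGMA i:{..<length cs}. {..<length (cs ! i)})"
      unfolding slot_def by auto
  qed auto
  have fim: "f v = (\<lambda>(i, k). comb_bar i k) ` {(i, k). slot cs i k \<and> cs ! i ! k = v}" for v
    unfolding f_def by auto
  have own: "cs ! i ! k \<in> V" if "slot cs i k" for i k
  proof -
    have "cs ! i \<in> set cs" "cs ! i ! k \<in> set (cs ! i)" using that unfolding slot_def by auto
    then show ?thesis using cV by auto
  qed
  have all: "(\<Union>w\<in>V. f w) = {comb_bar i k |i k. slot cs i k}"
    unfolding f_def using own by auto
  have "unit_bar_rep t V E f" unfolding unit_bar_rep_def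
  proof (intro conjI ballI impI)
    fix v assume v: "v \<in> V"
    show "finite (f v)" unfolding fim using finS by simp
    have "card (f v) \<le> card {(i, k). slot cs i k \<and> cs ! i ! k = v}"
      unfolding fim using finS by (rule card_image_le)
    then show "card (f v) \<le> t" using cnt[OF v] unfolding card_slots by simp
    show "is_bar B" if "B \<in> f v" for B using that unfolding f_def is_bar_def comb_bar_def by auto
  next
    fix u v B C assume "B \<in> f u" "C \<in> f v" and ne: "(u, B) \<noteq> (v, C)"
    then obtain i k i' k' where "B = comb_bar i k" "cs ! i ! k = u" "C = comb_bar i' k'" "cs ! i' ! k' = v"
      unfolding f_def by auto
    moreover from this have "(i, k) \<noteq> (i', k')" using ne by auto
    ultimately show "B \<inter> C = {}" using comb_bar_disjoint by simp
  next
    fix u v assume uv: "u \<in> V" "v \<in> V" "u \<noteq> v"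
    have "{u, v} \<in> E \<longleftrightarrow> (\<exists>i k i' k'. slot cs i k \<and> slot cs i' k' \<and> slot_adj i k i' k' \<and>
        cs ! i ! k = u \<and> cs ! i' ! k' = v)" (is "_ \<longleftrightarrow> ?S")
    proof
      assume "{u, v} \<in> E"
      then obtain i k i' k' where *: "slot cs i k" "slot cs i' k'" "slot_adj i k i' k'"
        "{u, v} = {cs ! i ! k, cs ! i' ! k'}" unfolding E comb_edges_slots by blast
      then consider "cs ! i ! k = u" "cs ! i' ! k' = v" | "cs ! i' ! k' = u" "cs ! i ! k = v"
        by (auto simp: doubleton_eq_iff)
      then show ?S
      proof cases
        case 2
        moreover have "slot_adj i' k' i k" using *(3) unfolding slot_adj_def by auto
        ultimately show ?thesis using * by blast
      qed (use * in blast)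
    next
      assume ?S
      then show "{u, v} \<in> E" unfolding E comb_edges_slots by metis
    qed
    also have "\<dots> \<longleftrightarrow> (\<exists>B\<in>f u. \<exists>C\<in>f v. sees (\<Union>w\<in>V. f w) B C)"
    proof
      assume ?S
      then obtain i k i' k' where s: "slot cs i k" "slot cs i' k'" "slot_adj i k i' k'"
        "cs ! i ! k = u" "cs ! i' ! k' = v" by blast
      have "comb_bar i k \<in> f u" "comb_bar i' k' \<in> f v" unfolding f_def using s by blast+
      then show "\<exists>B\<in>f u. \<exists>C\<in>f v. sees (\<Union>w\<in>V. f w) B C" using comb_bar_sees[OF all s(3)] by blast
    next
      assume "\<exists>B\<in>f u. \<exists>C\<in>f v. sees (\<Union>w\<in>V. f w) B C"
      then obtain B C where BC: "B \<in> f u" "C \<in> f v" "sees (\<Union>w\<in>V. f w) B C" by blast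
      obtain i k where i: "B = comb_bar i k" "slot cs i k" "cs ! i ! k = u"
        using BC(1) unfolding f_def by blast
      obtain i' k' where i': "C = comb_bar i' k'" "slot cs i' k'" "cs ! i' ! k' = v"
        using BC(2) unfolding f_def by blast
      have "slot_adj i k i' k'"
        using comb_bar_sees_only[OF i(2) i'(2) all] BC(3) unfolding i(1) i'(1) by blast
      then show ?S using i i' by blast
    qed
    finally show "{u, v} \<in> E \<longleftrightarrow> (\<exists>B\<in>f u. \<exists>C\<in>f v. sees (\<Union>w\<in>V. f w) B C)" .
  qed
  then show ?thesis by blast
qed

section \<open>Building the comb of one tree from the leaves upwards\<close>

definition comb :: "'a list list \<Rightarrow> 'a set \<Rightarrow> 'a set set \<Rightarrow> bool" where
  "comb cs A F \<longleftrightarrow> [] \<notin> set cs \<and> distinct (concat cs) \<and> set (concat cs) = A \<and> comb_edges cs = F"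

lemma comb_single: "comb [[v]] {v} {}"
  by (simp add: comb_def comb_edges_simps path_edges_simps)

text \<open>A path may also be laid out along the spine, which makes its end vertex a column of its
  own.\<close>

lemma comb_spread:
  assumes "comb [v # q] A F"
  shows "\<exists>cs. comb ([v] # cs) A F"
proof -
  have "comb_edges (map (\<lambda>x. [x]) xs) = path_edges xs" for xs :: "'a list"
    by (induction xs) (auto simp: comb_edges_simps comb_edges_Cons path_edges_simps path_edges_Cons link_def hd_map)
  from this[of "v # q"] have "comb (map (\<lambda>x. [x]) (v # q)) A F"
    using assms by (auto simp: comb_def comb_edges_simps comp_def)
  then show ?thesis by auto
qed

lemma comb_head:
  assumes "comb ((c # q) # cs) A F" "v \<notin> A"
  shows "comb ([v] # (c # q) # cs) (insert v A) (insert {v, c} F)"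
  using assms by (auto simp: comb_def comb_edges_Cons path_edges_simps link_def)



lemma comb_edges_column:
  "comb_edges (l @ [x] @ r) = comb_edges l \<union> path_edges x \<union> comb_edges r \<union>
     (if l = [] then {} else link (last l) x) \<union> (if r = [] then {} else link x (hd r))"
  by (auto simp: comb_edges_simps comb_edges_Cons)

lemma comb_pendant:
  assumes "comb (l @ [q @ [v]] @ r) A F" "comb [c # p] B G" "A \<inter> B = {}"
  shows "comb (l @ [(q @ [v]) @ (c # p)] @ r) (A \<union> B) (insert {v, c} (F \<union> G))"
proof -
  have d: "distinct (concat l @ (q @ [v]) @ concat r)" "distinct (c # p)"
    "set (concat l @ (q @ [v]) @ concat r) = A" "set (c # p) = B" "[] \<notin> set l" "[] \<notin> set r"
    using assms unfolding comb_def by auto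
  have E: "F = comb_edges (l @ [q @ [v]] @ r)" "G = path_edges (c # p)"
    using assms unfolding comb_def by (auto simp: comb_edges_simps)
  have lk: "link xs ((q @ [v]) @ c # p) = link xs (q @ [v])" "link ((q @ [v]) @ c # p) xs = link (q @ [v]) xs" for xs
    by (auto simp: link_def hd_append)
  have pe: "path_edges ((q @ [v]) @ c # p) = insert {v, c} (path_edges (q @ [v]) \<union> path_edges (c # p))"
    by (subst path_edges_simps(3)) auto
  have "comb_edges (l @ [(q @ [v]) @ (c # p)] @ r) = insert {v, c} (F \<union> G)"
    unfolding E comb_edges_column pe lk by auto
  moreover have "distinct (concat (l @ [(q @ [v]) @ (c # p)] @ r))"
    using d assms(3) by auto
  moreover have "set (concat (l @ [(q @ [v]) @ (c # p)] @ r)) = A \<union> B" using d(3,4) by auto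
  ultimately show ?thesis using d(5,6) unfolding comb_def by auto
qed

lemma comb_append:
  assumes "comb (l @ [q @ [c]] @ r) A F" "v \<notin> A"
  shows "comb (l @ [(q @ [c]) @ [v]] @ r) (insert v A) (insert {v, c} F)"
  using comb_pendant[OF assms(1) comb_single, of v] assms(2) by (simp add: insert_commute)

text \<open>One comb is mirrored so that the two first columns become neighbours on the
  spine.\<close>

lemma comb_middle:
  assumes "comb ((v # p) # cs) A F" "comb ((c # q) # cs') B G" "A \<inter> B = {}"
  shows "comb (rev ((c # q) # cs') @ (v # p) # cs) (A \<union> B) (insert {v, c} (F \<union> G))"
proof -
  have "comb_edges (rev ((c # q) # cs')) = G" using assms(2) unfolding comb_edges_rev comb_def by simp
  moreover have "comb_edges ((v # p) # cs) = F" using assms(1) by (simp add: comb_def)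
  moreover have "link (c # q) (v # p) = {{v, c}}" by (simp add: link_def insert_commute)
  ultimately have e: "comb_edges (rev ((c # q) # cs') @ (v # p) # cs) = insert {v, c} (F \<union> G)"
    unfolding comb_edges_simps(3) by (auto simp: last_rev)
  have "distinct (concat (rev xs))" if "distinct (concat xs)" for xs :: "'a list list"
    using that by (induction xs) auto
  from this[of "(c # q) # cs'"] show ?thesis
    using assms e unfolding comb_def by auto
qed

lemma card_le_2_cases:
  assumes "finite C" "card C \<le> 2"
  obtains "C = {}" | a where "C = {a}" | a b where "a \<noteq> b" "C = {a, b}"
proof -
  have "card C = 0 \<or> card C = 1 \<or> card C = 2" using assms(2) by linarith
  then show ?thesis using that assms(1) by (metis card_0_eq card_1_singletonE card_2_iff)
qed

text \<open>Here \<open>z c\<close> is the weight of the edge from \<open>c\<close> to its parent at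
  the parent. It dictates how the subtree of \<open>c\<close> has to be laid out: with 0 it is a
  path that can hang below the parent, with 1 it offers \<open>c\<close> at an end of the spine,
  with 2 it lets the parent be appended below \<open>c\<close>. The two bounds at a vertex leave
  just enough room to produce the layout that its own parent edge asks for.\<close>

lemma comb_of_rooted:
  assumes tr: "rooted W F r par pos" and z2: "\<And>c. c \<in> W - {r} \<Longrightarrow> z c \<le> (2 :: nat)"
    and Y: "\<And>v. v \<in> W \<Longrightarrow> (\<Sum>c\<in>{c \<in> W - {r}. par c = v}. z c) + (if v = r then 0 else 2 - z v) \<le> 2"
    and X: "\<And>v. v \<in> W \<Longrightarrow>
      (\<Sum>c\<in>{c \<in> W - {r}. par c = v}. max 1 (z c)) + (if v = r then 0 else max 1 (2 - z v)) \<le> 3"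
  shows "\<exists>cs. comb cs W F"
proof -
  define ch where "ch v = {c \<in> W - {r}. par c = v}" for v
  define P where "P = {(c, par c) | c. c \<in> W - {r}}"
  define sub where "sub v = {w \<in> W. (w, v) \<in> P\<^sup>*}" for v
  define Fe where "Fe v = (\<lambda>c. {c, par c}) ` (sub v - {v})" for v
  have finW: "finite W" and rW: "r \<in> W" and parW: "\<And>c. c \<in> W - {r} \<Longrightarrow> par c \<in> W \<and> pos c < pos (par c)"
    and F: "F = (\<lambda>c. {c, par c}) ` (W - {r})" using tr unfolding rooted_def by auto
  have finch: "finite (ch v)" for v unfolding ch_def using finW by simp
  have mono: "pos v \<le> pos w" if "(v, w) \<in> P\<^sup>*" for v w
    using that
  proof induction
    case (step y z)
    then have "pos y < pos z" using parW by (auto simp: P_def)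
    then show ?case using step by simp
  qed simp
  have sv: "single_valued P" unfolding P_def single_valued_def by auto
  have chP: "(c, v) \<in> P" "c \<in> W" "c \<noteq> r" "pos c < pos v" if "c \<in> ch v" for c v
    using that parW unfolding ch_def P_def by auto
  have vsub: "v \<notin> sub c" if "c \<in> ch v" for c v
    using chP(4)[OF that] mono[of v c] unfolding sub_def by auto
  have disj1: "(c, d) \<notin> P\<^sup>*" if cd: "c \<in> ch v" "d \<in> ch v" "c \<noteq> d" for c d v
  proof
    assume "(c, d) \<in> P\<^sup>*"
    then obtain y where "(c, y) \<in> P" "(y, d) \<in> P\<^sup>*" using cd(3) by (metis converse_rtranclE)
    then have "(v, d) \<in> P\<^sup>*" using chP(1)[OF cd(1)] sv unfolding single_valued_def by blast
    then show False using mono chP(4)[OF cd(2)] by fastforce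
  qed
  have disj: "sub c \<inter> sub d = {}" if cd: "c \<in> ch v" "d \<in> ch v" "c \<noteq> d" for c d v
  proof (rule ccontr)
    assume "sub c \<inter> sub d \<noteq> {}"
    then obtain w where "(w, c) \<in> P\<^sup>*" "(w, d) \<in> P\<^sup>*" unfolding sub_def by auto
    then have "(c, d) \<in> P\<^sup>* \<or> (d, c) \<in> P\<^sup>*" by (rule single_valued_confluent[OF sv])
    then show False using disj1[OF cd(1,2)] disj1[OF cd(2,1)] cd(3) by auto
  qed
  have sub_rec: "sub v = insert v (\<Union>c\<in>ch v. sub c)" if v: "v \<in> W" for v
  proof
    show "sub v \<subseteq> insert v (\<Union>c\<in>ch v. sub c)"
    proof
      fix w assume w: "w \<in> sub v"
      then have "w = v \<or> (\<exists>y. (w, y) \<in> P\<^sup>* \<and> (y, v) \<in> P)"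
        unfolding sub_def by (auto elim: rtranclE)
      then show "w \<in> insert v (\<Union>c\<in>ch v. sub c)"
        using w unfolding sub_def ch_def P_def by blast
    qed
    show "insert v (\<Union>c\<in>ch v. sub c) \<subseteq> sub v"
      using v chP(1)[of _ v] unfolding sub_def by (auto intro: rtrancl_into_rtrancl)
  qed
  have Fe_rec: "Fe v = (\<Union>c\<in>ch v. insert {v, c} (Fe c))" if v: "v \<in> W" for v
  proof -
    have "sub v - {v} = (\<Union>c\<in>ch v. sub c)" using sub_rec[OF v] vsub by auto
    then have "Fe v = (\<Union>c\<in>ch v. (\<lambda>c. {c, par c}) ` sub c)" unfolding Fe_def by (simp add: image_UN)
    also have "\<dots> = (\<Union>c\<in>ch v. insert {v, c} (Fe c))"
    proof (rule SUP_cong[OF refl])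
      fix c assume c: "c \<in> ch v"
      then have "sub c = insert c (sub c - {c})" "par c = v" using chP(2)[OF c] unfolding sub_def ch_def by auto
      note sc = arg_cong[OF this(1), of "image (\<lambda>c. {c, par c})", unfolded image_insert]
      show "(\<lambda>c. {c, par c}) ` sub c = insert {v, c} (Fe c)"
        using sc \<open>par c = v\<close> unfolding Fe_def by (simp only: insert_commute)
    qed
    finally show ?thesis .
  qed
  have subr: "sub r = W"
  proof -
    have "(w, r) \<in> P\<^sup>*" if "w \<in> W" for w
      using that
    proof (induction "Max (pos ` W) - pos w" arbitrary: w rule: less_induct)
      case less
      show ?case
      proof (cases "w = r")
        case False
        then have p: "par w \<in> W" "pos w < pos (par w)" "(w, par w) \<in> P"
          using parW less.prems by (auto simp: P_def)
        have "pos (par w) \<le> Max (pos ` W)" using p finW by auto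
        then have "(par w, r) \<in> P\<^sup>*" using less.hyps[of "par w"] p by linarith
        then show ?thesis using p(3) by (rule converse_rtrancl_into_rtrancl[rotated])
      qed simp
    qed
    then show ?thesis unfolding sub_def by auto
  qed
  define SA where "SA v C = insert v (\<Union>c\<in>C. sub c)" for v C
  define FA where "FA v C = (\<Union>c\<in>C. insert {v, c} (Fe c))" for v C
  have SA: "sub v = SA v (ch v)" "Fe v = FA v (ch v)" if "v \<in> W" for v
    using sub_rec[OF that] Fe_rec[OF that] unfolding SA_def FA_def by auto
  have disjA: "SA v C \<inter> sub c = {}" if "C \<subseteq> ch v" "c \<in> ch v" "c \<notin> C" for v C c
  proof -
    have "sub d \<inter> sub c = {}" if "d \<in> C" for d
      using disj[of d v c] that \<open>C \<subseteq> ch v\<close> \<open>c \<in> ch v\<close> \<open>c \<notin> C\<close> by blast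
    then show ?thesis using vsub[OF that(2)] unfolding SA_def by auto
  qed
  have SA_insert: "SA v (insert c C) = SA v C \<union> sub c" "FA v (insert c C) = insert {v, c} (FA v C \<union> Fe c)"
    "SA v {} = {v}" "FA v {} = {}" for v c C unfolding SA_def FA_def by auto
  define pathc where "pathc c \<longleftrightarrow> (\<exists>q. comb [c # q] (sub c) (Fe c))" for c
  define headc where "headc c \<longleftrightarrow> (\<exists>q cs. comb ((c # q) # cs) (sub c) (Fe c))" for c
  define tailc where "tailc c \<longleftrightarrow> (\<exists>l q r. comb (l @ [q @ [c]] @ r) (sub c) (Fe c))" for c
  have one: "\<exists>r. comb ([v] # r) (SA v {a}) (FA v {a})" if a: "a \<in> ch v" "headc a" for v a
  proof -
    obtain q cs where "comb ((a # q) # cs) (sub a) (Fe a)" using a(2) unfolding headc_def by blast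
    from comb_head[OF this vsub[OF a(1)]] show ?thesis unfolding SA_def FA_def by auto
  qed
  have two: "\<exists>l r. comb (l @ [[] @ [v]] @ r) (SA v C) (FA v C)"
    if C: "C \<subseteq> ch v" "card C \<le> 2" and h: "\<And>c. c \<in> C \<Longrightarrow> headc c" for v C
  proof -
    have "finite C" using C(1) finch finite_subset by blast
    then show ?thesis using C(2)
    proof (cases rule: card_le_2_cases)
      case 1
      have "comb ([] @ [[] @ [v]] @ []) (SA v C) (FA v C)" using comb_single by (simp add: 1 SA_insert)
      then show ?thesis by blast
    next
      case (2 a)
      then obtain r where "comb ([v] # r) (SA v C) (FA v C)" using one[of a v] C h by auto
      then have "comb ([] @ [[] @ [v]] @ r) (SA v C) (FA v C)" by simp
      then show ?thesis by blast
    next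
      case (3 a b)
      then obtain r where r: "comb ([v] # r) (SA v {a}) (FA v {a})" using one[of a v] C h by auto
      obtain q cs where b: "comb ((b # q) # cs) (sub b) (Fe b)" using h[of b] 3 unfolding headc_def by auto
      have "SA v {a} \<inter> sub b = {}" using disjA[of "{a}" v b] C 3 by auto
      from comb_middle[OF r b this] have "comb (rev ((b # q) # cs) @ [[] @ [v]] @ r) (SA v {b, a}) (FA v {b, a})"
        unfolding SA_insert(1)[of v b "{a}"] SA_insert(2)[of v b "{a}"] by simp
      moreover have "{b, a} = C" using 3 by auto
      ultimately show ?thesis by blast
    qed
  qed
  have addP: "\<exists>p. comb (l @ [(q @ [v]) @ (c # p)] @ r) (SA v (insert c C)) (FA v (insert c C))"
    if C: "comb (l @ [q @ [v]] @ r) (SA v C) (FA v C)" "C \<subseteq> ch v" "c \<in> ch v" "c \<notin> C" "pathc c" for l q v r c C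
  proof -
    obtain p where "comb [c # p] (sub c) (Fe c)" using C(5) unfolding pathc_def by blast
    from comb_pendant[OF C(1) this disjA[OF C(2,3,4)]] show ?thesis unfolding SA_insert by blast
  qed
  have addC: "\<exists>l q r. comb (l @ [q @ [v]] @ r) (SA v {c}) (FA v {c})" if c: "c \<in> ch v" "tailc c" for v c
  proof -
    obtain l q r where "comb (l @ [q @ [c]] @ r) (sub c) (Fe c)" using c(2) unfolding tailc_def by blast
    from comb_append[OF this vsub[OF c(1)]]
    have "comb (l @ [(q @ [c]) @ [v]] @ r) (SA v {c}) (FA v {c})"
      unfolding SA_def FA_def by (simp add: insert_commute)
    then show ?thesis by blast
  qed
  have path_head: "headc c" if "pathc c" for c
    using that comb_spread unfolding pathc_def headc_def by blast
  have cardX: "card C \<le> (\<Sum>c\<in>C. max 1 (z c))" for C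
    using sum_mono[of C "\<lambda>_. 1" "\<lambda>c. max 1 (z c)"] by simp
  have big: "z c + (\<Sum>d\<in>ch v - {c}. max 1 (z d)) \<le> (\<Sum>d\<in>ch v. max 1 (z d))" if "c \<in> ch v" for c v
    using sum.remove[OF finch that, of "\<lambda>d. max 1 (z d)"] by simp
  have state: "v \<noteq> r \<longrightarrow> (z v = 0 \<longrightarrow> pathc v) \<and> (z v = 1 \<longrightarrow> headc v) \<and> (z v = 2 \<longrightarrow> tailc v)" if "v \<in> W" for v
    using that
  proof (induction "pos v" arbitrary: v rule: less_induct)
    case less
    have IH: "(z c = 0 \<longrightarrow> pathc c) \<and> (z c = 1 \<longrightarrow> headc c) \<and> (z c = 2 \<longrightarrow> tailc c)" if "c \<in> ch v" for c
      using less.hyps[of c] chP[OF that] by simp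
    have IH1: "headc c" if "c \<in> ch v" "z c \<le> 1" for c
      using IH[OF that(1)] that(2) path_head by (cases "z c = 0") auto
    show ?case
    proof (intro impI conjI)
      assume vr: "v \<noteq> r" and z: "z v = 0"
      \<comment> \<open>The parent edge has weight 2 at \<open>v\<close>, which leaves weight 0 and
        one place: at most one child, and its subtree is again a path.\<close>
      have "card (ch v) \<le> 1" using X[OF less.prems] vr z cardX[of "ch v"] unfolding ch_def[symmetric] by simp
      moreover have "(\<Sum>c\<in>ch v. z c) = 0" using Y[OF less.prems] vr z unfolding ch_def[symmetric] by simp
      ultimately consider "ch v = {}" | a where "ch v = {a}" "z a = 0"
        using finch by (metis One_nat_def card_0_eq card_1_singletonE le_Suc_eq le_zero_eq finite.emptyI sum_eq_0_iff insertI1)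
      then show "pathc v"
      proof cases
        case 1
        then have "comb [v # []] (sub v) (Fe v)"
          unfolding SA[OF less.prems] 1 SA_insert by (rule_tac comb_single)
        then show ?thesis unfolding pathc_def by blast
      next
        case (2 a)
        have "comb ([] @ [[] @ [v]] @ []) (SA v {}) (FA v {})" using comb_single by (simp add: SA_insert)
        from addP[OF this, of a] obtain p where "comb ([] @ [([] @ [v]) @ a # p] @ []) (SA v {a}) (FA v {a})"
          using 2 IH by auto
        then have "comb [v # a # p] (sub v) (Fe v)" unfolding SA[OF less.prems] 2 by simp
        then show ?thesis unfolding pathc_def by blast
      qed
    next
      assume vr: "v \<noteq> r" and z: "z v = 1"
      \<comment> \<open>Weight 1 and two places are left. One child can continue the spine; of two
        children one has weight 0 and hangs below \<open>v\<close>.\<close>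
      have c2: "card (ch v) \<le> 2" using X[OF less.prems] vr z cardX[of "ch v"] unfolding ch_def[symmetric] by simp
      have zs: "(\<Sum>c\<in>ch v. z c) \<le> 1" using Y[OF less.prems] vr z unfolding ch_def[symmetric] by simp
      have z1: "z c \<le> 1" if "c \<in> ch v" for c
        using member_le_sum[OF that, of z] finch zs by simp
      from finch c2 show "headc v"
      proof (cases rule: card_le_2_cases)
        case 1
        then have "comb [v # []] (sub v) (Fe v)"
          unfolding SA[OF less.prems] 1 SA_insert by (rule_tac comb_single)
        then show ?thesis unfolding headc_def by blast
      next
        case (2 a)
        then show ?thesis using one[of a v] IH1 z1 unfolding headc_def SA[OF less.prems] by auto
      next
        case (3 a b)
        have "z a + z b \<le> 1" using zs 3 by simp
        then obtain a' b' where ab: "ch v = {a', b'}" "a' \<noteq> b'" "z b' = 0"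
          using 3 by (metis add_is_0 insert_commute le_less_linear less_one not_add_less1 add_le_same_cancel1 le_neq_implies_less)
        then have m: "a' \<in> ch v" "b' \<in> ch v" by auto
        obtain r where "comb ([v] # r) (SA v {a'}) (FA v {a'})" using one[OF m(1)] IH1[OF m(1)] z1[OF m(1)] by blast
        then have "comb ([] @ [[] @ [v]] @ r) (SA v {a'}) (FA v {a'})" by simp
        from addP[OF this, of b'] obtain p where "comb ([] @ [([] @ [v]) @ b' # p] @ r) (SA v {b', a'}) (FA v {b', a'})"
          using m ab IH[OF m(2)] by auto
        moreover have "{b', a'} = ch v" using ab by auto
        ultimately have "comb ((v # b' # p) # r) (sub v) (Fe v)" unfolding SA[OF less.prems] by simp
        then show ?thesis unfolding headc_def by blast
      qed
    next
      assume vr: "v \<noteq> r" and z: "z v = 2"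
      \<comment> \<open>The parent edge takes a place but no weight, so two places are left: either
        one child of weight 2, below which \<open>v\<close> is appended, or at most two children on
        the spine on either side of \<open>v\<close>. In both cases \<open>v\<close> is the last
        entry of its column.\<close>
      have x2: "(\<Sum>c\<in>ch v. max 1 (z c)) \<le> 2" using X[OF less.prems] vr z unfolding ch_def[symmetric] by simp
      show "tailc v"
      proof (cases "\<exists>c\<in>ch v. z c = 2")
        case True
        then obtain c where c: "c \<in> ch v" "z c = 2" by blast
        have "card (ch v - {c}) = 0" using big[OF c(1)] cardX[of "ch v - {c}"] c(2) x2 by linarith
        then have "ch v - {c} = {}" using finch[of v] by (metis card_0_eq finite_Diff)
        then have "ch v = {c}" using c(1) by blast
        then show ?thesis using addC[OF c(1)] IH[OF c(1)] c(2) unfolding tailc_def SA[OF less.prems] by auto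
      next
        case False
        have "headc c" if "c \<in> ch v" for c
        proof -
          have "z c \<le> 2" using z2 that chP by auto
          moreover have "z c \<noteq> 2" using False that by blast
          ultimately show ?thesis using IH1[OF that] by linarith
        qed
        moreover have "card (ch v) \<le> 2" using x2 cardX[of "ch v"] by linarith
        ultimately obtain l r where "comb (l @ [[] @ [v]] @ r) (sub v) (Fe v)"
          using two[of "ch v" v] unfolding SA[OF less.prems] by blast
        then show ?thesis unfolding tailc_def by blast
      qed
    qed
  qed
  have IH: "(z c = 0 \<longrightarrow> pathc c) \<and> (z c = 1 \<longrightarrow> headc c) \<and> (z c = 2 \<longrightarrow> tailc c)" if "c \<in> ch r" for c
    using state[of c] chP[OF that] by simp
  have IH1: "headc c" if "c \<in> ch r" "z c \<le> 1" for c
    using IH[OF that(1)] that(2) path_head by (cases "z c = 0") auto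
  have x3: "(\<Sum>c\<in>ch r. max 1 (z c)) \<le> 3" using X[OF rW] unfolding ch_def[symmetric] by simp
  have y2: "(\<Sum>c\<in>ch r. z c) \<le> 2" using Y[OF rW] unfolding ch_def[symmetric] by simp
  have W: "W = SA r (ch r)" "F = FA r (ch r)"
    using SA[OF rW] subr unfolding Fe_def F by auto
  show ?thesis
  proof (cases "\<exists>c\<in>ch r. z c = 2")
    case True
    then obtain c where c: "c \<in> ch r" "z c = 2" by blast
    obtain l q rr where lqr: "comb (l @ [q @ [r]] @ rr) (SA r {c}) (FA r {c})"
      using addC[OF c(1)] IH[OF c(1)] c(2) by blast
    \<comment> \<open>The child of weight 2 uses up the weight and two of the three places at the
      root; only a path below the root can be added.\<close>
    have y0: "(\<Sum>d\<in>ch r - {c}. z d) = 0" using sum.remove[OF finch c(1), of z] y2 c(2) by simp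
    have "card (ch r - {c}) \<le> 1" using big[OF c(1)] cardX[of "ch r - {c}"] c(2) x3 by linarith
    then consider "ch r - {c} = {}" | d where "ch r - {c} = {d}"
      using finch by (metis One_nat_def card_0_eq card_1_singletonE le_Suc_eq le_zero_eq finite_Diff)
    then show ?thesis
    proof cases
      case 1
      then have "ch r = {c}" using c by auto
      then show ?thesis using lqr unfolding W by auto
    next
      case (2 d)
      then have d: "d \<in> ch r" "d \<notin> {c}" "ch r = insert d {c}" using c by auto
      have "z d = 0" using y0 2 by simp
      then have "pathc d" using IH[OF d(1)] by simp
      then show ?thesis using addP[OF lqr _ d(1,2)] c(1) unfolding W d(3)[symmetric] by auto
    qed
  next
    case False
    have h: "headc c" if "c \<in> ch r" for c
    proof -
      have "z c \<le> 2" using z2 that chP by auto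
      moreover have "z c \<noteq> 2" using False that by blast
      ultimately show ?thesis using IH1[OF that] by linarith
    qed
    have c3: "card (ch r) \<le> 3" using x3 cardX[of "ch r"] by linarith
    show ?thesis
    proof (cases "card (ch r) = 3")
      case False
      then have "card (ch r) \<le> 2" using c3 by linarith
      then show ?thesis using two[of "ch r" r] h unfolding W by blast
    next
      case True
      \<comment> \<open>Three children share a total weight of 2, so one has weight 0. It hangs
        below the root, and the other two continue the spine on both sides.\<close>
      have "\<exists>c\<in>ch r. z c = 0"
      proof (rule ccontr)
        assume "\<not> ?thesis"
        then have "card (ch r) \<le> (\<Sum>c\<in>ch r. z c)" using sum_mono[of "ch r" "\<lambda>_. 1" z] by fastforce
        then show False using True y2 by simp
      qed
      then obtain c where c: "c \<in> ch r" "z c = 0" by blast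
      have "card (ch r - {c}) \<le> 2" using True card_Diff_singleton[OF c(1)] by simp
      then obtain l rr where lr: "comb (l @ [[] @ [r]] @ rr) (SA r (ch r - {c})) (FA r (ch r - {c}))"
        using two[of "ch r - {c}" r] h by blast
      have "insert c (ch r - {c}) = ch r" using c by auto
      then show ?thesis using addP[OF lr _ c(1)] IH[OF c(1)] c(2) unfolding W by auto
    qed
  qed
qed

section \<open>Sufficiency of the weights: classes of edges obtained by joining groups\<close>

section \<open>Splitting the edges at every vertex into groups\<close>

lemma distinct_count_list: "distinct xs \<Longrightarrow> count_list xs x \<le> 1"
  by (induction xs) (auto simp: count_list_0_iff)

text \<open>\<open>s c\<close> is the weight of the edge from \<open>c\<close> to its parent at the parent, so its weight at \<open>c\<close> is
  \<open>2 - s c\<close>. The edge belongs to group \<open>gc c\<close> at the parent and to group \<open>gp c\<close> at \<open>c\<close>.\<close>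

locale grouped_tree =
  fixes V :: "nat set" and E r par pos and s gc gp L :: "nat \<Rightarrow> nat" and t :: nat
  assumes tr: "rooted V E r par pos"
    and s2: "\<And>c. c \<in> V - {r} \<Longrightarrow> s c \<le> 2"
    and gct: "\<And>c. c \<in> V - {r} \<Longrightarrow> gc c < t" and gpt: "\<And>c. c \<in> V - {r} \<Longrightarrow> gp c < t"
    and Y: "\<And>v j. v \<in> V \<Longrightarrow> (\<Sum>c\<in>{c \<in> V - {r}. par c = v \<and> gc c = j}. s c) +
      (if v \<noteq> r \<and> gp v = j then 2 - s v else 0) \<le> 2"
    and X: "\<And>v j. v \<in> V \<Longrightarrow> (\<Sum>c\<in>{c \<in> V - {r}. par c = v \<and> gc c = j}. max 1 (s c)) +
      (if v \<noteq> r \<and> gp v = j then max 1 (2 - s v) else 0) \<le> 3"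
    and L: "\<And>c. c \<in> V - {r} \<Longrightarrow>
      L c = (if par c \<noteq> r \<and> gc c = gp (par c) then L (par c) else par c * t + gc c)"
begin

lemma finV: "finite V" and rV: "r \<in> V" and parV: "\<And>c. c \<in> V - {r} \<Longrightarrow> par c \<in> V"
  and posV: "\<And>c. c \<in> V - {r} \<Longrightarrow> pos c < pos (par c)" and E_eq: "E = (\<lambda>c. {c, par c}) ` (V - {r})"
  using tr unfolding rooted_def by auto

definition labels :: "nat set" where "labels = L ` (V - {r})"
definition members :: "nat \<Rightarrow> nat set" where "members l = {c \<in> V - {r}. L c = l}"
definition class_edges :: "nat \<Rightarrow> nat set set" where "class_edges l = (\<lambda>c. {c, par c}) ` members l"
definition class_verts :: "nat \<Rightarrow> nat set" where "class_verts l = insert (l div t) (members l)"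

text \<open>A label is handed down unchanged as long as the group stays the same. It therefore keeps
  encoding the top vertex \<open>L c div t\<close> of its class and the group
  \<open>L c mod t\<close> of the class at that vertex.\<close>

lemma label_cases:
  assumes "c \<in> V - {r}"
  shows "L c div t \<in> V \<and> pos c < pos (L c div t) \<and>
    ((par c = L c div t \<and> gc c = L c mod t) \<or> (par c \<in> V - {r} \<and> L (par c) = L c \<and> gc c = gp (par c)))"
  using assms
proof (induction "Max (pos ` V) - pos c" arbitrary: c rule: less_induct)
  case less
  show ?case
  proof (cases "par c \<noteq> r \<and> gc c = gp (par c)")
    case True
    then have Lc: "L c = L (par c)" using L[OF less.prems] by simp
    have pc: "par c \<in> V - {r}" using parV[OF less.prems] True by simp
    have "pos c < pos (par c)" "pos (par c) \<le> Max (pos ` V)" using posV[OF less.prems] pc finV by auto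
    then have "Max (pos ` V) - pos (par c) < Max (pos ` V) - pos c" by linarith
    from less.hyps[OF this pc] show ?thesis using True pc \<open>pos c < pos (par c)\<close> Lc by auto
  next
    case False
    then have "L c = par c * t + gc c" using L[OF less.prems] by auto
    moreover have "gc c < t" using gct[OF less.prems] .
    ultimately have "L c div t = par c" "L c mod t = gc c" by auto
    then show ?thesis using parV[OF less.prems] posV[OF less.prems] by simp
  qed
qed

lemma top_not_member: "l div t \<notin> members l"
  using label_cases[of "l div t"] unfolding members_def by auto

lemma member_group:
  assumes "c \<in> members l"
  shows "gc c = (if par c = l div t then l mod t else gp (par c))"
  using assms label_cases[of c] top_not_member[of l] unfolding members_def by auto

lemma member_parent: "c \<in> members l \<Longrightarrow> par c \<in> class_verts l"
  using label_cases[of c] unfolding members_def class_verts_def by auto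

lemma class_rooted:
  assumes "l \<in> labels"
  shows "rooted (class_verts l) (class_edges l) (l div t) par pos"
proof -
  have d: "class_verts l - {l div t} = members l" using top_not_member[of l] unfolding class_verts_def by auto
  show ?thesis
    unfolding rooted_def d
  proof (intro conjI ballI)
    show "finite (class_verts l)" using finV unfolding class_verts_def members_def by simp
    show "l div t \<in> class_verts l" unfolding class_verts_def by simp
    show "class_edges l = (\<lambda>c. {c, par c}) ` members l" by (rule class_edges_def)
    fix c assume c: "c \<in> members l"
    show "par c \<in> class_verts l" using c by (rule member_parent)
    show "pos c < pos (par c)" using c posV unfolding members_def by auto
  qed
qed

lemma top_child:
  assumes "l \<in> labels"
  obtains c where "c \<in> members l" "par c = l div t" "gc c = l mod t"
proof -
  have "members l \<noteq> {}" "finite (members l)"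
    using assms finV unfolding labels_def members_def by auto
  then obtain c where c: "c \<in> members l" "\<forall>d\<in>members l. pos d \<le> pos c"
    using finite_max[of "members l" pos] by auto
  have "par c \<notin> members l" using c posV[of c] unfolding members_def by fastforce
  then have "par c = l div t" "gc c = l mod t"
    using c(1) label_cases[of c] unfolding members_def by auto
  then show ?thesis using that c(1) by blast
qed

lemma union_class_edges:
  assumes "l \<in> labels"
  shows "\<Union>(class_edges l) = class_verts l"
proof
  show "\<Union>(class_edges l) \<subseteq> class_verts l"
    using member_parent unfolding class_edges_def class_verts_def by auto
  obtain c where c: "c \<in> members l" "par c = l div t" using top_child[OF assms] .
  have "l div t \<in> \<Union>(class_edges l)" unfolding class_edges_def c(2)[symmetric] using c(1) by blast
  then show "class_verts l \<subseteq> \<Union>(class_edges l)" unfolding class_edges_def class_verts_def by auto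
qed

text \<open>All edges of a class at one vertex belong to a single group there, so the class inherits
  the bounds of the group.\<close>

lemma class_comb:
  assumes l: "l \<in> labels"
  shows "\<exists>cs. comb cs (class_verts l) (class_edges l)"
proof (rule comb_of_rooted[OF class_rooted[OF l], of s])
  have d: "class_verts l - {l div t} = members l" using top_not_member[of l] unfolding class_verts_def by auto
  show "s c \<le> 2" if "c \<in> class_verts l - {l div t}" for c
    using that s2 unfolding d members_def by auto
  fix v assume v: "v \<in> class_verts l"
  define j where "j = (if v = l div t then l mod t else gp v)"
  have vV: "v \<in> V"
  proof -
    obtain c where "c \<in> V - {r}" "L c = l" using l unfolding labels_def by auto
    then show ?thesis using v label_cases[of c] unfolding class_verts_def members_def by auto
  qed
  have vr: "v \<noteq> r \<and> gp v = j" if "v \<noteq> l div t"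
    using that v unfolding class_verts_def members_def j_def by auto
  have sub: "{c \<in> class_verts l - {l div t}. par c = v} \<subseteq> {c \<in> V - {r}. par c = v \<and> gc c = j}"
    unfolding d using member_group unfolding members_def j_def by auto
  have le: "(\<Sum>c\<in>{c \<in> class_verts l - {l div t}. par c = v}. f c) \<le> (\<Sum>c\<in>{c \<in> V - {r}. par c = v \<and> gc c = j}. f c)"
    for f :: "nat \<Rightarrow> nat"
    by (rule sum_mono2[OF _ sub]) (use finV in auto)
  show "(\<Sum>c\<in>{c \<in> class_verts l - {l div t}. par c = v}. s c) + (if v = l div t then 0 else 2 - s v) \<le> 2"
    using le[of s] Y[OF vV, of j] vr by (auto split: if_splits)
  show "(\<Sum>c\<in>{c \<in> class_verts l - {l div t}. par c = v}. max 1 (s c)) +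
      (if v = l div t then 0 else max 1 (2 - s v)) \<le> 3"
    using le[of "\<lambda>c. max 1 (s c)"] X[OF vV, of j] vr by (auto split: if_splits)
qed

lemma class_ubvt:
  assumes "l \<in> labels"
  shows "ubvt (class_verts l) (class_edges l)"
proof -
  obtain cs where cs: "comb cs (class_verts l) (class_edges l)" using class_comb[OF assms] by blast
  have "\<exists>f. unit_bar_rep 1 (class_verts l) (class_edges l) f"
    using cs distinct_count_list unfolding comb_def
    by (intro comb_representation[of cs]) auto
  then show ?thesis using rooted_is_tree[OF class_rooted[OF assms]] unfolding ubvt_def by blast
qed

definition decomposition :: "(nat set \<times> nat set set) set" where
  "decomposition = (\<lambda>l. (class_verts l, class_edges l)) ` labels"

lemma class_verts_sub:
  assumes "l \<in> labels"
  shows "class_verts l \<subseteq> V"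
proof -
  obtain c where c: "c \<in> members l" "par c = l div t" using top_child[OF assms] .
  have "l div t \<in> V" unfolding c(2)[symmetric] using c(1) parV unfolding members_def by blast
  then show ?thesis unfolding class_verts_def members_def by auto
qed

lemma decomposition_ubvt: "ubvt_decomposition V E decomposition"
  unfolding ubvt_decomposition_def
proof
  show "\<forall>(W, F)\<in>decomposition. W \<subseteq> V \<and> F \<subseteq> E \<and> ubvt W F"
    using class_verts_sub class_ubvt
    unfolding decomposition_def by (auto simp: E_eq class_edges_def members_def)
  have "snd ` decomposition = class_edges ` labels" unfolding decomposition_def by (simp add: image_image)
  moreover have "partition_on E (class_edges ` labels)"
  proof (rule partition_onI)
    show "\<Union>(class_edges ` labels) = E"
      unfolding class_edges_def members_def labels_def E_eq by auto
    show "{} \<notin> class_edges ` labels"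
      unfolding class_edges_def members_def labels_def by auto
    fix p q assume "p \<in> class_edges ` labels" "q \<in> class_edges ` labels" and ne: "p \<noteq> q"
    then obtain l m where lm: "p = class_edges l" "q = class_edges m" by blast
    show "disjnt p q"
    proof (rule ccontr)
      assume "\<not> disjnt p q"
      then obtain c d where "c \<in> members l" "d \<in> members m" "{c, par c} = {d, par d}"
        unfolding lm class_edges_def disjnt_def by auto
      moreover from this have "c = d"
        using inj_onD[OF rooted_edge_inj[OF tr], of c d] unfolding members_def by auto
      ultimately have "l = m" unfolding members_def by auto
      then show False using ne lm by simp
    qed
  qed
  ultimately show "partition_on E (snd ` decomposition)" by simp
qed

text \<open>Distinct classes at \<open>v\<close> use distinct groups of \<open>v\<close>, of which
  there are \<open>t\<close>.\<close>

lemma few_classes: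
  assumes v: "v \<in> V"
  shows "card {l \<in> labels. v \<in> class_verts l} \<le> t"
proof -
  define h where "h l = (if v = l div t then l mod t else gp v)" for l
  have "card {l \<in> labels. v \<in> class_verts l} \<le> card {..<t}"
  proof (rule card_inj_on_le)
    show "h ` {l \<in> labels. v \<in> class_verts l} \<subseteq> {..<t}"
    proof safe
      fix l assume l: "l \<in> labels" "v \<in> class_verts l"
      then have "t > 0" using gct unfolding labels_def by fastforce
      then show "h l < t" using l gpt unfolding h_def class_verts_def members_def by auto
    qed
    \<comment> \<open>A class with top \<open>v\<close> cannot use the group of the parent edge of
      \<open>v\<close>: its topmost edge would have inherited the label of that edge.\<close>
    have mix: False if l: "l \<in> labels" "v = l div t" and m: "v \<in> members m" "l \<noteq> m" and h: "l mod t = gp v" for l m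
    proof -
      obtain c where c: "c \<in> members l" "par c = l div t" "gc c = l mod t" using top_child[OF l(1)] .
      have "L c = L v" using L[of c] c l(2) h m(1) unfolding members_def by auto
      then show False using c(1) m unfolding members_def by auto
    qed
    show "inj_on h {l \<in> labels. v \<in> class_verts l}"
    proof (rule inj_onI, rule ccontr)
      fix l m assume l: "l \<in> {l \<in> labels. v \<in> class_verts l}" and m: "m \<in> {l \<in> labels. v \<in> class_verts l}"
        and eq: "h l = h m" and ne: "l \<noteq> m"
      consider "v = l div t" "v = m div t" | "v = l div t" "v \<in> members m" "v \<noteq> m div t"
        | "v \<in> members l" "v = m div t" "v \<noteq> l div t" | "v \<in> members l" "v \<in> members m"
        using l m unfolding class_verts_def by blast
      then show False
      proof cases
        case 1
        then have "l div t = m div t" "l mod t = m mod t" using eq unfolding h_def by auto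
        then show False using ne by (metis div_mod_decomp)
      next
        case 2
        then show False using mix[of l m] l eq ne unfolding h_def by auto
      next
        case 3
        then show False using mix[of m l] m eq ne unfolding h_def by auto
      next
        case 4
        then show False using ne unfolding members_def by auto
      qed
    qed
  qed simp
  then show ?thesis by simp
qed

lemma finite_labels: "finite labels" unfolding labels_def using finV by simp

lemma few_members:
  assumes "v \<in> V"
  shows "card {S \<in> decomposition. v \<in> fst S} \<le> t"
proof -
  have "{S \<in> decomposition. v \<in> fst S} \<subseteq> (\<lambda>l. (class_verts l, class_edges l)) ` {l \<in> labels. v \<in> class_verts l}"
    unfolding decomposition_def by auto
  then have "card {S \<in> decomposition. v \<in> fst S} \<le> card {l \<in> labels. v \<in> class_verts l}"
    using finite_labels by (intro surj_card_le) auto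
  then show ?thesis using few_classes[OF assms] by simp
qed

lemma representation: "\<exists>f. unit_bar_rep t V E f"
proof -
  have "\<forall>l\<in>labels. \<exists>cs. comb cs (class_verts l) (class_edges l)" using class_comb by blast
  from bchoice[OF this] obtain cs where cs: "\<And>l. l \<in> labels \<Longrightarrow> comb (cs l) (class_verts l) (class_edges l)"
    by blast
  \<comment> \<open>The empty column after each comb keeps the heads of consecutive combs from
    seeing each other.\<close>
  define total where "total ls = concat (map (\<lambda>l. cs l @ [[]]) ls)" for ls
  have ed: "comb_edges (total ls) = (\<Union>l\<in>set ls. comb_edges (cs l))" for ls
    by (induction ls)
      (auto simp: total_def comb_edges_simps comb_edges_Cons path_edges_simps link_def last_append hd_append)
  have vs: "concat (total ls) = concat (map (\<lambda>l. concat (cs l)) ls)" for ls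
    by (induction ls) (auto simp: total_def)
  define ls where "ls = sorted_list_of_set labels"
  have ls: "set ls = labels" "distinct ls" unfolding ls_def using finite_labels by auto
  show ?thesis
  proof (rule comb_representation[of "total ls"])
    show "set (concat (total ls)) \<subseteq> V"
    proof
      fix v assume "v \<in> set (concat (total ls))"
      then obtain l where l: "l \<in> labels" "v \<in> set (concat (cs l))" unfolding vs using ls(1) by auto
      then have "v \<in> class_verts l" using cs[OF l(1)] unfolding comb_def by blast
      then show "v \<in> V" using class_verts_sub[OF l(1)] by blast
    qed
    have "comb_edges (total ls) = (\<Union>l\<in>labels. class_edges l)"
      using cs unfolding ed ls(1) comb_def by auto
    also have "\<dots> = E" unfolding class_edges_def members_def labels_def E_eq by auto
    finally show "E = comb_edges (total ls)" by simp
    fix v assume v: "v \<in> V"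
    have "count_list (concat (map (\<lambda>l. concat (cs l)) ks)) v \<le> length (filter (\<lambda>l. v \<in> class_verts l) ks)"
      if "set ks \<subseteq> labels" for ks
      using that
    proof (induction ks)
      case (Cons k ks)
      have c: "distinct (concat (cs k))" "set (concat (cs k)) = class_verts k"
        using cs[of k] Cons.prems unfolding comb_def by auto
      have "count_list (concat (cs k)) v \<le> (if v \<in> class_verts k then 1 else 0)"
        using distinct_count_list[OF c(1), of v] count_list_0_iff[of "concat (cs k)" v] c(2) by auto
      then show ?case using Cons by auto
    qed simp
    from this[of ls] have "count_list (concat (total ls)) v \<le> length (filter (\<lambda>l. v \<in> class_verts l) ls)"
      unfolding vs using ls by simp
    also have "\<dots> = card (set (filter (\<lambda>l. v \<in> class_verts l) ls))" using ls(2)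
      by (intro distinct_card[symmetric] distinct_filter)
    also have "\<dots> \<le> t" using few_classes[OF v] by (simp add: ls(1))
    finally show "count_list (concat (total ls)) v \<le> t" .
  qed
qed

end

section \<open>Sufficiency of the weights: packing half-edges into groups\<close>

section \<open>Seats\<close>

text \<open>A vertex offers \<open>3 * t\<close> seats: group \<open>j\<close> consists of the seats \<open>2 * j\<close>, \<open>2 * j + 1\<close> and
  \<open>2 * t + j\<close>. An edge of weight 2 takes the first two seats of a group, edges of weight 1 take
  further seats below the weight sum \<open>y\<close>, and edges of weight 0 take the seats from \<open>y\<close> on.\<close>

definition seat :: "nat \<Rightarrow> nat \<Rightarrow> nat \<Rightarrow> nat" where
  "seat y w k = (if w = 0 then y + k else if w = 1 then y - 1 - k else 2 * k)"

definition seat_group :: "nat \<Rightarrow> nat \<Rightarrow> nat" where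
  "seat_group t q = (if q < 2 * t then q div 2 else q - 2 * t)"

definition ranking :: "'h set \<Rightarrow> ('h \<Rightarrow> nat) \<Rightarrow> ('h \<Rightarrow> nat) \<Rightarrow> bool" where
  "ranking H w rk \<longleftrightarrow> (\<forall>h\<in>H. rk h < card {g \<in> H. w g = w h}) \<and>
     (\<forall>g\<in>H. \<forall>h\<in>H. w g = w h \<longrightarrow> rk g = rk h \<longrightarrow> g = h)"

lemma ranking_exists:
  assumes "finite H"
  shows "\<exists>rk. ranking H w rk"
proof -
  have "\<forall>k. \<exists>f. inj_on f {g \<in> H. w g = k} \<and> f ` {g \<in> H. w g = k} \<subseteq> {..<card {g \<in> H. w g = k}}"
  proof
    fix k
    have "finite {g \<in> H. w g = k}" using assms by simp
    from ex_bij_betw_finite_nat[OF this]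
    obtain f where "bij_betw f {g \<in> H. w g = k} {0..<card {g \<in> H. w g = k}}" by blast
    then show "\<exists>f. inj_on f {g \<in> H. w g = k} \<and> f ` {g \<in> H. w g = k} \<subseteq> {..<card {g \<in> H. w g = k}}"
      unfolding bij_betw_def by (intro exI[of _ f]) auto
  qed
  from choice[OF this] obtain f where f: "\<And>k. inj_on (f k) {g \<in> H. w g = k}"
    "\<And>k. f k ` {g \<in> H. w g = k} \<subseteq> {..<card {g \<in> H. w g = k}}" by blast
  have "ranking H w (\<lambda>h. f (w h) h)" unfolding ranking_def
  proof (intro conjI ballI impI)
    show "f (w h) h < card {g \<in> H. w g = w h}" if "h \<in> H" for h using f(2)[of "w h"] that by auto
    show "g = h" if "g \<in> H" "h \<in> H" "w g = w h" "f (w g) g = f (w h) h" for g h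
      using inj_onD[OF f(1)[of "w h"], of g h] that by auto
  qed
  then show ?thesis by blast
qed

text \<open>Each half-edge occupies as many seats as the maximum of 1 and its weight
  (\<open>Q\<close>), and for positive weight they lie below \<open>2 * t\<close>. Since different
  half-edges occupy different seats, the weight sum of a group counts occupied seats of its pair
  below \<open>2 * t\<close>, and the other sum counts occupied seats among all three.\<close>

lemma seat_groups:
  assumes fin: "finite H" and w2: "\<And>h. h \<in> H \<Longrightarrow> w h \<le> 2" and rk: "ranking H w rk"
    and Y: "(\<Sum>h\<in>H. w h) \<le> 2 * t" and X: "(\<Sum>h\<in>H. max 1 (w h)) \<le> 3 * t"
  defines "g \<equiv> \<lambda>h. seat_group t (seat (\<Sum>h\<in>H. w h) (w h) (rk h))"
  shows "\<And>h. h \<in> H \<Longrightarrow> seat (\<Sum>h\<in>H. w h) (w h) (rk h) < 3 * t \<and> g h < t"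
    and "(\<Sum>h\<in>{h \<in> H. g h = j}. w h) \<le> 2" and "(\<Sum>h\<in>{h \<in> H. g h = j}. max 1 (w h)) \<le> 3"
proof -
  define N where "N k = card {h \<in> H. w h = k}" for k
  have split: "(\<Sum>h\<in>H. f (w h)) = f 0 * N 0 + f 1 * N 1 + f 2 * N 2" for f :: "nat \<Rightarrow> nat"
  proof -
    have "(\<Sum>h\<in>H. f (w h)) = (\<Sum>k\<in>{0,1,2}. \<Sum>h\<in>{h \<in> H. w h = k}. f (w h))"
    proof (rule sum.group[symmetric])
      show "w ` H \<subseteq> {0, 1, 2}"
      proof
        fix k assume "k \<in> w ` H"
        then obtain h where "h \<in> H" "k = w h" by blast
        then show "k \<in> {0, 1, 2}" using w2[of h] by auto
      qed
    qed (use fin in auto)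
    also have "\<dots> = (\<Sum>k\<in>{0,1,2}. f k * N k)" unfolding N_def by (intro sum.cong) auto
    finally show ?thesis by simp
  qed
  define y where "y = (\<Sum>h\<in>H. w h)"
  have y: "y = N 1 + 2 * N 2" unfolding y_def using split[of "\<lambda>k. k"] by simp
  have x: "(\<Sum>h\<in>H. max 1 (w h)) = N 0 + N 1 + 2 * N 2" using split[of "max 1"] by simp
  define q where "q h = seat y (w h) (rk h)" for h
  define Q where "Q h = (if w h = 2 then {q h, Suc (q h)} else {q h})" for h
  have g: "g h = seat_group t (q h)" for h unfolding g_def q_def y_def ..
  have rkN: "rk h < N (w h)" if "h \<in> H" for h using rk that unfolding ranking_def N_def by auto
  have rki: "h = h'" if "h \<in> H" "h' \<in> H" "w h = w h'" "rk h = rk h'" for h h'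
    using rk that unfolding ranking_def by blast
  have w012: "w h = 0 \<or> w h = 1 \<or> w h = 2" if "h \<in> H" for h using w2[OF that] by linarith
  \<comment> \<open>Weights 2, 1 and 0 fill three consecutive intervals: the first
    \<open>2 * N 2\<close> seats, those from there up to \<open>y\<close>, and those from
    \<open>y\<close> on. So a half-edge of weight 2 starts at an even seat and fills the pair of one
    group.\<close>
  have range: "w h = 0 \<Longrightarrow> q h = y + rk h \<and> q h < 3 * t" "w h = 1 \<Longrightarrow> q h = y - 1 - rk h \<and> 2 * N 2 \<le> q h \<and> q h < y"
    "w h = 2 \<Longrightarrow> q h = 2 * rk h \<and> q h + 1 < 2 * N 2" if "h \<in> H" for h
    using rkN[OF that] X y x unfolding q_def seat_def by auto
  have yt: "y \<le> 2 * t" using Y unfolding y_def .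
  have q3: "q h < 3 * t" if "h \<in> H" for h
    using w012[OF that] range[OF that] y yt by auto
  have Qin: "Q h \<subseteq> {q \<in> {..<3 * t}. seat_group t q = g h}" if h: "h \<in> H" for h
  proof (cases "w h = 2")
    case True
    then have "q h = 2 * rk h" "q h + 1 < 2 * t" using range(3)[OF h] y yt by auto
    then show ?thesis unfolding Q_def g seat_group_def by auto
  next
    case False
    then show ?thesis using q3[OF h] unfolding Q_def g by auto
  qed
  have Qlow: "Q h \<subseteq> {..<2 * t}" if h: "h \<in> H" "w h \<noteq> 0" for h
    using w012[OF h(1)] range[OF h(1)] y yt h(2) unfolding Q_def by auto
  have Qdisj: "Q h \<inter> Q h' = {}" if h: "h \<in> H" "h' \<in> H" "h \<noteq> h'" for h h'
  proof -
    have *: "Q h \<inter> Q h' = {}" if h: "h \<in> H" "h' \<in> H" "h \<noteq> h'" "w h \<le> w h'" for h h'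
    proof (cases "w h = w h'")
      case True
      then have "rk h \<noteq> rk h'" using rki h by blast
      then show ?thesis using w012[OF h(1)] range[OF h(1)] range[OF h(2)] rkN[OF h(1)] rkN[OF h(2)] y True
        unfolding Q_def by auto
    next
      case False
      then consider "w h = 0" "w h' = 1" | "w h = 0" "w h' = 2" | "w h = 1" "w h' = 2"
        using w012[OF h(1)] w012[OF h(2)] h(4) by linarith
      then show ?thesis
        using range[OF h(1)] range[OF h(2)] y unfolding Q_def by cases auto
    qed
    show ?thesis using *[of h h'] *[of h' h] h by (metis Int_commute nat_le_linear)
  qed
  have cardQ: "card (Q h) = max 1 (w h)" if "h \<in> H" for h
    using w012[OF that] unfolding Q_def by auto
  have finQ: "finite (Q h)" for h unfolding Q_def by simp
  have total: "(\<Sum>h\<in>A. max 1 (w h)) = card (\<Union>h\<in>A. Q h)" if "A \<subseteq> H" for A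
  proof -
    have "card (\<Union>h\<in>A. Q h) = (\<Sum>h\<in>A. card (Q h))"
    proof (rule card_UN_disjoint)
      show "finite A" using that fin finite_subset by blast
      show "\<forall>i\<in>A. \<forall>j\<in>A. i \<noteq> j \<longrightarrow> Q i \<inter> Q j = {}" using that Qdisj by blast
    qed (use finQ in blast)
    also have "\<dots> = (\<Sum>h\<in>A. max 1 (w h))" using that cardQ by (intro sum.cong) auto
    finally show ?thesis by simp
  qed
  show "seat (\<Sum>h\<in>H. w h) (w h) (rk h) < 3 * t \<and> g h < t" if "h \<in> H" for h
    using q3[OF that] unfolding g q_def y_def[symmetric] seat_group_def by auto
  show "(\<Sum>h\<in>{h \<in> H. g h = j}. max 1 (w h)) \<le> 3"
  proof -
    have "(\<Union>h\<in>{h \<in> H. g h = j}. Q h) \<subseteq> {q \<in> {..<3 * t}. seat_group t q = j}" using Qin by auto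
    also have "\<dots> \<subseteq> {2 * j, 2 * j + 1, 2 * t + j}" unfolding seat_group_def by (auto split: if_splits)
    finally have "card (\<Union>h\<in>{h \<in> H. g h = j}. Q h) \<le> card {2 * j, 2 * j + 1, 2 * t + j}"
      by (intro card_mono) auto
    also have "\<dots> \<le> 3" by (simp add: card_insert_if)
    finally show ?thesis using total[of "{h \<in> H. g h = j}"] by auto
  qed
  show "(\<Sum>h\<in>{h \<in> H. g h = j}. w h) \<le> 2"
  proof -
    have "(\<Sum>h\<in>{h \<in> H. g h = j}. w h) = (\<Sum>h\<in>{h \<in> H. g h = j \<and> w h \<noteq> 0}. max 1 (w h))"
      using fin by (intro sum.mono_neutral_cong_right) (auto simp: max_def)
    also have "\<dots> = card (\<Union>h\<in>{h \<in> H. g h = j \<and> w h \<noteq> 0}. Q h)" by (rule total) auto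
    also have "\<dots> \<le> card {2 * j, 2 * j + 1}"
    proof (rule card_mono)
      have "(\<Union>h\<in>{h \<in> H. g h = j \<and> w h \<noteq> 0}. Q h) \<subseteq> {q \<in> {..<2 * t}. seat_group t q = j}"
        using Qin Qlow by auto
      also have "\<dots> \<subseteq> {2 * j, 2 * j + 1}" unfolding seat_group_def by (auto split: if_splits)
      finally show "(\<Union>h\<in>{h \<in> H. g h = j \<and> w h \<noteq> 0}. Q h) \<subseteq> {2 * j, 2 * j + 1}" .
    qed simp
    also have "\<dots> \<le> 2" by (simp add: card_insert_if)
    finally show ?thesis .
  qed
qed

section \<open>Weights indexed by children, and the greedy decision of \<open>ub\<close>\<close>

section \<open>Balanced trees and the unit bar visibility number\<close>

text \<open>The half-edge \<open>(c, True)\<close> is the end at \<open>c\<close> of the edge from \<open>c\<close> to its parent, and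
  \<open>(c, False)\<close> is its end at the parent.\<close>

definition half_edges :: "'a set \<Rightarrow> 'a \<Rightarrow> ('a \<Rightarrow> 'a) \<Rightarrow> 'a \<Rightarrow> ('a \<times> bool) set" where
  "half_edges V r par v = {(c, b). c \<in> V - {r} \<and> v = (if b then c else par c)}"

definition half_weight :: "('a \<Rightarrow> nat) \<Rightarrow> 'a \<times> bool \<Rightarrow> nat" where
  "half_weight s h = (if snd h then 2 - s (fst h) else s (fst h))"

definition balanced :: "'a set \<Rightarrow> 'a \<Rightarrow> ('a \<Rightarrow> 'a) \<Rightarrow> ('a \<Rightarrow> nat) \<Rightarrow> nat \<Rightarrow> bool" where
  "balanced V r par s t \<longleftrightarrow> (\<forall>c\<in>V - {r}. s c \<le> 2) \<and>
     (\<forall>v\<in>V. (\<Sum>h\<in>half_edges V r par v. half_weight s h) \<le> 2 * t \<and>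
            (\<Sum>h\<in>half_edges V r par v. max 1 (half_weight s h)) \<le> 3 * t)"

lemma sum_half_edges:
  fixes f :: "'a \<times> bool \<Rightarrow> nat"
  assumes "finite V" "v \<in> V"
  shows "(\<Sum>h\<in>{h \<in> half_edges V r par v. P h}. f h) =
    (\<Sum>c\<in>{c \<in> V - {r}. par c = v \<and> P (c, False)}. f (c, False)) + (if v \<noteq> r \<and> P (v, True) then f (v, True) else 0)"
proof -
  let ?A = "{c \<in> V - {r}. par c = v \<and> P (c, False)}"
  let ?B = "if v \<noteq> r \<and> P (v, True) then {(v, True)} else {}"
  have "{h \<in> half_edges V r par v. P h} = (\<lambda>c. (c, False)) ` ?A \<union> ?B"
  proof (rule set_eqI)
    fix h :: "'a \<times> bool"
    obtain c b where h: "h = (c, b)" by (cases h)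
    show "h \<in> {h \<in> half_edges V r par v. P h} \<longleftrightarrow> h \<in> (\<lambda>c. (c, False)) ` ?A \<union> ?B"
      using assms(2) unfolding h half_edges_def by (cases b) auto
  qed
  moreover have "(\<Sum>h\<in>(\<lambda>c. (c, False)) ` ?A \<union> ?B. f h) = (\<Sum>h\<in>(\<lambda>c. (c, False)) ` ?A. f h) + (\<Sum>h\<in>?B. f h)"
    using assms(1) by (intro sum.union_disjoint) auto
  moreover have "(\<Sum>h\<in>(\<lambda>c. (c, False)) ` ?A. f h) = (\<Sum>c\<in>?A. f (c, False))"
    by (subst sum.reindex) (auto simp: inj_on_def)
  moreover have "(\<Sum>h\<in>?B. f h) = (if v \<noteq> r \<and> P (v, True) then f (v, True) else 0)" by simp
  ultimately show ?thesis by simp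
qed

lemma half_edge_iff:
  "h \<in> half_edges V r par v \<longleftrightarrow> fst h \<in> V - {r} \<and> v = (if snd h then fst h else par (fst h))"
  by (cases h) (auto simp: half_edges_def)

lemma finite_half_edges: "finite V \<Longrightarrow> finite (half_edges V r par v)"
  by (rule finite_subset[of _ "V \<times> UNIV"]) (auto simp: half_edges_def)

lemma half_edges_bij:
  assumes "rooted V E r par pos"
  shows "bij_betw (\<lambda>h. {fst h, par (fst h)}) (half_edges V r par v) {e \<in> E. v \<in> e}"
  unfolding bij_betw_def
proof
  have E: "E = (\<lambda>c. {c, par c}) ` (V - {r})" and pos: "\<And>c. c \<in> V - {r} \<Longrightarrow> pos c < pos (par c)"
    using assms unfolding rooted_def by auto
  show "inj_on (\<lambda>h. {fst h, par (fst h)}) (half_edges V r par v)"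
  proof (rule inj_onI)
    fix g h assume g: "g \<in> half_edges V r par v" and h: "h \<in> half_edges V r par v"
      and "{fst g, par (fst g)} = {fst h, par (fst h)}"
    then have eq: "fst g = fst h"
      using inj_onD[OF rooted_edge_inj[OF assms], of "fst g" "fst h"] unfolding half_edges_def by auto
    have ne: "par (fst g) \<noteq> fst g" using pos[of "fst g"] g unfolding half_edges_def by auto
    have "snd g = snd h"
      using g h eq ne unfolding half_edge_iff by (cases "snd g"; cases "snd h") auto
    then show "g = h" using eq by (rule prod_eqI[rotated])
  qed
  show "(\<lambda>h. {fst h, par (fst h)}) ` half_edges V r par v = {e \<in> E. v \<in> e}"
  proof
    show "(\<lambda>h. {fst h, par (fst h)}) ` half_edges V r par v \<subseteq> {e \<in> E. v \<in> e}"
      unfolding half_edges_def E by auto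
    show "{e \<in> E. v \<in> e} \<subseteq> (\<lambda>h. {fst h, par (fst h)}) ` half_edges V r par v"
    proof
      fix e assume "e \<in> {e \<in> E. v \<in> e}"
      then obtain c where c: "c \<in> V - {r}" "e = {c, par c}" "v = c \<or> v = par c" unfolding E by auto
      then have "(c, v = c) \<in> half_edges V r par v" unfolding half_edges_def by auto
      then show "e \<in> (\<lambda>h. {fst h, par (fst h)}) ` half_edges V r par v" using c(2) by force
    qed
  qed
qed

lemma degree_half_edges:
  "rooted V E r par pos \<Longrightarrow> degree E v = card (half_edges V r par v)"
  unfolding degree_def using bij_betw_same_card[OF half_edges_bij] by metis

lemma weighting_balanced:
  assumes tr: "rooted V E r par pos" and w: "weighting t V E y"
  shows "\<exists>s. balanced V r par s t"
proof -
  define s where "s c = y (par c) {c, par c}" for c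
  have E: "{c, par c} \<in> E" if "c \<in> V - {r}" for c using tr that unfolding rooted_def by auto
  have two: "y c {c, par c} + s c = 2" if "c \<in> V - {r}" for c
    using w E[OF that] unfolding weighting_def s_def by blast
  have hw: "half_weight s h = y v {fst h, par (fst h)}" if "h \<in> half_edges V r par v" for h v
    using that two[of "fst h"] unfolding half_weight_def half_edges_def s_def by (auto split: if_splits)
  have tr_sum: "(\<Sum>h\<in>half_edges V r par v. g (half_weight s h)) = (\<Sum>e\<in>{e \<in> E. v \<in> e}. g (y v e))"
    for v and g :: "nat \<Rightarrow> nat"
  proof -
    have "(\<Sum>h\<in>half_edges V r par v. g (half_weight s h)) =
        (\<Sum>h\<in>half_edges V r par v. g (y v {fst h, par (fst h)}))" using hw by (intro sum.cong) auto
    also have "\<dots> = (\<Sum>e\<in>{e \<in> E. v \<in> e}. g (y v e))"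
      using sum.reindex_bij_betw[OF half_edges_bij[OF tr], of "\<lambda>e. g (y v e)" v] by simp
    finally show ?thesis .
  qed
  have "balanced V r par s t" unfolding balanced_def
  proof (intro conjI ballI)
    show "s c \<le> 2" if "c \<in> V - {r}" for c using two[OF that] by simp
    fix v assume "v \<in> V"
    then show "(\<Sum>h\<in>half_edges V r par v. half_weight s h) \<le> 2 * t"
      "(\<Sum>h\<in>half_edges V r par v. max 1 (half_weight s h)) \<le> 3 * t"
      using w tr_sum[of "\<lambda>x. x" v] tr_sum[of "max 1" v] unfolding weighting_def by auto
  qed
  then show ?thesis by blast
qed

definition half_seat :: "nat set \<Rightarrow> nat \<Rightarrow> (nat \<Rightarrow> nat) \<Rightarrow> (nat \<Rightarrow> nat) \<Rightarrow> (nat \<times> bool \<Rightarrow> nat) \<Rightarrow> nat \<times> bool \<Rightarrow> nat" where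
  "half_seat V r par s rk h =
     seat (\<Sum>h\<in>half_edges V r par (if snd h then fst h else par (fst h)). half_weight s h) (half_weight s h) (rk h)"

lemma half_seat_less:
  assumes tr: "rooted V E r par pos" and bal: "balanced V r par s t"
    and rk: "\<And>v. v \<in> V \<Longrightarrow> ranking (half_edges V r par v) (half_weight s) rk" and c: "c \<in> V - {r}"
  shows "half_seat V r par s rk (c, b) < 3 * t \<and> seat_group t (half_seat V r par s rk (c, b)) < t"
proof -
  define v where "v = (if b then c else par c)"
  have v: "v \<in> V" using tr c unfolding rooted_def v_def by auto
  have fin: "finite V" using tr unfolding rooted_def by simp
  have h: "(c, b) \<in> half_edges V r par v" using c unfolding half_edges_def v_def by auto
  have w2: "half_weight s h \<le> 2" if "h \<in> half_edges V r par v" for h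
    using bal that unfolding balanced_def half_weight_def half_edges_def by auto
  have YX: "(\<Sum>h\<in>half_edges V r par v. half_weight s h) \<le> 2 * t"
    "(\<Sum>h\<in>half_edges V r par v. max 1 (half_weight s h)) \<le> 3 * t"
    using bal v unfolding balanced_def by auto
  have eq: "half_seat V r par s rk (c, b) =
      seat (\<Sum>h\<in>half_edges V r par v. half_weight s h) (half_weight s (c, b)) (rk (c, b))"
    unfolding half_seat_def v_def by simp
  show ?thesis unfolding eq by (rule seat_groups(1)[OF finite_half_edges[OF fin] w2 rk[OF v] YX h])
qed

lemma seats_grouped_tree:
  fixes V :: "nat set"
  assumes tr: "rooted V E r par pos" and bal: "balanced V r par s t"
    and rk: "\<And>v. v \<in> V \<Longrightarrow> ranking (half_edges V r par v) (half_weight s) rk"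
    and gc: "\<And>c. c \<in> V - {r} \<Longrightarrow> gc c = seat_group t (half_seat V r par s rk (c, False))"
    and gp: "\<And>c. c \<in> V - {r} \<Longrightarrow> gp c = seat_group t (half_seat V r par s rk (c, True))"
    and L: "\<And>c. c \<in> V - {r} \<Longrightarrow>
      L c = (if par c \<noteq> r \<and> gc c = gp (par c) then L (par c) else par c * t + gc c)"
  shows "grouped_tree V E r par pos s gc gp L t"
proof
  have fin: "finite V" using tr unfolding rooted_def by simp
  show "rooted V E r par pos" by (rule tr)
  show "s c \<le> 2" if "c \<in> V - {r}" for c using bal that unfolding balanced_def by blast
  show "gc c < t" "gp c < t" if "c \<in> V - {r}" for c
    using half_seat_less[OF tr bal rk that, of False] half_seat_less[OF tr bal rk that, of True]
    unfolding gc[OF that] gp[OF that] by auto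
  show "L c = (if par c \<noteq> r \<and> gc c = gp (par c) then L (par c) else par c * t + gc c)"
    if "c \<in> V - {r}" for c using L[OF that] .
  fix v j assume v: "v \<in> V"
  define g where "g h = seat_group t (seat (\<Sum>h\<in>half_edges V r par v. half_weight s h) (half_weight s h) (rk h))" for h
  have w2: "half_weight s h \<le> 2" if "h \<in> half_edges V r par v" for h
    using bal that unfolding balanced_def half_weight_def half_edges_def by auto
  have b: "(\<Sum>h\<in>half_edges V r par v. half_weight s h) \<le> 2 * t"
    "(\<Sum>h\<in>half_edges V r par v. max 1 (half_weight s h)) \<le> 3 * t"
    using bal v unfolding balanced_def by auto
  note sg = seat_groups(2,3)[OF finite_half_edges[OF fin] w2 rk[OF v] b, of j, folded g_def]
  have gF: "gc c = g (c, False)" if "c \<in> V - {r}" "par c = v" for c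
    using gc[OF that(1)] that(2) unfolding g_def half_seat_def by simp
  have gT: "gp v = g (v, True)" if "v \<noteq> r"
    using gp[of v] v that unfolding g_def half_seat_def by simp
  have sets: "{c \<in> V - {r}. par c = v \<and> gc c = j} = {c \<in> V - {r}. par c = v \<and> g (c, False) = j}"
    using gF by auto
  have conv: "(\<Sum>c\<in>{c \<in> V - {r}. par c = v \<and> gc c = j}. f (s c)) + (if v \<noteq> r \<and> gp v = j then f (2 - s v) else 0)
      = (\<Sum>h\<in>{h \<in> half_edges V r par v. g h = j}. f (half_weight s h))" for f :: "nat \<Rightarrow> nat"
    unfolding sum_half_edges[OF fin v] sets by (cases "v = r") (simp_all add: half_weight_def gT)
  show "(\<Sum>c\<in>{c \<in> V - {r}. par c = v \<and> gc c = j}. s c) + (if v \<noteq> r \<and> gp v = j then 2 - s v else 0) \<le> 2"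
    using conv[of "\<lambda>x. x"] sg(1) by simp
  show "(\<Sum>c\<in>{c \<in> V - {r}. par c = v \<and> gc c = j}. max 1 (s c)) +
      (if v \<noteq> r \<and> gp v = j then max 1 (2 - s v) else 0) \<le> 3"
    using conv[of "max 1"] sg(2) by simp
qed

text \<open>The recursion climbs towards the root and must stop there, since \<open>A\<close> fails
  at the children of the root. Unrolled, \<open>L c\<close> is the value of \<open>B\<close> at the
  first vertex on the way up at which \<open>A\<close> fails.\<close>

lemma follow_parents:
  assumes tr: "rooted V E r par pos" and A: "\<And>c. A c \<Longrightarrow> par c \<noteq> r"
  shows "\<exists>L. \<forall>c\<in>V - {r}. L c = (if A c then L (par c) else B c)"
proof -
  have fin: "finite V" and par: "\<And>c. c \<in> V - {r} \<Longrightarrow> par c \<in> V \<and> pos c < pos (par c)"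
    using tr unfolding rooted_def by auto
  have ex: "\<exists>n. \<not> A ((par ^^ n) c)" if "c \<in> V - {r}" for c
    using that
  proof (induction "Max (pos ` V) - pos c" arbitrary: c rule: less_induct)
    case less
    show ?case
    proof (cases "A c")
      case True
      then have p: "par c \<in> V - {r}" "pos c < pos (par c)" using par[OF less.prems] A by auto
      have "pos (par c) \<le> Max (pos ` V)" using p fin by auto
      then have "Max (pos ` V) - pos (par c) < Max (pos ` V) - pos c" using p by linarith
      from less.hyps[OF this p(1)] obtain n where "\<not> A ((par ^^ n) (par c))" by blast
      then have "\<not> A ((par ^^ Suc n) c)" by (simp add: funpow_swap1)
      then show ?thesis by blast
    next
      case False
      then have "\<not> A ((par ^^ 0) c)" by simp
      then show ?thesis by blast
    qed
  qed
  define L where "L c = B ((par ^^ (LEAST n. \<not> A ((par ^^ n) c))) c)" for c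
  have "L c = (if A c then L (par c) else B c)" if c: "c \<in> V - {r}" for c
  proof (cases "A c")
    case True
    obtain n where "\<not> A ((par ^^ n) c)" using ex[OF c] by blast
    from Least_Suc[of "\<lambda>n. \<not> A ((par ^^ n) c)", OF this] True
    have "(LEAST n. \<not> A ((par ^^ n) c)) = Suc (LEAST n. \<not> A ((par ^^ Suc n) c))" by simp
    then show ?thesis using True unfolding L_def by (simp add: funpow_swap1)
  next
    case False
    then have "(LEAST n. \<not> A ((par ^^ n) c)) = 0" by (intro Least_equality) auto
    then show ?thesis using False unfolding L_def by simp
  qed
  then show ?thesis by blast
qed

lemma balanced_representation:
  fixes V :: "nat set"
  assumes tr: "rooted V E r par pos" and bal: "balanced V r par s t"
  shows "\<exists>f. unit_bar_rep t V E f"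
proof -
  have fin: "finite V" using tr unfolding rooted_def by simp
  have "\<forall>v. \<exists>rk. ranking (half_edges V r par v) (half_weight s) rk"
    using ranking_exists[OF finite_half_edges[OF fin]] by blast
  from choice[OF this] obtain rkv where rkv: "\<And>v. ranking (half_edges V r par v) (half_weight s) (rkv v)" by blast
  define rk where "rk h = rkv (if snd h then fst h else par (fst h)) h" for h
  have rk_eq: "rk h = rkv v h" if "h \<in> half_edges V r par v" for h v
    using that unfolding rk_def half_edges_def by auto
  have rk: "ranking (half_edges V r par v) (half_weight s) rk" for v
    using rkv[of v] rk_eq[of _ v] unfolding ranking_def by simp
  define gc where "gc c = seat_group t (half_seat V r par s rk (c, False))" for c
  define gp where "gp c = seat_group t (half_seat V r par s rk (c, True))" for c
  obtain L where L: "\<forall>c\<in>V - {r}. L c = (if par c \<noteq> r \<and> gc c = gp (par c) then L (par c) else par c * t + gc c)"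
    using follow_parents[OF tr, of "\<lambda>c. par c \<noteq> r \<and> gc c = gp (par c)" "\<lambda>c. par c * t + gc c"] by blast
  have "grouped_tree V E r par pos s gc gp L t"
    using L by (intro seats_grouped_tree[OF tr bal rk gc_def gp_def]) auto
  then show ?thesis by (rule grouped_tree.representation)
qed

definition child_sum :: "'a set \<Rightarrow> 'a \<Rightarrow> ('a \<Rightarrow> 'a) \<Rightarrow> ('a \<Rightarrow> nat) \<Rightarrow> 'a \<Rightarrow> nat" where
  "child_sum V r par g v = (\<Sum>c\<in>{c \<in> V - {r}. par c = v}. g c)"

text \<open>With child sums \<open>x\<close> and \<open>y\<close>, a weight at the parent of 0 adds
  2 to both sums, 1 adds 1 to both, and 2 adds 1 to \<open>x\<close> alone. The value 2 is also
  returned when nothing fits; this failure is left to the final test of the sums.\<close>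

definition greedy_weight :: "nat \<Rightarrow> nat \<Rightarrow> nat \<Rightarrow> nat" where
  "greedy_weight t x y =
     (if x + 2 \<le> 3 * t \<and> y + 2 \<le> 2 * t then 0 else if x + 1 \<le> 3 * t \<and> y + 1 \<le> 2 * t then 1 else 2)"

definition greedy :: "'a set \<Rightarrow> 'a \<Rightarrow> ('a \<Rightarrow> 'a) \<Rightarrow> ('a \<Rightarrow> nat) \<Rightarrow> nat \<Rightarrow> bool" where
  "greedy V r par s t \<longleftrightarrow> (\<forall>v\<in>V - {r}.
     s v = greedy_weight t (child_sum V r par (\<lambda>c. max 1 (s c)) v) (child_sum V r par s v))"

lemma half_sums:
  assumes "finite V" "v \<in> V"
  shows "(\<Sum>h\<in>half_edges V r par v. half_weight s h) =
      child_sum V r par s v + (if v \<noteq> r then 2 - s v else 0)"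
    and "(\<Sum>h\<in>half_edges V r par v. max 1 (half_weight s h)) =
      child_sum V r par (\<lambda>c. max 1 (s c)) v + (if v \<noteq> r then max 1 (2 - s v) else 0)"
  using sum_half_edges[OF assms, where r = r and par = par and P = "\<lambda>_. True" and f = "half_weight s"]
    sum_half_edges[OF assms, where r = r and par = par and P = "\<lambda>_. True" and f = "\<lambda>h. max 1 (half_weight s h)"]
  by (simp_all add: child_sum_def half_weight_def)

text \<open>Smaller weights at the children only lower both sums at the parent, so by induction from
  the leaves \<open>s\<close> is pointwise at most any feasible \<open>s'\<close>. Where
  \<open>s v\<close> is below 2 its choice ensures the bounds at \<open>v\<close>; where it is 2, so
  is \<open>s' v\<close>, and the bounds of \<open>s'\<close> carry over.\<close>

lemma greedy_optimal:
  assumes tr: "rooted V E r par pos" and gr: "greedy V r par s t" and bal: "balanced V r par s' t"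
  shows "balanced V r par s t"
proof -
  have fin: "finite V" using tr unfolding rooted_def by simp
  have pos: "\<And>c. c \<in> V - {r} \<Longrightarrow> pos c < pos (par c)" using tr unfolding rooted_def by auto
  have s'2: "s' v \<le> 2" if "v \<in> V - {r}" for v using bal that unfolding balanced_def by auto
  have b': "child_sum V r par s' v + (if v \<noteq> r then 2 - s' v else 0) \<le> 2 * t"
    "child_sum V r par (\<lambda>c. max 1 (s' c)) v + (if v \<noteq> r then max 1 (2 - s' v) else 0) \<le> 3 * t" if "v \<in> V" for v
    using bal that unfolding balanced_def half_sums[OF fin that, symmetric] by auto
  have sums: "child_sum V r par s v \<le> child_sum V r par s' v"
    "child_sum V r par (\<lambda>c. max 1 (s c)) v \<le> child_sum V r par (\<lambda>c. max 1 (s' c)) v"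
    if "\<And>c. c \<in> V - {r} \<Longrightarrow> par c = v \<Longrightarrow> s c \<le> s' c" for v
    unfolding child_sum_def using that by (auto intro!: sum_mono max.mono)
  have gw: "s v = greedy_weight t (child_sum V r par (\<lambda>c. max 1 (s c)) v) (child_sum V r par s v)"
    if "v \<in> V - {r}" for v using gr that unfolding greedy_def by blast
  have le: "s v \<le> s' v" if "v \<in> V - {r}" for v
    using that
  proof (induction "pos v" arbitrary: v rule: less_induct)
    case less
    have "s c \<le> s' c" if "c \<in> V - {r}" "par c = v" for c
      using less.hyps[of c] pos[of c] that by auto
    then have m: "child_sum V r par s v \<le> child_sum V r par s' v"
      "child_sum V r par (\<lambda>c. max 1 (s c)) v \<le> child_sum V r par (\<lambda>c. max 1 (s' c)) v"
      using sums[of v] by blast+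
    have v: "v \<in> V" "v \<noteq> r" using less.prems by auto
    consider "s' v = 0" | "s' v = 1" | "s' v = 2" using s'2[OF less.prems] by linarith
    then show ?case
    proof cases
      case 1
      then show ?thesis using gw[OF less.prems] m b'[OF v(1)] v(2) unfolding greedy_weight_def by auto
    next
      case 2
      then show ?thesis using gw[OF less.prems] m b'[OF v(1)] v(2) unfolding greedy_weight_def by auto
    next
      case 3
      then show ?thesis using gw[OF less.prems] unfolding greedy_weight_def by auto
    qed
  qed
  show ?thesis unfolding balanced_def
  proof (intro conjI ballI)
    show "s c \<le> 2" if "c \<in> V - {r}" for c using gw[OF that] unfolding greedy_weight_def by auto
    fix v assume v: "v \<in> V"
    have m: "child_sum V r par s v \<le> child_sum V r par s' v"
      "child_sum V r par (\<lambda>c. max 1 (s c)) v \<le> child_sum V r par (\<lambda>c. max 1 (s' c)) v"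
      using sums[of v] le by auto
    have "child_sum V r par s v + (if v \<noteq> r then 2 - s v else 0) \<le> 2 * t \<and>
      child_sum V r par (\<lambda>c. max 1 (s c)) v + (if v \<noteq> r then max 1 (2 - s v) else 0) \<le> 3 * t"
    proof (cases "v = r")
      case True
      then show ?thesis using m b'[OF v] by simp
    next
      case False
      then have g: "s v = greedy_weight t (child_sum V r par (\<lambda>c. max 1 (s c)) v) (child_sum V r par s v)"
        and l: "s v \<le> s' v" "s' v \<le> 2" using gw le s'2 v by auto
      show ?thesis
      proof (cases "s v = 2")
        case True
        then have "s' v = 2" using l by simp
        then show ?thesis using m b'[OF v] True False by simp
      next
        case n: False
        then show ?thesis using g False unfolding greedy_weight_def by (auto split: if_splits)
      qed
    qed
    then show "(\<Sum>h\<in>half_edges V r par v. half_weight s h) \<le> 2 * t"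
      "(\<Sum>h\<in>half_edges V r par v. max 1 (half_weight s h)) \<le> 3 * t"
      unfolding half_sums[OF fin v] by auto
  qed
qed

lemma ceiling_third: "nat \<lceil>real d / 3\<rceil> \<le> t \<longleftrightarrow> d \<le> 3 * t"
proof -
  have "nat \<lceil>real d / 3\<rceil> \<le> t \<longleftrightarrow> real d / 3 \<le> real t" by (simp add: nat_le_iff ceiling_le_iff)
  also have "\<dots> \<longleftrightarrow> d \<le> 3 * t" by (auto simp: field_simps)
  finally show ?thesis .
qed

text \<open>Every half-edge takes at least one of the \<open>3 * u\<close> places at a vertex, so
  \<open>u\<close> bars per vertex force \<open>u\<close> to be at least \<open>t\<close>. It
  remains to separate \<open>t\<close> from \<open>t + 1\<close>, which the greedy weights for
  \<open>t\<close> do.\<close>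

theorem ub_greedy:
  fixes V :: "nat set"
  assumes tr: "rooted V E r par pos" and t: "t = nat \<lceil>real (max_degree V E) / 3\<rceil>"
    and gr: "greedy V r par s t"
  shows "ub V E = (if balanced V r par s t then t else t + 1)"
proof -
  have fin: "finite V" "r \<in> V" using tr unfolding rooted_def by auto
  have deg: "degree E v \<le> max_degree V E" if "v \<in> V" for v
    unfolding max_degree_def using fin that by auto
  have nec: "\<exists>s'. balanced V r par s' u" if "\<exists>f. unit_bar_rep u V E f" for u
    using that representation_weighting[OF _ tr] weighting_balanced[OF tr] by blast
  have lower: "t \<le> u" if rep: "\<exists>f. unit_bar_rep u V E f" for u
  proof -
    obtain s' where s': "balanced V r par s' u" using nec[OF rep] by blast
    have "degree E v \<le> 3 * u" if "v \<in> V" for v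
    proof -
      have "card (half_edges V r par v) \<le> (\<Sum>h\<in>half_edges V r par v. max 1 (half_weight s' h))"
        using sum_mono[of "half_edges V r par v" "\<lambda>_. 1" "\<lambda>h. max 1 (half_weight s' h)"] by simp
      then show ?thesis using s' that unfolding degree_half_edges[OF tr] balanced_def by fastforce
    qed
    then have "max_degree V E \<le> 3 * u" unfolding max_degree_def using fin by (subst Max_le_iff) auto
    then show ?thesis unfolding t ceiling_third .
  qed
  have "max_degree V E \<le> 3 * t" using ceiling_third[of "max_degree V E" t] t by simp
  then have d3: "degree E v \<le> 3 * t" if "v \<in> V" for v using deg[OF that] by simp
  \<comment> \<open>At a vertex only its parent edge has positive weight, namely 2, so the places
    used exceed the degree by at most one.\<close>
  have "balanced V r par (\<lambda>_. 0) (t + 1)" unfolding balanced_def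
  proof (intro conjI ballI)
    fix v assume v: "v \<in> V"
    show "(\<Sum>h\<in>half_edges V r par v. half_weight (\<lambda>_. 0) h) \<le> 2 * (t + 1)"
      unfolding half_sums[OF fin(1) v] by (simp add: child_sum_def)
    have "{c \<in> V - {r}. par c = v} = fst ` {h \<in> half_edges V r par v. \<not> snd h}"
      unfolding half_edges_def by force
    then have "card {c \<in> V - {r}. par c = v} \<le> card {h \<in> half_edges V r par v. \<not> snd h}"
      using finite_half_edges[OF fin(1)] by (simp add: card_image_le)
    moreover have "card {h \<in> half_edges V r par v. \<not> snd h} + (if v \<noteq> r then 1 else 0) \<le> card (half_edges V r par v)"
    proof (cases "v = r")
      case True
      then show ?thesis using finite_half_edges[OF fin(1)] by (simp add: card_mono)
    next
      case False
      then have "insert (v, True) {h \<in> half_edges V r par v. \<not> snd h} \<subseteq> half_edges V r par v"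
        using v unfolding half_edges_def by auto
      from card_mono[OF finite_half_edges[OF fin(1)] this] show ?thesis
        using False finite_half_edges[OF fin(1), of r par v] by simp
    qed
    ultimately show "(\<Sum>h\<in>half_edges V r par v. max 1 (half_weight (\<lambda>_. 0) h)) \<le> 3 * (t + 1)"
      using d3[OF v] unfolding half_sums[OF fin(1) v] degree_half_edges[OF tr] by (auto simp: child_sum_def)
  qed simp
  then have up: "\<exists>f. unit_bar_rep (t + 1) V E f" by (rule balanced_representation[OF tr])
  show ?thesis
  proof (cases "balanced V r par s t")
    case True
    then have "\<exists>f. unit_bar_rep t V E f" by (rule balanced_representation[OF tr])
    then have "ub V E = t" unfolding ub_def using lower by (intro Least_equality) auto
    then show ?thesis using True by simp
  next
    case False
    have "t + 1 \<le> u" if "\<exists>f. unit_bar_rep u V E f" for u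
    proof -
      have "u \<noteq> t" using nec[OF that] greedy_optimal[OF tr gr] False by blast
      then show ?thesis using lower[OF that] by simp
    qed
    then have "ub V E = t + 1" unfolding ub_def using up by (intro Least_equality) auto
    then show ?thesis using False by simp
  qed
qed

section \<open>Time and word size of loop-free code, and an invariant rule for loops\<close>

section \<open>Straight-line code and loops\<close>

text \<open>Describes loop-free code as a function; the value at a loop is a default that
  \<open>straight\<close> excludes.\<close>

fun exec :: "com \<Rightarrow> ram_state \<Rightarrow> ram_state" where
  "exec (Const r k) (R, M) = (R(r := k), M)"
| "exec (Add r a b) (R, M) = (R(r := R a + R b), M)"
| "exec (Sub r a b) (R, M) = (R(r := R a - R b), M)"
| "exec (Load r a) (R, M) = (R(r := M (R a)), M)"
| "exec (Store a b) (R, M) = (R, M(R a := R b))"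
| "exec (Seq p q) s = exec q (exec p s)"
| "exec (IfLess a b p q) (R, M) = (if R a < R b then exec p (R, M) else exec q (R, M))"
| "exec (WhileLess a b p) s = s"

fun straight :: "com \<Rightarrow> bool" where
  "straight (Seq p q) \<longleftrightarrow> straight p \<and> straight q"
| "straight (IfLess a b p q) \<longleftrightarrow> straight p \<and> straight q"
| "straight (WhileLess a b p) \<longleftrightarrow> False"
| "straight _ \<longleftrightarrow> True"

fun len :: "com \<Rightarrow> nat" where
  "len (Seq p q) = len p + len q"
| "len (IfLess a b p q) = Suc (len p + len q)"
| "len _ = 1"

fun consts_le :: "nat \<Rightarrow> com \<Rightarrow> bool" where
  "consts_le B (Const r k) \<longleftrightarrow> k \<le> B"
| "consts_le B (Seq p q) \<longleftrightarrow> consts_le B p \<and> consts_le B q"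
| "consts_le B (IfLess a b p q) \<longleftrightarrow> consts_le B p \<and> consts_le B q"
| "consts_le B (WhileLess a b p) \<longleftrightarrow> consts_le B p"
| "consts_le B _ \<longleftrightarrow> True"

text \<open>The machine has no empty instruction, so a block ends by clearing register 63, which is
  reserved for this.\<close>

fun block :: "com list \<Rightarrow> com" where
  "block [] = Const 63 0"
| "block (c # cs) = Seq c (block cs)"

definition bounded :: "nat \<Rightarrow> ram_state \<Rightarrow> bool" where
  "bounded B s \<longleftrightarrow> (\<forall>r. fst s r \<le> B) \<and> (\<forall>a. snd s a \<le> B)"

lemma bounded_mono: "bounded B s \<Longrightarrow> B \<le> B' \<Longrightarrow> bounded B' s"
  unfolding bounded_def by (meson order_trans)

lemma bounded_reg: "bounded B (R, M) \<Longrightarrow> x \<le> B \<Longrightarrow> bounded B (R(r := x), M)"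
  unfolding bounded_def by auto

lemma bounded_mem: "bounded B (R, M) \<Longrightarrow> x \<le> B \<Longrightarrow> bounded B (R, M(a := x))"
  unfolding bounded_def by auto

lemma boundedD: "bounded B (R, M) \<Longrightarrow> R r \<le> B" "bounded B (R, M) \<Longrightarrow> M a \<le> B"
  unfolding bounded_def by auto

lemma consts_le_mono: "consts_le B p \<Longrightarrow> B \<le> B' \<Longrightarrow> consts_le B' p"
  by (induction p) auto

text \<open>Every instruction at most doubles the largest value, so straight-line code needs no
  bookkeeping of word sizes beyond a bound at its start.\<close>

lemma exec_run:
  assumes "straight p" "consts_le B p" "bounded B s" "2 ^ len p * B \<le> W"
  shows "(\<exists>t\<le>len p. run W p s t (exec p s)) \<and> bounded (2 ^ len p * B) (exec p s)"
  using assms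
proof (induction p arbitrary: s B)
  case (Const r k)
  obtain R M where s: "s = (R, M)" by (cases s)
  have "run W (Const r k) (R, M) 1 (R(r := k), M)" using Const by (intro run.Const) simp
  moreover have "bounded (2 * B) (R(r := k), M)"
    using Const bounded_mono[of B s "2 * B"] unfolding s by (intro bounded_reg) auto
  ultimately show ?case unfolding s by auto
next
  case (Add r a b)
  obtain R M where s: "s = (R, M)" by (cases s)
  have le: "R a + R b \<le> 2 * B" using boundedD(1)[of B R M] Add unfolding s by (metis add_mono mult_2)
  then have "run W (Add r a b) (R, M) 1 (R(r := R a + R b), M)" using Add by (intro run.Add) simp
  moreover have "bounded (2 * B) (R(r := R a + R b), M)"
    using Add bounded_mono[of B s "2 * B"] le unfolding s by (intro bounded_reg) auto
  ultimately show ?case unfolding s by auto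
next
  case (Sub r a b)
  obtain R M where s: "s = (R, M)" by (cases s)
  have le: "R a - R b \<le> 2 * B" using boundedD(1)[of B R M a] Sub unfolding s by simp
  then have "run W (Sub r a b) (R, M) 1 (R(r := R a - R b), M)" using Sub by (intro run.Sub) simp
  moreover have "bounded (2 * B) (R(r := R a - R b), M)"
    using Sub bounded_mono[of B s "2 * B"] le unfolding s by (intro bounded_reg) auto
  ultimately show ?case unfolding s by auto
next
  case (Load r a)
  obtain R M where s: "s = (R, M)" by (cases s)
  have le: "M (R a) \<le> 2 * B" using boundedD(2)[of B R M "R a"] Load unfolding s by simp
  then have "run W (Load r a) (R, M) 1 (R(r := M (R a)), M)" using Load by (intro run.Load) simp
  moreover have "bounded (2 * B) (R(r := M (R a)), M)"
    using Load bounded_mono[of B s "2 * B"] le unfolding s by (intro bounded_reg) auto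
  ultimately show ?case unfolding s by auto
next
  case (Store a b)
  obtain R M where s: "s = (R, M)" by (cases s)
  have le: "R b \<le> 2 * B" using boundedD(1)[of B R M b] Store unfolding s by simp
  then have "run W (Store a b) (R, M) 1 (R, M(R a := R b))" using Store by (intro run.Store) simp
  moreover have "bounded (2 * B) (R, M(R a := R b))"
    using Store bounded_mono[of B s "2 * B"] le unfolding s by (intro bounded_mem) auto
  ultimately show ?case unfolding s by auto
next
  case (Seq p q)
  have W: "2 ^ len q * (2 ^ len p * B) \<le> W" using Seq.prems(4) by (simp add: power_add mult_ac)
  have "2 ^ len p * B \<le> 2 ^ len q * (2 ^ len p * B)" by simp
  then have Wp: "2 ^ len p * B \<le> W" using W by (rule order_trans)
  obtain t1 where t1: "t1 \<le> len p" "run W p s t1 (exec p s)" and b1: "bounded (2 ^ len p * B) (exec p s)"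
    using Seq.IH(1)[of B s] Seq.prems Wp by auto
  have c: "consts_le (2 ^ len p * B) q" using Seq.prems(2) consts_le_mono[of B q] by simp
  obtain t2 where t2: "t2 \<le> len q" "run W q (exec p s) t2 (exec q (exec p s))"
    and b2: "bounded (2 ^ len q * (2 ^ len p * B)) (exec q (exec p s))"
    using Seq.IH(2)[OF _ c b1 W] Seq.prems(1) by auto
  have "run W (Seq p q) s (t1 + t2) (exec q (exec p s))" using t1(2) t2(2) by (rule run.Seq)
  moreover have "t1 + t2 \<le> len (Seq p q)" using t1 t2 by simp
  moreover have "2 ^ len q * (2 ^ len p * B) = 2 ^ len (Seq p q) * B" by (simp add: power_add mult_ac)
  ultimately show ?case using b2 by (metis exec.simps(6))
next
  case (IfLess a b p q)
  obtain R M where s: "s = (R, M)" by (cases s)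
  have le: "2 ^ len p * B \<le> 2 ^ len (IfLess a b p q) * B" "2 ^ len q * B \<le> 2 ^ len (IfLess a b p q) * B"
    by (rule mult_le_mono1, rule power_increasing, simp, simp)+
  show ?case
  proof (cases "R a < R b")
    case True
    obtain t where t: "t \<le> len p" "run W p s t (exec p s)" "bounded (2 ^ len p * B) (exec p s)"
      using IfLess.IH(1)[of B s] IfLess.prems le by auto
    have "run W (IfLess a b p q) s (t + 1) (exec p s)"
      using True t(2) unfolding s by (rule run.IfTrue)
    moreover have "exec (IfLess a b p q) s = exec p s" using True unfolding s by simp
    moreover have "t + 1 \<le> len (IfLess a b p q)" using t by simp
    ultimately show ?thesis using bounded_mono[OF t(3) le(1)] by metis
  next
    case False
    obtain t where t: "t \<le> len q" "run W q s t (exec q s)" "bounded (2 ^ len q * B) (exec q s)"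
      using IfLess.IH(2)[of B s] IfLess.prems le by auto
    have "run W (IfLess a b p q) s (t + 1) (exec q s)"
      using False t(2) unfolding s by (rule run.IfFalse)
    moreover have "exec (IfLess a b p q) s = exec q s" using False unfolding s by simp
    moreover have "t + 1 \<le> len (IfLess a b p q)" using t by simp
    ultimately show ?thesis using bounded_mono[OF t(3) le(2)] by metis
  qed
qed simp

definition runs :: "nat \<Rightarrow> com \<Rightarrow> ram_state \<Rightarrow> nat \<Rightarrow> (ram_state \<Rightarrow> bool) \<Rightarrow> bool" where
  "runs W p s T Q \<longleftrightarrow> (\<exists>t s'. run W p s t s' \<and> t \<le> T \<and> Q s')"

lemma runs_straight:
  assumes "straight p" "consts_le B p" "bounded B s" "2 ^ len p * B \<le> W" "Q (exec p s)"
  shows "runs W p s (len p) Q"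
  using exec_run[OF assms(1-4)] assms(5) unfolding runs_def by blast

lemma runs_seq:
  assumes "runs W p s T1 P" "\<And>s'. P s' \<Longrightarrow> runs W q s' T2 Q"
  shows "runs W (Seq p q) s (T1 + T2) Q"
  using assms unfolding runs_def by (meson add_mono run.Seq)

lemma runs_if:
  assumes "R a < R b \<Longrightarrow> runs W p (R, M) T Q" "\<not> R a < R b \<Longrightarrow> runs W q (R, M) T Q"
  shows "runs W (IfLess a b p q) (R, M) (Suc T) Q"
  using assms unfolding runs_def by (metis IfFalse IfTrue Suc_eq_plus1 Suc_le_mono)

text \<open>The invariant restores the bound \<open>B\<close> before every pass, so the growth by
  doubling is confined to a single pass and \<open>W\<close> does not depend on the number of
  passes, which \<open>\<mu>\<close> bounds.\<close>

lemma runs_loop: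
  assumes body: "straight p" "consts_le B p" "2 ^ len p * B \<le> W"
    and bnd: "\<And>s. I s \<Longrightarrow> bounded B s"
    and step: "\<And>R M. I (R, M) \<Longrightarrow> R a < R b \<Longrightarrow> I (exec p (R, M)) \<and> \<mu> (exec p (R, M)) < \<mu> (R, M)"
    and "I s" and "\<And>R M. I (R, M) \<Longrightarrow> \<not> R a < R b \<Longrightarrow> Q (R, M)"
  shows "runs W (WhileLess a b p) s (Suc (len p) * \<mu> s + 1) Q"
proof -
  have "\<exists>t s'. run W (WhileLess a b p) s t s' \<and> t \<le> Suc (len p) * \<mu> s + 1 \<and> I s' \<and> \<not> fst s' a < fst s' b"
    using \<open>I s\<close>
  proof (induction "\<mu> s" arbitrary: s rule: less_induct)
    case less
    obtain R M where s: "s = (R, M)" by (cases s)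
    show ?case
    proof (cases "R a < R b")
      case True
      have st: "I (exec p s)" "\<mu> (exec p s) < \<mu> s" using step[of R M] less.prems True unfolding s by auto
      obtain t1 where t1: "t1 \<le> len p" "run W p s t1 (exec p s)"
        using exec_run[OF body(1,2) bnd[OF less.prems] body(3)] by blast
      obtain t2 s' where t2: "run W (WhileLess a b p) (exec p s) t2 s'" "t2 \<le> Suc (len p) * \<mu> (exec p s) + 1"
        "I s'" "\<not> fst s' a < fst s' b" using less.hyps[OF st(2,1)] by blast
      have "run W (WhileLess a b p) s (t1 + t2 + 1) s'"
        using True t1(2) t2(1) unfolding s by (rule run.WhileTrue)
      moreover have "t1 + t2 + 1 \<le> Suc (len p) * \<mu> s + 1"
      proof -
        have "Suc (len p) * Suc (\<mu> (exec p s)) \<le> Suc (len p) * \<mu> s" using st(2) by (intro mult_le_mono2) simp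
        then show ?thesis using t1(1) t2(2) by simp
      qed
      ultimately show ?thesis using t2 by blast
    next
      case False
      then have "run W (WhileLess a b p) s 1 s" unfolding s by (rule run.WhileFalse)
      then show ?thesis using False less.prems unfolding s by (intro exI[of _ 1] exI[of _ "(R, M)"]) auto
    qed
  qed
  then obtain t s' where "run W (WhileLess a b p) s t s'" "t \<le> Suc (len p) * \<mu> s + 1" "I s'" "\<not> fst s' a < fst s' b"
    by blast
  moreover from this have "Q s'" using assms(7)[of "fst s'" "snd s'"] by simp
  ultimately show ?thesis unfolding runs_def by blast
qed

section \<open>Memory layout and the preparatory tables\<close>

section \<open>The program\<close>

text \<open>The memory is divided into arrays of size \<open>2 * n + 2\<close>; array \<open>k\<close> starts at the address held by
  register \<open>50 + k\<close>. Array 0 holds the input and later the labels of the edges. At a vertex \<open>v\<close>, the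
  arrays 15, 2, 3 and 4 hold the number of remaining incident edges, the sum of their indices (hence the
  index of the last one), and the sums over the half-edges at \<open>v\<close> of \<open>max 1\<close> of the weight and of the
  weight; the arrays 5, 6, 8 to 11, 13 and 14 hold the weight of the parent edge at the parent, the
  parent, the numbers of half-edges of weight 0, 1 and 2 that were seated so far, the group at \<open>v\<close> and
  the label of the parent edge, and \<open>v * t\<close>. Array 7 lists the vertices in the order in which they are
  removed as leaves, and array 12 maps seats to groups.\<close>

definition skip :: com where "skip = Const 48 0"

text \<open>Registers 1, 2 and 42 hold the constants 1, 2 and 3, registers 3 and 4 hold
  \<open>n\<close> and \<open>n - 1\<close>, register 49 the size of an array. Because
  \<open>block\<close> clears register 63, the base of array 13 is kept in register 65, and that of
  array 15 in register 66.\<close>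

definition init_code :: com where
  "init_code = block
     [Const 1 1, Const 2 2, Const 42 3, Load 3 0, Sub 4 3 1, Add 49 3 3, Add 49 49 2,
      Add 51 0 49, Add 52 51 49, Add 53 52 49, Add 54 53 49, Add 55 54 49, Add 56 55 49, Add 57 56 49,
      Add 58 57 49, Add 59 58 49, Add 60 59 49, Add 61 60 49, Add 62 61 49, Add 65 62 49, Add 64 65 49, Add 66 64 49]"

definition degree_body :: com where
  "degree_body = block
     [Add 6 5 5, Add 6 6 1, Load 7 6, Add 6 6 1, Load 8 6,
      Add 6 66 7, Load 9 6, Add 9 9 1, Store 6 9, Add 6 52 7, Load 9 6, Add 9 9 5, Store 6 9,
      Add 6 66 8, Load 9 6, Add 9 9 1, Store 6 9, Add 6 52 8, Load 9 6, Add 9 9 5, Store 6 9,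
      Add 5 5 1]"

definition max_body :: com where
  "max_body = block [Add 6 66 5, Load 9 6, IfLess 17 9 (Add 17 9 0) skip, Add 5 5 1]"

text \<open>Without division, \<open>t\<close> is found as the number of threes needed to reach the
  maximum degree. For the same reason \<open>base_body\<close> tabulates the multiples of
  \<open>t\<close> and \<open>table_body\<close> the groups of the seats.\<close>

definition third_body :: com where
  "third_body = block [Add 18 18 42, Add 16 16 1]"

definition base_body :: com where
  "base_body = block [Add 6 64 5, Store 6 39, Add 39 39 16, Add 5 5 1]"

definition table_body :: com where
  "table_body = block [Add 6 62 39, Store 6 5, Add 6 6 1, Store 6 5, Add 39 39 2,
     Add 6 62 19, Add 6 6 5, Store 6 5, Add 5 5 1]"

locale tree_input =
  fixes n :: nat and es :: "(nat \<times> nat) list" and E :: "nat set set"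
  assumes tree: "is_tree {..<n} E" and el: "edge_list es E"
begin

definition N :: nat where "N = 2 * n + 2"
text \<open>Between passes every register and cell is at most \<open>B\<close>: addresses stay below
  \<open>16 * N\<close>, index sums and labels below or at \<open>n * n\<close>. No piece of
  straight-line code has length above 200, and each instruction at most doubles the largest value;
  hence the factor in \<open>W\<close>.\<close>

definition B :: nat where "B = 100 * n * n"
definition W :: nat where "W = 2 ^ 200 * B"
definition addr :: "nat \<Rightarrow> nat \<Rightarrow> nat" where "addr k i = k * N + i"
definition M0 :: "nat \<Rightarrow> nat" where "M0 = snd (input_state n es)"

lemma n_pos: "1 \<le> n"
  using tree unfolding is_tree_def graph_connected_def by (cases n) auto

lemma length_es: "length es = n - 1"
proof -
  have "card E = length es"
    using el unfolding edge_list_def by (metis card_image distinct_card distinct_map length_map list.set_map)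
  then show ?thesis using tree_card_edges[OF tree] by simp
qed

lemma es_edge:
  assumes "i < n - 1"
  shows "edge_of (es ! i) \<in> E" "fst (es ! i) < n" "snd (es ! i) < n" "fst (es ! i) \<noteq> snd (es ! i)"
proof -
  have "es ! i \<in> set es" using assms length_es by simp
  then show e: "edge_of (es ! i) \<in> E" using el unfolding edge_list_def by blast
  obtain u v where "u < n" "v < n" "u \<noteq> v" "edge_of (es ! i) = {u, v}" using tree_edge[OF tree e] by auto
  then show "fst (es ! i) < n" "snd (es ! i) < n" "fst (es ! i) \<noteq> snd (es ! i)"
    unfolding edge_of_def by (auto simp: doubleton_eq_iff)
qed

lemma es_inj: "i < n - 1 \<Longrightarrow> j < n - 1 \<Longrightarrow> edge_of (es ! i) = edge_of (es ! j) \<Longrightarrow> i = j"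
  using el length_es unfolding edge_list_def by (metis distinct_conv_nth length_map nth_map)

lemma E_index: "e \<in> E \<Longrightarrow> \<exists>i<n - 1. e = edge_of (es ! i)"
  using el length_es unfolding edge_list_def by (metis imageE in_set_conv_nth)

lemma M0_length: "length (n # concat (map (\<lambda>(u, v). [u, v]) es)) = 2 * n - 1"
proof -
  have "length (concat (map (\<lambda>(u, v). [u, v]) xs)) = 2 * length xs" for xs :: "(nat \<times> nat) list"
    by (induction xs) auto
  then show ?thesis using length_es n_pos by simp
qed

lemma M0_0: "M0 0 = n"
  unfolding M0_def input_state_def Let_def by simp

lemma M0_edge:
  assumes "i < n - 1"
  shows "M0 (Suc (i + i)) = fst (es ! i)" "M0 (Suc (Suc (i + i))) = snd (es ! i)"
proof -
  have nth: "i < length xs \<Longrightarrow> concat (map (\<lambda>(u, v). [u, v]) xs) ! (i + i) = fst (xs ! i) \<and>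
      concat (map (\<lambda>(u, v). [u, v]) xs) ! Suc (i + i) = snd (xs ! i)" for xs :: "(nat \<times> nat) list" and i
  proof (induction xs arbitrary: i)
    case (Cons x xs)
    then show ?case by (cases i; cases x) auto
  qed simp
  have "Suc (Suc (i + i)) < 2 * n - 1" using assms by linarith
  then have "Suc (i + i) < length (n # concat (map (\<lambda>(u, v). [u, v]) es))"
    "Suc (Suc (i + i)) < length (n # concat (map (\<lambda>(u, v). [u, v]) es))"
    unfolding M0_length by auto
  then show "M0 (Suc (i + i)) = fst (es ! i)" "M0 (Suc (Suc (i + i))) = snd (es ! i)"
    using nth[of i es] assms length_es unfolding M0_def input_state_def Let_def snd_conv
    by (simp_all only: if_True nth_Cons_Suc)
qed

lemma M0_zero: "2 * n - 1 \<le> a \<Longrightarrow> M0 a = 0"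
  using M0_length unfolding M0_def input_state_def Let_def by (simp del: length_Cons)

lemma addr_add: "addr k 0 + x = addr k x" unfolding addr_def by simp

lemma addr_inj:
  assumes "i < N" "j < N"
  shows "addr k i = addr l j \<longleftrightarrow> k = l \<and> i = j"
proof
  assume eq: "addr k i = addr l j"
  have "addr k i div N = k" "addr k i mod N = i" "addr l j div N = l" "addr l j mod N = j"
    using assms unfolding addr_def by auto
  then show "k = l \<and> i = j" using eq by metis
qed simp

lemma addr_low: "i < N \<Longrightarrow> 0 < l \<Longrightarrow> i \<noteq> addr l j" "i < N \<Longrightarrow> 0 < l \<Longrightarrow> addr l j \<noteq> i"
proof -
  have "N \<le> addr l j" if "0 < l" using that unfolding addr_def by (cases l) auto
  then show "i < N \<Longrightarrow> 0 < l \<Longrightarrow> i \<noteq> addr l j" "i < N \<Longrightarrow> 0 < l \<Longrightarrow> addr l j \<noteq> i" by force+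
qed

lemma less_N: "v < n \<Longrightarrow> v < N" unfolding N_def by simp

lemma n_le_B: "100 * n \<le> B"
  unfolding B_def using n_pos by simp

lemma addr_le_B: "k \<le> 15 \<Longrightarrow> i < N \<Longrightarrow> addr k i \<le> B"
proof -
  assume "k \<le> 15" "i < N"
  then have "addr k i \<le> 15 * N + N" unfolding addr_def using mult_le_mono1[of k 15 N] by linarith
  also have "\<dots> \<le> 100 * n" unfolding N_def using n_pos by simp
  finally show ?thesis using n_le_B by simp
qed

definition env :: "(nat \<Rightarrow> nat) \<Rightarrow> bool" where
  "env R \<longleftrightarrow> R 0 = 0 \<and> R 1 = 1 \<and> R 2 = 2 \<and> R 3 = n \<and> R 4 = n - 1 \<and> R 42 = 3 \<and>
     R 66 = addr 15 0 \<and> R 52 = addr 2 0 \<and> R 53 = addr 3 0 \<and> R 54 = addr 4 0 \<and> R 55 = addr 5 0 \<and> R 56 = addr 6 0 \<and>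
     R 57 = addr 7 0 \<and> R 58 = addr 8 0 \<and> R 59 = addr 9 0 \<and> R 60 = addr 10 0 \<and> R 61 = addr 11 0 \<and> R 62 = addr 12 0 \<and>
     R 65 = addr 13 0 \<and> R 64 = addr 14 0"

definition deg_upto :: "nat \<Rightarrow> nat \<Rightarrow> nat" where
  "deg_upto i v = card {j. j < i \<and> v \<in> edge_of (es ! j)}"
definition ids_upto :: "nat \<Rightarrow> nat \<Rightarrow> nat" where
  "ids_upto i v = (\<Sum>j\<in>{j. j < i \<and> v \<in> edge_of (es ! j)}. j)"

lemma upto_0: "deg_upto 0 v = 0" "ids_upto 0 v = 0"
  unfolding deg_upto_def ids_upto_def by auto

lemma upto_Suc:
  "deg_upto (Suc i) v = (if v \<in> edge_of (es ! i) then Suc (deg_upto i v) else deg_upto i v)"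
  "ids_upto (Suc i) v = (if v \<in> edge_of (es ! i) then ids_upto i v + i else ids_upto i v)"
proof -
  have "{j. j < Suc i \<and> v \<in> edge_of (es ! j)} =
      (if v \<in> edge_of (es ! i) then insert i {j. j < i \<and> v \<in> edge_of (es ! j)} else {j. j < i \<and> v \<in> edge_of (es ! j)})"
    by (auto simp: less_Suc_eq)
  then show "deg_upto (Suc i) v = (if v \<in> edge_of (es ! i) then Suc (deg_upto i v) else deg_upto i v)"
    "ids_upto (Suc i) v = (if v \<in> edge_of (es ! i) then ids_upto i v + i else ids_upto i v)"
    unfolding deg_upto_def ids_upto_def by auto
qed

lemma upto_bound:
  assumes "i \<le> n"
  shows "deg_upto i v \<le> n" "ids_upto i v \<le> n * n"
proof -
  have s: "{j. j < i \<and> v \<in> edge_of (es ! j)} \<subseteq> {..<n}" using assms by auto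
  show "deg_upto i v \<le> n" unfolding deg_upto_def using card_mono[OF _ s] by simp
  have "(\<Sum>j\<in>{j. j < i \<and> v \<in> edge_of (es ! j)}. j) \<le> (\<Sum>j\<in>{..<n}. n)"
    using sum_mono2[OF _ s, of "\<lambda>j. j"] sum_mono[of "{..<n}" "\<lambda>j. j" "\<lambda>_. n"] by simp
  then show "ids_upto i v \<le> n * n" unfolding ids_upto_def by simp
qed

definition I1 :: "ram_state \<Rightarrow> bool" where
  "I1 s \<longleftrightarrow> bounded B s \<and> (case s of (R, M) \<Rightarrow> env R \<and> R 5 \<le> n - 1 \<and> (\<forall>a<N. M a = M0 a) \<and>
     (\<forall>v<n. M (addr 15 v) = deg_upto (R 5) v \<and> M (addr 2 v) = ids_upto (R 5) v) \<and>
     (\<forall>k v. 3 \<le> k \<longrightarrow> k \<le> 14 \<longrightarrow> v < N \<longrightarrow> M (addr k v) = 0))"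

lemma init_phase: "runs W init_code (input_state n es) (len init_code) (\<lambda>s. I1 s \<and> fst s 5 = 0)"
proof (rule runs_straight)
  have inp: "input_state n es = (\<lambda>_. 0, M0)" unfolding M0_def input_state_def Let_def by simp
  have M0B: "M0 a \<le> n" for a
  proof -
    let ?xs = "n # concat (map (\<lambda>(u, v). [u, v]) es)"
    have "x \<le> n" if x: "x \<in> set ?xs" for x
    proof -
      have "x = n \<or> (\<exists>e\<in>set es. x = fst e \<or> x = snd e)" using x by force
      then consider "x = n" | e where "e \<in> set es" "x = fst e \<or> x = snd e" by blast
      then show ?thesis
      proof cases
        case 2
        then obtain i where "i < n - 1" "e = es ! i" using length_es by (metis in_set_conv_nth)
        then show ?thesis using es_edge(2,3)[of i] 2(2) by auto
      qed simp
    qed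
    then have "?xs ! a \<le> n" if "a < length ?xs" using nth_mem[OF that] by blast
    then show ?thesis unfolding M0_def input_state_def Let_def snd_conv by (simp del: length_Cons nth_Cons)
  qed
  have b0: "bounded B (\<lambda>_. 0, M0)"
  proof -
    have "M0 a \<le> B" for a using M0B[of a] n_le_B by linarith
    then show ?thesis unfolding bounded_def by simp
  qed
  then show "bounded B (input_state n es)" unfolding inp .
  show "straight init_code" by (simp add: init_code_def)
  have "3 \<le> B" using n_le_B n_pos by simp
  then show "consts_le B init_code" by (simp add: init_code_def)
  show "2 ^ len init_code * B \<le> W" unfolding W_def
    by (intro mult_le_mono1 power_increasing) (simp_all add: init_code_def)
  have ats: "k * N \<le> B" if "k \<le> 15" for k using addr_le_B[OF that, of 0] unfolding addr_def N_def by simp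
  have ex: "exec init_code (\<lambda>_. 0, M0) = ((\<lambda>_. 0)(1 := 1, 2 := 2, 42 := 3, 3 := n, 4 := n - 1, 49 := N,
     51 := 1 * N, 52 := 2 * N, 53 := 3 * N, 54 := 4 * N, 55 := 5 * N, 56 := 6 * N, 57 := 7 * N, 58 := 8 * N,
     59 := 9 * N, 60 := 10 * N, 61 := 11 * N, 62 := 12 * N, 65 := 13 * N, 64 := 14 * N, 66 := 15 * N, 63 := 0), M0)"
  proof -
    have NN: "Suc (Suc (n + n)) = N" unfolding N_def by simp
    have sums: "N + N = 2 * N" "2 * N + N = 3 * N" "3 * N + N = 4 * N" "4 * N + N = 5 * N" "5 * N + N = 6 * N"
      "6 * N + N = 7 * N" "7 * N + N = 8 * N" "8 * N + N = 9 * N" "9 * N + N = 10 * N" "10 * N + N = 11 * N"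
      "11 * N + N = 12 * N" "12 * N + N = 13 * N" "13 * N + N = 14 * N" "14 * N + N = 15 * N" by simp_all
    show ?thesis unfolding init_code_def by (simp add: M0_0 NN sums)
  qed
  have small: "n \<le> B" "n - 1 \<le> B" "3 \<le> B" "2 \<le> B" "1 \<le> B" "N \<le> B"
    using n_le_B n_pos ats[of 1] by auto
  have "I1 (exec init_code (input_state n es))"
    unfolding inp ex I1_def
  proof (intro conjI, goal_cases)
    case 1
    show ?case by (intro bounded_reg b0 ats small) auto
  next
    case 2
    have "env ((\<lambda>_. 0)(1 := 1, 2 := 2, 42 := 3, 3 := n, 4 := n - 1, 49 := N,
     51 := 1 * N, 52 := 2 * N, 53 := 3 * N, 54 := 4 * N, 55 := 5 * N, 56 := 6 * N, 57 := 7 * N, 58 := 8 * N,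
     59 := 9 * N, 60 := 10 * N, 61 := 11 * N, 62 := 12 * N, 65 := 13 * N, 64 := 14 * N, 66 := 15 * N, 63 := 0))"
      unfolding env_def addr_def by simp
    moreover have "M0 (addr k v) = 0" if "1 \<le> k" for k v
      using that unfolding addr_def N_def by (intro M0_zero) (cases k, auto)
    ultimately show ?case by (simp add: upto_0)
  qed
  then show "I1 (exec init_code (input_state n es)) \<and> fst (exec init_code (input_state n es)) 5 = 0"
    unfolding inp ex by simp
qed

lemma W_len: "len p \<le> 200 \<Longrightarrow> 2 ^ len p * B \<le> W"
  unfolding W_def by (intro mult_le_mono1 power_increasing) simp_all

lemma B3: "3 \<le> B" using n_le_B n_pos by simp

lemmas code_simps = addr_add addr_inj addr_low less_N

lemma degree_phase:
  assumes "I1 s" "fst s 5 = 0"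
  shows "runs W (WhileLess 5 4 degree_body) s (Suc (len degree_body) * n + 1)
    (\<lambda>s. I1 s \<and> fst s 5 = n - 1)"
proof -
  have "runs W (WhileLess 5 4 degree_body) s (Suc (len degree_body) * (n - fst s 5) + 1)
    (\<lambda>s. I1 s \<and> fst s 5 = n - 1)"
  proof (rule runs_loop[where I = I1 and B = B and \<mu> = "\<lambda>s. n - fst s 5"])
    show "straight degree_body" "consts_le B degree_body" by (simp_all add: degree_body_def)
    show "2 ^ len degree_body * B \<le> W" by (rule W_len) (simp add: degree_body_def)
    show "bounded B s" if "I1 s" for s using that unfolding I1_def by simp
    show "I1 s" by fact
    show "I1 (R, M) \<and> fst (R, M) 5 = n - 1" if "I1 (R, M)" "\<not> R 5 < R 4" for R M
      using that unfolding I1_def env_def by auto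
    fix R M assume I: "I1 (R, M)" and lt: "R 5 < R 4"
    define i where "i = R 5"
    define u where "u = fst (es ! i)"
    define v where "v = snd (es ! i)"
    have b: "bounded B (R, M)" and e: "env R" using I unfolding I1_def by auto
    have i: "i < n - 1" using lt e unfolding env_def i_def by simp
    have uv: "u < n" "v < n" "u \<noteq> v" using es_edge[OF i] unfolding u_def v_def by auto
    have low: "Suc (i + i) < N" "Suc (Suc (i + i)) < N" using i unfolding N_def by auto
    have Muv: "M (Suc (i + i)) = u" "M (Suc (Suc (i + i))) = v"
      using I M0_edge[OF i] low unfolding I1_def u_def v_def by auto
    have MD: "M (addr 15 w) = deg_upto i w" "M (addr 2 w) = ids_upto i w" if "w < n" for w
      using I that unfolding I1_def i_def by auto
    have ex: "exec degree_body (R, M) = (R(7 := u, 8 := v, 6 := addr 2 v, 9 := ids_upto i v + i, 5 := Suc i, 63 := 0),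
      M(addr 15 u := Suc (deg_upto i u), addr 2 u := ids_upto i u + i, addr 15 v := Suc (deg_upto i v), addr 2 v := ids_upto i v + i))"
      using e uv unfolding degree_body_def env_def
      by (simp add: i_def[symmetric] Muv MD code_simps)
    have bd: "deg_upto (Suc i) w \<le> n" "ids_upto (Suc i) w \<le> n * n" for w
      using upto_bound[of "Suc i" w] i by auto
    have nn: "n * n \<le> B" unfolding B_def by simp
    have iv: "Suc (deg_upto i u) = deg_upto (Suc i) u" "Suc (deg_upto i v) = deg_upto (Suc i) v"
      "ids_upto i u + i = ids_upto (Suc i) u" "ids_upto i v + i = ids_upto (Suc i) v"
      unfolding upto_Suc edge_of_def u_def v_def by auto
    have small: "u \<le> B" "v \<le> B" "Suc i \<le> B" "deg_upto (Suc i) w \<le> B" "ids_upto (Suc i) w \<le> B" for w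
      using uv i n_le_B bd[of w] nn by auto
    show "I1 (exec degree_body (R, M)) \<and> n - fst (exec degree_body (R, M)) 5 < n - fst (R, M) 5"
      unfolding ex iv
    proof
      show "I1 (R(7 := u, 8 := v, 6 := addr 2 v, 9 := ids_upto (Suc i) v, 5 := Suc i, 63 := 0),
         M(addr 15 u := deg_upto (Suc i) u, addr 2 u := ids_upto (Suc i) u, addr 15 v := deg_upto (Suc i) v,
           addr 2 v := ids_upto (Suc i) v))"
        unfolding I1_def
      proof (intro conjI, goal_cases)
        case 1
        show ?case by (intro bounded_reg bounded_mem b small addr_le_B less_N uv) auto
      next
        case 2
        have "env (R(7 := u, 8 := v, 6 := addr 2 v, 9 := ids_upto (Suc i) v, 5 := Suc i, 63 := 0))"
          using e unfolding env_def by simp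
        moreover have "w \<notin> edge_of (es ! i)" if "w \<noteq> u" "w \<noteq> v" for w
          using that unfolding edge_of_def u_def v_def by auto
        ultimately show ?case using I i uv
          unfolding I1_def by (auto simp: code_simps MD upto_Suc)
      qed
      show "n - fst (R(7 := u, 8 := v, 6 := addr 2 v, 9 := ids_upto (Suc i) v, 5 := Suc i, 63 := 0),
         M(addr 15 u := deg_upto (Suc i) u, addr 2 u := ids_upto (Suc i) u, addr 15 v := deg_upto (Suc i) v,
           addr 2 v := ids_upto (Suc i) v)) 5 < n - fst (R, M) 5"
        using i unfolding i_def by simp
    qed
  qed
  then show ?thesis using assms(2) by simp
qed

end

text \<open>Registers 43 and 44 hold the limits increased by 1, because the machine compares
  strictly while the greedy conditions are weak inequalities.\<close>

definition limits_code :: com where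
  "limits_code = block [Add 19 16 16, Add 43 18 1, Add 44 19 1, Const 5 0, Const 39 0]"

context tree_input
begin

lemma es_card:
  "bij_betw (\<lambda>j. edge_of (es ! j)) {j. j < n - 1 \<and> P (edge_of (es ! j))} {e \<in> E. P e}"
  unfolding bij_betw_def
proof
  show "inj_on (\<lambda>j. edge_of (es ! j)) {j. j < n - 1 \<and> P (edge_of (es ! j))}"
    using es_inj by (auto simp: inj_on_def)
  show "(\<lambda>j. edge_of (es ! j)) ` {j. j < n - 1 \<and> P (edge_of (es ! j))} = {e \<in> E. P e}"
    using es_edge(1) E_index by fastforce
qed

lemma deg_upto_all: "deg_upto (n - 1) v = degree E v"
  unfolding deg_upto_def degree_def using bij_betw_same_card[OF es_card[of "\<lambda>e. v \<in> e"]] by simp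

definition \<Delta> :: nat where "\<Delta> = max_degree {..<n} E"
definition t :: nat where "t = nat \<lceil>real \<Delta> / 3\<rceil>"

lemma degree_less: "degree E v \<le> n - 1"
proof -
  have "degree E v \<le> card E" unfolding degree_def using tree_finite_edges[OF tree] by (intro card_mono) auto
  then show ?thesis using tree_card_edges[OF tree] by simp
qed

lemma \<Delta>_max: "v < n \<Longrightarrow> degree E v \<le> \<Delta>" and \<Delta>_attained: "\<exists>v<n. degree E v = \<Delta>"
proof -
  show "v < n \<Longrightarrow> degree E v \<le> \<Delta>" unfolding \<Delta>_def max_degree_def by auto
  have "Max (degree E ` {..<n}) \<in> degree E ` {..<n}" using n_pos by (intro Max_in) (auto simp: lessThan_empty_iff)
  then show "\<exists>v<n. degree E v = \<Delta>" unfolding \<Delta>_def max_degree_def by auto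
qed

lemma \<Delta>_less: "\<Delta> \<le> n - 1"
  using \<Delta>_attained degree_less by metis

lemma t_unique:
  assumes "\<Delta> \<le> 3 * u" "u = 0 \<or> 3 * (u - 1) < \<Delta>"
  shows "u = t"
proof (rule antisym)
  show "t \<le> u" unfolding t_def ceiling_third using assms(1) .
  have "\<Delta> \<le> 3 * t" using ceiling_third[of \<Delta> t] unfolding t_def by simp
  then show "u \<le> t" using assms(2) by linarith
qed

lemma t_bounds: "\<Delta> \<le> 3 * t" "3 * t \<le> n + 1" "t \<le> n"
proof -
  show 1: "\<Delta> \<le> 3 * t" using ceiling_third[of \<Delta> t] unfolding t_def by simp
  have "t \<le> (\<Delta> + 2) div 3" unfolding t_def ceiling_third by linarith
  then show "3 * t \<le> n + 1" using \<Delta>_less n_pos by linarith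
  then show "t \<le> n" using n_pos by linarith
qed

definition limits :: "(nat \<Rightarrow> nat) \<Rightarrow> bool" where
  "limits R \<longleftrightarrow> R 16 = t \<and> R 18 = 3 * t \<and> R 19 = 2 * t \<and> R 43 = 3 * t + 1 \<and> R 44 = 2 * t + 1"

definition mem1 :: "(nat \<Rightarrow> nat) \<Rightarrow> bool" where
  "mem1 M \<longleftrightarrow> (\<forall>a<N. M a = M0 a) \<and>
     (\<forall>v<n. M (addr 15 v) = degree E v \<and> M (addr 2 v) = ids_upto (n - 1) v) \<and>
     (\<forall>k v. 3 \<le> k \<longrightarrow> k \<le> 13 \<longrightarrow> k \<noteq> 12 \<longrightarrow> v < N \<longrightarrow> M (addr k v) = 0)"

lemma mem1_I1: "I1 (R, M) \<Longrightarrow> R 5 = n - 1 \<Longrightarrow> mem1 M"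
  unfolding I1_def mem1_def using deg_upto_all by simp

definition I2 :: "ram_state \<Rightarrow> bool" where
  "I2 s \<longleftrightarrow> bounded B s \<and> (case s of (R, M) \<Rightarrow> env R \<and> mem1 M \<and> R 5 \<le> n \<and>
     (\<forall>w<R 5. degree E w \<le> R 17) \<and> (R 17 = 0 \<or> (\<exists>w<R 5. degree E w = R 17)))"

definition I3 :: "ram_state \<Rightarrow> bool" where
  "I3 s \<longleftrightarrow> bounded B s \<and> (case s of (R, M) \<Rightarrow> env R \<and> mem1 M \<and> R 17 = \<Delta> \<and>
     R 18 = 3 * R 16 \<and> (R 16 = 0 \<or> 3 * (R 16 - 1) < \<Delta>))"

lemma max_phase:
  assumes "I2 s" "fst s 5 = 0"
  shows "runs W (WhileLess 5 3 max_body) s (Suc (len max_body) * n + 1)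
    (\<lambda>s. bounded B s \<and> env (fst s) \<and> mem1 (snd s) \<and> fst s 17 = \<Delta>)"
proof -
  have "runs W (WhileLess 5 3 max_body) s (Suc (len max_body) * (n - fst s 5) + 1)
    (\<lambda>s. bounded B s \<and> env (fst s) \<and> mem1 (snd s) \<and> fst s 17 = \<Delta>)"
  proof (rule runs_loop[where I = I2 and B = B and \<mu> = "\<lambda>s. n - fst s 5"])
    show "straight max_body" "consts_le B max_body" by (simp_all add: max_body_def skip_def)
    show "2 ^ len max_body * B \<le> W" by (rule W_len) (simp add: max_body_def skip_def)
    show "bounded B s" if "I2 s" for s using that unfolding I2_def by simp
    show "I2 s" by fact
  next
    fix R M assume I: "I2 (R, M)" and "\<not> R 5 < R 3"
    then have R5: "R 5 = n" unfolding I2_def env_def by auto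
    obtain w where w: "w < n" "degree E w = \<Delta>" using \<Delta>_attained by blast
    have "\<Delta> \<le> R 17" using I R5 w unfolding I2_def by auto
    moreover have "R 17 \<le> \<Delta>"
    proof -
      have "R 17 = 0 \<or> (\<exists>w<R 5. degree E w = R 17)" using I unfolding I2_def by simp
      then show ?thesis using \<Delta>_max unfolding R5 by (metis le0)
    qed
    ultimately show "bounded B (R, M) \<and> env (fst (R, M)) \<and> mem1 (snd (R, M)) \<and> fst (R, M) 17 = \<Delta>"
      using I unfolding I2_def by simp
  next
    fix R M assume I: "I2 (R, M)" and lt: "R 5 < R 3"
    define i where "i = R 5"
    have b: "bounded B (R, M)" and e: "env R" and m: "mem1 M" using I unfolding I2_def by auto
    have i: "i < n" using lt e unfolding env_def i_def by simp
    have MD: "M (addr 15 i) = degree E i" using m i unfolding mem1_def by simp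
    have e': "env (R(6 := x1, 9 := x2, 17 := x3, 5 := x4, 63 := x5))" "env (R(6 := x1, 9 := x2, 48 := x3, 5 := x4, 63 := x5))"
      for x1 x2 x3 x4 x5 using e unfolding env_def by auto
    have small: "degree E i \<le> B" "Suc i \<le> B" using degree_less[of i] n_le_B i by auto
    show "I2 (exec max_body (R, M)) \<and> n - fst (exec max_body (R, M)) 5 < n - fst (R, M) 5"
    proof (cases "R 17 < degree E i")
      case True
      have ex: "exec max_body (R, M) = (R(6 := addr 15 i, 9 := degree E i, 17 := degree E i, 5 := Suc i, 63 := 0), M)"
        using e True unfolding max_body_def env_def by (simp add: i_def[symmetric] MD code_simps)
      have "bounded B (exec max_body (R, M))"
        unfolding ex by (intro bounded_reg b small addr_le_B less_N i) auto
      then show ?thesis using I i True m e' unfolding ex I2_def i_def[symmetric]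
        by (auto simp: less_Suc_eq i_def[symmetric] intro: less_imp_le order_trans)
    next
      case False
      have ex: "exec max_body (R, M) = (R(6 := addr 15 i, 9 := degree E i, 48 := 0, 5 := Suc i, 63 := 0), M)"
        using e False unfolding max_body_def env_def skip_def by (simp add: i_def[symmetric] MD code_simps)
      have "bounded B (exec max_body (R, M))"
        unfolding ex by (intro bounded_reg b small addr_le_B less_N i) auto
      then show ?thesis using I i False m e' unfolding ex I2_def i_def[symmetric]
        by (auto simp: less_Suc_eq i_def[symmetric])
    qed
  qed
  then show ?thesis using assms(2) by simp
qed

lemma third_phase:
  assumes "I3 s" "fst s 16 = 0"
  shows "runs W (WhileLess 18 17 third_body) s (Suc (len third_body) * n + 1)
    (\<lambda>s. bounded B s \<and> env (fst s) \<and> mem1 (snd s) \<and> fst s 16 = t \<and> fst s 18 = 3 * t)"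
proof -
  have "runs W (WhileLess 18 17 third_body) s (Suc (len third_body) * (n - fst s 16) + 1)
    (\<lambda>s. bounded B s \<and> env (fst s) \<and> mem1 (snd s) \<and> fst s 16 = t \<and> fst s 18 = 3 * t)"
  proof (rule runs_loop[where I = I3 and B = B and \<mu> = "\<lambda>s. n - fst s 16"])
    show "straight third_body" "consts_le B third_body" by (simp_all add: third_body_def)
    show "2 ^ len third_body * B \<le> W" by (rule W_len) (simp add: third_body_def)
    show "bounded B s" if "I3 s" for s using that unfolding I3_def by simp
    show "I3 s" by fact
  next
    fix R M assume I: "I3 (R, M)" and "\<not> R 18 < R 17"
    then have "R 16 = t" unfolding I3_def by (intro t_unique) auto
    then show "bounded B (R, M) \<and> env (fst (R, M)) \<and> mem1 (snd (R, M)) \<and> fst (R, M) 16 = t \<and> fst (R, M) 18 = 3 * t"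
      using I unfolding I3_def by simp
  next
    fix R M assume I: "I3 (R, M)" and lt: "R 18 < R 17"
    have b: "bounded B (R, M)" and e: "env R" and m: "mem1 M" using I unfolding I3_def by auto
    have ex: "exec third_body (R, M) = (R(18 := R 18 + 3, 16 := Suc (R 16), 63 := 0), M)"
      using e unfolding third_body_def env_def by simp
    have lt': "3 * R 16 < \<Delta>" "R 18 = 3 * R 16" using I lt unfolding I3_def by auto
    then have "bounded B (exec third_body (R, M))"
      unfolding ex using \<Delta>_less n_le_B by (intro bounded_reg b) auto
    moreover have "env (R(18 := R 18 + 3, 16 := Suc (R 16), 63 := 0))" using e unfolding env_def by simp
    ultimately show "I3 (exec third_body (R, M)) \<and> n - fst (exec third_body (R, M)) 16 < n - fst (R, M) 16"
      using I lt' \<Delta>_less unfolding ex I3_def by auto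
  qed
  then show ?thesis using assms(2) by simp
qed

definition I4 :: "ram_state \<Rightarrow> bool" where
  "I4 s \<longleftrightarrow> bounded B s \<and> (case s of (R, M) \<Rightarrow> env R \<and> limits R \<and> mem1 M \<and> R 5 \<le> n \<and> R 39 = R 5 * t \<and>
     (\<forall>w<R 5. M (addr 14 w) = w * t))"

definition mem2 :: "(nat \<Rightarrow> nat) \<Rightarrow> bool" where
  "mem2 M \<longleftrightarrow> mem1 M \<and> (\<forall>w<n. M (addr 14 w) = w * t)"

lemma addr_big: "0 < k \<Longrightarrow> \<not> addr k i < N"
  unfolding addr_def by (cases k) auto

lemma mem1_upd: "k = 12 \<or> k = 14 \<Longrightarrow> i < N \<Longrightarrow> mem1 M \<Longrightarrow> mem1 (M(addr k i := x))"
  unfolding mem1_def by (auto simp: code_simps addr_big)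

lemma limits_phase:
  assumes "bounded B s \<and> env (fst s) \<and> mem1 (snd s) \<and> fst s 16 = t \<and> fst s 18 = 3 * t"
  shows "runs W limits_code s (len limits_code) (\<lambda>s. I4 s \<and> fst s 5 = 0)"
proof (rule runs_straight)
  obtain R M where s: "s = (R, M)" by (cases s)
  show "bounded B s" using assms by simp
  show "straight limits_code" "consts_le B limits_code" by (simp_all add: limits_code_def)
  show "2 ^ len limits_code * B \<le> W" by (rule W_len) (simp add: limits_code_def)
  have ex: "exec limits_code (R, M) = (R(19 := 2 * t, 43 := 3 * t + 1, 44 := 2 * t + 1, 5 := 0, 39 := 0, 63 := 0), M)"
    using assms unfolding s limits_code_def env_def by (simp add: mult_2)
  have "bounded B (exec limits_code (R, M))"
    unfolding ex using t_bounds n_le_B n_pos assms unfolding s by (intro bounded_reg) auto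
  moreover have "env (R(19 := 2 * t, 43 := 3 * t + 1, 44 := 2 * t + 1, 5 := 0, 39 := 0, 63 := 0))"
    using assms unfolding s env_def by simp
  ultimately show "I4 (exec limits_code s) \<and> fst (exec limits_code s) 5 = 0"
    using assms unfolding s ex unfolding I4_def by (auto simp: limits_def)
qed

lemma base_phase:
  assumes "I4 s" "fst s 5 = 0"
  shows "runs W (WhileLess 5 3 base_body) s (Suc (len base_body) * n + 1)
    (\<lambda>s. bounded B s \<and> env (fst s) \<and> limits (fst s) \<and> mem2 (snd s))"
proof -
  have "runs W (WhileLess 5 3 base_body) s (Suc (len base_body) * (n - fst s 5) + 1)
    (\<lambda>s. bounded B s \<and> env (fst s) \<and> limits (fst s) \<and> mem2 (snd s))"
  proof (rule runs_loop[where I = I4 and B = B and \<mu> = "\<lambda>s. n - fst s 5"])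
    show "straight base_body" "consts_le B base_body" by (simp_all add: base_body_def)
    show "2 ^ len base_body * B \<le> W" by (rule W_len) (simp add: base_body_def)
    show "bounded B s" if "I4 s" for s using that unfolding I4_def by simp
    show "I4 s" by fact
  next
    fix R M assume "I4 (R, M)" "\<not> R 5 < R 3"
    then show "bounded B (R, M) \<and> env (fst (R, M)) \<and> limits (fst (R, M)) \<and> mem2 (snd (R, M))"
      unfolding I4_def mem2_def env_def by auto
  next
    fix R M assume I: "I4 (R, M)" and lt: "R 5 < R 3"
    define i where "i = R 5"
    have b: "bounded B (R, M)" and e: "env R" and m: "mem1 M" and l: "limits R" using I unfolding I4_def by auto
    have i: "i < n" using lt e unfolding env_def i_def by simp
    have acc: "R 39 = i * t" using I unfolding I4_def i_def by simp
    have ex: "exec base_body (R, M) = (R(6 := addr 14 i, 39 := i * t + t, 5 := Suc i, 63 := 0), M(addr 14 i := i * t))"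
      using e l unfolding base_body_def env_def limits_def by (simp add: i_def[symmetric] acc code_simps)
    have nn: "i * t \<le> B" "i * t + t \<le> B"
    proof -
      have "Suc i * t \<le> n * n" using i t_bounds by (intro mult_le_mono) auto
      then show "i * t + t \<le> B" "i * t \<le> B" unfolding B_def by auto
    qed
    have "bounded B (exec base_body (R, M))"
      unfolding ex using nn i n_le_B by (intro bounded_reg bounded_mem b addr_le_B less_N) auto
    moreover have "env (R(6 := addr 14 i, 39 := i * t + t, 5 := Suc i, 63 := 0))"
      "limits (R(6 := addr 14 i, 39 := i * t + t, 5 := Suc i, 63 := 0))"
      using e l unfolding env_def limits_def by simp_all
    moreover have "mem1 (M(addr 14 i := i * t))" using m i less_N by (intro mem1_upd) auto
    ultimately show "I4 (exec base_body (R, M)) \<and> n - fst (exec base_body (R, M)) 5 < n - fst (R, M) 5"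
      using I i unfolding ex I4_def i_def[symmetric] by (auto simp: code_simps less_Suc_eq i_def[symmetric])
  qed
  then show ?thesis using assms(2) by simp
qed

definition I5 :: "ram_state \<Rightarrow> bool" where
  "I5 s \<longleftrightarrow> bounded B s \<and> (case s of (R, M) \<Rightarrow> env R \<and> limits R \<and> mem2 M \<and> R 5 \<le> t \<and> R 39 = 2 * R 5 \<and>
     (\<forall>q<3 * t. seat_group t q < R 5 \<longrightarrow> M (addr 12 q) = seat_group t q))"

definition mem3 :: "(nat \<Rightarrow> nat) \<Rightarrow> bool" where
  "mem3 M \<longleftrightarrow> mem2 M \<and> (\<forall>q<3 * t. M (addr 12 q) = seat_group t q)"

lemma table_phase:
  assumes "I5 s" "fst s 5 = 0"
  shows "runs W (WhileLess 5 16 table_body) s (Suc (len table_body) * n + 1)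
    (\<lambda>s. bounded B s \<and> env (fst s) \<and> limits (fst s) \<and> mem3 (snd s))"
proof -
  have "runs W (WhileLess 5 16 table_body) s (Suc (len table_body) * (n - fst s 5) + 1)
    (\<lambda>s. bounded B s \<and> env (fst s) \<and> limits (fst s) \<and> mem3 (snd s))"
  proof (rule runs_loop[where I = I5 and B = B and \<mu> = "\<lambda>s. n - fst s 5"])
    show "straight table_body" "consts_le B table_body" by (simp_all add: table_body_def)
    show "2 ^ len table_body * B \<le> W" by (rule W_len) (simp add: table_body_def)
    show "bounded B s" if "I5 s" for s using that unfolding I5_def by simp
    show "I5 s" by fact
  next
    fix R M assume I: "I5 (R, M)" and "\<not> R 5 < R 16"
    moreover have "seat_group t q < t" if "q < 3 * t" for q using that unfolding seat_group_def by auto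
    ultimately show "bounded B (R, M) \<and> env (fst (R, M)) \<and> limits (fst (R, M)) \<and> mem3 (snd (R, M))"
      unfolding I5_def mem3_def limits_def by auto
  next
    fix R M assume I: "I5 (R, M)" and lt: "R 5 < R 16"
    define i where "i = R 5"
    have b: "bounded B (R, M)" and e: "env R" and m: "mem2 M" and l: "limits R" using I unfolding I5_def by auto
    have i: "i < t" using lt l unfolding limits_def i_def by simp
    have acc: "R 39 = 2 * i" using I unfolding I5_def i_def by simp
    have less: "2 * i < N" "Suc (2 * i) < N" "2 * t + i < N" using i t_bounds unfolding N_def by auto
    let ?M = "M(addr 12 (2 * i) := i, addr 12 (Suc (2 * i)) := i, addr 12 (2 * t + i) := i)"
    have s1: "addr 12 (2 * i) + 1 = addr 12 (Suc (2 * i))" "addr 12 (2 * t) + i = addr 12 (2 * t + i)"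
      unfolding addr_def by auto
    have ex: "exec table_body (R, M) = (R(39 := 2 * Suc i, 6 := addr 12 (2 * t + i), 5 := Suc i, 63 := 0), ?M)"
      using e l s1 unfolding table_body_def env_def limits_def by (simp add: i_def[symmetric] acc code_simps)
    have "bounded B (exec table_body (R, M))"
      unfolding ex using less i t_bounds n_le_B by (intro bounded_reg bounded_mem b addr_le_B) auto
    moreover have "env (R(39 := 2 * Suc i, 6 := addr 12 (2 * t + i), 5 := Suc i, 63 := 0))"
      "limits (R(39 := 2 * Suc i, 6 := addr 12 (2 * t + i), 5 := Suc i, 63 := 0))"
      using e l unfolding env_def limits_def by simp_all
    moreover have "mem2 ?M"
    proof -
      have "mem1 ?M" using m less unfolding mem2_def by (intro mem1_upd) auto
      then show ?thesis using m less unfolding mem2_def by (simp add: code_simps)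
    qed
    moreover have "?M (addr 12 q) = seat_group t q" if q: "q < 3 * t" "seat_group t q < Suc i" for q
    proof -
      have qN: "q < N" using q t_bounds unfolding N_def by linarith
      show ?thesis
      proof (cases "seat_group t q = i")
        case True
        then have "q = 2 * i \<or> q = Suc (2 * i) \<or> q = 2 * t + i"
          using i unfolding seat_group_def by (auto split: if_splits)
        then show ?thesis using True less by (auto simp: code_simps)
      next
        case False
        then have g: "seat_group t q < i" using q by simp
        then have "q \<noteq> 2 * i" "q \<noteq> Suc (2 * i)" "q \<noteq> 2 * t + i"
          using i unfolding seat_group_def by (auto split: if_splits)
        moreover have "M (addr 12 q) = seat_group t q" using I g q(1) unfolding I5_def i_def by simp
        ultimately show ?thesis using less qN by (simp add: code_simps)
      qed
    qed
    ultimately show "I5 (exec table_body (R, M)) \<and> n - fst (exec table_body (R, M)) 5 < n - fst (R, M) 5"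
      using i t_bounds unfolding ex I5_def by (auto simp: i_def[symmetric])
  qed
  then show ?thesis using assms(2) by simp
qed

end

section \<open>The elimination order, with parents and greedy weights found on the way\<close>

section \<open>Removing the leaves of a tree one by one\<close>

context tree_input
begin

definition remaining :: "nat list \<Rightarrow> nat set" where "remaining ord = {..<n} - set ord"
definition remaining_edges :: "nat list \<Rightarrow> nat set set" where
  "remaining_edges ord = {e \<in> E. e \<inter> set ord = {}}"

definition part_sum :: "nat set \<Rightarrow> (nat \<Rightarrow> nat) \<Rightarrow> (nat \<Rightarrow> nat) \<Rightarrow> nat \<Rightarrow> nat" where
  "part_sum A P f x = (\<Sum>c\<in>{c \<in> A. P c = x}. f c)"

lemma part_sum_insert:
  assumes "finite A" "c \<notin> A"
  shows "part_sum (insert c A) (P(c := p)) (f(c := y)) x = part_sum A P f x + (if x = p then y else 0)"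
proof -
  have "{a \<in> insert c A. (P(c := p)) a = x} = {a \<in> A. P a = x} \<union> (if x = p then {c} else {})"
    using assms(2) by auto
  moreover have "sum (f(c := y)) {a \<in> A. P a = x} = sum f {a \<in> A. P a = x}"
    using assms(2) by (intro sum.cong) auto
  ultimately show ?thesis unfolding part_sum_def using assms by (auto simp: sum.union_disjoint)
qed

text \<open>\<open>ord\<close> lists the removed vertices, \<open>P\<close> their parents and
  \<open>s\<close> the weights of their parent edges at the parents. \<open>D\<close> is the degree
  in the remaining tree, and 0 once a vertex is removed, so that it is not taken for a leaf again.
  \<open>I\<close> is the index sum of the remaining edges; at a removed vertex it stays at the
  index of its parent edge. \<open>X\<close> and \<open>Y\<close> are the two sums over the
  half-edges settled so far.\<close>

definition elim_state :: "nat list \<Rightarrow> (nat \<Rightarrow> nat) \<Rightarrow> (nat \<Rightarrow> nat) \<Rightarrow> (nat \<Rightarrow> nat) \<Rightarrow> (nat \<Rightarrow> nat) \<Rightarrow>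
    (nat \<Rightarrow> nat) \<Rightarrow> (nat \<Rightarrow> nat) \<Rightarrow> bool" where
  "elim_state ord P s D I X Y \<longleftrightarrow>
     distinct ord \<and> set ord \<subseteq> {..<n} \<and> is_tree (remaining ord) (remaining_edges ord) \<and>
     E = remaining_edges ord \<union> (\<lambda>c. {c, P c}) ` set ord \<and>
     (\<forall>v<n. D v = (if v \<in> set ord then 0 else degree (remaining_edges ord) v)) \<and>
     (\<forall>v\<in>remaining ord. I v = (\<Sum>j\<in>{j. j < n - 1 \<and> edge_of (es ! j) \<in> remaining_edges ord \<and> v \<in> edge_of (es ! j)}. j)) \<and>
     (\<forall>j<length ord. P (ord ! j) < n \<and> P (ord ! j) \<notin> set (take (Suc j) ord)) \<and>
     (\<forall>c\<in>set ord. I c < n - 1 \<and> edge_of (es ! I c) = {c, P c}) \<and>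
     (\<forall>v<n. X v = part_sum (set ord) P (\<lambda>c. max 1 (s c)) v + (if v \<in> set ord then max 1 (2 - s v) else 0)) \<and>
     (\<forall>v<n. Y v = part_sum (set ord) P s v + (if v \<in> set ord then 2 - s v else 0)) \<and>
     (\<forall>c\<in>set ord. s c = greedy_weight t (part_sum (set ord) P (\<lambda>c. max 1 (s c)) c) (part_sum (set ord) P s c))"

lemma elim_start:
  assumes "\<And>v. v < n \<Longrightarrow> D v = degree E v" "\<And>v. v < n \<Longrightarrow> I v = ids_upto (n - 1) v"
    "\<And>v. v < n \<Longrightarrow> X v = 0" "\<And>v. v < n \<Longrightarrow> Y v = 0"
  shows "elim_state [] P s D I X Y"
proof -
  have "{j. j < n - 1 \<and> edge_of (es ! j) \<in> E \<and> v \<in> edge_of (es ! j)} = {j. j < n - 1 \<and> v \<in> edge_of (es ! j)}" for v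
    using es_edge(1) by auto
  then show ?thesis
    using assms tree unfolding elim_state_def remaining_def remaining_edges_def ids_upto_def
    by (simp add: part_sum_def)
qed

text \<open>At a leaf the index sum has a single term and is the index of its only edge; the
  neighbour is the sum of both endpoints minus the leaf.\<close>

lemma elim_leaf:
  assumes st: "elim_state ord P s D I X Y" and c: "c < n" "D c = 1"
  obtains p where "p < n" "p \<noteq> c" "c \<notin> set ord" "p \<notin> set ord" "{c, p} \<in> remaining_edges ord"
    "{e \<in> remaining_edges ord. c \<in> e} = {{c, p}}" "I c < n - 1" "edge_of (es ! I c) = {c, p}"
    "fst (es ! I c) + snd (es ! I c) - c = p"
proof -
  let ?E = "remaining_edges ord"
  have D: "D c = (if c \<in> set ord then 0 else degree ?E c)" and tr: "is_tree (remaining ord) ?E"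
    using st c unfolding elim_state_def by auto
  then have co: "c \<notin> set ord" and d1: "degree ?E c = 1" using c(2) by (auto split: if_splits)
  obtain p where p: "p \<in> remaining ord" "p \<noteq> c" "{e \<in> ?E. c \<in> e} = {{c, p}}" using leaf_edge[OF tr d1] by metis
  have cp: "{c, p} \<in> ?E" using p(3) by auto
  obtain j where j: "j < n - 1" "{c, p} = edge_of (es ! j)" using E_index[of "{c, p}"] cp unfolding remaining_edges_def by auto
  have "{j. j < n - 1 \<and> edge_of (es ! j) \<in> ?E \<and> c \<in> edge_of (es ! j)} = {j}"
  proof
    show "{j. j < n - 1 \<and> edge_of (es ! j) \<in> ?E \<and> c \<in> edge_of (es ! j)} \<subseteq> {j}"
    proof
      fix i assume "i \<in> {j. j < n - 1 \<and> edge_of (es ! j) \<in> ?E \<and> c \<in> edge_of (es ! j)}"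
      then have i: "i < n - 1" "edge_of (es ! i) \<in> {e \<in> ?E. c \<in> e}" by auto
      then have "edge_of (es ! i) = edge_of (es ! j)" unfolding p(3) using j(2) by simp
      then show "i \<in> {j}" using es_inj[OF i(1) j(1)] by simp
    qed
    have "c \<in> edge_of (es ! j)" unfolding j(2)[symmetric] by simp
    then show "{j} \<subseteq> {j. j < n - 1 \<and> edge_of (es ! j) \<in> ?E \<and> c \<in> edge_of (es ! j)}"
      using j(1) cp unfolding j(2) by simp
  qed
  moreover have "c \<in> remaining ord" using c co unfolding remaining_def by simp
  ultimately have Ic: "I c = j" using st unfolding elim_state_def by simp
  have "{fst (es ! j), snd (es ! j)} = {c, p}" using j(2) unfolding edge_of_def by simp
  then have "fst (es ! j) + snd (es ! j) - c = p" by (auto simp: doubleton_eq_iff)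
  moreover have "p < n" "p \<notin> set ord" using p(1) unfolding remaining_def by auto
  ultimately show ?thesis using that p(2,3) cp co j(1) j(2)[symmetric] unfolding Ic by blast
qed

text \<open>All children of \<open>c\<close> were removed earlier, and no vertex removed later gets
  \<open>c\<close> as its parent. So \<open>X c\<close> and \<open>Y c\<close> are the final child
  sums of \<open>c\<close> at the moment when the weight of its parent edge is chosen.\<close>

lemma elim_step:
  assumes st: "elim_state ord P s D I X Y" and c: "c < n" and co: "c \<notin> set ord" and p: "p < n" "p \<noteq> c" "p \<notin> set ord"
    and cp: "{e \<in> remaining_edges ord. c \<in> e} = {{c, p}}" and Ic: "I c < n - 1" "edge_of (es ! I c) = {c, p}"
    and w: "w = greedy_weight t (X c) (Y c)"
  shows "elim_state (ord @ [c]) (P(c := p)) (s(c := w)) (D(c := 0, p := D p - 1)) (I(p := I p - I c))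
    (X(c := X c + max 1 (2 - w), p := X p + max 1 w)) (Y(c := Y c + (2 - w), p := Y p + w))"
proof -
  let ?E = "remaining_edges ord" and ?E' = "remaining_edges (ord @ [c])"
  from st have dist: "distinct ord" and sub: "set ord \<subseteq> {..<n}" and tr: "is_tree (remaining ord) ?E"
    and EE: "E = ?E \<union> (\<lambda>c. {c, P c}) ` set ord"
    and D: "\<forall>v<n. D v = (if v \<in> set ord then 0 else degree ?E v)"
    and I: "\<forall>v\<in>remaining ord. I v = (\<Sum>j\<in>{j. j < n - 1 \<and> edge_of (es ! j) \<in> ?E \<and> v \<in> edge_of (es ! j)}. j)"
    and P: "\<forall>j<length ord. P (ord ! j) < n \<and> P (ord ! j) \<notin> set (take (Suc j) ord)"
    and IP: "\<forall>c\<in>set ord. I c < n - 1 \<and> edge_of (es ! I c) = {c, P c}"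
    and X: "\<forall>v<n. X v = part_sum (set ord) P (\<lambda>c. max 1 (s c)) v + (if v \<in> set ord then max 1 (2 - s v) else 0)"
    and Y: "\<forall>v<n. Y v = part_sum (set ord) P s v + (if v \<in> set ord then 2 - s v else 0)"
    and g: "\<forall>c\<in>set ord. s c = greedy_weight t (part_sum (set ord) P (\<lambda>c. max 1 (s c)) c) (part_sum (set ord) P s c)"
    unfolding elim_state_def by - (elim conjE, assumption)+
  have E': "?E' = ?E - {e \<in> ?E. c \<in> e}" unfolding remaining_edges_def by auto
  have R': "remaining (ord @ [c]) = remaining ord - {c}" unfolding remaining_def by auto
  have cpE: "{c, p} \<in> ?E" using cp by auto
  have d1: "degree ?E c = 1" unfolding degree_def cp by simp
  have finE: "finite ?E" using tree_finite_edges[OF tr] .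
  have degp: "{e \<in> ?E. p \<in> e} = insert {c, p} {e \<in> ?E'. p \<in> e}" "{c, p} \<notin> {e \<in> ?E'. p \<in> e}"
    unfolding E' cp using cpE by auto
  have deg': "{e \<in> ?E'. v \<in> e} = {e \<in> ?E. v \<in> e}" if "v \<noteq> c" "v \<noteq> p" for v
    unfolding E' cp using that by auto
  let ?J = "\<lambda>F v. {j. j < n - 1 \<and> edge_of (es ! j) \<in> F \<and> v \<in> edge_of (es ! j)}"
  have finJ: "finite (?J F v)" for F v by (rule finite_subset[of _ "{..<n}"]) auto
  have uniq: "j = I c" if "j < n - 1" "edge_of (es ! j) = {c, p}" for j
    using es_inj[OF that(1) Ic(1)] that(2) Ic(2) by simp
  have E'_iff: "e \<in> ?E' \<longleftrightarrow> e \<in> ?E \<and> e \<noteq> {c, p}" for e unfolding E' cp by blast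
  have Jp: "?J ?E p = insert (I c) (?J ?E' p)"
  proof (rule set_eqI)
    fix j
    show "j \<in> ?J ?E p \<longleftrightarrow> j \<in> insert (I c) (?J ?E' p)"
    proof (cases "j = I c")
      case True
      then show ?thesis using Ic cpE by simp
    next
      case False
      then show ?thesis using uniq[of j] unfolding insert_iff mem_Collect_eq E'_iff by blast
    qed
  qed
  have Jp2: "I c \<notin> ?J ?E' p" using Ic(2) unfolding mem_Collect_eq E'_iff by blast
  have J': "?J ?E' v = ?J ?E v" if "v \<noteq> c" "v \<noteq> p" for v
    unfolding E'_iff using that by auto
  have cr: "c \<in> remaining ord" "p \<in> remaining ord" using c co p unfolding remaining_def by auto
  have mx: "(\<lambda>d. max 1 ((s(c := w)) d)) = (\<lambda>d. max 1 (s d))(c := max 1 w)" by auto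
  have ps: "part_sum (set (ord @ [c])) (P(c := p)) (s(c := w)) v = part_sum (set ord) P s v + (if v = p then w else 0)"
    "part_sum (set (ord @ [c])) (P(c := p)) (\<lambda>d. max 1 ((s(c := w)) d)) v =
      part_sum (set ord) P (\<lambda>d. max 1 (s d)) v + (if v = p then max 1 w else 0)" for v
    unfolding mx using part_sum_insert[of "set ord" c] co by simp_all
  have Xc: "X c = part_sum (set ord) P (\<lambda>d. max 1 (s d)) c" "Y c = part_sum (set ord) P s c"
    using X Y c co by auto
  show ?thesis
    unfolding elim_state_def
  proof (intro conjI allI impI ballI)
    show "distinct (ord @ [c])" using dist co by simp
    show "set (ord @ [c]) \<subseteq> {..<n}" using sub c by simp
    show "is_tree (remaining (ord @ [c])) ?E'" unfolding R' E' by (rule tree_remove_leaf[OF tr d1])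
    have "(\<lambda>d. {d, (P(c := p)) d}) ` set (ord @ [c]) = insert {c, p} ((\<lambda>d. {d, P d}) ` set ord)"
      using co by auto
    then show "E = ?E' \<union> (\<lambda>d. {d, (P(c := p)) d}) ` set (ord @ [c])" using EE cpE unfolding E' cp by auto
  next
    fix v assume v: "v < n"
    show "(D(c := 0, p := D p - 1)) v = (if v \<in> set (ord @ [c]) then 0 else degree ?E' v)"
    proof (cases "v = p")
      case True
      have "degree ?E p = Suc (degree ?E' p)"
        unfolding degree_def degp(1) using degp(2) finE unfolding E' by (intro card_insert_disjoint) auto
      then show ?thesis using True D p by simp
    next
      case False
      then show ?thesis using D v deg'[of v] unfolding degree_def by auto
    qed
  next
    fix v assume v: "v \<in> remaining (ord @ [c])"
    then have vc: "v \<noteq> c" "v \<in> remaining ord" unfolding R' by auto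
    show "(I(p := I p - I c)) v = (\<Sum>j\<in>?J ?E' v. j)"
    proof (cases "v = p")
      case True
      have "I p = I c + (\<Sum>j\<in>?J ?E' p. j)"       proof -
        have "I p = (\<Sum>j\<in>?J ?E p. j)" using I cr(2) by (rule bspec)
        also have "\<dots> = I c + (\<Sum>j\<in>?J ?E' p. j)" unfolding Jp by (rule sum.insert[OF finJ Jp2])
        finally show ?thesis .
      qed
      then show ?thesis using True by simp
    next
      case False
      have "I v = (\<Sum>j\<in>?J ?E v. j)" using I vc(2) by (rule bspec)
      then have "(I(p := I p - I c)) v = (\<Sum>j\<in>?J ?E v. j)" using False by simp
      then show ?thesis unfolding J'[OF vc(1) False] .
    qed
  next
    fix j assume j: "j < length (ord @ [c])"
    have "(P(c := p)) ((ord @ [c]) ! j) < n \<and> (P(c := p)) ((ord @ [c]) ! j) \<notin> set (take (Suc j) (ord @ [c]))"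
    proof (cases "j < length ord")
      case True
      then have "ord ! j \<noteq> c" using co nth_mem by metis
      then show ?thesis using P True by (simp add: nth_append)
    next
      case False
      then have "j = length ord" using j by simp
      then show ?thesis using p by (simp add: nth_append)
    qed
    then show "(P(c := p)) ((ord @ [c]) ! j) < n" "(P(c := p)) ((ord @ [c]) ! j) \<notin> set (take (Suc j) (ord @ [c]))"
      by auto
  next
    fix d assume d: "d \<in> set (ord @ [c])"
    then have dp: "d \<noteq> p" using p by auto
    show "(I(p := I p - I c)) d < n - 1" "edge_of (es ! (I(p := I p - I c)) d) = {d, (P(c := p)) d}"
      using d dp IP Ic by auto
    have "(s(c := w)) d = greedy_weight t (part_sum (set ord) P (\<lambda>d. max 1 (s d)) d) (part_sum (set ord) P s d)"
      using d g w Xc by auto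
    then show "(s(c := w)) d = greedy_weight t (part_sum (set (ord @ [c])) (P(c := p)) (\<lambda>d. max 1 ((s(c := w)) d)) d)
        (part_sum (set (ord @ [c])) (P(c := p)) (s(c := w)) d)"
      unfolding ps using dp by simp
  next
    fix v assume v: "v < n"
    show "(X(c := X c + max 1 (2 - w), p := X p + max 1 w)) v =
        part_sum (set (ord @ [c])) (P(c := p)) (\<lambda>d. max 1 ((s(c := w)) d)) v +
        (if v \<in> set (ord @ [c]) then max 1 (2 - (s(c := w)) v) else 0)"
      unfolding ps using X v c co p by auto
    show "(Y(c := Y c + (2 - w), p := Y p + w)) v = part_sum (set (ord @ [c])) (P(c := p)) (s(c := w)) v +
        (if v \<in> set (ord @ [c]) then 2 - (s(c := w)) v else 0)"
      unfolding ps using Y v c co p by auto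
  qed
qed

lemma elim_bounds:
  assumes st: "elim_state ord P s D I X Y" and v: "v < n"
  shows "D v \<le> n" "I v \<le> n * n" "X v \<le> 2 * n + 2" "Y v \<le> 2 * n + 2" "c \<in> set ord \<Longrightarrow> s c \<le> 2" "length ord \<le> n"
proof -
  have sub: "set ord \<subseteq> {..<n}" "distinct ord" using st unfolding elim_state_def by auto
  then show "length ord \<le> n" using card_mono[OF _ sub(1)] distinct_card[OF sub(2)] by simp
  have s2: "s c \<le> 2" if "c \<in> set ord" for c
    using st that unfolding elim_state_def greedy_weight_def by (auto split: if_splits)
  then show "c \<in> set ord \<Longrightarrow> s c \<le> 2" by simp
  have "degree (remaining_edges ord) v \<le> degree E v"
    unfolding degree_def remaining_edges_def using tree_finite_edges[OF tree] by (intro card_mono) auto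
  then show "D v \<le> n" using st v degree_less[of v] unfolding elim_state_def by auto
  have "{j. j < n - 1 \<and> edge_of (es ! j) \<in> remaining_edges ord \<and> v \<in> edge_of (es ! j)} \<subseteq>
      {j. j < n - 1 \<and> v \<in> edge_of (es ! j)}" by auto
  then have "(\<Sum>j\<in>{j. j < n - 1 \<and> edge_of (es ! j) \<in> remaining_edges ord \<and> v \<in> edge_of (es ! j)}. j) \<le> ids_upto (n - 1) v"
    unfolding ids_upto_def by (intro sum_mono2) auto
  also have "\<dots> \<le> n * n" by (rule upto_bound) simp
  finally have rem: "(\<Sum>j\<in>{j. j < n - 1 \<and> edge_of (es ! j) \<in> remaining_edges ord \<and> v \<in> edge_of (es ! j)}. j) \<le> n * n" .
  show "I v \<le> n * n"
  proof (cases "v \<in> set ord")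
    case True
    then have "I v < n - 1" using st unfolding elim_state_def by auto
    moreover have "n \<le> n * n" using n_pos by simp
    ultimately show ?thesis by linarith
  next
    case False
    then have "v \<in> remaining ord" using v unfolding remaining_def by simp
    then show ?thesis using st rem unfolding elim_state_def by simp
  qed
  have card: "card {c \<in> set ord. P c = v} \<le> n"
    using card_mono[of "{..<n}" "{c \<in> set ord. P c = v}"] sub(1) by auto
  have le: "part_sum (set ord) P f v \<le> 2 * n" if "\<And>c. c \<in> set ord \<Longrightarrow> f c \<le> 2" for f
  proof -
    have "part_sum (set ord) P f v \<le> card {c \<in> set ord. P c = v} * 2"
      unfolding part_sum_def using sum_mono[of "{c \<in> set ord. P c = v}" f "\<lambda>_. 2"] that by simp
    then show ?thesis using card by linarith
  qed
  have "max 1 (s c) \<le> 2" if "c \<in> set ord" for c using s2[OF that] by simp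
  from le[of "\<lambda>c. max 1 (s c)", OF this] show "X v \<le> 2 * n + 2"
    using st v unfolding elim_state_def by auto
  show "Y v \<le> 2 * n + 2" using le[of s, OF s2] st v unfolding elim_state_def by auto
qed

text \<open>A tree without leaves is a single vertex, which becomes the root. The position in
  \<open>ord\<close>, with the root at the end, serves as \<open>pos\<close>, because parents are
  removed after their children or not at all.\<close>

lemma elim_end:
  assumes st: "elim_state ord P s D I X Y" and noleaf: "\<And>v. v < n \<Longrightarrow> D v \<noteq> 1"
    and r: "r < n" "r \<notin> set ord"
  shows "set ord = {..<n} - {r}" and "\<exists>pos. rooted {..<n} E r P pos"
    and "greedy {..<n} r P s t"
    and "\<And>v. v < n \<Longrightarrow> X v = (\<Sum>h\<in>half_edges {..<n} r P v. max 1 (half_weight s h))"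
    and "\<And>v. v < n \<Longrightarrow> Y v = (\<Sum>h\<in>half_edges {..<n} r P v. half_weight s h)"
proof -
  have tr: "is_tree (remaining ord) (remaining_edges ord)" using st unfolding elim_state_def by blast
  have rr: "r \<in> remaining ord" using r unfolding remaining_def by simp
  have "remaining ord = {r}"
  proof (rule ccontr)
    assume "remaining ord \<noteq> {r}"
    from tree_has_leaf[OF tr this rr] obtain v where "v \<in> remaining ord" "degree (remaining_edges ord) v = 1" by blast
    then show False using st noleaf[of v] unfolding elim_state_def remaining_def by auto
  qed
  moreover have "set ord \<subseteq> {..<n}" using st unfolding elim_state_def by blast
  ultimately show so: "set ord = {..<n} - {r}" unfolding remaining_def by blast
  have Em: "remaining_edges ord = {}"
    using tree_edge[OF tr] unfolding \<open>remaining ord = {r}\<close> by blast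
  define pos where "pos v = length (takeWhile (\<lambda>x. x \<noteq> v) ord)" for v
  have dist: "distinct ord" using st unfolding elim_state_def by blast
  have posn: "pos (ord ! j) = j" if "j < length ord" for j
  proof -
    have "takeWhile (\<lambda>x. x \<noteq> ord ! j) ord = take j ord"
      using that dist by (intro takeWhile_eq_take_P_nth) (auto simp: nth_eq_iff_index_eq)
    then show ?thesis unfolding pos_def using that by simp
  qed
  have posr: "pos v = length ord" if "v \<notin> set ord" for v
  proof -
    have "takeWhile (\<lambda>x. x \<noteq> v) ord = ord" unfolding takeWhile_eq_all_conv using that by auto
    then show ?thesis unfolding pos_def by (rule arg_cong)
  qed
  have up: "P c < n \<and> pos c < pos (P c)" if c: "c \<in> {..<n} - {r}" for c
  proof -
    obtain j where j: "j < length ord" "c = ord ! j" using c so by (metis in_set_conv_nth)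
    then have Pn: "P c < n" "P c \<notin> set (take (Suc j) ord)" using st unfolding elim_state_def by auto
    show ?thesis
    proof (cases "P c \<in> set ord")
      case True
      then obtain i where i: "i < length ord" "P c = ord ! i" by (metis in_set_conv_nth)
      have "\<not> i \<le> j"
      proof
        assume "i \<le> j"
        then have "ord ! i \<in> set (take (Suc j) ord)" using i j by (auto simp: in_set_conv_nth intro!: exI[of _ i])
        then show False using Pn i by simp
      qed
      then show ?thesis using Pn posn[OF j(1)] posn[OF i(1)] i j by simp
    next
      case False
      then show ?thesis using Pn posn[OF j(1)] posr[OF False] j by simp
    qed
  qed
  have "rooted {..<n} E r P pos"
    unfolding rooted_def
  proof (intro conjI ballI)
    show "E = (\<lambda>c. {c, P c}) ` ({..<n} - {r})" using st so Em unfolding elim_state_def by simp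
  qed (use r up in auto)
  then show "\<exists>pos. rooted {..<n} E r P pos" by blast
  have cs: "child_sum {..<n} r P f v = part_sum (set ord) P f v" for f v
    unfolding child_sum_def part_sum_def so ..
  from st have g: "\<forall>c\<in>set ord. s c = greedy_weight t (part_sum (set ord) P (\<lambda>c. max 1 (s c)) c) (part_sum (set ord) P s c)"
    and Xs: "\<forall>v<n. X v = part_sum (set ord) P (\<lambda>c. max 1 (s c)) v + (if v \<in> set ord then max 1 (2 - s v) else 0)"
    and Ys: "\<forall>v<n. Y v = part_sum (set ord) P s v + (if v \<in> set ord then 2 - s v else 0)"
    unfolding elim_state_def by - (elim conjE, assumption)+
  show "greedy {..<n} r P s t"
    using g unfolding greedy_def cs so[symmetric] .
  fix v assume v: "v < n"
  have iff: "v \<in> set ord \<longleftrightarrow> v \<noteq> r" using so v by auto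
  show "X v = (\<Sum>h\<in>half_edges {..<n} r P v. max 1 (half_weight s h))"
    using Xs v iff half_sums(2)[where V = "{..<n}" and v = v and r = r and par = P and s = s] unfolding cs by simp
  show "Y v = (\<Sum>h\<in>half_edges {..<n} r P v. half_weight s h)"
    using Ys v iff half_sums(1)[where V = "{..<n}" and v = v and r = r and par = P and s = s] unfolding cs by simp
qed

end

section \<open>Code and invariants of the leaf removal\<close>

definition clamp :: "nat \<Rightarrow> com" where
  "clamp r = IfLess r 1 (Const r 1) (Add r r 0)"

text \<open>The weights 2, 1 and 0 are tried in this order, so the least one whose test succeeds
  stays. \<open>Add 11 11 0\<close> does nothing.\<close>

definition choose_code :: com where
  "choose_code = block [Add 7 12 1, Add 8 13 1, Const 11 2,
     IfLess 7 43 (IfLess 8 44 (Const 11 1) (Add 11 11 0)) (Add 11 11 0), Add 7 7 1, Add 8 8 1,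
     IfLess 7 43 (IfLess 8 44 (Const 11 0) (Add 11 11 0)) (Add 11 11 0)]"

text \<open>Register 14 holds the leaf, 45 the index of its edge, 10 its neighbour; 11 and 9 the
  weights of the edge at the neighbour and at the leaf, 46 and 47 their maxima with 1. Register 15
  counts the removed vertices. The neighbour is examined next, and is recorded in register 20 as a
  vertex that is still present.\<close>

definition remove_code :: com where
  "remove_code = block [Store 6 0,
     Add 6 52 14, Load 45 6, Add 6 45 45, Add 6 6 1, Load 7 6, Add 6 6 1, Load 8 6, Add 10 7 8, Sub 10 10 14,
     Add 6 66 10, Load 9 6, Sub 9 9 1, Store 6 9, Add 6 52 10, Load 9 6, Sub 9 9 45, Store 6 9,
     Add 6 53 14, Load 12 6, Add 6 54 14, Load 13 6, choose_code, Sub 9 2 11,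
     Add 46 11 0, clamp 46, Add 47 9 0, clamp 47,
     Add 6 53 14, Add 12 12 47, Store 6 12, Add 6 54 14, Add 13 13 9, Store 6 13,
     Add 6 53 10, Load 12 6, Add 12 12 46, Store 6 12, Add 6 54 10, Load 13 6, Add 13 13 11, Store 6 13,
     Add 6 55 14, Store 6 11, Add 6 56 14, Store 6 10, Add 6 57 15, Store 6 14,
     Add 15 15 1, Add 14 10 0, Add 20 10 0]"

definition advance_code :: com where
  "advance_code = block [Add 5 5 1, Add 14 5 0]"

definition elim_body :: com where
  "elim_body = block [Add 6 66 14, Load 9 6, IfLess 0 9 (IfLess 9 2 remove_code advance_code) advance_code]"

context tree_input
begin

lemma clamp_exec: "R 0 = 0 \<Longrightarrow> R 1 = 1 \<Longrightarrow> exec (clamp r) (R, M) = (R(r := max 1 (R r)), M)"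
  unfolding clamp_def by (auto simp: fun_eq_iff max_def)

lemma choose_exec:
  assumes "R 0 = 0" "R 1 = 1" "R 43 = 3 * t + 1" "R 44 = 2 * t + 1"
  shows "exec choose_code (R, M) =
    (R(7 := R 12 + 2, 8 := R 13 + 2, 11 := greedy_weight t (R 12) (R 13), 63 := 0), M)"
  using assms unfolding choose_code_def by (auto simp: fun_eq_iff greedy_weight_def)

definition rd :: "(nat \<Rightarrow> nat) \<Rightarrow> nat \<Rightarrow> nat \<Rightarrow> nat" where
  "rd M k v = (if v < n then M (addr k v) else 0)"

lemma rd_upd: "i < n \<Longrightarrow> rd (M(addr l i := x)) k = (if k = l then (rd M k)(i := x) else rd M k)"
  unfolding rd_def by (auto simp: fun_eq_iff code_simps)

definition static :: "(nat \<Rightarrow> nat) \<Rightarrow> bool" where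
  "static M \<longleftrightarrow> (\<forall>a<N. M a = M0 a) \<and> (\<forall>k v. k \<in> {8, 9, 10, 11, 13} \<longrightarrow> v < n \<longrightarrow> M (addr k v) = 0) \<and>
     (\<forall>w<n. M (addr 14 w) = w * t) \<and> (\<forall>q<3 * t. M (addr 12 q) = seat_group t q)"

lemma static_upd: "i < n \<Longrightarrow> k \<in> {15, 2, 3, 4, 5, 6, 7} \<Longrightarrow> static M \<Longrightarrow> static (M(addr k i := x))"
proof -
  assume *: "i < n" "k \<in> {15, 2, 3, 4, 5, 6, 7}" "static M"
  have "q < N" if "q < 3 * t" for q using that t_bounds unfolding N_def by linarith
  then show ?thesis using * unfolding static_def by (auto simp: code_simps addr_big)
qed

definition elim_mem :: "nat list \<Rightarrow> (nat \<Rightarrow> nat) \<Rightarrow> bool" where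
  "elim_mem ord M \<longleftrightarrow> static M \<and> (\<forall>j<length ord. M (addr 7 j) = ord ! j) \<and>
     elim_state ord (rd M 6) (rd M 5) (rd M 15) (rd M 2) (rd M 3) (rd M 4)"

text \<open>Only the neighbour of a removed leaf can become a new leaf. If it is examined at once,
  every remaining leaf is either this vertex (register 14) or lies at or beyond the scanning
  position (register 5). Register 20 always holds a surviving vertex, in the end the root; its
  initial value 0 is right for a tree with one vertex, too.\<close>

definition cursor :: "nat list \<Rightarrow> (nat \<Rightarrow> nat) \<Rightarrow> (nat \<Rightarrow> nat) \<Rightarrow> bool" where
  "cursor ord R M \<longleftrightarrow> R 5 \<le> n \<and> (R 5 < n \<longrightarrow> R 14 < n) \<and> (R 14 = R 5 \<or> R 5 \<in> set ord) \<and>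
     (\<forall>w<n. rd M 15 w = 1 \<longrightarrow> R 5 \<le> w \<or> w = R 14) \<and> R 20 < n \<and> R 20 \<notin> set ord \<and> R 15 = length ord"

definition I6 :: "ram_state \<Rightarrow> bool" where
  "I6 s \<longleftrightarrow> bounded B s \<and> (case s of (R, M) \<Rightarrow> env R \<and> limits R \<and> (\<exists>ord. elim_mem ord M \<and> cursor ord R M))"

lemma elim_step_mem:
  assumes e: "elim_mem ord M" and c: "c < n" "rd M 15 c = 1"
  obtains p i where "p < n" "p \<noteq> c" "c \<notin> set ord" "p \<notin> set ord" "M (addr 2 c) = i" "i < n - 1"
    "M (Suc (i + i)) + M (Suc (Suc (i + i))) - c = p" "length ord < n"
    "\<forall>w. w = greedy_weight t (M (addr 3 c)) (M (addr 4 c)) \<longrightarrow>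
      elim_mem (ord @ [c]) (M(addr 15 c := 0, addr 15 p := M (addr 15 p) - 1, addr 2 p := M (addr 2 p) - i,
        addr 3 c := M (addr 3 c) + max 1 (2 - w), addr 4 c := M (addr 4 c) + (2 - w),
        addr 3 p := M (addr 3 p) + max 1 w, addr 4 p := M (addr 4 p) + w,
        addr 5 c := w, addr 6 c := p, addr 7 (length ord) := c))"
proof -
  have st: "elim_state ord (rd M 6) (rd M 5) (rd M 15) (rd M 2) (rd M 3) (rd M 4)" and sta: "static M"
    and o: "\<forall>j<length ord. M (addr 7 j) = ord ! j" using e unfolding elim_mem_def by auto
  obtain p where p: "p < n" "p \<noteq> c" "c \<notin> set ord" "p \<notin> set ord" "{c, p} \<in> remaining_edges ord"
    "{e \<in> remaining_edges ord. c \<in> e} = {{c, p}}"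
    "rd M 2 c < n - 1" "edge_of (es ! rd M 2 c) = {c, p}"
    "fst (es ! rd M 2 c) + snd (es ! rd M 2 c) - c = p"
    by (rule elim_leaf[OF st c])
  define i where "i = M (addr 2 c)"
  have i: "rd M 2 c = i" using c unfolding rd_def i_def by simp
  have low: "Suc (i + i) < N" "Suc (Suc (i + i)) < N" using p(7) unfolding i N_def by auto
  have uv: "M (Suc (i + i)) + M (Suc (Suc (i + i))) - c = p"
    using p(9) sta low M0_edge[of i] p(7) unfolding i static_def by simp
  have sub: "set ord \<subseteq> {..<n}" "distinct ord" using st unfolding elim_state_def by auto
  have len: "length ord < n"
  proof -
    have "card (set ord) < card {..<n}" using sub p(3) c(1) by (intro psubset_card_mono) auto
    then show ?thesis using distinct_card[OF sub(2)] by simp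
  qed
  show ?thesis
  proof (rule that[of p i])
    show "M (addr 2 c) = i" by (simp add: i_def)
  next
    show "\<forall>w. w = greedy_weight t (M (addr 3 c)) (M (addr 4 c)) \<longrightarrow>
      elim_mem (ord @ [c]) (M(addr 15 c := 0, addr 15 p := M (addr 15 p) - 1, addr 2 p := M (addr 2 p) - i,
        addr 3 c := M (addr 3 c) + max 1 (2 - w), addr 4 c := M (addr 4 c) + (2 - w),
        addr 3 p := M (addr 3 p) + max 1 w, addr 4 p := M (addr 4 p) + w,
        addr 5 c := w, addr 6 c := p, addr 7 (length ord) := c))"
    proof (intro allI impI)
    fix w assume w: "w = greedy_weight t (M (addr 3 c)) (M (addr 4 c))"
    let ?M = "M(addr 15 c := 0, addr 15 p := M (addr 15 p) - 1, addr 2 p := M (addr 2 p) - i,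
        addr 3 c := M (addr 3 c) + max 1 (2 - w), addr 4 c := M (addr 4 c) + (2 - w),
        addr 3 p := M (addr 3 p) + max 1 w, addr 4 p := M (addr 4 p) + w,
        addr 5 c := w, addr 6 c := p, addr 7 (length ord) := c)"
    have rdM: "rd M k c = M (addr k c)" "rd M k p = M (addr k p)" for k using c p(1) unfolding rd_def by auto
    have w': "w = greedy_weight t (rd M 3 c) (rd M 4 c)" using w unfolding rdM .
    have rds: "rd ?M 6 = (rd M 6)(c := p)" "rd ?M 5 = (rd M 5)(c := w)" "rd ?M 15 = (rd M 15)(c := 0, p := rd M 15 p - 1)"
      "rd ?M 2 = (rd M 2)(p := rd M 2 p - rd M 2 c)" "rd ?M 3 = (rd M 3)(c := rd M 3 c + max 1 (2 - w), p := rd M 3 p + max 1 w)"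
      "rd ?M 4 = (rd M 4)(c := rd M 4 c + (2 - w), p := rd M 4 p + w)"
      using c p len by (simp_all add: rd_upd rdM i_def)
    have "elim_state (ord @ [c]) (rd ?M 6) (rd ?M 5) (rd ?M 15) (rd ?M 2) (rd ?M 3) (rd ?M 4)"
      unfolding rds by (rule elim_step[OF st c(1) p(3,1,2,4,6-8) w'])
    moreover have "static ?M" by (intro static_upd sta c p len) auto
    moreover have "?M (addr 7 j) = (ord @ [c]) ! j" if "j < length (ord @ [c])" for j
    proof (cases "j = length ord")
      case False
      then have "j < length ord" using that by simp
      then show ?thesis using False o len c p by (simp add: code_simps nth_append)
    qed simp
    ultimately show "elim_mem (ord @ [c]) ?M" unfolding elim_mem_def by blast
    qed
  qed (use p uv len i in auto)
qed

lemma elim_mem_bounds: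
  assumes "elim_mem ord M" "v < n"
  shows "M (addr 15 v) \<le> n" "M (addr 2 v) \<le> n * n" "M (addr 3 v) \<le> 2 * n + 2" "M (addr 4 v) \<le> 2 * n + 2"
  using elim_bounds(1-4)[of ord "rd M 6" "rd M 5" "rd M 15" "rd M 2" "rd M 3" "rd M 4" v] assms
  unfolding elim_mem_def rd_def by auto

lemma remove_exec:
  assumes e: "env R" and l: "limits R" and c: "R 14 = c" "c < n" and R6: "R 6 = addr 15 c"
    and p: "p < n" "p \<noteq> c" "M (addr 2 c) = i" "i < n - 1" "M (Suc (i + i)) + M (Suc (Suc (i + i))) - c = p"
    and m: "R 15 = m" "m < n" and w: "w = greedy_weight t (M (addr 3 c)) (M (addr 4 c))"
  shows "exec remove_code (R, M) = (R(45 := i, 10 := p, 7 := M (addr 3 c) + 2, 8 := M (addr 4 c) + 2, 11 := w,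
      9 := 2 - w, 46 := max 1 w, 47 := max 1 (2 - w), 12 := M (addr 3 p) + max 1 w, 13 := M (addr 4 p) + w,
      6 := addr 7 m, 15 := Suc m, 14 := p, 20 := p, 63 := 0),
    M(addr 15 c := 0, addr 15 p := M (addr 15 p) - 1, addr 2 p := M (addr 2 p) - i,
        addr 3 c := M (addr 3 c) + max 1 (2 - w), addr 4 c := M (addr 4 c) + (2 - w),
        addr 3 p := M (addr 3 p) + max 1 w, addr 4 p := M (addr 4 p) + w,
        addr 5 c := w, addr 6 c := p, addr 7 m := c))"
proof -
  have low: "Suc (i + i) < N" "Suc (Suc (i + i)) < N" using p(4) unfolding N_def by auto
  have pM: "M (Suc (i + i)) + M (Suc (Suc (i + i))) - c = p" using p(5) .
  show ?thesis
    using e l c p(1-4) m R6 w low unfolding remove_code_def env_def limits_def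
    by (simp add: code_simps clamp_exec choose_exec pM)
qed

text \<open>Each pass either removes a vertex or advances the scanning position, so
  \<open>2 * n\<close> passes suffice.\<close>

lemma elim_phase:
  assumes "I6 s" "fst s 5 = 0" "fst s 15 = 0"
  shows "runs W (WhileLess 5 3 elim_body) s (Suc (len elim_body) * (2 * n) + 1)
    (\<lambda>s. I6 s \<and> fst s 5 = n)"
proof -
  have "runs W (WhileLess 5 3 elim_body) s (Suc (len elim_body) * ((n - fst s 5) + (n - fst s 15)) + 1)
    (\<lambda>s. I6 s \<and> fst s 5 = n)"
  proof (rule runs_loop[where I = I6 and B = B and \<mu> = "\<lambda>s. (n - fst s 5) + (n - fst s 15)"])
    show "straight elim_body" "consts_le B elim_body"
      using B3 by (simp_all add: elim_body_def remove_code_def advance_code_def choose_code_def clamp_def)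
    show "2 ^ len elim_body * B \<le> W"
      by (rule W_len) (simp add: elim_body_def remove_code_def advance_code_def choose_code_def clamp_def)
    show "bounded B s" if "I6 s" for s using that unfolding I6_def by simp
    show "I6 s" by fact
  next
    fix R M assume "I6 (R, M)" "\<not> R 5 < R 3"
    then show "I6 (R, M) \<and> fst (R, M) 5 = n" unfolding I6_def env_def cursor_def by auto
  next
    fix R M assume I: "I6 (R, M)" and lt: "R 5 < R 3"
    have b: "bounded B (R, M)" and e: "env R" and l: "limits R" using I unfolding I6_def by auto
    obtain ord where m: "elim_mem ord M" and cu: "cursor ord R M" using I unfolding I6_def by auto
    define c where "c = R 14"
    have R5: "R 5 < n" using lt e unfolding env_def by simp
    have c: "c < n" using cu R5 unfolding cursor_def c_def by simp
    define d where "d = M (addr 15 c)"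
    define R' where "R' = R(6 := addr 15 c, 9 := d)"
    have e': "env R'" and l': "limits R'" using e l unfolding R'_def env_def limits_def by simp_all
    have dB: "d \<le> B" unfolding d_def using boundedD(2)[OF b] .
    have b': "bounded B (R', M)"
      unfolding R'_def using dB by (intro bounded_reg b addr_le_B less_N c) auto
    have ex: "exec elim_body (R, M) = (let (S, M') = exec (if d = 1 then remove_code else advance_code) (R', M) in (S(63 := 0), M'))"
    proof -
      have "exec elim_body (R, M) = exec (Const 63 0) (exec (if d = 1 then remove_code else advance_code) (R', M))"
      proof -
        have r: "R' 0 = 0" "R' 2 = 2" "R' 9 = d" using e unfolding R'_def env_def by simp_all
        have "exec elim_body (R, M) =
            exec (block [IfLess 0 9 (IfLess 9 2 remove_code advance_code) advance_code]) (R', M)"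
          using e unfolding elim_body_def env_def R'_def d_def c_def by (simp add: code_simps)
        then show ?thesis using r by auto
      qed
      then show ?thesis by (simp add: case_prod_beta) (metis exec.simps(1) prod.collapse)
    qed
    show "I6 (exec elim_body (R, M)) \<and>
      n - fst (exec elim_body (R, M)) 5 + (n - fst (exec elim_body (R, M)) 15) < n - fst (R, M) 5 + (n - fst (R, M) 15)"
    proof (cases "d = 1")
      case True
      then have c15: "rd M 15 c = 1" using c unfolding rd_def d_def by simp
      obtain p i where p: "p < n" "p \<noteq> c" "c \<notin> set ord" "p \<notin> set ord"
        "M (addr 2 c) = i" "i < n - 1" "M (Suc (i + i)) + M (Suc (Suc (i + i))) - c = p" "length ord < n"
        and step: "\<forall>w. w = greedy_weight t (M (addr 3 c)) (M (addr 4 c)) \<longrightarrow>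
          elim_mem (ord @ [c]) (M(addr 15 c := 0, addr 15 p := M (addr 15 p) - 1, addr 2 p := M (addr 2 p) - i,
            addr 3 c := M (addr 3 c) + max 1 (2 - w), addr 4 c := M (addr 4 c) + (2 - w),
            addr 3 p := M (addr 3 p) + max 1 w, addr 4 p := M (addr 4 p) + w,
            addr 5 c := w, addr 6 c := p, addr 7 (length ord) := c))"
        by (rule elim_step_mem[OF m c c15])
      define w where "w = greedy_weight t (M (addr 3 c)) (M (addr 4 c))"
      have w2: "w \<le> 2" unfolding w_def greedy_weight_def by simp
      let ?M = "M(addr 15 c := 0, addr 15 p := M (addr 15 p) - 1, addr 2 p := M (addr 2 p) - i,
            addr 3 c := M (addr 3 c) + max 1 (2 - w), addr 4 c := M (addr 4 c) + (2 - w),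
            addr 3 p := M (addr 3 p) + max 1 w, addr 4 p := M (addr 4 p) + w,
            addr 5 c := w, addr 6 c := p, addr 7 (length ord) := c)"
      let ?R = "R'(45 := i, 10 := p, 7 := M (addr 3 c) + 2, 8 := M (addr 4 c) + 2, 11 := w,
        9 := 2 - w, 46 := max 1 w, 47 := max 1 (2 - w), 12 := M (addr 3 p) + max 1 w, 13 := M (addr 4 p) + w,
        6 := addr 7 (length ord), 15 := Suc (length ord), 14 := p, 20 := p, 63 := 0)"
      have R15: "R' 15 = length ord" "R' 14 = c" "R' 6 = addr 15 c"
        using cu unfolding R'_def cursor_def c_def by auto
      have ex': "exec elim_body (R, M) = (?R, ?M)"
        unfolding ex using remove_exec[OF e' l' R15(2) c R15(3) p(1,2,5-7) R15(1) p(8) w_def] True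
        by (simp add: fun_eq_iff)
      note bd = elim_mem_bounds[OF m c] elim_mem_bounds[OF m p(1)]
      have nB: "2 * n + 4 \<le> B" "n \<le> B" "n * n \<le> B"
        using n_le_B n_pos by (linarith, linarith, simp add: B_def)
      have bnd: "bounded B (?R, ?M)"
        using bd w2 nB p c by (intro bounded_reg bounded_mem b' addr_le_B less_N) (auto intro: order_trans)
      have em: "elim_mem (ord @ [c]) ?M" by (rule step[rule_format, OF w_def])
      have "env ?R" "limits ?R" using e' l' unfolding env_def limits_def by simp_all
      moreover have "cursor (ord @ [c]) ?R ?M"
      proof -
        have r15: "rd ?M 15 = (rd M 15)(c := 0, p := M (addr 15 p) - 1)"
          using c p by (simp add: rd_upd)
        have "R 5 \<le> x \<or> x = p" if x: "x < n" "rd ?M 15 x = 1" for x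
        proof (cases "x = p \<or> x = c")
          case True
          then show ?thesis using x(2) p(2) unfolding r15 by auto
        next
          case False
          then have "rd M 15 x = 1" using x(2) unfolding r15 by simp
          then show ?thesis using cu x(1) False unfolding cursor_def c_def by auto
        qed
        moreover have "R 5 = c \<or> R 5 \<in> set ord" using cu unfolding cursor_def c_def by auto
        ultimately show ?thesis using cu R5 p unfolding cursor_def R'_def by simp
      qed
      ultimately have "I6 (?R, ?M)" using bnd em unfolding I6_def by blast
      moreover have "R 15 = length ord" using cu unfolding cursor_def by simp
      ultimately show ?thesis unfolding ex' using p(8) by (simp add: R'_def)
    next
      case False
      have ex': "exec elim_body (R, M) = (R'(5 := Suc (R 5), 14 := Suc (R 5), 63 := 0), M)"
        unfolding ex using False e unfolding advance_code_def R'_def env_def by (simp add: fun_eq_iff)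
      have bnd: "bounded B (R'(5 := Suc (R 5), 14 := Suc (R 5), 63 := 0), M)"
        using R5 n_le_B by (intro bounded_reg b') auto
      have "env (R'(5 := Suc (R 5), 14 := Suc (R 5), 63 := 0))" "limits (R'(5 := Suc (R 5), 14 := Suc (R 5), 63 := 0))"
        using e' l' unfolding env_def limits_def by simp_all
      moreover have "cursor ord (R'(5 := Suc (R 5), 14 := Suc (R 5), 63 := 0)) M"
      proof -
        have st: "elim_state ord (rd M 6) (rd M 5) (rd M 15) (rd M 2) (rd M 3) (rd M 4)"
          using m unfolding elim_mem_def by blast
        then have z: "\<forall>v<n. rd M 15 v = (if v \<in> set ord then 0 else degree (remaining_edges ord) v)"
          unfolding elim_state_def by - (elim conjE, assumption)
        have "Suc (R 5) \<le> x" if x: "x < n" "rd M 15 x = 1" for x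
        proof -
          have "x \<noteq> c" using x False unfolding rd_def d_def by auto
          moreover have "x \<notin> set ord" using z x by (metis zero_neq_one)
          ultimately show ?thesis using cu x unfolding cursor_def c_def by (metis Suc_leI le_neq_implies_less)
        qed
        then show ?thesis using cu R5 unfolding cursor_def R'_def by simp
      qed
      ultimately have "I6 (R'(5 := Suc (R 5), 14 := Suc (R 5), 63 := 0), M)"
        using bnd m unfolding I6_def by blast
      then show ?thesis unfolding ex' using R5 by (simp add: R'_def)
    qed
  qed
  then show ?thesis using assms(2,3) by (simp add: mult_2)
qed

end

section \<open>Testing feasibility, then distributing half-edges to groups and labels to
  edges\<close>

section \<open>Seating the edges\<close>

definition check_body :: com where
  "check_body = block [Add 6 53 5, Load 12 6, IfLess 18 12 (Const 36 1) (Add 36 36 0),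
     Add 6 54 5, Load 13 6, IfLess 19 13 (Const 36 1) (Add 36 36 0), Add 5 5 1]"

text \<open>The value \<open>t\<close> stored in array 11 at the root is a sentinel. All groups are
  below \<open>t\<close>, so the edges at the root never inherit a label and need no separate
  test.\<close>

definition answer_code :: com where
  "answer_code = block [Add 9 16 36, Store 0 9, Add 6 61 20, Store 6 16, Add 5 4 0]"

text \<open>\<open>v\<close> and \<open>w\<close> name the registers that hold a vertex and a
  weight. The arrays 8, 9 and 10 count the half-edges of weight 0, 1 and 2 seated at each vertex;
  the count before the increment is the rank that enters \<open>seat\<close>.\<close>

definition seat_code :: "nat \<Rightarrow> nat \<Rightarrow> com" where
  "seat_code v w = block [IfLess w 1 (Add 6 58 v) (IfLess w 2 (Add 6 59 v) (Add 6 60 v)),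
     Load 40 6, Add 41 40 1, Store 6 41, Add 6 54 v, Load 12 6,
     IfLess w 1 (Add 40 12 40) (IfLess w 2 (Seq (Sub 40 12 40) (Sub 40 40 1)) (Add 40 40 40)),
     Add 6 62 40, Load 37 6]"

text \<open>Vertices are visited in the reverse of the order of removal, so the group and the label
  of the parent are already known. Two strict comparisons test whether the group of the edge at the
  parent equals that of the parent's own parent edge.\<close>

definition assign_body :: com where
  "assign_body = block [Sub 5 5 1, Add 6 57 5, Load 14 6, Add 6 56 14, Load 10 6, Add 6 55 14, Load 11 6, Sub 9 2 11,
     seat_code 14 9, Add 6 61 14, Store 6 37, seat_code 10 11, Add 6 61 10, Load 12 6, Add 6 64 10, Load 13 6,
     Add 13 13 37, IfLess 12 37 (Add 13 13 0) (IfLess 37 12 (Add 13 13 0) (Seq (Add 6 65 10) (Load 13 6))),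
     Add 6 65 14, Store 6 13, Add 6 52 14, Load 7 6, Add 7 7 1, Store 7 13]"

locale eliminated = tree_input n es E for n es E +
  fixes ord :: "nat list" and r :: nat and P s I :: "nat \<Rightarrow> nat"
  assumes r: "r < n" and ord: "set ord = {..<n} - {r}" "distinct ord"
    and rooted_P: "\<exists>pos. rooted {..<n} E r P pos"
    and greedy_s: "greedy {..<n} r P s t"
    and later: "\<And>j. j < length ord \<Longrightarrow> P (ord ! j) \<notin> set (take (Suc j) ord)"
    and edge_I: "\<And>c. c \<in> set ord \<Longrightarrow> I c < n - 1 \<and> edge_of (es ! I c) = {c, P c}"
begin

abbreviation halves :: "nat \<Rightarrow> (nat \<times> bool) set" where "halves \<equiv> half_edges {..<n} r P"

lemma length_ord: "length ord = n - 1"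
  using distinct_card[OF ord(2)] ord(1) r by simp

lemma P_less: "c \<in> set ord \<Longrightarrow> P c < n" and P_neq: "c \<in> set ord \<Longrightarrow> P c \<noteq> c"
  using rooted_P ord(1) unfolding rooted_def by (auto, metis DiffI lessThan_iff less_irrefl singletonD)

lemma I_inj: "c \<in> set ord \<Longrightarrow> d \<in> set ord \<Longrightarrow> I c = I d \<Longrightarrow> c = d"
proof -
  assume *: "c \<in> set ord" "d \<in> set ord" "I c = I d"
  obtain pos where tr: "rooted {..<n} E r P pos" using rooted_P by blast
  have "{c, P c} = {d, P d}" using edge_I[OF *(1)] edge_I[OF *(2)] *(3) by simp
  then show "c = d" using inj_onD[OF rooted_edge_inj[OF tr], of c d] * ord(1) by auto
qed

definition count :: "nat set \<Rightarrow> nat \<Rightarrow> nat \<Rightarrow> nat" where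
  "count A v w = card {h \<in> halves v. fst h \<in> A \<and> half_weight s h = w}"

lemma finite_halves: "finite (halves v)" by (rule finite_half_edges) simp

lemma count_empty: "count {} v w = 0" unfolding count_def by simp

lemma count_insert:
  assumes "c \<in> set ord" "c \<notin> A"
  shows "count (insert c A) v w = count A v w + (if v = c \<and> w = 2 - s c then 1 else 0) + (if v = P c \<and> w = s c then 1 else 0)"
proof -
  let ?T = "if v = c \<and> w = 2 - s c then {(c, True)} else {}" and ?F = "if v = P c \<and> w = s c then {(c, False)} else {}"
  have "{h \<in> halves v. fst h \<in> insert c A \<and> half_weight s h = w} =
      {h \<in> halves v. fst h \<in> A \<and> half_weight s h = w} \<union> (?T \<union> ?F)"
  proof (rule set_eqI)
    fix h :: "nat \<times> bool"
    obtain d b where h: "h = (d, b)" by (cases h)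
    have "c < n" "c \<noteq> r" using assms(1) ord(1) by auto
    then show "h \<in> {h \<in> halves v. fst h \<in> insert c A \<and> half_weight s h = w} \<longleftrightarrow>
        h \<in> {h \<in> halves v. fst h \<in> A \<and> half_weight s h = w} \<union> (?T \<union> ?F)"
      unfolding h half_edge_iff half_weight_def by (cases b; cases "d = c"; simp; metis)
  qed
  moreover have "card ({h \<in> halves v. fst h \<in> A \<and> half_weight s h = w} \<union> (?T \<union> ?F)) =
      card {h \<in> halves v. fst h \<in> A \<and> half_weight s h = w} + card (?T \<union> ?F)"
    using assms(2) finite_halves by (intro card_Un_disjoint) auto
  moreover have "card (?T \<union> ?F) = (if v = c \<and> w = 2 - s c then 1 else 0) + (if v = P c \<and> w = s c then 1 else 0)"
    using P_neq[OF assms(1)] by auto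
  ultimately show ?thesis unfolding count_def by simp
qed

definition idx :: "nat \<Rightarrow> nat" where "idx v = length (takeWhile (\<lambda>x. x \<noteq> v) ord)"

lemma idx_nth: "j < length ord \<Longrightarrow> idx (ord ! j) = j"
proof -
  assume j: "j < length ord"
  have "takeWhile (\<lambda>x. x \<noteq> ord ! j) ord = take j ord"
    using j ord(2) by (intro takeWhile_eq_take_P_nth) (auto simp: nth_eq_iff_index_eq)
  then show ?thesis unfolding idx_def using j by simp
qed

text \<open>The edges are seated in the reverse of the order of removal.\<close>

definition rank :: "nat \<times> bool \<Rightarrow> nat" where
  "rank h = count {d \<in> set ord. idx (fst h) < idx d} (if snd h then fst h else P (fst h)) (half_weight s h)"

lemma rank_nth:
  assumes "j < length ord"
  shows "rank (ord ! j, b) = count (set (drop (Suc j) ord)) (if b then ord ! j else P (ord ! j))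
    (half_weight s (ord ! j, b))"
proof -
  have "{d \<in> set ord. j < idx d} = set (drop (Suc j) ord)"
  proof (rule set_eqI)
    fix d
    have "d \<in> set (drop (Suc j) ord) \<longleftrightarrow> (\<exists>i. j < i \<and> i < length ord \<and> ord ! i = d)"
    proof
      assume "d \<in> set (drop (Suc j) ord)"
      then obtain k where k: "k < length ord - Suc j" "drop (Suc j) ord ! k = d" by (auto simp: in_set_conv_nth)
      then show "\<exists>i. j < i \<and> i < length ord \<and> ord ! i = d"
        by (intro exI[of _ "Suc j + k"]) auto
    next
      assume "\<exists>i. j < i \<and> i < length ord \<and> ord ! i = d"
      then obtain i where "j < i" "i < length ord" "ord ! i = d" by blast
      then show "d \<in> set (drop (Suc j) ord)"
        unfolding in_set_conv_nth by (intro exI[of _ "i - Suc j"]) auto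
    qed
    then show "d \<in> {d \<in> set ord. j < idx d} \<longleftrightarrow> d \<in> set (drop (Suc j) ord)"
      using idx_nth by (auto simp: in_set_conv_nth)
  qed
  then show ?thesis unfolding rank_def using idx_nth[OF assms] by simp
qed

text \<open>The rank counts the half-edges of equal weight at the same vertex that are seated
  earlier. For two of them these sets are strictly nested, so the ranks differ.\<close>

lemma ranking_rank: "ranking (halves v) (half_weight s) rank"
proof -
  have rk: "rank h = card {g \<in> halves v. idx (fst h) < idx (fst g) \<and> half_weight s g = half_weight s h}" if h: "h \<in> halves v" for h
  proof -
    have "v = (if snd h then fst h else P (fst h))" using h unfolding half_edge_iff by simp
    moreover have "{g \<in> halves v. fst g \<in> {d \<in> set ord. idx (fst h) < idx d} \<and> half_weight s g = half_weight s h} =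
        {g \<in> halves v. idx (fst h) < idx (fst g) \<and> half_weight s g = half_weight s h}"
      using ord(1) unfolding half_edge_iff by auto
    ultimately show ?thesis unfolding rank_def count_def by simp
  qed
  have less: "rank h < rank g" if g: "g \<in> halves v" and h: "h \<in> halves v" and "half_weight s g = half_weight s h"
    and "idx (fst g) < idx (fst h)" for g h
    unfolding rk[OF g] rk[OF h] using that finite_halves[of v] by (intro psubset_card_mono) auto
  show ?thesis unfolding ranking_def
  proof (intro conjI ballI impI)
    fix h assume h: "h \<in> halves v"
    show "rank h < card {g \<in> halves v. half_weight s g = half_weight s h}"
      unfolding rk[OF h] using h finite_halves[of v] by (intro psubset_card_mono) auto
  next
    fix g h assume g: "g \<in> halves v" and h: "h \<in> halves v" and w: "half_weight s g = half_weight s h" "rank g = rank h"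
    then have "idx (fst g) = idx (fst h)" using less[OF g h] less[OF h g] by (metis less_irrefl nat_neq_iff)
    moreover have "fst g \<in> set ord" "fst h \<in> set ord" using g h ord(1) unfolding half_edge_iff by auto
    ultimately have fst: "fst g = fst h" using idx_nth by (metis in_set_conv_nth)
    moreover have "snd g = snd h"
      using g h fst P_neq[OF \<open>fst h \<in> set ord\<close>] unfolding half_edge_iff by (auto split: if_splits)
    ultimately show "g = h" by (rule prod_eqI)
  qed
qed

definition gc :: "nat \<Rightarrow> nat" where "gc c = seat_group t (half_seat {..<n} r P s rank (c, False))"
definition gp :: "nat \<Rightarrow> nat" where "gp c = seat_group t (half_seat {..<n} r P s rank (c, True))"
definition lab :: "nat \<Rightarrow> nat" where
  "lab = (SOME L. \<forall>c\<in>{..<n} - {r}. L c = (if P c \<noteq> r \<and> gc c = gp (P c) then L (P c) else P c * t + gc c))"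

lemma lab_eq: "c \<in> set ord \<Longrightarrow> lab c = (if P c \<noteq> r \<and> gc c = gp (P c) then lab (P c) else P c * t + gc c)"
proof -
  obtain pos where tr: "rooted {..<n} E r P pos" using rooted_P by blast
  from someI_ex[OF follow_parents[OF tr, of "\<lambda>c. P c \<noteq> r \<and> gc c = gp (P c)" "\<lambda>c. P c * t + gc c"]]
  show "c \<in> set ord \<Longrightarrow> lab c = (if P c \<noteq> r \<and> gc c = gp (P c) then lab (P c) else P c * t + gc c)"
    unfolding lab_def[symmetric] ord(1) by auto
qed

lemma s_le: "c \<in> set ord \<Longrightarrow> s c \<le> 2"
  using greedy_s ord(1) unfolding greedy_def greedy_weight_def by auto

lemma balanced_iff:
  "balanced {..<n} r P s t \<longleftrightarrow> (\<forall>v<n. (\<Sum>h\<in>halves v. half_weight s h) \<le> 2 * t \<and>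
     (\<Sum>h\<in>halves v. max 1 (half_weight s h)) \<le> 3 * t)"
  unfolding balanced_def using s_le ord(1) by auto

lemma grouped: "balanced {..<n} r P s t \<Longrightarrow> \<exists>pos. grouped_tree {..<n} E r P pos s gc gp lab t"
proof -
  assume bal: "balanced {..<n} r P s t"
  obtain pos where tr: "rooted {..<n} E r P pos" using rooted_P by blast
  have "grouped_tree {..<n} E r P pos s gc gp lab t"
    using lab_eq unfolding ord(1) by (intro seats_grouped_tree[OF tr bal ranking_rank gc_def gp_def])
  then show ?thesis by blast
qed

lemma seat_bounds:
  assumes bal: "balanced {..<n} r P s t" and c: "c \<in> set ord"
  shows "half_seat {..<n} r P s rank (c, b) < 3 * t" "gc c < t" "gp c < t"
proof -
  obtain pos where tr: "rooted {..<n} E r P pos" using rooted_P by blast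
  note * = half_seat_less[OF tr bal ranking_rank c[unfolded ord(1)]]
  show "half_seat {..<n} r P s rank (c, b) < 3 * t" "gc c < t" "gp c < t" using * unfolding gc_def gp_def by auto
qed

lemma rank_less: "c \<in> set ord \<Longrightarrow> rank (c, b) < n"
proof -
  assume c: "c \<in> set ord"
  define v where "v = (if b then c else P c)"
  obtain pos where tr: "rooted {..<n} E r P pos" using rooted_P by blast
  have "(c, b) \<in> halves v" using c ord(1) unfolding half_edge_iff v_def by simp
  then have "rank (c, b) < card {g \<in> halves v. half_weight s g = half_weight s (c, b)}"
    using ranking_rank[of v] unfolding ranking_def by blast
  also have "\<dots> \<le> card (halves v)" using finite_halves by (intro card_mono) auto
  also have "\<dots> = degree E v" using degree_half_edges[OF tr] by simp
  finally show ?thesis using degree_less[of v] by simp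
qed

definition shape :: "(nat \<Rightarrow> nat) \<Rightarrow> bool" where
  "shape M \<longleftrightarrow> (\<forall>j<length ord. M (addr 7 j) = ord ! j) \<and>
     (\<forall>c\<in>set ord. M (addr 2 c) = I c \<and> M (addr 5 c) = s c \<and> M (addr 6 c) = P c) \<and>
     (\<forall>v<n. M (addr 3 v) = (\<Sum>h\<in>halves v. max 1 (half_weight s h)) \<and> M (addr 4 v) = (\<Sum>h\<in>halves v. half_weight s h)) \<and>
     (\<forall>w<n. M (addr 14 w) = w * t) \<and> (\<forall>q<3 * t. M (addr 12 q) = seat_group t q)"

lemma shape_upd:
  assumes "shape M"
  shows "k \<in> {8, 9, 10, 11, 13} \<Longrightarrow> i < n \<Longrightarrow> shape (M(addr k i := x))" and "a < N \<Longrightarrow> shape (M(a := x))"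
proof -
  have q: "q < N" if "q < 3 * t" for q using that t_bounds unfolding N_def by linarith
  have o: "c < n" if "c \<in> set ord" for c using that ord(1) by auto
  have j: "j < n" if "j < length ord" for j using that length_ord by simp
  show "k \<in> {8, 9, 10, 11, 13} \<Longrightarrow> i < n \<Longrightarrow> shape (M(addr k i := x))"
    using assms q o j unfolding shape_def by (auto simp: code_simps)
  show "a < N \<Longrightarrow> shape (M(a := x))"
    using assms unfolding shape_def by (auto simp: code_simps)
qed

definition I7 :: "(nat \<Rightarrow> nat) \<Rightarrow> ram_state \<Rightarrow> bool" where
  "I7 M' st \<longleftrightarrow> bounded B st \<and> (case st of (R, M) \<Rightarrow> env R \<and> limits R \<and> M = M' \<and> R 20 = r \<and> R 5 \<le> n \<and>
     R 36 = (if \<forall>v<R 5. M (addr 4 v) \<le> 2 * t \<and> M (addr 3 v) \<le> 3 * t then 0 else 1))"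

definition bad :: nat where "bad = (if balanced {..<n} r P s t then 0 else 1)"

lemma check_phase:
  assumes "shape M'" "I7 M' st" "fst st 5 = 0"
  shows "runs W (WhileLess 5 3 check_body) st (Suc (len check_body) * n + 1)
    (\<lambda>st. bounded B st \<and> env (fst st) \<and> limits (fst st) \<and> snd st = M' \<and> fst st 20 = r \<and> fst st 36 = bad)"
proof -
  have "runs W (WhileLess 5 3 check_body) st (Suc (len check_body) * (n - fst st 5) + 1)
    (\<lambda>st. bounded B st \<and> env (fst st) \<and> limits (fst st) \<and> snd st = M' \<and> fst st 20 = r \<and> fst st 36 = bad)"
  proof (rule runs_loop[where I = "I7 M'" and B = B and \<mu> = "\<lambda>st. n - fst st 5"])
    show "straight check_body" "consts_le B check_body" using B3 by (simp_all add: check_body_def)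
    show "2 ^ len check_body * B \<le> W" by (rule W_len) (simp add: check_body_def)
    show "bounded B st" if "I7 M' st" for st using that unfolding I7_def by simp
    show "I7 M' st" by fact
  next
    fix R M assume I: "I7 M' (R, M)" and "\<not> R 5 < R 3"
    then have "R 5 = n" unfolding I7_def env_def by auto
    then show "bounded B (R, M) \<and> env (fst (R, M)) \<and> limits (fst (R, M)) \<and> snd (R, M) = M' \<and>
        fst (R, M) 20 = r \<and> fst (R, M) 36 = bad"
      using I assms(1) unfolding I7_def bad_def balanced_iff shape_def by auto
  next
    fix R M assume I: "I7 M' (R, M)" and lt: "R 5 < R 3"
    define i where "i = R 5"
    have b: "bounded B (R, M)" and e: "env R" and l: "limits R" using I unfolding I7_def by auto
    have i: "i < n" using lt e unfolding env_def i_def by simp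
    define f where "f = (if 3 * t < M (addr 3 i) \<or> 2 * t < M (addr 4 i) then 1 else R 36)"
    have ex: "exec check_body (R, M) =
        (R(12 := M (addr 3 i), 13 := M (addr 4 i), 6 := addr 4 i, 36 := f, 5 := Suc i, 63 := 0), M)"
      using e l i unfolding check_body_def env_def limits_def f_def
      by (auto simp: i_def[symmetric] code_simps fun_eq_iff)
    have f1: "f \<le> 1" using I unfolding f_def I7_def by auto
    have "bounded B (exec check_body (R, M))"
      unfolding ex using f1 B3 i n_le_B boundedD(2)[OF b] by (intro bounded_reg b addr_le_B less_N) auto
    moreover have "env (R(12 := M (addr 3 i), 13 := M (addr 4 i), 6 := addr 4 i, 36 := f, 5 := Suc i, 63 := 0))"
      "limits (R(12 := M (addr 3 i), 13 := M (addr 4 i), 6 := addr 4 i, 36 := f, 5 := Suc i, 63 := 0))"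
      using e l unfolding env_def limits_def by simp_all
    moreover have "f = (if \<forall>v<Suc i. M (addr 4 v) \<le> 2 * t \<and> M (addr 3 v) \<le> 3 * t then 0 else 1)"
      using I unfolding f_def I7_def i_def[symmetric] by (auto simp: less_Suc_eq i_def[symmetric] not_less)
    ultimately show "I7 M' (exec check_body (R, M)) \<and> n - fst (exec check_body (R, M)) 5 < n - fst (R, M) 5"
      using I i unfolding ex I7_def by (simp add: i_def[symmetric])
  qed
  then show ?thesis using assms(3) by simp
qed

lemma seat_exec:
  assumes e: "env R" and v: "R v = x" "x < n" "v = 10 \<or> v = 14" and w: "R w = y" "y \<le> 2" "w = 9 \<or> w = 11"
    and k: "M (addr (8 + y) x) = k" and Y: "M (addr 4 x) = Y" and q: "seat Y y k = q" "q < N"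
  shows "exec (seat_code v w) (R, M) =
    (R(41 := Suc k, 12 := Y, 40 := q, 6 := addr 12 q, 37 := M (addr 12 q), 63 := 0), M(addr (8 + y) x := Suc k))"
proof -
  have r: "R 0 = 0" "R 1 = 1" "R 2 = 2" "R 58 = addr 8 0" "R 59 = addr 9 0" "R 60 = addr 10 0" "R 54 = addr 4 0" "R 62 = addr 12 0"
    using e unfolding env_def by auto
  have vw: "v \<noteq> 6" "v \<noteq> 40" "v \<noteq> 41" "v \<noteq> 12" "w \<noteq> 6" "w \<noteq> 40" "w \<noteq> 41" "w \<noteq> 12"
    using v(3) w(3) by auto
  consider "y = 0" | "y = 1" | "y = 2" using w(2) by linarith
  then show ?thesis
  proof cases
    case 1
    show ?thesis
      using k q(2) unfolding seat_code_def q(1)[symmetric] 1 seat_def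
      by (simp add: r r(2)[simplified] vw v w(1) 1 code_simps Y fun_eq_iff)
  next
    case 2
    show ?thesis
      using k q(2) unfolding seat_code_def q(1)[symmetric] 2 seat_def
      by (simp add: r r(2)[simplified] vw v w(1) 2 code_simps Y fun_eq_iff)
  next
    case 3
    show ?thesis
      using k q(2) unfolding seat_code_def q(1)[symmetric] 3 seat_def
      by (simp add: r r(2)[simplified] vw v w(1) 3 code_simps Y fun_eq_iff mult_2)
  qed
qed

end

context eliminated
begin

lemma assign_exec:
  assumes e: "env R" and sh: "shape M" and j: "R 5 = Suc j" "Suc j \<le> n - 1"
    and c: "c = ord ! j" and p: "p = P c" and w: "w = s c"
    and k1: "M (addr (8 + (2 - w)) c) = k1" and k2: "M (addr (8 + w) p) = k2"
    and q1: "seat (\<Sum>h\<in>halves c. half_weight s h) (2 - w) k1 = q1" "q1 < 3 * t"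
    and q2: "seat (\<Sum>h\<in>halves p. half_weight s h) w k2 = q2" "q2 < 3 * t"
  defines "l \<equiv> (if M (addr 11 p) = seat_group t q2 then M (addr 13 p) else p * t + seat_group t q2)"
  shows "exec assign_body (R, M) = (R(5 := j, 14 := c, 10 := p, 11 := w, 9 := 2 - w, 41 := Suc k2, 40 := q2,
      37 := seat_group t q2, 12 := M (addr 11 p), 13 := l, 6 := addr 2 c, 7 := Suc (I c), 63 := 0),
    M(addr (8 + (2 - w)) c := Suc k1, addr 11 c := seat_group t q1, addr (8 + w) p := Suc k2, addr 13 c := l, Suc (I c) := l))"
proof -
  have jl: "j < length ord" using j(2) length_ord by simp
  have co: "c \<in> set ord" using jl unfolding c by simp
  have cn: "c < n" "p < n" "c \<noteq> p" using co ord(1) P_less[OF co] P_neq[OF co] unfolding p by auto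
  have jn: "j < n" using j(2) by simp
  have w2: "w \<le> 2" using s_le[OF co] unfolding w .
  have qN: "q1 < N" "q2 < N" using q1 q2 t_bounds unfolding N_def by auto
  have rd: "M (addr 7 j) = c" "M (addr 6 c) = p" "M (addr 5 c) = w" "M (addr 2 c) = I c"
    "M (addr 4 c) = (\<Sum>h\<in>halves c. half_weight s h)" "M (addr 4 p) = (\<Sum>h\<in>halves p. half_weight s h)"
    "M (addr 14 p) = p * t" "M (addr 12 q1) = seat_group t q1" "M (addr 12 q2) = seat_group t q2"
    using sh jl co cn q1(2) q2(2) unfolding shape_def c[symmetric] p[symmetric] w[symmetric] by (auto simp: c p w)
  define R1 where "R1 = R(5 := j, 14 := c, 10 := p, 6 := addr 5 c, 11 := w, 9 := 2 - w)"
  define M1 where "M1 = M(addr (8 + (2 - w)) c := Suc k1)"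
  define R2 where "R2 = R1(41 := Suc k1, 12 := M (addr 4 c), 40 := q1, 6 := addr 11 c, 37 := seat_group t q1, 63 := 0)"
  define M2 where "M2 = M1(addr 11 c := seat_group t q1)"
  define M3 where "M3 = M2(addr (8 + w) p := Suc k2)"
  define R3 where "R3 = R2(41 := Suc k2, 12 := M (addr 4 p), 40 := q2, 6 := addr 12 q2, 37 := seat_group t q2, 63 := 0)"
  have e1: "env R1" and e2: "env R2" and e3: "env R3"
    using e unfolding R1_def R2_def R3_def env_def by simp_all
  have ne: "8 + w \<noteq> 11" "8 + w \<noteq> 12" "8 + w \<noteq> 4" "8 + (2 - w) \<noteq> 11" "8 + (2 - w) \<noteq> 4" "8 + (2 - w) \<noteq> 12"
    "8 + w \<noteq> 13" "8 + w \<noteq> 14" "8 + (2 - w) \<noteq> 13" "8 + (2 - w) \<noteq> 14" "8 + w \<noteq> 2" "8 + (2 - w) \<noteq> 2"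
    using w2 by auto
  have v1: "exec (seat_code 14 9) (R1, M) =
      (R1(41 := Suc k1, 12 := M (addr 4 c), 40 := q1, 6 := addr 12 q1, 37 := seat_group t q1, 63 := 0), M1)"
    unfolding M1_def rd(8)[symmetric]
    using seat_exec[where R = R1 and v = 14 and x = c and w = 9 and y = "2 - w" and M = M and k = k1 and Y = "M (addr 4 c)" and q = q1]
      e1 cn(1) k1 qN(1) q1(1) rd(5) by (simp add: R1_def)
  have v2: "exec (seat_code 10 11) (R2, M2) = (R3, M3)"
  proof -
    have "M2 (addr 12 q2) = seat_group t q2" "M2 (addr 4 p) = M (addr 4 p)" "M2 (addr (8 + w) p) = k2"
      using rd(9) ne cn qN k2 unfolding M2_def M1_def by (simp_all add: addr_inj less_N)
    moreover have "exec (seat_code 10 11) (R2, M2) = (R2(41 := Suc k2, 12 := M (addr 4 p), 40 := q2, 6 := addr 12 q2,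
        37 := M2 (addr 12 q2), 63 := 0), M2(addr (8 + w) p := Suc k2))"
      using seat_exec[where R = R2 and v = 10 and x = p and w = 11 and y = w and M = M2 and k = k2 and Y = "M (addr 4 p)" and q = q2]
        e2 cn(2) w2 calculation(2,3) qN(2) q2(1) rd(6) by (simp add: R2_def R1_def)
    ultimately show ?thesis unfolding R3_def M3_def by simp
  qed
  have a: "exec assign_body (R, M) = exec (block [Add 6 61 10, Load 12 6, Add 6 64 10, Load 13 6,
     Add 13 13 37, IfLess 12 37 (Add 13 13 0) (IfLess 37 12 (Add 13 13 0) (Seq (Add 6 65 10) (Load 13 6))),
     Add 6 65 14, Store 6 13, Add 6 52 14, Load 7 6, Add 7 7 1, Store 7 13]) (R3, M3)"
  proof -
    have "exec assign_body (R, M) = exec (block [seat_code 14 9, Add 6 61 14, Store 6 37, seat_code 10 11, Add 6 61 10, Load 12 6, Add 6 64 10, Load 13 6,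
     Add 13 13 37, IfLess 12 37 (Add 13 13 0) (IfLess 37 12 (Add 13 13 0) (Seq (Add 6 65 10) (Load 13 6))),
     Add 6 65 14, Store 6 13, Add 6 52 14, Load 7 6, Add 7 7 1, Store 7 13]) (R1, M)"
      using e j cn jn unfolding assign_body_def env_def R1_def by (simp add: code_simps rd del: exec.simps(7))
    also have "\<dots> = exec (block [seat_code 10 11, Add 6 61 10, Load 12 6, Add 6 64 10, Load 13 6,
     Add 13 13 37, IfLess 12 37 (Add 13 13 0) (IfLess 37 12 (Add 13 13 0) (Seq (Add 6 65 10) (Load 13 6))),
     Add 6 65 14, Store 6 13, Add 6 52 14, Load 7 6, Add 7 7 1, Store 7 13]) (R2, M2)"
    proof -
      have "exec (Store 6 37) (exec (Add 6 61 14) (R1(41 := Suc k1, 12 := M (addr 4 c), 40 := q1, 6 := addr 12 q1, 37 := seat_group t q1, 63 := 0), M1)) = (R2, M2)"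
        using e1 unfolding R2_def M2_def env_def by (simp add: R1_def code_simps fun_eq_iff)
      then show ?thesis by (simp only: block.simps exec.simps(6) v1)
    qed
    finally show ?thesis by (simp only: block.simps exec.simps(6) v2)
  qed
  have M3: "M3 (addr 11 p) = M (addr 11 p)" "M3 (addr 13 p) = M (addr 13 p)" "M3 (addr 14 p) = p * t" "M3 (addr 2 c) = I c"
    using ne cn rd unfolding M3_def M2_def M1_def by (simp_all add: addr_inj less_N)
  let ?x = "M (addr 11 p)"
  define R4 where "R4 = R(5 := j, 14 := c, 10 := p, 11 := w, 9 := 2 - w, 41 := Suc k2, 40 := q2, 37 := seat_group t q2,
        12 := ?x, 13 := l, 6 := addr 2 c, 7 := Suc (I c), 63 := 0)"
  have R3: "R3 10 = p" "R3 14 = c" "R3 37 = seat_group t q2" unfolding R3_def R2_def R1_def by simp_all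
  have out: "exec assign_body (R, M) = (R4, M3(addr 13 c := l, Suc (I c) := l))"
  proof -
    have r: "R3 0 = 0" "R3 (Suc 0) = 1" "R3 61 = addr 11 0" "R3 64 = addr 14 0" "R3 65 = addr 13 0" "R3 52 = addr 2 0"
      using e3 unfolding env_def by auto
    have st: "R4 = R3(12 := ?x, 13 := l, 6 := addr 2 c, 7 := Suc (I c), 63 := 0)"
      unfolding R4_def R3_def R2_def R1_def by (simp add: fun_eq_iff)
    consider "?x < seat_group t q2" | "seat_group t q2 < ?x" | "?x = seat_group t q2" by linarith
    then show ?thesis
      unfolding a st by cases (auto simp: r R3 M3 code_simps cn l_def fun_eq_iff)
  qed
  show ?thesis unfolding out R4_def M3_def M2_def M1_def ..
qed

definition I8 :: "ram_state \<Rightarrow> bool" where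
  "I8 st \<longleftrightarrow> bounded B st \<and> (case st of (R, M) \<Rightarrow> env R \<and> shape M \<and> R 5 \<le> n - 1 \<and> M 0 = t \<and> M (addr 11 r) = t \<and>
     (\<forall>v<n. \<forall>w\<le>2. M (addr (8 + w) v) = count (set (drop (R 5) ord)) v w) \<and>
     (\<forall>c\<in>set (drop (R 5) ord). M (addr 11 c) = gp c \<and> M (addr 13 c) = lab c \<and> M (Suc (I c)) = lab c))"

lemma assign_phase:
  assumes bal: "balanced {..<n} r P s t" and "I8 st"
  shows "runs W (WhileLess 0 5 assign_body) st (Suc (len assign_body) * n + 1)
    (\<lambda>st. snd st 0 = t \<and> (\<forall>c\<in>set ord. snd st (Suc (I c)) = lab c))"
proof -
  have "runs W (WhileLess 0 5 assign_body) st (Suc (len assign_body) * fst st 5 + 1)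
    (\<lambda>st. snd st 0 = t \<and> (\<forall>c\<in>set ord. snd st (Suc (I c)) = lab c))"
  proof (rule runs_loop[where I = I8 and B = B and \<mu> = "\<lambda>st. fst st 5"])
    show "straight assign_body" "consts_le B assign_body" by (simp_all add: assign_body_def seat_code_def)
    show "2 ^ len assign_body * B \<le> W" by (rule W_len) (simp add: assign_body_def seat_code_def)
    show "bounded B st" if "I8 st" for st using that unfolding I8_def by simp
    show "I8 st" by fact
  next
    fix R M assume I: "I8 (R, M)" and "\<not> R 0 < R 5"
    then have "R 5 = 0" unfolding I8_def env_def by auto
    then show "snd (R, M) 0 = t \<and> (\<forall>c\<in>set ord. snd (R, M) (Suc (I c)) = lab c)"
      using I unfolding I8_def by simp
  next
    fix R M assume I: "I8 (R, M)" and lt: "R 0 < R 5"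
    have b: "bounded B (R, M)" and e: "env R" and sh: "shape M" using I unfolding I8_def by auto
    obtain j where j: "R 5 = Suc j" using lt by (cases "R 5") auto
    have jn: "Suc j \<le> n - 1" using I j unfolding I8_def by simp
    define c where "c = ord ! j"
    define p where "p = P c"
    define w where "w = s c"
    define A where "A = set (drop (Suc j) ord)"
    have jl: "j < length ord" using jn length_ord by simp
    have co: "c \<in> set ord" using jl unfolding c_def by simp
    have cn: "c < n" "p < n" "c \<noteq> p" "c \<noteq> r" using co ord(1) P_less[OF co] P_neq[OF co] unfolding p_def by auto
    have w2: "w \<le> 2" using s_le[OF co] unfolding w_def .
    have A: "set (drop j ord) = insert c A" "c \<notin> A" "A \<subseteq> set ord"
    proof -
      have "drop j ord = c # drop (Suc j) ord" using jl unfolding c_def by (simp add: Cons_nth_drop_Suc)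
      moreover have "distinct (drop j ord)" using ord(2) by simp
      ultimately show "set (drop j ord) = insert c A" "c \<notin> A" unfolding A_def by auto
      show "A \<subseteq> set ord" unfolding A_def by (rule set_drop_subset)
    qed
    \<comment> \<open>Parents come later in \<open>ord\<close> than their children, so in the
      reverse order they have already been seated.\<close>
    have pA: "p = r \<or> p \<in> A"
    proof -
      have "p \<notin> set (take (Suc j) ord)" using later[OF jl] unfolding c_def[symmetric] p_def .
      moreover have "set ord = set (take (Suc j) ord) \<union> A" unfolding A_def by (metis append_take_drop_id set_append)
      ultimately show ?thesis using ord(1) cn(2) by auto
    qed
    have cnt: "\<forall>v<n. \<forall>w\<le>2. M (addr (8 + w) v) = count A v w" and t: "M 0 = t" "M (addr 11 r) = t"
      and seated: "\<forall>c\<in>A. M (addr 11 c) = gp c \<and> M (addr 13 c) = lab c \<and> M (Suc (I c)) = lab c"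
      using I j unfolding I8_def A_def by auto
    define q1 where "q1 = half_seat {..<n} r P s rank (c, True)"
    define q2 where "q2 = half_seat {..<n} r P s rank (c, False)"
    have k1: "M (addr (8 + (2 - w)) c) = rank (c, True)"
      using cnt[rule_format, of c "2 - w"] cn w2 rank_nth[OF jl, of True] unfolding c_def[symmetric] A_def by (simp add: half_weight_def w_def)
    have k2: "M (addr (8 + w) p) = rank (c, False)"
      using cnt[rule_format, of p w] cn w2 rank_nth[OF jl, of False] unfolding c_def[symmetric] A_def by (simp add: half_weight_def w_def p_def)
    have q1: "seat (\<Sum>h\<in>halves c. half_weight s h) (2 - w) (rank (c, True)) = q1" "q1 < 3 * t"
      by (simp add: q1_def half_seat_def half_weight_def w_def) (simp add: q1_def seat_bounds(1)[OF bal co])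
    have q2: "seat (\<Sum>h\<in>halves p. half_weight s h) w (rank (c, False)) = q2" "q2 < 3 * t"
      by (simp add: q2_def half_seat_def half_weight_def w_def p_def) (simp add: q2_def seat_bounds(1)[OF bal co])
    have g: "seat_group t q1 = gp c" "seat_group t q2 = gc c" unfolding gp_def gc_def q1_def q2_def by simp_all
    \<comment> \<open>At the root the sentinel \<open>t\<close> differs from every group; elsewhere
      the cells hold the group and the label of the parent, and the test is the recursion for
      \<open>lab\<close>.\<close>
    have l: "(if M (addr 11 p) = gc c then M (addr 13 p) else p * t + gc c) = lab c"
    proof (cases "p = r")
      case True
      then show ?thesis using t(2) seat_bounds(2)[OF bal co] lab_eq[OF co] unfolding p_def by simp
    next
      case False
      then show ?thesis using pA seated lab_eq[OF co] unfolding p_def by auto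
    qed
    have lB: "lab c \<le> B"
    proof (cases "M (addr 11 p) = gc c")
      case True
      then show ?thesis using l boundedD(2)[OF b] by metis
    next
      case False
      have "Suc p * t \<le> n * n" using cn t_bounds by (intro mult_le_mono) auto
      moreover have "n * n \<le> B" unfolding B_def by simp
      ultimately show ?thesis using False l seat_bounds(2)[OF bal co] by simp
    qed
    let ?M = "M(addr (8 + (2 - w)) c := Suc (rank (c, True)), addr 11 c := gp c,
      addr (8 + w) p := Suc (rank (c, False)), addr 13 c := lab c, Suc (I c) := lab c)"
    let ?R = "R(5 := j, 14 := c, 10 := p, 11 := w, 9 := 2 - w, 41 := Suc (rank (c, False)), 40 := q2, 37 := gc c,
        12 := M (addr 11 p), 13 := lab c, 6 := addr 2 c, 7 := Suc (I c), 63 := 0)"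
    have ex: "exec assign_body (R, M) = (?R, ?M)"
      using assign_exec[OF e sh j jn c_def p_def w_def k1 k2 q1 q2] unfolding g l .
    have Ic: "Suc (I c) < N" "Suc (I c) \<le> n" using edge_I[OF co] unfolding N_def by auto
    have small: "j \<le> B" "c \<le> B" "p \<le> B" "w \<le> B" "2 - w \<le> B" "Suc (rank (c, x)) \<le> B" "q2 \<le> B" "gc c \<le> B" "gp c \<le> B"
      "Suc (I c) \<le> B" for x
      using jn cn w2 B3 n_le_B rank_less[OF co, of x] q2(2) t_bounds seat_bounds(2,3)[OF bal co] Ic n_pos by linarith+
    have a0: "addr l j \<noteq> 0" "0 \<noteq> addr l j" if "0 < l" for l j
      using addr_big[OF that, of j] N_def by auto
    have "bounded B (?R, ?M)"
      by (intro bounded_reg bounded_mem b small lB boundedD(2)[OF b] addr_le_B less_N cn) simp_all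
    moreover have "env ?R" using e unfolding env_def by simp
    moreover have "shape ?M"
    proof -
      have "8 + w \<in> {8, 9, 10, 11, 13}" "8 + (2 - w) \<in> {8, 9, 10, 11, 13}" using w2 by auto
      then show ?thesis by (intro shape_upd sh cn Ic) auto
    qed
    moreover have "?M 0 = t" using t(1) by (simp add: a0)
    moreover have "?M (addr 11 r) = t"
      using t(2) w2 cn r Ic by (auto simp: addr_inj less_N addr_low)
    moreover have "?M (addr (8 + w') v) = count (insert c A) v w'" if v: "v < n" "w' \<le> 2" for v w'
    proof -
      have ne: "8 + w' \<noteq> 11" "8 + w' \<noteq> 13" using v by auto
      have "?M (addr (8 + w') v) = (if w' = w \<and> v = p then Suc (rank (c, False)) else
          if w' = 2 - w \<and> v = c then Suc (rank (c, True)) else M (addr (8 + w') v))"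
        using ne cn v Ic by (auto simp: addr_inj less_N addr_low)
      moreover have "rank (c, True) = count A c (2 - w)" "rank (c, False) = count A p w"
        using k1 k2 cnt[rule_format, of c "2 - w"] cnt[rule_format, of p w] cn w2 by simp_all
      ultimately show ?thesis
        using cnt[rule_format, OF v] cn(3) unfolding count_insert[OF co A(2)] p_def[symmetric] w_def[symmetric] by auto
    qed
    moreover have "?M (addr 11 d) = gp d \<and> ?M (addr 13 d) = lab d \<and> ?M (Suc (I d)) = lab d" if d: "d \<in> insert c A" for d
    proof -
      have dn: "d \<in> set ord" "d < n" using d co A(3) ord(1) by auto
      have Id: "Suc (I d) < N" using edge_I[OF dn(1)] unfolding N_def by auto
      have ne: "8 + w \<noteq> 11" "8 + w \<noteq> 13" "8 + (2 - w) \<noteq> 11" "8 + (2 - w) \<noteq> 13" using w2 by auto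
      have "d = c \<longleftrightarrow> I d = I c" using I_inj[OF dn(1) co] by auto
      then show ?thesis
        using seated d ne dn cn Ic Id by (auto simp: addr_inj less_N addr_low)
    qed
    ultimately have "I8 (?R, ?M)"
      using jn unfolding I8_def by (simp only: A(1) case_prod_conv) (simp add: A(1))
    then show "I8 (exec assign_body (R, M)) \<and> fst (exec assign_body (R, M)) 5 < fst (R, M) 5"
      unfolding ex using j by simp
  qed
  moreover have "Suc (len assign_body) * fst st 5 + 1 \<le> Suc (len assign_body) * n + 1"
  proof -
    have "fst st 5 \<le> n" using assms(2) unfolding I8_def by auto
    then show ?thesis by (simp add: add_mono)
  qed
  ultimately show ?thesis unfolding runs_def by (meson order_trans)
qed

end

section \<open>Assembling the phases\<close>

section \<open>Correctness and running time\<close>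

definition clear :: "nat list \<Rightarrow> com" where "clear rs = block (map (\<lambda>r. Const r 0) rs)"

definition finish_code :: com where
  "finish_code = Seq (clear [5, 36]) (Seq (WhileLess 5 3 check_body) (Seq answer_code
     (IfLess 36 1 (WhileLess 0 5 assign_body) skip)))"

definition main_code :: com where
  "main_code = Seq init_code (Seq (WhileLess 5 4 degree_body) (Seq (clear [5, 17]) (Seq (WhileLess 5 3 max_body)
     (Seq (clear [16, 18]) (Seq (WhileLess 18 17 third_body) (Seq limits_code (Seq (WhileLess 5 3 base_body)
     (Seq (clear [5, 39]) (Seq (WhileLess 5 16 table_body) (Seq (clear [5, 14, 15, 20])
     (Seq (WhileLess 5 3 elim_body) finish_code)))))))))))"

lemma runs_mono: "runs W p s T Q \<Longrightarrow> T \<le> T' \<Longrightarrow> (\<And>s. Q s \<Longrightarrow> Q' s) \<Longrightarrow> runs W p s T' Q'"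
  unfolding runs_def by (meson order_trans)

lemma exec_clear: "exec (clear rs) (R, M) = (\<lambda>r. if r \<in> insert 63 (set rs) then 0 else R r, M)"
  unfolding clear_def by (induction rs arbitrary: R) (auto simp: fun_eq_iff)

lemma clear_size: "straight (clear rs)" "consts_le B (clear rs)" "len (clear rs) = Suc (length rs)"
  unfolding clear_def by (induction rs) auto

context tree_input
begin

lemma clear_phase:
  assumes b: "bounded B (R, M)" and "length rs \<le> 100"
    and Q: "bounded B (\<lambda>r. if r \<in> insert 63 (set rs) then 0 else R r, M) \<Longrightarrow>
      Q (\<lambda>r. if r \<in> insert 63 (set rs) then 0 else R r, M)"
  shows "runs W (clear rs) (R, M) 101 Q"
proof (rule runs_mono)
  show "runs W (clear rs) (R, M) (len (clear rs)) Q"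
  proof (rule runs_straight[OF clear_size(1,2) b])
    show "2 ^ len (clear rs) * B \<le> W" using assms(2) by (intro W_len) (simp add: clear_size)
    show "Q (exec (clear rs) (R, M))" unfolding exec_clear using b by (intro Q) (auto simp: bounded_def)
  qed
qed (use assms(2) in \<open>simp_all add: clear_size\<close>)

lemma mem3_static: "mem3 M \<Longrightarrow> static M"
  unfolding mem3_def mem2_def mem1_def static_def using less_N by auto

lemma mem3_elim: "mem3 M \<Longrightarrow> elim_mem [] M"
proof -
  assume m: "mem3 M"
  then have "elim_state [] (rd M 6) (rd M 5) (rd M 15) (rd M 2) (rd M 3) (rd M 4)"
    unfolding mem3_def mem2_def mem1_def rd_def by (intro elim_start) (auto simp: less_N)
  then show ?thesis using mem3_static[OF m] unfolding elim_mem_def by simp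
qed

lemma elim_result:
  assumes I: "I6 (R, M)" and R5: "R 5 = n"
  shows "\<exists>ord. eliminated n es E ord (R 20) (rd M 6) (rd M 5) (rd M 2) \<and>
    eliminated.shape n E ord (R 20) (rd M 6) (rd M 5) (rd M 2) M"
proof -
  obtain ord where m: "elim_mem ord M" and cu: "cursor ord R M" using I unfolding I6_def by auto
  have st: "elim_state ord (rd M 6) (rd M 5) (rd M 15) (rd M 2) (rd M 3) (rd M 4)"
    and o: "\<forall>j<length ord. M (addr 7 j) = ord ! j" and sta: "static M" using m unfolding elim_mem_def by auto
  have sub: "set ord \<subseteq> {..<n}" "distinct ord" using st unfolding elim_state_def by auto
  then have "R 14 = n" using cu R5 unfolding cursor_def by auto
  then have nl: "rd M 15 v \<noteq> 1" if "v < n" for v using cu R5 that unfolding cursor_def by force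
  have r: "R 20 < n" "R 20 \<notin> set ord" using cu unfolding cursor_def by auto
  note en = elim_end[OF st nl r]
  have later: "\<forall>j<length ord. rd M 6 (ord ! j) < n \<and> rd M 6 (ord ! j) \<notin> set (take (Suc j) ord)"
    and eI: "\<forall>c\<in>set ord. rd M 2 c < n - 1 \<and> edge_of (es ! rd M 2 c) = {c, rd M 6 c}"
    using st unfolding elim_state_def by - (elim conjE, assumption)+
  interpret el: eliminated n es E ord "R 20" "rd M 6" "rd M 5" "rd M 2"
    using r(1) en(1-3) sub(2) later eI by unfold_locales auto
  have "el.shape M"
    using o en(4,5) sub sta unfolding el.shape_def static_def rd_def by auto
  then show ?thesis using el.eliminated_axioms by blast
qed

end

context eliminated
begin

lemma finish_phase:
  assumes b: "bounded B (R, M)" and e: "env R" and l: "limits R" and sh: "shape M" and r20: "R 20 = r"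
    and zero: "\<And>k v. k \<in> {8, 9, 10} \<Longrightarrow> v < n \<Longrightarrow> M (addr k v) = 0"
  shows "runs W finish_code (R, M) (1000 * n)
    (\<lambda>st. snd st 0 = t + bad \<and> (bad = 0 \<longrightarrow> (\<forall>c\<in>set ord. snd st (Suc (I c)) = lab c)))" (is "runs W _ _ _ ?Q")
proof -
  have 1: "runs W (clear [5, 36]) (R, M) 101 (\<lambda>st. I7 M st \<and> fst st 5 = 0)"
  proof (rule clear_phase[OF b])
    have "env (\<lambda>x. if x \<in> insert 63 (set [5, 36]) then 0 else R x)" "limits (\<lambda>x. if x \<in> insert 63 (set [5, 36]) then 0 else R x)"
      using e l unfolding env_def limits_def by simp_all
    then show "bounded B (\<lambda>x. if x \<in> insert 63 (set [5, 36]) then 0 else R x, M) \<Longrightarrow>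
        I7 M (\<lambda>x. if x \<in> insert 63 (set [5, 36]) then 0 else R x, M) \<and>
        fst (\<lambda>x. if x \<in> insert 63 (set [5, 36]) then 0 else R x, M) 5 = 0"
      using r20 unfolding I7_def by simp
  qed simp
  have bad1: "bad \<le> 1" unfolding bad_def by simp
  have 2: "runs W answer_code st (len answer_code)
      (\<lambda>st. bounded B st \<and> fst st 1 = 1 \<and> fst st 36 = bad \<and> snd st 0 = t + bad \<and> (bad = 0 \<longrightarrow> I8 st))"
    if st: "bounded B st \<and> env (fst st) \<and> limits (fst st) \<and> snd st = M \<and> fst st 20 = r \<and> fst st 36 = bad" for st
  proof (rule runs_straight)
    obtain R where s: "st = (R, M)" using st by (cases st) auto
    show bd: "bounded B st" using st by simp
    show "straight answer_code" "consts_le B answer_code" by (simp_all add: answer_code_def)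
    show "2 ^ len answer_code * B \<le> W" by (rule W_len) (simp add: answer_code_def)
    let ?R = "R(9 := t + bad, 6 := addr 11 r, 5 := n - 1, 63 := 0)" and ?M = "M(0 := t + bad, addr 11 r := t)"
    have ex: "exec answer_code st = (?R, ?M)"
      using st unfolding s answer_code_def env_def limits_def by (simp add: code_simps)
    have bd': "bounded B (?R, ?M)"
      using bad1 t_bounds n_le_B n_pos r bd unfolding s by (intro bounded_reg bounded_mem addr_le_B less_N) auto
    have e': "env ?R" and R: "?R 1 = 1" "?R 36 = bad" using st unfolding s env_def by simp_all
    have a0: "addr k j \<noteq> 0" "0 \<noteq> addr k j" if "0 < k" for k j
      using addr_big[OF that, of j] N_def by auto
    have M0: "?M 0 = t + bad" by (simp add: a0)
    have sh': "shape ?M" using r N_def by (intro shape_upd sh) auto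
    have z: "?M (addr (8 + w) v) = 0" if v: "v < n" "w \<le> 2" for v w
    proof -
      have "8 + w \<noteq> 11" "8 + w \<in> {8, 9, 10}" using v by auto
      then show ?thesis using a0[of "8 + w" v] zero[of "8 + w" v] v r by (simp add: addr_inj less_N)
    qed
    show "bounded B (exec answer_code st) \<and> fst (exec answer_code st) 1 = 1 \<and> fst (exec answer_code st) 36 = bad \<and>
        snd (exec answer_code st) 0 = t + bad \<and> (bad = 0 \<longrightarrow> I8 (exec answer_code st))"
      unfolding ex fst_conv snd_conv
    proof (intro conjI impI)
      assume b0: "bad = 0"
      have "?R 5 = n - 1" "drop (n - 1) ord = []" using length_ord by simp_all
      then show "I8 (?R, ?M)"
        unfolding I8_def case_prod_conv using bd' e' sh' z M0 b0 by (simp add: count_empty)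
    qed (fact bd' R M0)+
  qed
  have 3: "runs W (IfLess 36 1 (WhileLess 0 5 assign_body) skip) st (Suc (Suc (len assign_body) * n + 1)) ?Q"
    if st: "bounded B st \<and> fst st 1 = 1 \<and> fst st 36 = bad \<and> snd st 0 = t + bad \<and> (bad = 0 \<longrightarrow> I8 st)" for st
  proof -
    obtain R M where s: "st = (R, M)" by (cases st)
    show ?thesis unfolding s
    proof (rule runs_if)
      assume "R 36 < R 1"
      then have "bad = 0" "I8 (R, M)" using st unfolding s by auto
      then show "runs W (WhileLess 0 5 assign_body) (R, M) (Suc (len assign_body) * n + 1) ?Q"
        using assign_phase[of "(R, M)"] unfolding bad_def by (simp split: if_splits)
    next
      assume "\<not> R 36 < R 1"
      then have bad: "bad = 1" using st bad1 unfolding s by auto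
      have "runs W skip (R, M) (len skip) ?Q"
      proof (rule runs_straight)
        show "2 ^ len skip * B \<le> W" by (rule W_len) (simp add: skip_def)
      qed (use st bad in \<open>simp_all add: skip_def s\<close>)
      then show "runs W skip (R, M) (Suc (len assign_body) * n + 1) ?Q"
        by (rule runs_mono) (simp_all add: skip_def)
    qed
  qed
  have "runs W finish_code (R, M) (101 + ((Suc (len check_body) * n + 1) + (len answer_code + Suc (Suc (len assign_body) * n + 1)))) ?Q"
    unfolding finish_code_def
    by (intro runs_seq[OF 1] runs_seq[OF check_phase[OF sh]] runs_seq[OF 2] 3) auto
  then show ?thesis
    by (rule runs_mono) (use n_pos in \<open>simp_all add: check_body_def answer_code_def assign_body_def seat_code_def\<close>)
qed

text \<open>Every edge of the input is the parent edge of exactly one vertex \<open>c\<close>, and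
  its index is \<open>I c\<close>. So edges with equal output labels are the classes of
  \<open>grouped_tree\<close>.\<close>

lemma output_correct:
  assumes bal: "balanced {..<n} r P s t" and M: "\<And>c. c \<in> set ord \<Longrightarrow> M (Suc (I c)) = lab c"
  shows "ubvt_decomposition {..<n} E (output_decomposition es M)"
    and "v < n \<Longrightarrow> card {S \<in> output_decomposition es M. v \<in> fst S} \<le> t"
proof -
  obtain pos where gt: "grouped_tree {..<n} E r P pos s gc gp lab t" using grouped[OF bal] by blast
  interpret G: grouped_tree "{..<n}" E r P pos s gc gp lab t by (rule gt)
  have ex: "\<exists>c\<in>set ord. I c = j" if j: "j < n - 1" for j
  proof -
    obtain c where c: "c \<in> set ord" "edge_of (es ! j) = {c, P c}"
      using es_edge(1)[OF j] unfolding G.E_eq ord(1) by blast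
    then show ?thesis using es_inj[of "I c" j] edge_I[OF c(1)] j by auto
  qed
  have cls: "{edge_of (es ! j) |j. j < n - 1 \<and> M (Suc j) = l} = G.class_edges l" for l
  proof
    show "{edge_of (es ! j) |j. j < n - 1 \<and> M (Suc j) = l} \<subseteq> G.class_edges l"
    proof
      fix e assume "e \<in> {edge_of (es ! j) |j. j < n - 1 \<and> M (Suc j) = l}"
      then obtain j where j: "e = edge_of (es ! j)" "j < n - 1" "M (Suc j) = l" by blast
      then obtain c where c: "c \<in> set ord" "I c = j" using ex by blast
      then show "e \<in> G.class_edges l"
        using edge_I[OF c(1)] M[OF c(1)] j unfolding G.class_edges_def G.members_def ord(1) by auto
    qed
    show "G.class_edges l \<subseteq> {edge_of (es ! j) |j. j < n - 1 \<and> M (Suc j) = l}"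
    proof
      fix e assume "e \<in> G.class_edges l"
      then obtain c where c: "c \<in> set ord" "lab c = l" "e = {c, P c}"
        unfolding G.class_edges_def G.members_def ord(1) by blast
      then show "e \<in> {edge_of (es ! j) |j. j < n - 1 \<and> M (Suc j) = l}"
        using edge_I[OF c(1)] M[OF c(1)] by (intro CollectI exI[of _ "I c"]) auto
    qed
  qed
  have "G.labels = (\<lambda>j. M (Suc j)) ` {..<n - 1}"
  proof
    show "G.labels \<subseteq> (\<lambda>j. M (Suc j)) ` {..<n - 1}"
    proof
      fix l assume "l \<in> G.labels"
      then obtain c where "c \<in> set ord" "l = lab c" unfolding G.labels_def ord(1) by blast
      then show "l \<in> (\<lambda>j. M (Suc j)) ` {..<n - 1}"
        using M[of c] edge_I[of c] by (intro image_eqI[of _ _ "I c"]) auto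
    qed
    show "(\<lambda>j. M (Suc j)) ` {..<n - 1} \<subseteq> G.labels"
    proof
      fix l assume "l \<in> (\<lambda>j. M (Suc j)) ` {..<n - 1}"
      then obtain j where "j < n - 1" "l = M (Suc j)" by blast
      then obtain c where "c \<in> set ord" "l = lab c" using ex M by blast
      then show "l \<in> G.labels" unfolding G.labels_def ord(1) by blast
    qed
  qed
  then have "output_decomposition es M = (\<lambda>l. (\<Union>(G.class_edges l), G.class_edges l)) ` G.labels"
    unfolding output_decomposition_def Let_def length_es cls by (simp add: image_image)
  also have "\<dots> = G.decomposition"
    unfolding G.decomposition_def using G.union_class_edges by (intro image_cong) auto
  finally have eq: "output_decomposition es M = G.decomposition" .
  show "ubvt_decomposition {..<n} E (output_decomposition es M)" unfolding eq by (rule G.decomposition_ubvt)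
  show "v < n \<Longrightarrow> card {S \<in> output_decomposition es M. v \<in> fst S} \<le> t" unfolding eq by (rule G.few_members) simp
qed

end

context tree_input
begin

definition correct :: "(nat \<Rightarrow> nat) \<Rightarrow> bool" where
  "correct M \<longleftrightarrow> M 0 = ub {..<n} E \<and> (ub {..<n} E = t \<longrightarrow>
     ubvt_decomposition {..<n} E (output_decomposition es M) \<and>
     (\<forall>v<n. card {S \<in> output_decomposition es M. v \<in> fst S} \<le> t))"

lemma finish_correct:
  assumes "I6 st \<and> fst st 5 = n"
  shows "runs W finish_code st (1000 * n) (\<lambda>st. correct (snd st))"
proof -
  obtain R M where s: "st = (R, M)" by (cases st)
  have I: "I6 (R, M)" "R 5 = n" using assms unfolding s by auto
  obtain ord where el: "eliminated n es E ord (R 20) (rd M 6) (rd M 5) (rd M 2)"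
    and sh: "eliminated.shape n E ord (R 20) (rd M 6) (rd M 5) (rd M 2) M" using elim_result[OF I] by blast
  interpret el: eliminated n es E ord "R 20" "rd M 6" "rd M 5" "rd M 2" by (rule el)
  obtain pos where tr: "rooted {..<n} E (R 20) (rd M 6) pos" using el.rooted_P by blast
  have ub: "ub {..<n} E = t + el.bad"
    using ub_greedy[OF tr _ el.greedy_s] unfolding el.bad_def t_def \<Delta>_def by simp
  have "static M" using I(1) unfolding I6_def elim_mem_def by auto
  then have "runs W finish_code (R, M) (1000 * n)
    (\<lambda>st. snd st 0 = t + el.bad \<and> (el.bad = 0 \<longrightarrow> (\<forall>c\<in>set ord. snd st (Suc (rd M 2 c)) = el.lab c)))"
    using I(1) sh by (intro el.finish_phase) (auto simp: I6_def static_def)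
  then show ?thesis unfolding s
  proof (rule runs_mono)
    fix st assume st: "snd st 0 = t + el.bad \<and> (el.bad = 0 \<longrightarrow> (\<forall>c\<in>set ord. snd st (Suc (rd M 2 c)) = el.lab c))"
    show "correct (snd st)" unfolding correct_def ub
    proof (intro conjI impI allI)
      show "snd st 0 = t + el.bad" using st by simp
      assume "t + el.bad = t"
      then have "el.bad = 0" by simp
      then have "balanced {..<n} (R 20) (rd M 6) (rd M 5) t" and "\<forall>c\<in>set ord. snd st (Suc (rd M 2 c)) = el.lab c"
        using st unfolding el.bad_def by (auto split: if_splits)
      then show "ubvt_decomposition {..<n} E (output_decomposition es (snd st))"
        "\<And>v. v < n \<Longrightarrow> card {S \<in> output_decomposition es (snd st). v \<in> fst S} \<le> t"
        using el.output_correct by blast+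
    qed
  qed simp
qed

lemma main_phase: "runs W main_code (input_state n es) (10000 * n) (\<lambda>st. correct (snd st))"
proof -
  have c1: "runs W (clear [5, 17]) st 101 (\<lambda>st. I2 st \<and> fst st 5 = 0)" if "I1 st \<and> fst st 5 = n - 1" for st
  proof -
    obtain R M where s: "st = (R, M)" by (cases st)
    have I: "I1 (R, M)" "R 5 = n - 1" using that unfolding s by auto
    have "env (\<lambda>x. if x \<in> insert 63 (set [5, 17]) then 0 else R x)" using I unfolding I1_def env_def by simp
    then show ?thesis unfolding s using mem1_I1[OF I] I(1)
      by (intro clear_phase) (auto simp: I1_def I2_def)
  qed
  have c2: "runs W (clear [16, 18]) st 101 (\<lambda>st. I3 st \<and> fst st 16 = 0)"
    if "bounded B st \<and> env (fst st) \<and> mem1 (snd st) \<and> fst st 17 = \<Delta>" for st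
  proof -
    obtain R M where s: "st = (R, M)" by (cases st)
    have "env (\<lambda>x. if x \<in> insert 63 (set [16, 18]) then 0 else R x)" using that unfolding s env_def by simp
    then show ?thesis using that unfolding s by (intro clear_phase) (auto simp: I3_def)
  qed
  have c3: "runs W (clear [5, 39]) st 101 (\<lambda>st. I5 st \<and> fst st 5 = 0)"
    if "bounded B st \<and> env (fst st) \<and> limits (fst st) \<and> mem2 (snd st)" for st
  proof -
    obtain R M where s: "st = (R, M)" by (cases st)
    have "env (\<lambda>x. if x \<in> insert 63 (set [5, 39]) then 0 else R x)"
      "limits (\<lambda>x. if x \<in> insert 63 (set [5, 39]) then 0 else R x)" using that unfolding s env_def limits_def by simp_all
    then show ?thesis using that unfolding s by (intro clear_phase) (auto simp: I5_def)
  qed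
  have c4: "runs W (clear [5, 14, 15, 20]) st 101 (\<lambda>st. I6 st \<and> fst st 5 = 0 \<and> fst st 15 = 0)"
    if "bounded B st \<and> env (fst st) \<and> limits (fst st) \<and> mem3 (snd st)" for st
  proof -
    obtain R M where s: "st = (R, M)" by (cases st)
    let ?R = "\<lambda>x. if x \<in> insert 63 (set [5, 14, 15, 20]) then 0 else R x"
    have "env ?R" "limits ?R" using that unfolding s env_def limits_def by simp_all
    moreover have "elim_mem [] M" using that mem3_elim unfolding s by simp
    moreover have "cursor [] ?R M" using n_pos unfolding cursor_def by simp
    ultimately have "bounded B (?R, M) \<Longrightarrow> I6 (?R, M)" unfolding I6_def by blast
    then show ?thesis using that unfolding s by (intro clear_phase) auto
  qed
  have "runs W main_code (input_state n es) (len init_code + ((Suc (len degree_body) * n + 1) + (101 +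
     ((Suc (len max_body) * n + 1) + (101 + ((Suc (len third_body) * n + 1) + (len limits_code +
     ((Suc (len base_body) * n + 1) + (101 + ((Suc (len table_body) * n + 1) + (101 +
     ((Suc (len elim_body) * (2 * n) + 1) + 1000 * n)))))))))))) (\<lambda>st. correct (snd st))"
    unfolding main_code_def
    by (intro runs_seq[OF init_phase] runs_seq[OF degree_phase] runs_seq[OF c1] runs_seq[OF max_phase] runs_seq[OF c2]
        runs_seq[OF third_phase] runs_seq[OF limits_phase] runs_seq[OF base_phase] runs_seq[OF c3]
        runs_seq[OF table_phase] runs_seq[OF c4] runs_seq[OF elim_phase] finish_correct) auto
  then show ?thesis
  proof (rule runs_mono)
    have *: "len init_code \<le> 200" "len degree_body \<le> 100" "len max_body \<le> 100" "len third_body \<le> 100" "len limits_code \<le> 100"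
      "len base_body \<le> 100" "len table_body \<le> 100" "len elim_body \<le> 200"
      by (simp_all add: init_code_def degree_body_def max_body_def skip_def third_body_def limits_code_def base_body_def
          table_body_def elim_body_def remove_code_def advance_code_def choose_code_def clamp_def)
    have m: "Suc l * n \<le> 101 * n" if "l \<le> 100" for l using that by (intro mult_le_mono1) simp
    have m2: "Suc (len elim_body) * (2 * n) \<le> 201 * (2 * n)" using *(8) by (intro mult_le_mono1) simp
    show "len init_code + ((Suc (len degree_body) * n + 1) + (101 +
     ((Suc (len max_body) * n + 1) + (101 + ((Suc (len third_body) * n + 1) + (len limits_code +
     ((Suc (len base_body) * n + 1) + (101 + ((Suc (len table_body) * n + 1) + (101 +
     ((Suc (len elim_body) * (2 * n) + 1) + 1000 * n))))))))))) \<le> 10000 * n"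
      using * m[OF *(2)] m[OF *(3)] m[OF *(4)] m[OF *(6)] m[OF *(7)] m2 n_pos by linarith
  qed
qed

end

theorem theorem9:
  shows "\<exists>(p :: com) (c :: nat) (k :: nat). \<forall>(n :: nat) (es :: (nat \<times> nat) list) (E :: nat set set).
    is_tree {..<n} E \<and> edge_list es E \<longrightarrow>
    (\<exists>R M t. run (c * n ^ k) p (input_state n es) t (R, M) \<and> t \<le> c * n \<and>
       M 0 = ub {..<n} E \<and>
       (ub {..<n} E = nat \<lceil>real (max_degree {..<n} E) / 3\<rceil> \<longrightarrow>
          ubvt_decomposition {..<n} E (output_decomposition es M) \<and>
          (\<forall>v<n. card {S \<in> output_decomposition es M. v \<in> fst S}
                   \<le> nat \<lceil>real (max_degree {..<n} E) / 3\<rceil>)))"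
proof (rule exI[of _ main_code], rule exI[of _ "2 ^ 200 * 100"], rule exI[of _ 2], intro allI impI)
  fix n :: nat and es :: "(nat \<times> nat) list" and E :: "nat set set"
  assume "is_tree {..<n} E \<and> edge_list es E"
  then interpret tree_input n es E by unfold_locales auto
  obtain u st where u: "run W main_code (input_state n es) u st" "u \<le> 10000 * n" "correct (snd st)"
    using main_phase unfolding runs_def by blast
  obtain R M where s: "st = (R, M)" by (cases st)
  \<comment> \<open>One constant serves both purposes: times \<open>n ^ 2\<close> it is the word
    bound \<open>W\<close>, and times \<open>n\<close> it exceeds the time bound.\<close>
  have W: "2 ^ 200 * 100 * n ^ 2 = W" unfolding W_def B_def power2_eq_square by (simp only: mult.assoc)
  have "(10000 :: nat) \<le> 2 ^ 200 * 100" by simp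
  then have "10000 * n \<le> 2 ^ 200 * 100 * n" by (rule mult_le_mono1)
  then have "u \<le> 2 ^ 200 * 100 * n" using u(2) by (rule order_trans[rotated])
  then show "\<exists>R M t. run (2 ^ 200 * 100 * n ^ 2) main_code (input_state n es) t (R, M) \<and> t \<le> 2 ^ 200 * 100 * n \<and>
       M 0 = ub {..<n} E \<and>
       (ub {..<n} E = nat \<lceil>real (max_degree {..<n} E) / 3\<rceil> \<longrightarrow>
          ubvt_decomposition {..<n} E (output_decomposition es M) \<and>
          (\<forall>v<n. card {S \<in> output_decomposition es M. v \<in> fst S}
                   \<le> nat \<lceil>real (max_degree {..<n} E) / 3\<rceil>))"
    using u(1,3) unfolding s W correct_def t_def \<Delta>_def snd_conv by blast
qed

end
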